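(* Let $x_1(0),x_2(0)\in(0,\infty)$ be deterministic and assume $\frac{4k}{\sigma_1^2}>1$ and $\frac{4l}{\sigma_2^2}>1$. Let $(x_1,x_2)$ be the solution of the two factor CIR model and $(y_1,y_2)$ its approximation with step $\Delta=T/n$, both defined in the context. Then there is a constant $C>0$, not depending on $n$ or $t$, such that for every integer $n\ge2$, $$\mathbb{E}\big(|x_1(t)-y_1(t)|^2+|x_2(t)-y_2(t)|^2\big)\le C\,\frac1{\sqrt{\ln n}}\qquad\text{for all }t\in[0,T].$$
   Context: $(\Omega,\mathcal F,\mathbb P,(\mathcal F_t))$ is a complete filtered probability space carrying two independent Wiener processes $W^1,W^2$; $T>0$; $k,l,\sigma_1,\sigma_2>0$ and $\lambda_{11},\lambda_{12},\lambda_{21},\lambda_{22}\ge0$ are constants. The two factor CIR model is the (nonnegative) solution $(x_1,x_2)$ of $$x_1(t)=x_1(0)+\int_0^t(k-\lambda_{11}x_1(s)+\lambda_{12}x_2(s))\,ds+\int_0^t\sigma_1\sqrt{x_1(s)}\,dW^1_s,$$ $$x_2(t)=x_2(0)+\int_0^t(l-\lambda_{21}x_2(s)+\lambda_{22}x_1(s))\,ds+\int_0^t\sigma_2\sqrt{x_2(s)}\,dW^2_s.$$ Splitting: $k=k_1+k_2$ and $l=l_1+l_2$ with $\frac{4k_2}{\sigma_1^2}=\big[\frac{4k}{\sigma_1^2}\big]$, $\frac{4l_2}{\sigma_2^2}=\big[\frac{4l}{\sigma_2^2}\big]$, where $[\cdot]$ is the integer part. Grid: $t_j=j\Delta$, $\Delta=T/n$,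 $j=0,\dots,n$. The approximation has $y_i(0)=x_i(0)$ and, successively for $j=0,\dots,n-1$ and $t\in(t_j,t_{j+1}]$, $y_1,y_2$ are the nonnegative solutions of $$y_1(t)=y_1(t_j)+\Delta\lambda_{12}y_2(t_j)+\Delta k_1+\int_{t_j}^t(k_2-\lambda_{11}y_1(s))\,ds+\sigma_1\int_{t_j}^t\sqrt{y_1(s)}\,dW^1_s,$$ $$y_2(t)=y_2(t_j)+\Delta\lambda_{22}y_1(t_j)+\Delta l_1+\int_{t_j}^t(l_2-\lambda_{21}y_2(s))\,ds+\sigma_2\int_{t_j}^t\sqrt{y_2(s)}\,dW^2_s.$$ *)

theory Defs
  imports "HOL-Probability.Probability"
begin

section \<open>Filtered probability spaces and Wiener processes\<close>

text \<open>Time is \<open>real\<close>; only the values \<open>F t\<close> with \<open>t \<ge> 0\<close> are ever used. Completeness means that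
  \<open>M\<close> is complete and that its null sets belong to \<open>F 0\<close>; right-continuity is not required.\<close>

locale complete_filtered_prob_space =
  prob_space M + complete_measure M + filtration "space M" F
  for M :: "'a measure" and F :: "real \<Rightarrow> 'a measure" +
  assumes sets_F_subset: "sets (F t) \<subseteq> sets M"
    and null_sets_F0: "null_sets M \<subseteq> sets (F 0)"

definition wiener_process ::
    "'a measure \<Rightarrow> (real \<Rightarrow> 'a measure) \<Rightarrow> (real \<Rightarrow> 'a \<Rightarrow> real) \<Rightarrow> bool" where
  "wiener_process M F W \<longleftrightarrow>
     (\<forall>t\<ge>0. W t \<in> borel_measurable (F t)) \<and>
     (AE \<omega> in M. W 0 \<omega> = 0) \<and>
     (AE \<omega> in M. continuous_on {0..} (\<lambda>t. W t \<omega>)) \<and>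
     (\<forall>s t. 0 \<le> s \<and> s < t \<longrightarrow>
        distributed M lborel (\<lambda>\<omega>. W t \<omega> - W s \<omega>) (normal_density 0 (sqrt (t - s))) \<and>
        prob_space.indep_set M (sets (F s))
          (sets (vimage_algebra (space M) (\<lambda>\<omega>. W t \<omega> - W s \<omega>) borel)))"

text \<open>Independence of the processes as a whole, as random elements of the product space.\<close>

definition indep_processes ::
    "'a measure \<Rightarrow> (real \<Rightarrow> 'a \<Rightarrow> real) \<Rightarrow> (real \<Rightarrow> 'a \<Rightarrow> real) \<Rightarrow> bool" where
  "indep_processes M X Y \<longleftrightarrow>
     prob_space.indep_var M
       (\<Pi>\<^sub>M t\<in>{0..}. borel) (\<lambda>\<omega>. \<lambda>t\<in>{0..}. X t \<omega>)
       (\<Pi>\<^sub>M t\<in>{0..}. borel) (\<lambda>\<omega>. \<lambda>t\<in>{0..}. Y t \<omega>)"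


section \<open>The It\^o integral\<close>

definition tendsto_zero_in_prob ::
    "'a measure \<Rightarrow> (nat \<Rightarrow> 'a \<Rightarrow> ennreal) \<Rightarrow> bool" where
  "tendsto_zero_in_prob M D \<longleftrightarrow>
     (\<forall>\<epsilon>>0. (\<lambda>m. measure M {\<omega> \<in> space M. D m \<omega> > ennreal \<epsilon>}) \<longlonglongrightarrow> 0)"

definition progressively_measurable ::
    "(real \<Rightarrow> 'a measure) \<Rightarrow> real \<Rightarrow> real \<Rightarrow> (real \<Rightarrow> 'a \<Rightarrow> real) \<Rightarrow> bool" where
  "progressively_measurable F a b H \<longleftrightarrow>
     (\<forall>t\<in>{a..b}. (\<lambda>(s, \<omega>). H s \<omega>) \<in> borel_measurable (restrict_space borel {a..t} \<Otimes>\<^sub>M F t))"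

text \<open>The data \<open>N, s, \<xi>\<close> represent the simple process
  \<open>\<Sum>i<N. \<xi> i * indicator {s i<..s (Suc i)}\<close>.\<close>

definition simple_process ::
    "'a measure \<Rightarrow> (real \<Rightarrow> 'a measure) \<Rightarrow> real \<Rightarrow> real \<Rightarrow>
     nat \<Rightarrow> (nat \<Rightarrow> real) \<Rightarrow> (nat \<Rightarrow> 'a \<Rightarrow> real) \<Rightarrow> bool" where
  "simple_process M F a b N s \<xi> \<longleftrightarrow>
     s 0 = a \<and> s N = b \<and>
     (\<forall>i<N. s i \<le> s (Suc i) \<and> \<xi> i \<in> borel_measurable (F (s i)) \<and>
            (\<exists>B. \<forall>\<omega>\<in>space M. \<bar>\<xi> i \<omega>\<bar> \<le> B))"

definition simple_value ::
    "nat \<Rightarrow> (nat \<Rightarrow> real) \<Rightarrow> (nat \<Rightarrow> 'a \<Rightarrow> real) \<Rightarrow> real \<Rightarrow> 'a \<Rightarrow> real" where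
  "simple_value N s \<xi> u \<omega> = (\<Sum>i<N. \<xi> i \<omega> * indicator {s i<..s (Suc i)} u)"

definition simple_integral_wrt ::
    "(real \<Rightarrow> 'a \<Rightarrow> real) \<Rightarrow> nat \<Rightarrow> (nat \<Rightarrow> real) \<Rightarrow> (nat \<Rightarrow> 'a \<Rightarrow> real) \<Rightarrow> 'a \<Rightarrow> real" where
  "simple_integral_wrt W N s \<xi> \<omega> = (\<Sum>i<N. \<xi> i \<omega> * (W (s (Suc i)) \<omega> - W (s i) \<omega>))"

text \<open>\<open>has_ito_integral M F W H a b I\<close>: the random variable \<open>I\<close> is (a version of) the It\^o
  integral of \<open>H\<close> with respect to \<open>W\<close> over \<open>[a, b]\<close>, for progressively measurable \<open>H\<close> with
  almost surely square integrable paths: approximate \<open>H\<close> by simple processes so that the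
  integral of the squared error tends to 0 in probability, and take the limit in probability of
  the elementary integrals.\<close>

definition has_ito_integral ::
    "'a measure \<Rightarrow> (real \<Rightarrow> 'a measure) \<Rightarrow> (real \<Rightarrow> 'a \<Rightarrow> real) \<Rightarrow> (real \<Rightarrow> 'a \<Rightarrow> real) \<Rightarrow>
     real \<Rightarrow> real \<Rightarrow> ('a \<Rightarrow> real) \<Rightarrow> bool" where
  "has_ito_integral M F W H a b I \<longleftrightarrow>
     progressively_measurable F a b H \<and>
     (AE \<omega> in M. (\<integral>\<^sup>+ u\<in>{a..b}. ennreal ((H u \<omega>)\<^sup>2) \<partial>lborel) < \<infinity>) \<and>
     I \<in> borel_measurable M \<and>
     (\<exists>N s \<xi>.
        (\<forall>m. simple_process M F a b (N m) (s m) (\<xi> m)) \<and>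
        tendsto_zero_in_prob M
          (\<lambda>m \<omega>. \<integral>\<^sup>+ u\<in>{a..b}. ennreal ((simple_value (N m) (s m) (\<xi> m) u \<omega> - H u \<omega>)\<^sup>2) \<partial>lborel) \<and>
        tendsto_zero_in_prob M
          (\<lambda>m \<omega>. ennreal \<bar>simple_integral_wrt W (N m) (s m) (\<xi> m) \<omega> - I \<omega>\<bar>))"


section \<open>The two factor CIR model and its approximation\<close>

text \<open>\<open>z\<close> is a nonnegative, continuous, adapted solution on \<open>(a, b]\<close> of
  \<open>z(t) = z\<^sub>0 + \<integral>\<^sub>a\<^sup>t drift(s) ds + \<integral>\<^sub>a\<^sup>t \<sigma> sqrt (z(s)) dW(s)\<close>.
  The value \<open>z a\<close> is left free: for the approximation it differs from the starting value \<open>z\<^sub>0\<close>,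
  which is the right limit of \<open>z\<close> at \<open>a\<close>.\<close>

definition sqrt_diffusion ::
    "'a measure \<Rightarrow> (real \<Rightarrow> 'a measure) \<Rightarrow> (real \<Rightarrow> 'a \<Rightarrow> real) \<Rightarrow> real \<Rightarrow> real \<Rightarrow> real \<Rightarrow>
     ('a \<Rightarrow> real) \<Rightarrow> (real \<Rightarrow> 'a \<Rightarrow> real) \<Rightarrow> (real \<Rightarrow> 'a \<Rightarrow> real) \<Rightarrow> bool" where
  "sqrt_diffusion M F W \<sigma> a b z0 drift z \<longleftrightarrow>
     (\<forall>t\<in>{a<..b}. z t \<in> borel_measurable (F t)) \<and>
     (AE \<omega> in M. \<forall>t\<in>{a<..b}. 0 \<le> z t \<omega>) \<and>
     (AE \<omega> in M. continuous_on {a<..b} (\<lambda>t. z t \<omega>) \<and> ((\<lambda>t. z t \<omega>) \<longlongrightarrow> z0 \<omega>) (at_right a)) \<and>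
     (AE \<omega> in M. set_integrable lborel {a..b} (\<lambda>s. drift s \<omega>)) \<and>
     (\<forall>t\<in>{a<..b}. \<exists>J.
        has_ito_integral M F W (\<lambda>s \<omega>. \<sigma> * sqrt (z s \<omega>)) a t J \<and>
        (AE \<omega> in M. z t \<omega> = z0 \<omega> + (LINT s:{a..t}|lborel. drift s \<omega>) + J \<omega>))"

definition two_factor_CIR ::
    "'a measure \<Rightarrow> (real \<Rightarrow> 'a measure) \<Rightarrow> (real \<Rightarrow> 'a \<Rightarrow> real) \<Rightarrow> (real \<Rightarrow> 'a \<Rightarrow> real) \<Rightarrow> real \<Rightarrow>
     real \<Rightarrow> real \<Rightarrow> real \<Rightarrow> real \<Rightarrow> real \<Rightarrow> real \<Rightarrow> real \<Rightarrow> real \<Rightarrow> real \<Rightarrow> real \<Rightarrow>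
     (real \<Rightarrow> 'a \<Rightarrow> real) \<Rightarrow> (real \<Rightarrow> 'a \<Rightarrow> real) \<Rightarrow> bool" where
  "two_factor_CIR M F W1 W2 T k l \<sigma>1 \<sigma>2 lam11 lam12 lam21 lam22 x10 x20 x1 x2 \<longleftrightarrow>
     (AE \<omega> in M. x1 0 \<omega> = x10 \<and> x2 0 \<omega> = x20) \<and>
     sqrt_diffusion M F W1 \<sigma>1 0 T (\<lambda>_. x10)
       (\<lambda>s \<omega>. k - lam11 * x1 s \<omega> + lam12 * x2 s \<omega>) x1 \<and>
     sqrt_diffusion M F W2 \<sigma>2 0 T (\<lambda>_. x20)
       (\<lambda>s \<omega>. l - lam21 * x2 s \<omega> + lam22 * x1 s \<omega>) x2"

definition CIR_splitting_approximation ::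
    "'a measure \<Rightarrow> (real \<Rightarrow> 'a measure) \<Rightarrow> (real \<Rightarrow> 'a \<Rightarrow> real) \<Rightarrow> (real \<Rightarrow> 'a \<Rightarrow> real) \<Rightarrow> real \<Rightarrow>
     real \<Rightarrow> real \<Rightarrow> real \<Rightarrow> real \<Rightarrow> real \<Rightarrow> real \<Rightarrow> real \<Rightarrow> real \<Rightarrow> real \<Rightarrow> real \<Rightarrow> real \<Rightarrow> real \<Rightarrow>
     nat \<Rightarrow> (real \<Rightarrow> 'a \<Rightarrow> real) \<Rightarrow> (real \<Rightarrow> 'a \<Rightarrow> real) \<Rightarrow> bool" where
  "CIR_splitting_approximation M F W1 W2 T k1 k2 l1 l2 \<sigma>1 \<sigma>2 lam11 lam12 lam21 lam22 x10 x20 n y1 y2 \<longleftrightarrow>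
     (let \<Delta> = T / real n; t = (\<lambda>j. real j * \<Delta>) in
       (AE \<omega> in M. y1 0 \<omega> = x10 \<and> y2 0 \<omega> = x20) \<and>
       (\<forall>j<n.
          sqrt_diffusion M F W1 \<sigma>1 (t j) (t (Suc j))
            (\<lambda>\<omega>. y1 (t j) \<omega> + \<Delta> * lam12 * y2 (t j) \<omega> + \<Delta> * k1)
            (\<lambda>s \<omega>. k2 - lam11 * y1 s \<omega>) y1 \<and>
          sqrt_diffusion M F W2 \<sigma>2 (t j) (t (Suc j))
            (\<lambda>\<omega>. y2 (t j) \<omega> + \<Delta> * lam22 * y1 (t j) \<omega> + \<Delta> * l1)
            (\<lambda>s \<omega>. l2 - lam21 * y2 s \<omega>) y2))"

end

theory Submission
  imports Defs
begin

text \<open>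
The square root is only Hoelder continuous of order \<open>1/2\<close>, so a Gronwall argument for the mean
square error fails directly: the Ito isometry returns \<open>E |x - y|\<close> instead of \<open>E (x - y)\<^sup>2\<close>. The
mean absolute error is therefore estimated first, by the method of Yamada and Watanabe, and its
rate is then fed into the mean square estimate.

Each component of the model, and of the approximation, satisfies one integral equation on all of
\<open>[0,T]\<close> (\<open>cir_component\<close>): the grid corrections of the approximation are a sum of jumps, one for
each grid point before \<open>t\<close>. Hence the error \<open>z = x - y\<close> of a component is \<open>V + \<delta>\<close>, where \<open>\<delta>\<close> is
the integral of the cross drift \<open>k1 + b y'\<close> minus its left Riemann sum, and
\<open>dV = (b (x' - y') - a z) dt + \<sigma> (sqrt x - sqrt y) dW\<close>. Since the components oscillate by
\<open>O(n^(-1/2))\<close> in mean square over one cell, \<open>E \<delta>\<^sup>2 = O(1/n)\<close> (\<open>component_frozen_drift_error\<close>).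

The function \<open>smooth_abs r\<close> is within \<open>O(1 / ln (1/r))\<close> of the absolute value for bounded second
moments, and its second derivative \<open>\<phi>''\<close> satisfies \<open>\<bar>v\<bar> \<phi>'' v \<le> 1 / ln (1/r)\<close>. As
\<open>(sqrt x - sqrt y)\<^sup>2 \<le> \<bar>z\<bar>\<close> and \<open>E \<bar>z - V\<bar> = O(n^(-1/2))\<close>, the second order term in the expansion of
\<open>E (smooth_abs r V)\<close> is \<open>O((1 + n^(-1/2) / r) / ln (1/r))\<close> (\<open>yamada_estimate\<close>). With
\<open>r = n^(-1/2)\<close> this is \<open>O(1 / ln n)\<close>, and Gronwall's lemma for both components together gives
\<open>E \<bar>z\<bar> = O(1 / ln n)\<close>. In the mean square estimate the noise contributes
\<open>\<integral> E \<bar>z\<bar> = O(1 / ln n)\<close>, and a second use of Gronwall's lemma yields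
\<open>E z\<^sup>2 = O(1 / ln n)\<close>, which is stronger than the claimed rate (\<open>splitting_mean_square_error\<close>).

The Ito integral is given as a limit in probability of elementary integrals. Along a subsequence
the limit is almost sure, which carries over upper bounds for second and fourth moments by Fatou's
lemma and the vanishing of the mean by uniform integrability. In place of the Ito formula, the
smoothed absolute value is expanded to third order over a mesh that is refined to zero: the fourth
moments of the noise make the remainder \<open>O(h^(3/2))\<close> per step. Moment bounds for the solutions
themselves (\<open>second_moment_bound\<close>) follow from estimates localised to the event that the time
integral of the solution is below a level \<open>R\<close>, uniformly in \<open>R\<close>.
\<close>

section \<open>Moments of Wiener increments\<close>

context complete_filtered_prob_space
begin

lemma measurable_F_mono: "f \<in> measurable (F s) N \<Longrightarrow> s \<le> t \<Longrightarrow> f \<in> measurable (F t) N"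
  using sets_F_mono[of s t] by (auto simp: measurable_def space_F)

lemma measurable_F_M: "f \<in> measurable (F s) N \<Longrightarrow> f \<in> measurable M N"
  using sets_F_subset[of s] by (auto simp: measurable_def space_F)

lemma wiener_adapted: "wiener_process M F W \<Longrightarrow> 0 \<le> s \<Longrightarrow> s \<le> t \<Longrightarrow> W s \<in> borel_measurable (F t)"
  by (rule measurable_F_mono[of _ s]) (auto simp: wiener_process_def)

text \<open>The definition of a Wiener process has independence of \<sigma>-algebras; products of an
  adapted factor with powers of a later increment need independence of random variables.\<close>

lemma wiener_increment_indep:
  assumes W: "wiener_process M F W" and "0 \<le> s" "s < t" and \<zeta>: "\<zeta> \<in> borel_measurable (F s)"
  shows "indep_var borel \<zeta> borel (\<lambda>w. W t w - W s w)"
proof -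
  have WM: "(\<lambda>w. W t w - W s w) \<in> borel_measurable M"
    using measurable_F_M[OF wiener_adapted[OF W, of s s]] measurable_F_M[OF wiener_adapted[OF W, of t t]] assms by auto
  have ind: "indep_set (sets (F s)) (sets (vimage_algebra (space M) (\<lambda>w. W t w - W s w) borel))"
    using assms by (auto simp: wiener_process_def)
  have a: "sigma_sets (space M) {\<zeta> -` A \<inter> space M |A. A \<in> sets borel} \<subseteq> sets (F s)"
  proof -
    have "{\<zeta> -` A \<inter> space M |A. A \<in> sets borel} \<subseteq> sets (F s)"
      using measurable_sets[OF \<zeta>] by (auto simp: space_F)
    then show ?thesis using sets.sigma_sets_subset[of _ "F s"] by (simp add: space_F)
  qed
  have b: "sigma_sets (space M) {(\<lambda>w. W t w - W s w) -` A \<inter> space M |A. A \<in> sets borel} \<subseteq>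
     sets (vimage_algebra (space M) (\<lambda>w. W t w - W s w) borel)"
    using sets.sigma_sets_subset[of _ "vimage_algebra (space M) (\<lambda>w. W t w - W s w) borel"]
    by (simp add: sets_vimage_algebra2)
  show ?thesis
    unfolding indep_var_eq indep_set_def
  proof (intro conjI measurable_F_M[OF \<zeta>] WM indep_sets_mono_sets[OF ind[unfolded indep_set_def]])
    fix i :: bool
    show "case_bool (sigma_sets (space M) {\<zeta> -` A \<inter> space M |A. A \<in> sets borel})
        (sigma_sets (space M) {(\<lambda>w. W t w - W s w) -` A \<inter> space M |A. A \<in> sets borel}) i
      \<subseteq> case_bool (sets (F s)) (sets (vimage_algebra (space M) (\<lambda>w. W t w - W s w) borel)) i"
      using a b by (cases i) simp_all
  qed
qed

text \<open>The moment of order \<open>k\<close> of the centred normal distribution with variance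
  \<open>\<delta>\<close>.\<close>

definition gauss_moment :: "nat \<Rightarrow> real \<Rightarrow> real" where
  "gauss_moment k \<delta> = (if odd k then 0 else fact k / (2 ^ (k div 2) * fact (k div 2)) * \<delta> ^ (k div 2))"

lemma wiener_increment_moment:
  assumes W: "wiener_process M F W" and st: "0 \<le> s" "s \<le> t" and k: "k > 0"
    and \<zeta>: "\<zeta> \<in> borel_measurable (F s)" "integrable M \<zeta>"
  shows "has_bochner_integral M (\<lambda>w. \<zeta> w * (W t w - W s w) ^ k) (expectation \<zeta> * gauss_moment k (t - s))"
proof (cases "s = t")
  case True
  then have "(\<lambda>w. \<zeta> w * (W t w - W s w) ^ k) = (\<lambda>w. 0)" "gauss_moment k (t - s) = 0"
    using k by (auto simp: gauss_moment_def elim!: evenE)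
  then show ?thesis by (simp add: has_bochner_integral_zero)
next
  case False
  then have st': "s < t" using st by simp
  let ?D = "\<lambda>w. W t w - W s w" and ?sd = "sqrt (t - s)"
  have sd: "?sd > 0" using st' by simp
  have D: "distributed M lborel ?D (normal_density 0 ?sd)"
    using W st st' by (auto simp: wiener_process_def)
  have hb: "has_bochner_integral lborel (\<lambda>x. normal_density 0 ?sd x * x ^ k) (gauss_moment k (t - s))"
  proof (cases "odd k")
    case True
    then obtain j where "k = 2 * j + 1" by (auto elim: oddE)
    then show ?thesis using normal_moment_odd[OF sd, of 0 j] by (simp add: gauss_moment_def)
  next
    case False
    then obtain j where j: "k = 2 * j" by (auto elim: evenE)
    have "?sd ^ 2 = t - s" using st' by simp
    then show ?thesis using normal_moment_even[OF sd, of 0 j] st'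
      by (simp add: gauss_moment_def j power_divide field_simps)
  qed
  have iD: "integrable M (\<lambda>w. ?D w ^ k)"
    using distributed_integrable[OF D, of "\<lambda>x. x ^ k"] hb
    by (auto simp: has_bochner_integral_iff)
  have eD: "expectation (\<lambda>w. ?D w ^ k) = gauss_moment k (t - s)"
    using distributed_integral[OF D, of "\<lambda>x. x ^ k"] hb
    by (auto simp: has_bochner_integral_iff)
  have iv: "indep_var borel \<zeta> borel (\<lambda>w. ?D w ^ k)"
    using indep_var_compose[OF wiener_increment_indep[OF W st(1) st' \<zeta>(1)], of id borel "\<lambda>x. x ^ k" borel]
    by (simp add: comp_def)
  show ?thesis
    using indep_var_integrable[OF iv \<zeta>(2) iD] indep_var_lebesgue_integral[OF iv \<zeta>(2) iD]
    by (simp add: has_bochner_integral_iff eD)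
qed

section \<open>Elementary integrals\<close>

text \<open>A simple process is built from the left by adding one step at a time, so that its
  properties follow by induction. \<open>elementary W a b X I Q\<close> records the integrand
  \<open>X\<close> on \<open>(a,b]\<close>, its integral \<open>I\<close> against \<open>W\<close>
  and its energy \<open>Q\<close>, the time integral of \<open>X\<^sup>2\<close>. The energy is kept
  as data because it is known one step ahead: after the next step it is measurable at the left end
  of that step.\<close>

inductive elementary ::
    "(real \<Rightarrow> 'a \<Rightarrow> real) \<Rightarrow> real \<Rightarrow> real \<Rightarrow> (real \<Rightarrow> 'a \<Rightarrow> real) \<Rightarrow> ('a \<Rightarrow> real) \<Rightarrow> ('a \<Rightarrow> real) \<Rightarrow> bool"
  for W a where
  start: "elementary W a a (\<lambda>u w. 0) (\<lambda>w. 0) (\<lambda>w. 0)"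
| extend: "elementary W a b X I Q \<Longrightarrow> b \<le> c \<Longrightarrow> \<xi> \<in> borel_measurable (F b) \<Longrightarrow>
    (\<And>w. w \<in> space M \<Longrightarrow> \<bar>\<xi> w\<bar> \<le> K) \<Longrightarrow>
    elementary W a c (\<lambda>u w. X u w + \<xi> w * indicator {b<..c} u)
      (\<lambda>w. I w + \<xi> w * (W c w - W b w)) (\<lambda>w. Q w + (\<xi> w)\<^sup>2 * (c - b))"

lemma elementary_extend:
  assumes "elementary W a b X I Q" "b \<le> c" "\<xi> \<in> borel_measurable (F b)"
    "\<And>w. w \<in> space M \<Longrightarrow> \<bar>\<xi> w\<bar> \<le> K"
    "X' = (\<lambda>u w. X u w + \<xi> w * indicator {b<..c} u)"
    "I' = (\<lambda>w. I w + \<xi> w * (W c w - W b w))"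
    "Q' = (\<lambda>w. Q w + (\<xi> w)\<^sup>2 * (c - b))"
  shows "elementary W a c X' I' Q'"
  using elementary.extend[OF assms(1-4)] assms(5-7) by simp

lemma elementary_le: "elementary W a b X I Q \<Longrightarrow> a \<le> b"
  by (induction rule: elementary.induct) auto

lemma elementary_support: "elementary W a b X I Q \<Longrightarrow> u \<le> a \<or> b < u \<Longrightarrow> X u w = 0"
proof (induction rule: elementary.induct)
  case (extend b X I Q c \<xi> K)
  then show ?case using elementary_le[OF extend(1)] by (auto simp: indicator_def)
qed auto

lemma elementary_energy:
  "elementary W a b X I Q \<Longrightarrow>
    Q \<in> borel_measurable (F b) \<and> (\<forall>w. 0 \<le> Q w) \<and> (\<exists>B. \<forall>w\<in>space M. Q w \<le> B)"
proof (induction rule: elementary.induct)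
  case (extend b X I Q c \<xi> K)
  obtain B where B: "\<forall>w\<in>space M. Q w \<le> B" using extend by auto
  have "Q w + (\<xi> w)\<^sup>2 * (c - b) \<le> B + K\<^sup>2 * (c - b)" if "w \<in> space M" for w
  proof -
    have "(\<xi> w)\<^sup>2 \<le> K\<^sup>2" using extend(4)[OF that] by (metis abs_ge_zero power2_abs power_mono)
    then show ?thesis using B that extend(2) by (intro add_mono mult_right_mono) auto
  qed
  moreover have "Q \<in> borel_measurable (F c)" "\<xi> \<in> borel_measurable (F c)"
    using extend measurable_F_mono by auto
  ultimately show ?case using extend by auto
qed auto

lemma elementary_adapted:
  "elementary W a b X I Q \<Longrightarrow> wiener_process M F W \<Longrightarrow> 0 \<le> a \<Longrightarrow> I \<in> borel_measurable (F b)"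
proof (induction rule: elementary.induct)
  case (extend b X I Q c \<xi> K)
  have "I \<in> borel_measurable (F c)" "\<xi> \<in> borel_measurable (F c)"
    "W c \<in> borel_measurable (F c)" "W b \<in> borel_measurable (F c)"
    using extend elementary_le[OF extend(1)] by (auto intro: measurable_F_mono wiener_adapted)
  then show ?case by auto
qed auto

lemma elementary_measurable:
  "elementary W a b X I Q \<Longrightarrow> (\<lambda>(u, w). X u w) \<in> borel_measurable (lborel \<Otimes>\<^sub>M F b)"
proof (induction rule: elementary.induct)
  case (extend b X I Q c \<xi> K)
  have \<xi>: "\<xi> \<in> borel_measurable (F c)" by (rule measurable_F_mono[OF extend(3,2)])
  have "(\<lambda>x. x) \<in> measurable (lborel \<Otimes>\<^sub>M F c) (lborel \<Otimes>\<^sub>M F b)"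
  proof (rule measurable_pair)
    have "(\<lambda>w. w) \<in> measurable (F c) (F b)"
      using sets_F_mono[OF extend(2)] by (auto simp: measurable_def space_F)
    then show "snd \<circ> (\<lambda>x. x) \<in> measurable (lborel \<Otimes>\<^sub>M F c) (F b)"
      unfolding comp_def by (rule measurable_compose[OF measurable_snd])
  qed (simp add: comp_def)
  from measurable_compose[OF this extend.IH]
  have "(\<lambda>(u, w). X u w) \<in> borel_measurable (lborel \<Otimes>\<^sub>M F c)" by simp
  then show ?case using \<xi> unfolding split_beta' by measurable
qed auto

lemma elementary_nn_energy:
  "elementary W a b X I Q \<Longrightarrow> (\<integral>\<^sup>+u. ennreal ((X u w)\<^sup>2) \<partial>lborel) = ennreal (Q w)
    \<and> (\<lambda>u. X u w) \<in> borel_measurable lborel"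
proof (induction rule: elementary.induct)
  case (extend b X I Q c \<xi> K)
  have [measurable]: "(\<lambda>u. X u w) \<in> borel_measurable lborel" using extend by auto
  have "(X u w + \<xi> w * indicator {b<..c} u)\<^sup>2 = (X u w)\<^sup>2 + (\<xi> w)\<^sup>2 * indicator {b<..c} u" for u
    using elementary_support[OF extend(1), of u] by (auto simp: indicator_def)
  then have "(\<integral>\<^sup>+u. ennreal ((X u w + \<xi> w * indicator {b<..c} u)\<^sup>2) \<partial>lborel)
    = (\<integral>\<^sup>+u. ennreal ((X u w)\<^sup>2) + ennreal ((\<xi> w)\<^sup>2) * indicator {b<..c} u \<partial>lborel)"
    by (intro nn_integral_cong) (auto simp: ennreal_plus indicator_def)
  also have "\<dots> = ennreal (Q w) + ennreal ((\<xi> w)\<^sup>2) * ennreal (c - b)"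
    using extend by (subst nn_integral_add) (auto simp: nn_integral_cmult)
  finally show ?case using extend elementary_energy[OF extend(1)]
    by (auto simp: ennreal_plus ennreal_mult)
qed auto

lemma elementary_concat:
  assumes "elementary W b c Y J R" "elementary W a b X I Q"
  shows "elementary W a c (\<lambda>u w. X u w + Y u w) (\<lambda>w. I w + J w) (\<lambda>w. Q w + R w)"
  using assms
proof (induction rule: elementary.induct)
  case start then show ?case by simp
next
  case (extend d X I Q c \<xi> K)
  show ?case
    by (rule elementary_extend[OF extend.IH[OF extend.prems] extend(2,3,4)]) (auto simp: algebra_simps)
qed

text \<open>A step that straddles \<open>c\<close> is cut into two steps with the same
  height.\<close>

lemma elementary_split:
  assumes "elementary W a b X I Q" "a \<le> c" "c \<le> b"
  shows "\<exists>X1 I1 Q1 X2 I2 Q2. elementary W a c X1 I1 Q1 \<and> elementary W c b X2 I2 Q2 \<and>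
    X = (\<lambda>u w. X1 u w + X2 u w) \<and> I = (\<lambda>w. I1 w + I2 w)"
  using assms
proof (induction rule: elementary.induct)
  case start
  then have "c = a" by simp
  then show ?case by (auto intro!: exI elementary.start)
next
  case (extend b X I Q d \<xi> K)
  show ?case
  proof (cases "c \<le> b")
    case True
    then obtain X1 I1 Q1 X2 I2 Q2 where *: "elementary W a c X1 I1 Q1" "elementary W c b X2 I2 Q2"
      "X = (\<lambda>u w. X1 u w + X2 u w)" "I = (\<lambda>w. I1 w + I2 w)"
      using extend.IH extend.prems by blast
    show ?thesis
      by (rule exI)+ (rule conjI, rule *(1), rule conjI,
         rule elementary.extend[OF *(2) extend(2,3,4)], assumption, auto simp: * add.assoc)
  next
    case False
    have \<xi>: "\<xi> \<in> borel_measurable (F c)" using False by (intro measurable_F_mono[OF extend(3)]) auto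
    have 1: "elementary W a c (\<lambda>u w. X u w + \<xi> w * indicator {b<..c} u)
      (\<lambda>w. I w + \<xi> w * (W c w - W b w)) (\<lambda>w. Q w + (\<xi> w)\<^sup>2 * (c - b))"
      using False by (intro elementary.extend[OF extend(1) _ extend(3,4)]) auto
    have 2: "elementary W c d (\<lambda>u w. 0 + \<xi> w * indicator {c<..d} u)
      (\<lambda>w. 0 + \<xi> w * (W d w - W c w)) (\<lambda>w. 0 + (\<xi> w)\<^sup>2 * (d - c))"
      using extend.prems by (intro elementary.extend[OF elementary.start _ \<xi> extend(4)]) auto
    have e: "indicator {b<..d} u = (indicator {b<..c} u + indicator {c<..d} u :: real)" for u
      using False extend.prems by (auto simp: indicator_def)
    show ?thesis
      by (rule exI)+ (rule conjI, rule 1, rule conjI, rule 2, auto simp: e algebra_simps)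
  qed
qed

text \<open>The step that is subtracted starts at the same point as the process, which makes this
  the base from which differences of arbitrary processes are formed by splitting.\<close>

lemma elementary_diff_const:
  assumes "elementary W b c X I Q" "\<eta> \<in> borel_measurable (F b)" "\<And>w. w \<in> space M \<Longrightarrow> \<bar>\<eta> w\<bar> \<le> L"
  shows "\<exists>Q'. elementary W b c (\<lambda>u w. X u w - \<eta> w * indicator {b<..c} u)
    (\<lambda>w. I w - \<eta> w * (W c w - W b w)) Q'"
  using assms
proof (induction rule: elementary.induct)
  case start
  show ?case using elementary.start[of W b] by auto
next
  case (extend d X I Q c \<xi> K)
  then obtain Q' where Q': "elementary W b d (\<lambda>u w. X u w - \<eta> w * indicator {b<..d} u)
    (\<lambda>w. I w - \<eta> w * (W d w - W b w)) Q'" by blast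
  note bd = elementary_le[OF extend(1)]
  have e: "indicator {b<..c} u = (indicator {b<..d} u + indicator {d<..c} u :: real)" for u
    using bd extend(2) by (auto simp: indicator_def)
  have m: "(\<lambda>w. \<xi> w - \<eta> w) \<in> borel_measurable (F d)"
    using extend(3) measurable_F_mono[OF extend.prems(1) bd] by auto
  have B: "\<bar>\<xi> w - \<eta> w\<bar> \<le> K + L" if "w \<in> space M" for w
    using extend(4)[OF that] extend.prems(2)[OF that] by linarith
  show ?case
    by (rule exI, rule elementary_extend[OF Q' extend(2) m B]) (auto simp: e algebra_simps)
qed

text \<open>By induction on the steps of the subtracted process: its last step has the shape treated
  above on the part of the other process to the right of the cut.\<close>

lemma elementary_diff:
  assumes "elementary W a b Y J R" "elementary W a b X I Q"
  shows "\<exists>Q'. elementary W a b (\<lambda>u w. X u w - Y u w) (\<lambda>w. I w - J w) Q'"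
  using assms
proof (induction arbitrary: X I Q rule: elementary.induct)
  case start
  then show ?case by auto
next
  case (extend b Y J R c \<xi> K)
  obtain X1 I1 Q1 X2 I2 Q2 where *: "elementary W a b X1 I1 Q1" "elementary W b c X2 I2 Q2"
      "X = (\<lambda>u w. X1 u w + X2 u w)" "I = (\<lambda>w. I1 w + I2 w)"
    using elementary_split[OF extend.prems elementary_le[OF extend(1)] extend(2)] by blast
  obtain R1 where 1: "elementary W a b (\<lambda>u w. X1 u w - Y u w) (\<lambda>w. I1 w - J w) R1"
    using extend.IH[OF *(1)] by blast
  obtain R2 where 2: "elementary W b c (\<lambda>u w. X2 u w - \<xi> w * indicator {b<..c} u)
    (\<lambda>w. I2 w - \<xi> w * (W c w - W b w)) R2"
    using elementary_diff_const[OF *(2) extend(3,4)] by blast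
  show ?case using elementary_concat[OF 2 1] by (auto simp: * algebra_simps)
qed

lemma elementary_scale:
  assumes "elementary W a b X I Q" "\<eta> \<in> borel_measurable (F a)" "\<And>w. w \<in> space M \<Longrightarrow> \<bar>\<eta> w\<bar> \<le> L"
  shows "elementary W a b (\<lambda>u w. \<eta> w * X u w) (\<lambda>w. \<eta> w * I w) (\<lambda>w. (\<eta> w)\<^sup>2 * Q w)"
  using assms
proof (induction rule: elementary.induct)
  case start
  show ?case using elementary.start[of W a] by auto
next
  case (extend b X I Q c \<xi> K)
  have m: "(\<lambda>w. \<eta> w * \<xi> w) \<in> borel_measurable (F b)"
    using extend(3) measurable_F_mono[OF extend.prems(1) elementary_le[OF extend(1)]] by auto
  have B: "\<bar>\<eta> w * \<xi> w\<bar> \<le> L * K" if "w \<in> space M" for w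
    unfolding abs_mult using extend(4)[OF that] extend.prems(2)[OF that] by (intro mult_mono) auto
  show ?case
    by (rule elementary_extend[OF extend.IH[OF extend.prems] extend(2) m B])
       (auto simp: algebra_simps power_mult_distrib)
qed

text \<open>Steps are kept only as long as the energy including the next step is at most
  \<open>R\<close>. This condition is decided at the left end of the step, so the truncated process
  is still adapted; it agrees with the original one where the total energy never exceeds
  \<open>R\<close>.\<close>

lemma elementary_truncate:
  assumes "elementary W a b X I Q" "R \<ge> 0"
  shows "\<exists>X' I' Q'. elementary W a b X' I' Q' \<and> (\<forall>w. Q' w \<le> min R (Q w) \<and> (Q w \<le> R \<longrightarrow> I' w = I w))"
  using assms
proof (induction rule: elementary.induct)
  case start
  then show ?case using elementary.start[of W a] by fastforce
next
  case (extend b X I Q c \<xi> K)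
  obtain X' I' Q' where *: "elementary W a b X' I' Q'"
      "\<And>w. Q' w \<le> min R (Q w)" "\<And>w. Q w \<le> R \<Longrightarrow> I' w = I w"
    using extend.IH[OF extend.prems] by blast
  define S where "S = {w. Q w + (\<xi> w)\<^sup>2 * (c - b) \<le> R}"
  have [measurable]: "\<xi> \<in> borel_measurable (F b)" "Q \<in> borel_measurable (F b)"
    using extend(3) elementary_energy[OF extend(1)] by auto
  have m: "(\<lambda>w. \<xi> w * indicator S w) \<in> borel_measurable (F b)"
    unfolding S_def indicator_def mem_Collect_eq by measurable
  have B: "\<bar>\<xi> w * indicator S w\<bar> \<le> K" if "w \<in> space M" for w
    using extend(4)[OF that] by (auto simp: indicator_def)
  have "Q' w + (\<xi> w * indicator S w)\<^sup>2 * (c - b) \<le> min R (Q w + (\<xi> w)\<^sup>2 * (c - b))" for w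
  proof -
    have "0 \<le> (\<xi> w)\<^sup>2 * (c - b)" using extend(2) by simp
    then show ?thesis using *(2)[of w] by (auto simp: S_def indicator_def)
  qed
  moreover have "I' w + \<xi> w * indicator S w * (W c w - W b w) = I w + \<xi> w * (W c w - W b w)"
    if "Q w + (\<xi> w)\<^sup>2 * (c - b) \<le> R" for w
  proof -
    have "0 \<le> (\<xi> w)\<^sup>2 * (c - b)" using extend(2) by simp
    then show ?thesis using that *(3)[of w] by (auto simp: S_def)
  qed
  ultimately show ?case using elementary.extend[OF *(1) extend(2) m B] by blast
qed

end

section \<open>Moments of elementary integrals\<close>

context complete_filtered_prob_space
begin

lemma integrable_power_bounded:
  fixes I g :: "'a \<Rightarrow> real"
  assumes [measurable]: "I \<in> borel_measurable M" "g \<in> borel_measurable M"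
    and 4: "integrable M (\<lambda>w. I w ^ 4)" and k: "k \<le> 4" and B: "\<And>w. w \<in> space M \<Longrightarrow> \<bar>g w\<bar> \<le> B"
  shows "integrable M (\<lambda>w. I w ^ k * g w)"
proof (rule Bochner_Integration.integrable_bound)
  show "integrable M (\<lambda>w. (1 + I w ^ 4) * B)" using 4 by simp
  show "AE w in M. norm (I w ^ k * g w) \<le> norm ((1 + I w ^ 4) * B)"
  proof (rule AE_I2)
    fix w assume w: "w \<in> space M"
    have "\<bar>I w\<bar> ^ k \<le> 1 + \<bar>I w\<bar> ^ 4"
    proof (cases "\<bar>I w\<bar> \<le> 1")
      case True then show ?thesis using power_le_one[of "\<bar>I w\<bar>" k] by (simp add: add_increasing2)
    next
      case False then show ?thesis using power_increasing[OF k, of "\<bar>I w\<bar>"] by simp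
    qed
    then have "\<bar>I w\<bar> ^ k * \<bar>g w\<bar> \<le> (1 + I w ^ 4) * B"
      using B[OF w] by (intro mult_mono) auto
    also have "\<dots> \<le> (1 + I w ^ 4) * \<bar>B\<bar>" by (intro mult_left_mono) auto
    finally show "norm (I w ^ k * g w) \<le> norm ((1 + I w ^ 4) * B)"
      by (simp add: abs_mult power_abs)
  qed
qed simp

text \<open>The new increment is independent of the past and centred, so odd mixed moments vanish
  and \<open>E (I + \<xi> D)\<^sup>4\<close> only gains the terms \<open>6 I\<^sup>2 \<xi>\<^sup>2
  d\<close> and \<open>3 \<xi>\<^sup>4 d\<^sup>2\<close>, where \<open>d\<close> is the length of
  the step. The bound for the fourth moment is left in terms of \<open>I\<^sup>2 Q\<close> since
  this is what induction can maintain.\<close>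

lemma elementary_moments:
  assumes "elementary W a b X I Q" and W: "wiener_process M F W" and "0 \<le> a"
  shows "integrable M (\<lambda>w. I w ^ 4) \<and> expectation I = 0 \<and>
    expectation (\<lambda>w. (I w)\<^sup>2) = expectation Q \<and>
    expectation (\<lambda>w. I w ^ 4) \<le> 6 * expectation (\<lambda>w. (I w)\<^sup>2 * Q w) + 3 * expectation (\<lambda>w. (Q w)\<^sup>2)"
  using assms(1)
proof (induction rule: elementary.induct)
  case start
  then show ?case by simp
next
  case (extend b X I Q c \<xi> K)
  let ?D = "\<lambda>w. W c w - W b w" and ?d = "c - b"
  have b: "0 \<le> b" using elementary_le[OF extend(1)] assms(3) by simp
  have Fb [measurable]: "I \<in> borel_measurable (F b)" "Q \<in> borel_measurable (F b)" "\<xi> \<in> borel_measurable (F b)"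
    using elementary_adapted[OF extend(1) W assms(3)] elementary_energy[OF extend(1)] extend(3) by auto
  note FM [measurable] = Fb[THEN measurable_F_M]
  obtain B where B: "\<And>w. w \<in> space M \<Longrightarrow> \<bar>Q w\<bar> \<le> B" using elementary_energy[OF extend(1)] by auto
  have \<xi>j: "\<bar>\<xi> w ^ j\<bar> \<le> K ^ j" if "w \<in> space M" for w j
    using extend(4)[OF that] by (simp add: power_abs power_mono)
  have Qj: "\<bar>Q w ^ j\<bar> \<le> B ^ j" if "w \<in> space M" for w j
    using B[OF that] by (simp add: power_abs power_mono)
  have ii: "integrable M (\<lambda>w. I w ^ i * (\<xi> w ^ j * Q w ^ l))" if "i \<le> 4" for i j l
  proof (rule integrable_power_bounded[OF FM(1) _ _ that])
    show "integrable M (\<lambda>w. I w ^ 4)" using extend.IH by simp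
    show "\<bar>\<xi> w ^ j * Q w ^ l\<bar> \<le> K ^ j * B ^ l" if "w \<in> space M" for w
      unfolding abs_mult using \<xi>j[OF that, of j] Qj[OF that, of l] by (intro mult_mono) auto
  qed simp
  define P where "P i j l = expectation (\<lambda>w. I w ^ i * (\<xi> w ^ j * Q w ^ l))" for i j l :: nat
  have hb0: "has_bochner_integral M (\<lambda>w. I w ^ i * (\<xi> w ^ j * Q w ^ l)) (P i j l)" if "i \<le> 4" for i j l
    using ii[OF that] by (simp add: has_bochner_integral_iff P_def)
  have hb: "has_bochner_integral M (\<lambda>w. I w ^ i * (\<xi> w ^ j * Q w ^ l) * ?D w ^ k) (P i j l * gauss_moment k ?d)"
    if "i \<le> 4" "k > 0" for i j l k
    unfolding P_def by (rule wiener_increment_moment[OF W b extend(2) that(2) _ ii[OF that(1)]]) simp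
  have g: "gauss_moment 1 ?d = 0" "gauss_moment 2 ?d = ?d" "gauss_moment 3 ?d = 0" "gauss_moment 4 ?d = 3 * ?d\<^sup>2"
    by (simp_all add: gauss_moment_def fact_numeral)
  let ?I = "\<lambda>w. I w + \<xi> w * ?D w" and ?Q = "\<lambda>w. Q w + (\<xi> w)\<^sup>2 * ?d"
  have h1: "has_bochner_integral M ?I (P 1 0 0)"
    using has_bochner_integral_add[OF hb0[of 1 0 0] hb[of 0 1 1 0]] unfolding g by simp
  have h2: "has_bochner_integral M (\<lambda>w. (?I w)\<^sup>2) (P 2 0 0 + P 0 2 0 * ?d)"
  proof -
    have "has_bochner_integral M (\<lambda>w. I w ^ 2 * (\<xi> w ^ 0 * Q w ^ 0) + (2 * (I w ^ 1 * (\<xi> w ^ 1 * Q w ^ 0) * ?D w ^ 1)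
      + I w ^ 0 * (\<xi> w ^ 2 * Q w ^ 0) * ?D w ^ 2))
      (P 2 0 0 + (2 * (P 1 1 0 * gauss_moment 1 ?d) + P 0 2 0 * gauss_moment 2 ?d))"
      by (intro has_bochner_integral_add has_bochner_integral_mult_right hb hb0) auto
    then show ?thesis unfolding g by (simp add: power2_eq_square algebra_simps)
  qed
  have hQ: "has_bochner_integral M ?Q (P 0 0 1 + P 0 2 0 * ?d)"
    using has_bochner_integral_add[OF hb0[of 0 0 1] has_bochner_integral_mult_left[OF hb0[of 0 2 0], of ?d]] by simp
  have h4: "has_bochner_integral M (\<lambda>w. ?I w ^ 4) (P 4 0 0 + 6 * P 2 2 0 * ?d + 3 * P 0 4 0 * ?d\<^sup>2)"
  proof -
    have "has_bochner_integral M (\<lambda>w. I w ^ 4 * (\<xi> w ^ 0 * Q w ^ 0) + (4 * (I w ^ 3 * (\<xi> w ^ 1 * Q w ^ 0) * ?D w ^ 1)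
      + (6 * (I w ^ 2 * (\<xi> w ^ 2 * Q w ^ 0) * ?D w ^ 2) + (4 * (I w ^ 1 * (\<xi> w ^ 3 * Q w ^ 0) * ?D w ^ 3)
      + I w ^ 0 * (\<xi> w ^ 4 * Q w ^ 0) * ?D w ^ 4))))
      (P 4 0 0 + (4 * (P 3 1 0 * gauss_moment 1 ?d) + (6 * (P 2 2 0 * gauss_moment 2 ?d)
      + (4 * (P 1 3 0 * gauss_moment 3 ?d) + P 0 4 0 * gauss_moment 4 ?d))))"
      by (intro has_bochner_integral_add has_bochner_integral_mult_right hb hb0) auto
    then show ?thesis unfolding g by (simp add: eval_nat_numeral algebra_simps)
  qed
  have h2Q: "has_bochner_integral M (\<lambda>w. (?I w)\<^sup>2 * ?Q w) (P 2 0 1 + P 2 2 0 * ?d + P 0 2 1 * ?d + P 0 4 0 * ?d\<^sup>2)"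
  proof -
    have "has_bochner_integral M (\<lambda>w. I w ^ 2 * (\<xi> w ^ 0 * Q w ^ 1) + (?d * (I w ^ 2 * (\<xi> w ^ 2 * Q w ^ 0))
      + (2 * (I w ^ 1 * (\<xi> w ^ 1 * Q w ^ 1) * ?D w ^ 1) + (2 * ?d * (I w ^ 1 * (\<xi> w ^ 3 * Q w ^ 0) * ?D w ^ 1)
      + (I w ^ 0 * (\<xi> w ^ 2 * Q w ^ 1) * ?D w ^ 2 + ?d * (I w ^ 0 * (\<xi> w ^ 4 * Q w ^ 0) * ?D w ^ 2))))))
      (P 2 0 1 + (?d * P 2 2 0 + (2 * (P 1 1 1 * gauss_moment 1 ?d) + (2 * ?d * (P 1 3 0 * gauss_moment 1 ?d)
      + (P 0 2 1 * gauss_moment 2 ?d + ?d * (P 0 4 0 * gauss_moment 2 ?d))))))"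
      by (intro has_bochner_integral_add has_bochner_integral_mult_right hb hb0) auto
    then show ?thesis unfolding g by (simp add: eval_nat_numeral algebra_simps)
  qed
  have hQ2: "has_bochner_integral M (\<lambda>w. (?Q w)\<^sup>2) (P 0 0 2 + 2 * P 0 2 1 * ?d + P 0 4 0 * ?d\<^sup>2)"
  proof -
    have "has_bochner_integral M (\<lambda>w. I w ^ 0 * (\<xi> w ^ 0 * Q w ^ 2) + (2 * ?d * (I w ^ 0 * (\<xi> w ^ 2 * Q w ^ 1))
      + ?d\<^sup>2 * (I w ^ 0 * (\<xi> w ^ 4 * Q w ^ 0))))
      (P 0 0 2 + (2 * ?d * P 0 2 1 + ?d\<^sup>2 * P 0 4 0))"
      by (intro has_bochner_integral_add has_bochner_integral_mult_right hb0) auto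
    then show ?thesis by (simp add: eval_nat_numeral algebra_simps)
  qed
  have IH: "P 1 0 0 = 0" "P 2 0 0 = P 0 0 1" "P 4 0 0 \<le> 6 * P 2 0 1 + 3 * P 0 0 2"
    using extend.IH by (simp_all add: P_def)
  have pos: "0 \<le> P 0 2 1" "0 \<le> P 0 4 0"
    using elementary_energy[OF extend(1)] by (auto simp: P_def intro!: Bochner_Integration.integral_nonneg)
  have dpos: "0 \<le> ?d" using extend(2) by simp
  note v = h1[THEN has_bochner_integral_integral_eq] h2[THEN has_bochner_integral_integral_eq]
    hQ[THEN has_bochner_integral_integral_eq] h4[THEN has_bochner_integral_integral_eq]
    h2Q[THEN has_bochner_integral_integral_eq] hQ2[THEN has_bochner_integral_integral_eq]
  show ?case
  proof (intro conjI)
    show "integrable M (\<lambda>w. ?I w ^ 4)" using h4 by (simp add: has_bochner_integral_iff)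
    have "0 \<le> P 0 2 1 * ?d" "0 \<le> P 0 4 0 * ?d\<^sup>2" using pos dpos by auto
    then show "expectation (\<lambda>w. ?I w ^ 4) \<le> 6 * expectation (\<lambda>w. (?I w)\<^sup>2 * ?Q w) + 3 * expectation (\<lambda>w. (?Q w)\<^sup>2)"
      unfolding v using IH(3) by (simp add: algebra_simps)
  qed (use v IH in auto)
qed

text \<open>Stated with the exponents of \<open>ito_limit_power\<close>, as is the next lemma, so
  that both moments pass to the limit by the same argument.\<close>

lemma elementary_second_moment:
  assumes "elementary W a b X I Q" "wiener_process M F W" "0 \<le> a"
  shows "(\<integral>\<^sup>+w. ennreal ((I w) ^ (2 * 1)) \<partial>M) \<le> ennreal 1 * (\<integral>\<^sup>+w. ennreal (Q w ^ 1) \<partial>M)"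
proof -
  note m = elementary_moments[OF assms]
  have [measurable]: "I \<in> borel_measurable M" "Q \<in> borel_measurable M"
    using elementary_adapted[OF assms] elementary_energy[OF assms(1)] measurable_F_M by auto
  obtain B where B: "\<forall>w\<in>space M. Q w \<le> B" "\<forall>w. 0 \<le> Q w" using elementary_energy[OF assms(1)] by auto
  have "integrable M (\<lambda>w. (I w)\<^sup>2)"
    using integrable_power_bounded[of I "\<lambda>_. 1" 2 1] m by simp
  moreover have "integrable M Q" using B by (intro integrable_const_bound[of _ B]) auto
  ultimately show ?thesis using m B by (simp add: nn_integral_eq_integral)
qed

text \<open>From \<open>6 I\<^sup>2 Q \<le> I^4 / 2 + 18 Q\<^sup>2\<close> the fourth moment is
  absorbed, leaving \<open>2 (18 + 3) = 42\<close>.\<close>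

lemma elementary_fourth_moment:
  assumes "elementary W a b X I Q" "wiener_process M F W" "0 \<le> a"
  shows "(\<integral>\<^sup>+w. ennreal ((I w) ^ (2 * 2)) \<partial>M) \<le> ennreal 42 * (\<integral>\<^sup>+w. ennreal (Q w ^ 2) \<partial>M)"
proof -
  note m = elementary_moments[OF assms]
  have [measurable]: "I \<in> borel_measurable M" "Q \<in> borel_measurable M"
    using elementary_adapted[OF assms] elementary_energy[OF assms(1)] measurable_F_M by auto
  obtain B where B: "\<And>w. w\<in>space M \<Longrightarrow> \<bar>Q w\<bar> \<le> B" "\<forall>w. 0 \<le> Q w" using elementary_energy[OF assms(1)] by auto
  have i4: "integrable M (\<lambda>w. I w ^ 4)" using m by simp
  have iQ: "integrable M (\<lambda>w. (Q w)\<^sup>2)"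
    using power_mono[OF B(1) abs_ge_zero, of _ 2] by (intro integrable_const_bound[of _ "B\<^sup>2"]) auto
  have i2Q: "integrable M (\<lambda>w. (I w)\<^sup>2 * Q w)"
    using integrable_power_bounded[of I Q 2 B] i4 B by simp
  have "6 * expectation (\<lambda>w. (I w)\<^sup>2 * Q w) = expectation (\<lambda>w. 6 * ((I w)\<^sup>2 * Q w))" by simp
  also have "\<dots> \<le> expectation (\<lambda>w. I w ^ 4 / 2 + 18 * (Q w)\<^sup>2)"
  proof (rule integral_mono)
    fix w
    have "0 \<le> ((I w)\<^sup>2 - 6 * Q w)\<^sup>2" by simp
    then show "6 * ((I w)\<^sup>2 * Q w) \<le> I w ^ 4 / 2 + 18 * (Q w)\<^sup>2"
      by (simp add: eval_nat_numeral algebra_simps)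
  qed (use i4 iQ i2Q in auto)
  also have "\<dots> = expectation (\<lambda>w. I w ^ 4) / 2 + 18 * expectation (\<lambda>w. (Q w)\<^sup>2)"
    using i4 iQ by simp
  finally have "expectation (\<lambda>w. I w ^ 4) \<le> 42 * expectation (\<lambda>w. (Q w)\<^sup>2)" using m by simp
  then have "ennreal (expectation (\<lambda>w. I w ^ 4)) \<le> ennreal (42 * expectation (\<lambda>w. (Q w)\<^sup>2))"
    by (rule ennreal_leI)
  also have "\<dots> = ennreal 42 * ennreal (expectation (\<lambda>w. (Q w)\<^sup>2))"
    by (rule ennreal_mult') simp
  finally have "ennreal (expectation (\<lambda>w. I w ^ 4)) \<le> ennreal 42 * ennreal (expectation (\<lambda>w. (Q w)\<^sup>2))" .
  moreover have "(\<integral>\<^sup>+w. ennreal (I w ^ (2 * 2)) \<partial>M) = ennreal (expectation (\<lambda>w. I w ^ 4))"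
    using i4 by (subst nn_integral_eq_integral) auto
  moreover have "(\<integral>\<^sup>+w. ennreal ((Q w)\<^sup>2) \<partial>M) = ennreal (expectation (\<lambda>w. (Q w)\<^sup>2))"
    using iQ by (subst nn_integral_eq_integral) auto
  ultimately show ?thesis by simp
qed

end

section \<open>Joint measurability and energy of integrands\<close>

text \<open>Convergence in \<open>L\<^sup>2\<close> implies convergence of the norms, for
  nonnegative integrals that may be infinite along the sequence.\<close>

lemma nn_integral_square_tendsto:
  fixes f :: "nat \<Rightarrow> 'b \<Rightarrow> real"
  assumes [measurable]: "\<And>m. f m \<in> borel_measurable N" "g \<in> borel_measurable N"
    and g: "(\<integral>\<^sup>+u. ennreal ((g u)\<^sup>2) \<partial>N) < \<infinity>"
    and lim: "(\<lambda>m. \<integral>\<^sup>+u. ennreal ((f m u - g u)\<^sup>2) \<partial>N) \<longlonglongrightarrow> 0"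
  shows "(\<lambda>m. \<integral>\<^sup>+u. ennreal ((f m u)\<^sup>2) \<partial>N) \<longlonglongrightarrow> (\<integral>\<^sup>+u. ennreal ((g u)\<^sup>2) \<partial>N)"
proof -
  let ?q = "\<lambda>m. \<integral>\<^sup>+u. ennreal ((f m u)\<^sup>2) \<partial>N" and ?e = "\<integral>\<^sup>+u. ennreal ((g u)\<^sup>2) \<partial>N"
    and ?d = "\<lambda>m. \<integral>\<^sup>+u. ennreal ((f m u - g u)\<^sup>2) \<partial>N"
  obtain e where e: "?e = ennreal e" "0 \<le> e" using g by (cases ?e) auto
  \<comment> \<open>Young's inequality with a free parameter, in both directions.\<close>
  have key: "x\<^sup>2 \<le> h\<^sup>2 + \<eta> * h\<^sup>2 + (1 + 1/\<eta>) * (x - h)\<^sup>2" "h\<^sup>2 \<le> x\<^sup>2 + \<eta> * h\<^sup>2 + (1 + 1/\<eta>) * (x - h)\<^sup>2"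
    if "\<eta> > 0" for x h \<eta> :: real
  proof -
    have 1: "2 * h * (x - h) \<le> \<eta> * h\<^sup>2 + (x - h)\<^sup>2 / \<eta>"
    proof -
      have "0 \<le> (\<eta> * h - (x - h))\<^sup>2 / \<eta>" using that by simp
      also have "\<dots> = \<eta> * h\<^sup>2 + (x - h)\<^sup>2 / \<eta> - 2 * h * (x - h)" using that by (simp add: power2_eq_square field_simps)
      finally show ?thesis by simp
    qed
    have 2: "- (2 * h * (x - h)) \<le> \<eta> * h\<^sup>2 + (x - h)\<^sup>2 / \<eta>"
    proof -
      have "0 \<le> (\<eta> * h + (x - h))\<^sup>2 / \<eta>" using that by simp
      also have "\<dots> = \<eta> * h\<^sup>2 + (x - h)\<^sup>2 / \<eta> + 2 * h * (x - h)" using that by (simp add: power2_eq_square field_simps)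
      finally show ?thesis by simp
    qed
    have 3: "x\<^sup>2 = h\<^sup>2 + 2 * h * (x - h) + (x - h)\<^sup>2" by (simp add: power2_eq_square algebra_simps)
    have 4: "(1 + 1/\<eta>) * (x - h)\<^sup>2 = (x - h)\<^sup>2 + (x - h)\<^sup>2 / \<eta>" by (simp add: algebra_simps)
    have 5: "0 \<le> (x - h)\<^sup>2" by simp
    show "x\<^sup>2 \<le> h\<^sup>2 + \<eta> * h\<^sup>2 + (1 + 1/\<eta>) * (x - h)\<^sup>2" using 1 3 4 by linarith
    show "h\<^sup>2 \<le> x\<^sup>2 + \<eta> * h\<^sup>2 + (1 + 1/\<eta>) * (x - h)\<^sup>2" using 2 3 4 5 by linarith
  qed
  have bd: "?q m \<le> ?e + ennreal \<eta> * ?e + ennreal (1 + 1/\<eta>) * ?d m"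
    "?e \<le> ?q m + ennreal \<eta> * ?e + ennreal (1 + 1/\<eta>) * ?d m" if "\<eta> > 0" for \<eta> m
  proof -
    have "?q m \<le> (\<integral>\<^sup>+u. ennreal ((g u)\<^sup>2) + ennreal \<eta> * ennreal ((g u)\<^sup>2) + ennreal (1 + 1/\<eta>) * ennreal ((f m u - g u)\<^sup>2) \<partial>N)"
      using that key(1)[OF that]
      by (intro nn_integral_mono) (simp add: ennreal_plus[symmetric] ennreal_mult'[symmetric] del: ennreal_plus)
    also have "\<dots> = ?e + ennreal \<eta> * ?e + ennreal (1 + 1/\<eta>) * ?d m"
      by (simp add: nn_integral_add nn_integral_cmult)
    finally show "?q m \<le> ?e + ennreal \<eta> * ?e + ennreal (1 + 1/\<eta>) * ?d m" .
    have "?e \<le> (\<integral>\<^sup>+u. ennreal ((f m u)\<^sup>2) + ennreal \<eta> * ennreal ((g u)\<^sup>2) + ennreal (1 + 1/\<eta>) * ennreal ((f m u - g u)\<^sup>2) \<partial>N)"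
      using that key(2)[OF that]
      by (intro nn_integral_mono) (simp add: ennreal_plus[symmetric] ennreal_mult'[symmetric] del: ennreal_plus)
    also have "\<dots> = ?q m + ennreal \<eta> * ?e + ennreal (1 + 1/\<eta>) * ?d m"
      by (simp add: nn_integral_add nn_integral_cmult)
    finally show "?e \<le> ?q m + ennreal \<eta> * ?e + ennreal (1 + 1/\<eta>) * ?d m" .
  qed
  have ev: "eventually (\<lambda>m. ?q m \<le> ennreal (e + \<eta> * (e + 1)) \<and> ennreal e \<le> ?q m + ennreal (\<eta> * (e + 1))) sequentially"
    if "\<eta> > 0" for \<eta>
  proof -
    let ?c = "\<eta> / (1 + 1/\<eta>)"
    have c: "0 < ?c" using that by (simp add: add_pos_pos)
    have "eventually (\<lambda>m. ?d m < ennreal ?c) sequentially"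
      using lim c by (intro order_tendstoD(2)[OF lim]) (simp add: ennreal_zero_less_mult_iff)
    then show ?thesis
    proof eventually_elim
      case (elim m)
      have "ennreal (1 + 1/\<eta>) * ?d m \<le> ennreal (1 + 1/\<eta>) * ennreal ?c"
        using elim by (intro mult_left_mono) auto
      also have "\<dots> = ennreal \<eta>"
      proof -
        have nz: "1 + 1/\<eta> > 0" using that by (simp add: add_pos_pos)
        have "(1 + 1/\<eta>) * ?c = \<eta>"
          unfolding times_divide_eq_right by (rule nonzero_mult_div_cancel_left) (use nz in linarith)
        moreover have "ennreal (1 + 1/\<eta>) * ennreal ?c = ennreal ((1 + 1/\<eta>) * ?c)"
          using that by (intro ennreal_mult'[symmetric]) simp
        ultimately show ?thesis by simp
      qed
      finally have d: "ennreal (1 + 1/\<eta>) * ?d m \<le> ennreal \<eta>" .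
      have s: "ennreal \<eta> * ennreal e + ennreal \<eta> = ennreal (\<eta> * (e + 1))"
        using that e(2) by (simp add: ennreal_mult'[symmetric] ennreal_plus[symmetric] algebra_simps del: ennreal_plus)
      have "?q m \<le> ennreal e + ennreal \<eta> * ennreal e + ennreal \<eta>"
        using order_trans[OF bd(1)[OF that, of m, unfolded e(1)] add_left_mono[OF d]] .
      then have "?q m \<le> ennreal e + (ennreal \<eta> * ennreal e + ennreal \<eta>)" by (simp only: add.assoc)
      moreover have "ennreal e \<le> ?q m + ennreal \<eta> * ennreal e + ennreal \<eta>"
        using order_trans[OF bd(2)[OF that, of m, unfolded e(1)] add_left_mono[OF d]] .
      then have "ennreal e \<le> ?q m + (ennreal \<eta> * ennreal e + ennreal \<eta>)" by (simp only: add.assoc)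
      ultimately show ?case unfolding s using e(2) that by (simp add: ennreal_plus)
    qed
  qed
  have fin: "eventually (\<lambda>m. ?q m = ennreal (enn2real (?q m))) sequentially"
    using ev[of 1]
  proof (rule eventually_mono)
    fix m assume "?q m \<le> ennreal (e + 1 * (e + 1)) \<and> ennreal e \<le> ?q m + ennreal (1 * (e + 1))"
    then have "?q m < \<top>" using ennreal_less_top le_less_trans by blast
    then show "?q m = ennreal (enn2real (?q m))" by simp
  qed simp
  have "(\<lambda>m. enn2real (?q m)) \<longlonglongrightarrow> e"
  proof (rule tendstoI)
    fix \<epsilon> :: real assume \<epsilon>: "\<epsilon> > 0"
    define \<eta> where "\<eta> = \<epsilon> / (2 * (e + 1))"
    have \<eta>: "\<eta> > 0" "\<eta> * (e + 1) = \<epsilon> / 2" using \<epsilon> e(2) by (auto simp: \<eta>_def field_simps)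
    show "eventually (\<lambda>m. dist (enn2real (?q m)) e < \<epsilon>) sequentially"
      using ev[OF \<eta>(1)] fin
    proof eventually_elim
      case (elim m)
      have "ennreal (enn2real (?q m)) \<le> ennreal (e + \<epsilon>/2)" "ennreal e \<le> ennreal (enn2real (?q m) + \<epsilon>/2)"
        using elim \<epsilon> unfolding \<eta>(2) by (simp_all add: ennreal_plus)
      then have "enn2real (?q m) \<le> e + \<epsilon>/2" "e \<le> enn2real (?q m) + \<epsilon>/2"
        using \<epsilon> e(2) ennreal_le_iff[of "e + \<epsilon>/2"] ennreal_le_iff[of "enn2real (?q m) + \<epsilon>/2" e]
        by (simp_all del: ennreal_plus)
      then have "\<bar>enn2real (?q m) - e\<bar> < \<epsilon>" using \<epsilon> by linarith
      then show ?case by (simp add: dist_real_def)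
    qed
  qed
  then have "(\<lambda>m. ennreal (enn2real (?q m))) \<longlonglongrightarrow> ennreal e" by (rule tendsto_ennrealI)
  then show ?thesis unfolding e(1)
    by (rule Lim_transform_eventually) (use fin in \<open>auto elim: eventually_mono\<close>)
qed

text \<open>The indicator restricts attention to \<open>[a,b]\<close> while the product remains one
  on the whole line, so that Fubini applies without changing measure spaces.\<close>

definition jointly_measurable :: "'b measure \<Rightarrow> real \<Rightarrow> real \<Rightarrow> (real \<Rightarrow> 'b \<Rightarrow> real) \<Rightarrow> bool" where
  "jointly_measurable N a b H \<longleftrightarrow> (\<lambda>(u, w). indicator {a..b} u * H u w) \<in> borel_measurable (lborel \<Otimes>\<^sub>M N)"

definition energy :: "real \<Rightarrow> real \<Rightarrow> (real \<Rightarrow> 'b \<Rightarrow> real) \<Rightarrow> 'b \<Rightarrow> ennreal" where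
  "energy a b H w = (\<integral>\<^sup>+u\<in>{a..b}. ennreal ((H u w)\<^sup>2) \<partial>lborel)"

lemma energy_eq: "energy a b H w = (\<integral>\<^sup>+u. ennreal ((indicator {a..b} u * H u w)\<^sup>2) \<partial>lborel)"
  unfolding energy_def by (intro nn_integral_cong) (auto simp: indicator_def)

lemma jointly_measurable_mono:
  assumes "jointly_measurable N a b H" "sets N \<subseteq> sets N'" "space N = space N'"
  shows "jointly_measurable N' a b H"
proof -
  have "(\<lambda>w. w) \<in> measurable N' N" using assms by (auto simp: measurable_def)
  then have "snd \<circ> (\<lambda>x. x) \<in> measurable (lborel \<Otimes>\<^sub>M N') N"
    unfolding comp_def by (rule measurable_compose[OF measurable_snd])
  then have "(\<lambda>x. x) \<in> measurable (lborel \<Otimes>\<^sub>M N') (lborel \<Otimes>\<^sub>M N)"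
    by (intro measurable_pair) (auto simp: comp_def)
  from measurable_compose[OF this assms(1)[unfolded jointly_measurable_def]]
  show ?thesis by (simp add: jointly_measurable_def)
qed

lemma jointly_measurable_cong:
  assumes "jointly_measurable N a b G" "\<And>u w. u \<in> {a..b} \<Longrightarrow> G u w = H u w"
  shows "jointly_measurable N a b H"
proof -
  have "(\<lambda>(u, w). indicator {a..b} u * H u w) = (\<lambda>(u, w). indicator {a..b} u * G u w)"
    using assms(2) by (auto simp: fun_eq_iff indicator_def)
  then show ?thesis using assms(1) by (simp add: jointly_measurable_def)
qed

lemma jointly_measurable_subset:
  assumes "jointly_measurable N a b H" "a \<le> c" "d \<le> b"
  shows "jointly_measurable N c d H"
proof -
  have [measurable]: "(\<lambda>(u, w). indicator {a..b} u * H u w) \<in> borel_measurable (lborel \<Otimes>\<^sub>M N)"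
    using assms(1) by (simp add: jointly_measurable_def)
  have "(\<lambda>x. indicator {c..d} (fst x) * (case x of (u, w) \<Rightarrow> indicator {a..b} u * H u w))
    \<in> borel_measurable (lborel \<Otimes>\<^sub>M N)" by measurable
  moreover have "(\<lambda>x. indicator {c..d} (fst x) * (case x of (u, w) \<Rightarrow> indicator {a..b} u * H u w))
    = (\<lambda>(u, w). indicator {c..d} u * H u w)" using assms(2,3) by (auto simp: fun_eq_iff indicator_def)
  ultimately show ?thesis by (simp add: jointly_measurable_def)
qed

lemma jointly_measurable_diff:
  assumes "jointly_measurable N a b H" "jointly_measurable N a b G"
  shows "jointly_measurable N a b (\<lambda>u w. H u w - G u w)"
  using borel_measurable_diff[OF assms[unfolded jointly_measurable_def]]
  by (simp add: jointly_measurable_def split_beta' algebra_simps)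

lemma jointly_measurable_add:
  assumes "jointly_measurable N a b H" "jointly_measurable N a b G"
  shows "jointly_measurable N a b (\<lambda>u w. H u w + G u w)"
  using borel_measurable_add[OF assms[unfolded jointly_measurable_def]]
  by (simp add: jointly_measurable_def split_beta' algebra_simps)

lemma jointly_measurable_scale:
  assumes "jointly_measurable N a b H" and [measurable]: "\<zeta> \<in> borel_measurable N"
  shows "jointly_measurable N a b (\<lambda>u w. \<zeta> w * H u w)"
proof -
  have [measurable]: "(\<lambda>x. indicator {a..b} (fst x) * H (fst x) (snd x)) \<in> borel_measurable (lborel \<Otimes>\<^sub>M N)"
    using assms(1) by (simp add: jointly_measurable_def split_beta')
  have "(\<lambda>x. \<zeta> (snd x) * (indicator {a..b} (fst x) * H (fst x) (snd x))) \<in> borel_measurable (lborel \<Otimes>\<^sub>M N)"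
    by measurable
  then show ?thesis by (simp add: jointly_measurable_def split_beta' mult_ac)
qed

lemma jointly_measurable_compose:
  assumes "jointly_measurable N a b H" and [measurable]: "f \<in> borel_measurable borel"
  shows "jointly_measurable N a b (\<lambda>u w. f (H u w))"
proof -
  have [measurable]: "(\<lambda>x. indicator {a..b} (fst x) * H (fst x) (snd x)) \<in> borel_measurable (lborel \<Otimes>\<^sub>M N)"
    using assms(1) by (simp add: jointly_measurable_def split_beta')
  have "(\<lambda>x. indicator {a..b} (fst x) * f (indicator {a..b} (fst x) * H (fst x) (snd x))) \<in> borel_measurable (lborel \<Otimes>\<^sub>M N)"
    by measurable
  also have "(\<lambda>x. indicator {a..b} (fst x) * f (indicator {a..b} (fst x) * H (fst x) (snd x))) =
    (\<lambda>(u, w). indicator {a..b} u * f (H u w))" by (auto simp: fun_eq_iff indicator_def)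
  finally show ?thesis by (simp add: jointly_measurable_def)
qed

lemma jointly_measurable_const:
  assumes [measurable]: "\<zeta> \<in> borel_measurable N"
  shows "jointly_measurable N a b (\<lambda>u. \<zeta>)"
  unfolding jointly_measurable_def by measurable

lemma jointly_measurable_concat:
  assumes "jointly_measurable N a b H" "jointly_measurable N b c H" "a \<le> b" "b \<le> c"
  shows "jointly_measurable N a c H"
proof -
  have [measurable]: "(\<lambda>x. indicator {a..b} (fst x) * H (fst x) (snd x)) \<in> borel_measurable (lborel \<Otimes>\<^sub>M N)"
    "(\<lambda>x. indicator {b..c} (fst x) * H (fst x) (snd x)) \<in> borel_measurable (lborel \<Otimes>\<^sub>M N)"
    using assms by (simp_all add: jointly_measurable_def split_beta')
  have "(\<lambda>x. indicator {a..b} (fst x) * H (fst x) (snd x) + indicator {b<..c} (fst x) * (indicator {b..c} (fst x) * H (fst x) (snd x)))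
    \<in> borel_measurable (lborel \<Otimes>\<^sub>M N)" by measurable
  also have "(\<lambda>x. indicator {a..b} (fst x) * H (fst x) (snd x) + indicator {b<..c} (fst x) * (indicator {b..c} (fst x) * H (fst x) (snd x)))
    = (\<lambda>(u, w). indicator {a..c} u * H u w)" using assms(3,4) by (auto simp: fun_eq_iff indicator_def)
  finally show ?thesis by (simp add: jointly_measurable_def)
qed

lemma jointly_measurable_section:
  assumes "jointly_measurable N a b H" "w \<in> space N"
  shows "(\<lambda>u. indicator {a..b} u * H u w) \<in> borel_measurable lborel"
  using measurable_compose[OF measurable_Pair2'[OF assms(2)] assms(1)[unfolded jointly_measurable_def]]
  by simp

lemma energy_measurable:
  assumes "jointly_measurable N a b H"
  shows "energy a b H \<in> borel_measurable N"
proof -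
  have [measurable]: "(\<lambda>x. indicator {a..b} (fst x) * H (fst x) (snd x)) \<in> borel_measurable (lborel \<Otimes>\<^sub>M N)"
    using assms by (simp add: jointly_measurable_def split_beta')
  have "(\<lambda>p. indicator {a..b} (snd p) * H (snd p) (fst p)) \<in> borel_measurable (N \<Otimes>\<^sub>M lborel)"
    by (rule measurable_compose[OF measurable_pair_swap' , of "\<lambda>x. indicator {a..b} (fst x) * H (fst x) (snd x)", simplified split_beta' fst_conv snd_conv]) measurable
  then have "(\<lambda>(w, u). ennreal ((indicator {a..b} u * H u w)\<^sup>2)) \<in> borel_measurable (N \<Otimes>\<^sub>M lborel)"
    by (simp add: split_beta')
  then have "(\<lambda>w. \<integral>\<^sup>+u. ennreal ((indicator {a..b} u * H u w)\<^sup>2) \<partial>lborel) \<in> borel_measurable N"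
    by (rule lborel.borel_measurable_nn_integral)
  then show ?thesis by (simp add: energy_eq[abs_def])
qed

lemma energy_diff_le:
  assumes "jointly_measurable N a b H" "jointly_measurable N a b G" "w \<in> space N"
  shows "energy a b (\<lambda>u w. H u w - G u w) w \<le> 2 * energy a b H w + 2 * energy a b G w"
proof -
  note [measurable] = jointly_measurable_section[OF assms(1,3)] jointly_measurable_section[OF assms(2,3)]
  have "energy a b (\<lambda>u w. H u w - G u w) w \<le>
    (\<integral>\<^sup>+u. 2 * ennreal ((indicator {a..b} u * H u w)\<^sup>2) + 2 * ennreal ((indicator {a..b} u * G u w)\<^sup>2) \<partial>lborel)"
    unfolding energy_eq
  proof (rule nn_integral_mono)
    fix u
    have "(x - y)\<^sup>2 \<le> 2 * x\<^sup>2 + 2 * y\<^sup>2" for x y :: real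
      using zero_le_power2[of "x + y"] by (simp add: power2_eq_square algebra_simps)
    then have "ennreal ((indicator {a..b} u * (H u w - G u w))\<^sup>2) \<le>
      ennreal (2 * (indicator {a..b} u * H u w)\<^sup>2 + 2 * (indicator {a..b} u * G u w)\<^sup>2)"
      by (intro ennreal_leI) (simp add: right_diff_distrib)
    then show "ennreal ((indicator {a..b} u * (H u w - G u w))\<^sup>2) \<le>
      2 * ennreal ((indicator {a..b} u * H u w)\<^sup>2) + 2 * ennreal ((indicator {a..b} u * G u w)\<^sup>2)"
      by (simp add: ennreal_plus ennreal_mult')
  qed
  also have "\<dots> = 2 * energy a b H w + 2 * energy a b G w"
    unfolding energy_eq by (simp add: nn_integral_add nn_integral_cmult)
  finally show ?thesis .
qed

lemma energy_subset: "a \<le> c \<Longrightarrow> d \<le> b \<Longrightarrow> energy c d H w \<le> energy a b H w"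
  unfolding energy_def by (intro nn_integral_mono) (auto simp: indicator_def)

lemma energy_concat_le:
  assumes "jointly_measurable N a b H" "jointly_measurable N b c H" "w \<in> space N"
  shows "energy a c H w \<le> energy a b H w + energy b c H w"
proof -
  note [measurable] = jointly_measurable_section[OF assms(1,3)] jointly_measurable_section[OF assms(2,3)]
  have "energy a c H w \<le> (\<integral>\<^sup>+u. ennreal ((indicator {a..b} u * H u w)\<^sup>2) + ennreal ((indicator {b..c} u * H u w)\<^sup>2) \<partial>lborel)"
    unfolding energy_eq by (intro nn_integral_mono) (auto simp: indicator_def)
  also have "\<dots> = energy a b H w + energy b c H w"
    unfolding energy_eq by (simp add: nn_integral_add)
  finally show ?thesis .
qed

section \<open>The Ito integral as an almost sure limit\<close>

lemma ennreal_tendsto_zero_le: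
  fixes f g :: "nat \<Rightarrow> ennreal"
  assumes "g \<longlonglongrightarrow> 0" "\<And>m. f m \<le> g m"
  shows "f \<longlonglongrightarrow> 0"
  by (rule tendsto_sandwich[OF _ _ tendsto_const assms(1)]) (simp_all add: assms(2))

text \<open>Indices are chosen at which both sequences exceed \<open>2^(-m)\<close> with probability
  at most \<open>2^(-m)\<close>; the claim is then the Borel-Cantelli lemma. Two sequences are
  treated at once to obtain a common subsequence for integrands and integrals.\<close>

lemma (in prob_space) tendsto_zero_in_prob_AE_subseq:
  assumes D: "tendsto_zero_in_prob M D" "tendsto_zero_in_prob M E"
    and [measurable]: "\<And>m. D m \<in> borel_measurable M" "\<And>m. E m \<in> borel_measurable M"
  shows "\<exists>r. AE w in M. (\<lambda>m. D (r m) w) \<longlonglongrightarrow> 0 \<and> (\<lambda>m. E (r m) w) \<longlonglongrightarrow> 0"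
proof -
  let ?P = "\<lambda>G j m. prob {w \<in> space M. G j w > ennreal ((1/2)^m)}"
  have "\<exists>j. ?P D j m \<le> (1/2)^m \<and> ?P E j m \<le> (1/2)^m" for m :: nat
  proof -
    have p: "(0::real) < (1/2)^m" by simp
    have "eventually (\<lambda>j. ?P D j m < (1/2)^m) sequentially" "eventually (\<lambda>j. ?P E j m < (1/2)^m) sequentially"
      using order_tendstoD(2)[OF D(1)[unfolded tendsto_zero_in_prob_def, rule_format, OF p] p]
        order_tendstoD(2)[OF D(2)[unfolded tendsto_zero_in_prob_def, rule_format, OF p] p] .
    then have "eventually (\<lambda>j. ?P D j m < (1/2)^m \<and> ?P E j m < (1/2)^m) sequentially"
      by (rule eventually_conj)
    then obtain j where "?P D j m < (1/2)^m \<and> ?P E j m < (1/2)^m"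
      unfolding eventually_sequentially by blast
    then show ?thesis by (intro exI[of _ j]) simp
  qed
  then have "\<exists>r. \<forall>m. ?P D (r m) m \<le> (1/2)^m \<and> ?P E (r m) m \<le> (1/2)^m"
    by (intro choice allI)
  then obtain r where r: "\<And>m. ?P D (r m) m \<le> (1/2)^m" "\<And>m. ?P E (r m) m \<le> (1/2)^m" by blast
  have sD: "AE w in M. (\<lambda>m. G (r m) w) \<longlonglongrightarrow> 0"
    if [measurable]: "\<And>m. G m \<in> borel_measurable M"
      and rG: "\<And>m. ?P G (r m) m \<le> (1/2)^m" for G :: "nat \<Rightarrow> 'a \<Rightarrow> ennreal"
  proof -
    let ?A = "\<lambda>m. {w \<in> space M. G (r m) w > ennreal ((1/2)^m)}"
    have "summable (\<lambda>m. prob (?A m))"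
      by (rule summable_comparison_test[OF exI[of _ 0] summable_geometric[of "1/2::real"]])
         (simp_all only: real_norm_def abs_of_nonneg measure_nonneg rG abs_divide abs_one abs_numeral, simp_all)
    then have "AE w in M. eventually (\<lambda>m. w \<in> space M - ?A m) sequentially"
      by (intro borel_cantelli_AE1) (auto simp: emeasure_eq_measure)
    then show ?thesis
    proof eventually_elim
      case (elim w)
      have "(\<lambda>m. ennreal ((1/2::real)^m)) \<longlonglongrightarrow> ennreal 0"
        by (intro tendsto_ennrealI LIMSEQ_power_zero) simp
      then have l: "(\<lambda>m. ennreal ((1/2::real)^m)) \<longlonglongrightarrow> 0" by simp
      have e: "eventually (\<lambda>m. G (r m) w \<le> ennreal ((1/2)^m)) sequentially"
        using elim by eventually_elim auto
      show ?case by (rule tendsto_sandwich[OF _ e tendsto_const l]) simp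
    qed
  qed
  have "AE w in M. (\<lambda>m. D (r m) w) \<longlonglongrightarrow> 0 \<and> (\<lambda>m. E (r m) w) \<longlonglongrightarrow> 0"
    by (rule AE_conjI; rule sD) (simp_all add: r)
  then show ?thesis by blast
qed

context complete_filtered_prob_space
begin

lemma jointly_measurable_F_mono: "jointly_measurable (F s) a b H \<Longrightarrow> s \<le> t \<Longrightarrow> jointly_measurable (F t) a b H"
  using sets_F_mono by (auto intro!: jointly_measurable_mono[of "F s"] simp: space_F)

lemma jointly_measurable_F_M: "jointly_measurable (F s) a b H \<Longrightarrow> jointly_measurable M a b H"
  using sets_F_subset by (auto intro!: jointly_measurable_mono[of "F s"] simp: space_F)

lemma elementary_jointly_measurable: "elementary W a b X I Q \<Longrightarrow> jointly_measurable (F b) c d X"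
  using elementary_measurable[of W a b X I Q] unfolding jointly_measurable_def split_beta' by measurable

text \<open>Progressive measurability at the right end of the interval already contains joint
  measurability on all of it.\<close>

lemma progressively_measurable_jointly:
  assumes "progressively_measurable F a b H" "a \<le> b"
  shows "jointly_measurable (F b) a b H"
proof -
  have H: "(\<lambda>(s, w). H s w) \<in> borel_measurable (restrict_space borel {a..b} \<Otimes>\<^sub>M F b)"
    using assms by (auto simp: progressively_measurable_def)
  have "(\<lambda>u. max a (min b u)) \<in> measurable lborel (restrict_space borel {a..b})"
    using assms(2) by (intro measurable_restrict_space2) auto
  then have "(\<lambda>x. (max a (min b (fst x)), snd x)) \<in> measurable (lborel \<Otimes>\<^sub>M F b) (restrict_space borel {a..b} \<Otimes>\<^sub>M F b)"
    by measurable
  from measurable_compose[OF this H]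
  have [measurable]: "(\<lambda>x. H (max a (min b (fst x))) (snd x)) \<in> borel_measurable (lborel \<Otimes>\<^sub>M F b)" by simp
  have "(\<lambda>x. indicator {a..b} (fst x) * H (max a (min b (fst x))) (snd x)) \<in> borel_measurable (lborel \<Otimes>\<^sub>M F b)"
    by measurable
  also have "(\<lambda>x. indicator {a..b} (fst x) * H (max a (min b (fst x))) (snd x)) = (\<lambda>(u, w). indicator {a..b} u * H u w)"
    by (auto simp: fun_eq_iff indicator_def)
  finally show ?thesis by (simp add: jointly_measurable_def)
qed

lemma simple_process_elementary:
  assumes "simple_process M F a b N s \<xi>"
  shows "\<exists>Q. elementary W a b (simple_value N s \<xi>) (simple_integral_wrt W N s \<xi>) Q"
proof -
  have "\<exists>Q. elementary W a (s n) (simple_value n s \<xi>) (simple_integral_wrt W n s \<xi>) Q" if "n \<le> N" for n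
    using that
  proof (induction n)
    case 0
    have "s 0 = a" using assms by (simp add: simple_process_def)
    then show ?case using elementary.start[of W a] by (intro exI[of _ "\<lambda>w. 0"]) (simp add: simple_value_def[abs_def] simple_integral_wrt_def[abs_def])
  next
    case (Suc n)
    then obtain Q where Q: "elementary W a (s n) (simple_value n s \<xi>) (simple_integral_wrt W n s \<xi>) Q" by auto
    obtain B where B: "\<And>w. w \<in> space M \<Longrightarrow> \<bar>\<xi> n w\<bar> \<le> B" "s n \<le> s (Suc n)" "\<xi> n \<in> borel_measurable (F (s n))"
      using assms Suc.prems unfolding simple_process_def by (metis Suc_le_eq)
    have e: "simple_value (Suc n) s \<xi> = (\<lambda>u w. simple_value n s \<xi> u w + \<xi> n w * indicator {s n<..s (Suc n)} u)"
      "simple_integral_wrt W (Suc n) s \<xi> = (\<lambda>w. simple_integral_wrt W n s \<xi> w + \<xi> n w * (W (s (Suc n)) w - W (s n) w))"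
      unfolding simple_value_def[abs_def] simple_integral_wrt_def[abs_def] sum.lessThan_Suc by (rule refl)+
    show ?case
      by (rule exI, rule elementary_extend[OF Q B(2,3,1) e refl])
  qed
  from this[of N] show ?thesis using assms by (auto simp: simple_process_def)
qed

text \<open>\<open>J\<close> is an almost sure limit of elementary integrals whose integrands
  converge to \<open>H\<close> in the energy for almost every path. Every Ito integral has this
  form, and this form is stable under the operations below.\<close>

definition ito_limit :: "(real \<Rightarrow> 'a \<Rightarrow> real) \<Rightarrow> (real \<Rightarrow> 'a \<Rightarrow> real) \<Rightarrow> real \<Rightarrow> real \<Rightarrow> ('a \<Rightarrow> real) \<Rightarrow> bool" where
  "ito_limit W H a b J \<longleftrightarrow> 0 \<le> a \<and> a \<le> b \<and> jointly_measurable (F b) a b H \<and> J \<in> borel_measurable M \<and>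
    (AE w in M. energy a b H w < \<infinity>) \<and>
    (\<exists>X I Q. (\<forall>m. elementary W a b (X m) (I m) (Q m)) \<and>
      (AE w in M. (\<lambda>m. energy a b (\<lambda>u w. X m u w - H u w) w) \<longlonglongrightarrow> 0) \<and>
      (AE w in M. (\<lambda>m. I m w) \<longlonglongrightarrow> J w))"

lemma ito_limitI:
  assumes "0 \<le> a" "jointly_measurable (F b) a b H" "J \<in> borel_measurable M" "AE w in M. energy a b H w < \<infinity>"
    "\<And>m. elementary W a b (X m) (I m) (Q m)"
    "AE w in M. (\<lambda>m. energy a b (\<lambda>u w. X m u w - H u w) w) \<longlonglongrightarrow> 0"
    "AE w in M. (\<lambda>m. I m w) \<longlonglongrightarrow> J w"
  shows "ito_limit W H a b J"
  unfolding ito_limit_def using assms elementary_le[OF assms(5)] by blast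

lemma ito_limitD:
  assumes "ito_limit W H a b J"
  shows "0 \<le> a" "a \<le> b" "jointly_measurable (F b) a b H" "jointly_measurable M a b H" "J \<in> borel_measurable M"
    "AE w in M. energy a b H w < \<infinity>"
  using assms by (auto simp: ito_limit_def intro: jointly_measurable_F_M)

lemma has_ito_integral_ito_limit:
  assumes wiener: "wiener_process M F W" and "has_ito_integral M F W H a b J" "0 \<le> a"
  shows "ito_limit W H a b J"
proof -
  obtain N s \<xi> where sp: "\<And>m. simple_process M F a b (N m) (s m) (\<xi> m)"
    and p1: "tendsto_zero_in_prob M
          (\<lambda>m w. \<integral>\<^sup>+ u\<in>{a..b}. ennreal ((simple_value (N m) (s m) (\<xi> m) u w - H u w)\<^sup>2) \<partial>lborel)"
    and p2: "tendsto_zero_in_prob M (\<lambda>m w. ennreal \<bar>simple_integral_wrt W (N m) (s m) (\<xi> m) w - J w\<bar>)"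
    using assms unfolding has_ito_integral_def by blast
  have "\<exists>Q. \<forall>m. elementary W a b (simple_value (N m) (s m) (\<xi> m)) (simple_integral_wrt W (N m) (s m) (\<xi> m)) (Q m)"
    by (intro choice allI simple_process_elementary[OF sp])
  then obtain Q where Q: "\<And>m. elementary W a b (simple_value (N m) (s m) (\<xi> m)) (simple_integral_wrt W (N m) (s m) (\<xi> m)) (Q m)"
    by blast
  note ab = elementary_le[OF Q[of 0]]
  have jm: "jointly_measurable (F b) a b H"
    using assms ab by (auto simp: has_ito_integral_def intro: progressively_measurable_jointly)
  have J [measurable]: "J \<in> borel_measurable M" using assms by (simp add: has_ito_integral_def)
  have [measurable]: "simple_integral_wrt W (N m) (s m) (\<xi> m) \<in> borel_measurable M" for m
    using elementary_adapted[OF Q wiener assms(3)] measurable_F_M by blast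
  have em: "energy a b (\<lambda>u w. simple_value (N m) (s m) (\<xi> m) u w - H u w) \<in> borel_measurable M" for m
    by (intro energy_measurable jointly_measurable_F_M[of b] jointly_measurable_diff elementary_jointly_measurable[OF Q] jm)
  have "\<exists>r. AE w in M. (\<lambda>m. energy a b (\<lambda>u w. simple_value (N (r m)) (s (r m)) (\<xi> (r m)) u w - H u w) w) \<longlonglongrightarrow> 0 \<and>
    (\<lambda>m. ennreal \<bar>simple_integral_wrt W (N (r m)) (s (r m)) (\<xi> (r m)) w - J w\<bar>) \<longlonglongrightarrow> 0"
    by (rule tendsto_zero_in_prob_AE_subseq[OF _ p2]) (use p1 em in \<open>simp_all add: energy_def[abs_def]\<close>)
  then obtain r where r: "AE w in M. (\<lambda>m. energy a b (\<lambda>u w. simple_value (N (r m)) (s (r m)) (\<xi> (r m)) u w - H u w) w) \<longlonglongrightarrow> 0 \<and>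
    (\<lambda>m. ennreal \<bar>simple_integral_wrt W (N (r m)) (s (r m)) (\<xi> (r m)) w - J w\<bar>) \<longlonglongrightarrow> 0" by blast
  have "AE w in M. (\<lambda>m. simple_integral_wrt W (N (r m)) (s (r m)) (\<xi> (r m)) w) \<longlonglongrightarrow> J w"
    using r
  proof eventually_elim
    case (elim w)
    then have "(\<lambda>m. ennreal \<bar>simple_integral_wrt W (N (r m)) (s (r m)) (\<xi> (r m)) w - J w\<bar>) \<longlonglongrightarrow> ennreal 0" by simp
    then have "(\<lambda>m. \<bar>simple_integral_wrt W (N (r m)) (s (r m)) (\<xi> (r m)) w - J w\<bar>) \<longlonglongrightarrow> 0"
      by (subst (asm) tendsto_ennreal_iff) auto
    then show ?case by (simp add: tendsto_rabs_zero_iff LIM_zero_iff)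
  qed
  moreover have "AE w in M. energy a b H w < \<infinity>" using assms by (simp add: has_ito_integral_def energy_def)
  moreover have "AE w in M. (\<lambda>m. energy a b (\<lambda>u w. simple_value (N (r m)) (s (r m)) (\<xi> (r m)) u w - H u w) w) \<longlonglongrightarrow> 0"
    using r by eventually_elim auto
  ultimately show ?thesis by (intro ito_limitI[OF assms(3) jm J _ Q])
qed

lemma ito_limit_diff:
  assumes "ito_limit W H a b J" "ito_limit W G a b K"
  shows "ito_limit W (\<lambda>u w. H u w - G u w) a b (\<lambda>w. J w - K w)"
proof -
  obtain X I Q where 1: "\<And>m. elementary W a b (X m) (I m) (Q m)"
      "AE w in M. (\<lambda>m. energy a b (\<lambda>u w. X m u w - H u w) w) \<longlonglongrightarrow> 0"
      "AE w in M. (\<lambda>m. I m w) \<longlonglongrightarrow> J w"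
    using assms(1) unfolding ito_limit_def by blast
  obtain Y L R where 2: "\<And>m. elementary W a b (Y m) (L m) (R m)"
      "AE w in M. (\<lambda>m. energy a b (\<lambda>u w. Y m u w - G u w) w) \<longlonglongrightarrow> 0"
      "AE w in M. (\<lambda>m. L m w) \<longlonglongrightarrow> K w"
    using assms(2) unfolding ito_limit_def by blast
  have "\<exists>S. \<forall>m. elementary W a b (\<lambda>u w. X m u w - Y m u w) (\<lambda>w. I m w - L m w) (S m)"
    by (intro choice allI elementary_diff[OF 2(1) 1(1)])
  then obtain S where S: "\<And>m. elementary W a b (\<lambda>u w. X m u w - Y m u w) (\<lambda>w. I m w - L m w) (S m)" by blast
  have jH: "jointly_measurable M a b H" and jG: "jointly_measurable M a b G"
    using assms by (auto simp: ito_limit_def intro: jointly_measurable_F_M)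
  have jX: "jointly_measurable M a b (\<lambda>u w. X m u w - H u w)" "jointly_measurable M a b (\<lambda>u w. Y m u w - G u w)" for m
    by (auto intro!: jointly_measurable_diff jH jG jointly_measurable_F_M[OF elementary_jointly_measurable[OF 1(1)]]
       jointly_measurable_F_M[OF elementary_jointly_measurable[OF 2(1)]])
  have "AE w in M. (\<lambda>m. energy a b (\<lambda>u w. X m u w - Y m u w - (H u w - G u w)) w) \<longlonglongrightarrow> 0"
    using 1(2) 2(2) AE_space
  proof eventually_elim
    case (elim w)
    have "(\<lambda>m. 2 * energy a b (\<lambda>u w. X m u w - H u w) w + 2 * energy a b (\<lambda>u w. Y m u w - G u w) w) \<longlonglongrightarrow> 2 * 0 + 2 * 0"
      by (intro tendsto_add ennreal_tendsto_cmult elim) auto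
    then have l: "(\<lambda>m. 2 * energy a b (\<lambda>u w. X m u w - H u w) w + 2 * energy a b (\<lambda>u w. Y m u w - G u w) w) \<longlonglongrightarrow> 0" by simp
    have "energy a b (\<lambda>u w. X m u w - Y m u w - (H u w - G u w)) w \<le>
      2 * energy a b (\<lambda>u w. X m u w - H u w) w + 2 * energy a b (\<lambda>u w. Y m u w - G u w) w" for m
      using energy_diff_le[OF jX(1)[of m] jX(2)[of m] elim(3)] by (simp add: algebra_simps)
    then show ?case by (intro ennreal_tendsto_zero_le[OF l])
  qed
  moreover have "AE w in M. (\<lambda>m. I m w - L m w) \<longlonglongrightarrow> J w - K w"
    using 1(3) 2(3) by eventually_elim (rule tendsto_diff)
  moreover have "AE w in M. energy a b (\<lambda>u w. H u w - G u w) w < \<infinity>"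
  proof -
    have "AE w in M. energy a b H w < \<infinity>" "AE w in M. energy a b G w < \<infinity>"
      using assms by (auto simp: ito_limit_def)
    then show ?thesis using AE_space
    proof eventually_elim
      case (elim w)
      show ?case
        by (rule le_less_trans[OF energy_diff_le[OF jH jG elim(3)]]) (use elim in \<open>simp add: ennreal_mult_less_top\<close>)
    qed
  qed
  ultimately show ?thesis
    using ito_limitD[OF assms(1)] ito_limitD[OF assms(2)]
    by (intro ito_limitI[OF _ _ _ _ S]) (auto intro!: jointly_measurable_diff)
qed

lemma ito_limit_scale:
  assumes "ito_limit W H a b J" "\<zeta> \<in> borel_measurable (F a)" "\<And>w. w \<in> space M \<Longrightarrow> \<bar>\<zeta> w\<bar> \<le> L"
  shows "ito_limit W (\<lambda>u w. \<zeta> w * H u w) a b (\<lambda>w. \<zeta> w * J w)"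
proof -
  obtain X I Q where 1: "\<And>m. elementary W a b (X m) (I m) (Q m)"
      "AE w in M. (\<lambda>m. energy a b (\<lambda>u w. X m u w - H u w) w) \<longlonglongrightarrow> 0"
      "AE w in M. (\<lambda>m. I m w) \<longlonglongrightarrow> J w"
    using assms(1) unfolding ito_limit_def by blast
  have jH: "jointly_measurable M a b H" and ab: "a \<le> b"
    using assms by (auto simp: ito_limit_def intro: jointly_measurable_F_M)
  have en: "energy a b (\<lambda>u w. \<zeta> w * G u w) w = ennreal ((\<zeta> w)\<^sup>2) * energy a b G w"
    if "jointly_measurable M a b G" "w \<in> space M" for G w
  proof -
    note [measurable] = jointly_measurable_section[OF that]
    have "energy a b (\<lambda>u w. \<zeta> w * G u w) w = (\<integral>\<^sup>+u. ennreal ((\<zeta> w)\<^sup>2) * ennreal ((indicator {a..b} u * G u w)\<^sup>2) \<partial>lborel)"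
      unfolding energy_eq by (intro nn_integral_cong) (simp add: ennreal_mult'[symmetric] power_mult_distrib mult_ac)
    then show ?thesis unfolding energy_eq by (simp add: nn_integral_cmult)
  qed
  have jX: "jointly_measurable M a b (\<lambda>u w. X m u w - H u w)" for m
    by (auto intro!: jointly_measurable_diff jH jointly_measurable_F_M[OF elementary_jointly_measurable[OF 1(1)]])
  have "AE w in M. (\<lambda>m. energy a b (\<lambda>u w. \<zeta> w * X m u w - \<zeta> w * H u w) w) \<longlonglongrightarrow> 0"
    using 1(2) AE_space
  proof eventually_elim
    case (elim w)
    have "(\<lambda>m. ennreal ((\<zeta> w)\<^sup>2) * energy a b (\<lambda>u w. X m u w - H u w) w) \<longlonglongrightarrow> ennreal ((\<zeta> w)\<^sup>2) * 0"
      by (intro ennreal_tendsto_cmult elim) auto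
    then show ?case using en[OF jX elim(2)] by (simp add: right_diff_distrib)
  qed
  moreover have "AE w in M. (\<lambda>m. \<zeta> w * I m w) \<longlonglongrightarrow> \<zeta> w * J w"
    using 1(3) by eventually_elim (rule tendsto_mult_left)
  moreover have "AE w in M. energy a b (\<lambda>u w. \<zeta> w * H u w) w < \<infinity>"
  proof -
    have "AE w in M. energy a b H w < \<infinity>" using assms by (auto simp: ito_limit_def)
    then show ?thesis using AE_space
      by eventually_elim (simp add: en[OF jH] ennreal_mult_less_top)
  qed
  ultimately show ?thesis
    using ito_limitD[OF assms(1)] measurable_F_M[OF assms(2)] measurable_F_mono[OF assms(2) ab]
    by (intro ito_limitI[OF _ _ _ _ elementary_scale[OF 1(1) assms(2,3)]])
       (auto intro!: jointly_measurable_scale)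
qed

text \<open>Approximations on adjacent intervals are joined by
  \<open>elementary_concat\<close>.\<close>

lemma ito_limit_concat:
  assumes "ito_limit W H a b J" "ito_limit W H b c K"
  shows "ito_limit W H a c (\<lambda>w. J w + K w)"
proof -
  obtain X I Q where 1: "\<And>m. elementary W a b (X m) (I m) (Q m)"
      "AE w in M. (\<lambda>m. energy a b (\<lambda>u w. X m u w - H u w) w) \<longlonglongrightarrow> 0"
      "AE w in M. (\<lambda>m. I m w) \<longlonglongrightarrow> J w"
    using assms(1) unfolding ito_limit_def by blast
  obtain Y L R where 2: "\<And>m. elementary W b c (Y m) (L m) (R m)"
      "AE w in M. (\<lambda>m. energy b c (\<lambda>u w. Y m u w - H u w) w) \<longlonglongrightarrow> 0"
      "AE w in M. (\<lambda>m. L m w) \<longlonglongrightarrow> K w"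
    using assms(2) unfolding ito_limit_def by blast
  have ab: "a \<le> b" "b \<le> c" using assms by (auto simp: ito_limit_def)
  have jF: "jointly_measurable (F c) a b H" "jointly_measurable (F c) b c H"
    using assms ab by (auto simp: ito_limit_def intro: jointly_measurable_F_mono)
  note jH = jF[THEN jointly_measurable_F_M]
  let ?Z = "\<lambda>m u w. X m u w + Y m u w"
  have S: "elementary W a c (?Z m) (\<lambda>w. I m w + L m w) (\<lambda>w. Q m w + R m w)" for m
    by (rule elementary_concat[OF 2(1) 1(1)])
  have jZ: "jointly_measurable M a b (\<lambda>u w. ?Z m u w - H u w)" "jointly_measurable M b c (\<lambda>u w. ?Z m u w - H u w)" for m
    by (auto intro!: jointly_measurable_diff jH jointly_measurable_F_M[OF elementary_jointly_measurable[OF S]])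
  have eb: "energy a b (\<lambda>u w. ?Z m u w - H u w) w = energy a b (\<lambda>u w. X m u w - H u w) w" for m w
    unfolding energy_def
    by (intro nn_integral_cong) (auto simp: indicator_def elementary_support[OF 2(1)])
  have ec: "energy b c (\<lambda>u w. ?Z m u w - H u w) w = energy b c (\<lambda>u w. Y m u w - H u w) w" for m w
    unfolding energy_def
  proof (intro nn_integral_cong_AE, rule AE_mp[OF AE_lborel_singleton[of b]], rule AE_I2, intro impI)
    fix u assume "u \<noteq> b"
    then show "ennreal ((?Z m u w - H u w)\<^sup>2) * indicator {b..c} u = ennreal ((Y m u w - H u w)\<^sup>2) * indicator {b..c} u"
      by (auto simp: indicator_def elementary_support[OF 1(1)])
  qed
  have "AE w in M. (\<lambda>m. energy a c (\<lambda>u w. ?Z m u w - H u w) w) \<longlonglongrightarrow> 0"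
    using 1(2) 2(2) AE_space
  proof eventually_elim
    case (elim w)
    have l: "(\<lambda>m. energy a b (\<lambda>u w. X m u w - H u w) w + energy b c (\<lambda>u w. Y m u w - H u w) w) \<longlonglongrightarrow> 0"
      using tendsto_add[OF elim(1,2)] by simp
    have "energy a c (\<lambda>u w. ?Z m u w - H u w) w \<le>
      energy a b (\<lambda>u w. X m u w - H u w) w + energy b c (\<lambda>u w. Y m u w - H u w) w" for m
      using energy_concat_le[OF jZ(1)[of m] jZ(2)[of m] elim(3)] unfolding eb ec .
    then show ?case by (intro ennreal_tendsto_zero_le[OF l])
  qed
  moreover have "AE w in M. (\<lambda>m. I m w + L m w) \<longlonglongrightarrow> J w + K w"
    using 1(3) 2(3) by eventually_elim (rule tendsto_add)
  moreover have "AE w in M. energy a c H w < \<infinity>"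
  proof -
    have "AE w in M. energy a b H w < \<infinity>" "AE w in M. energy b c H w < \<infinity>"
      using assms by (auto simp: ito_limit_def)
    then show ?thesis using AE_space
    proof eventually_elim
      case (elim w)
      show ?case
        by (rule le_less_trans[OF energy_concat_le[OF jH elim(3)]]) (use elim in simp)
    qed
  qed
  ultimately show ?thesis
    using ito_limitD[OF assms(1)] ito_limitD[OF assms(2)]
    by (intro ito_limitI[OF _ jointly_measurable_concat[OF jF ab] _ _ S]) auto
qed

lemma ito_limit_empty: "0 \<le> a \<Longrightarrow> jointly_measurable (F a) a a H \<Longrightarrow> ito_limit W H a a (\<lambda>_. 0)"
proof -
  assume a: "0 \<le> a" "jointly_measurable (F a) a a H"
  have e: "energy a a G w = 0" for G :: "real \<Rightarrow> 'a \<Rightarrow> real" and w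
  proof -
    have "energy a a G w = (\<integral>\<^sup>+u. ennreal ((G a w)\<^sup>2) * indicator {a} u \<partial>lborel)"
      unfolding energy_def by (intro nn_integral_cong) (auto simp: indicator_def)
    then show ?thesis by (simp add: nn_integral_cmult_indicator)
  qed
  show ?thesis using a
    by (intro ito_limitI[OF _ _ _ _ elementary.start]) (auto simp: e)
qed

end

section \<open>Moments and increments of Ito integrals\<close>

text \<open>Monotone convergence along the events \<open>q < n\<close>, which exhaust the space up
  to a null set.\<close>

lemma nn_integral_le_of_truncations:
  fixes X q :: "'b \<Rightarrow> ennreal"
  assumes [measurable]: "X \<in> borel_measurable M" "q \<in> borel_measurable M"
    and fin: "AE w in M. q w < \<infinity>"
    and bound: "\<And>n::nat. (\<integral>\<^sup>+w. X w * indicator {w. q w < ennreal (real n)} w \<partial>M) \<le> C"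
  shows "(\<integral>\<^sup>+w. X w \<partial>M) \<le> C"
proof -
  have "(\<integral>\<^sup>+w. X w \<partial>M) \<le> (\<integral>\<^sup>+w. liminf (\<lambda>n. X w * indicator {w. q w < ennreal (real n)} w) \<partial>M)"
  proof (rule nn_integral_mono_AE)
    show "AE w in M. X w \<le> liminf (\<lambda>n. X w * indicator {w. q w < ennreal (real n)} w)"
      using fin
    proof eventually_elim
      case (elim w)
      obtain n0 where n0: "q w < ennreal (real n0)"
        using elim ennreal_Ex_less_of_nat by (auto simp: ennreal_of_nat_eq_real_of_nat)
      have "eventually (\<lambda>n. X w = X w * indicator {w. q w < ennreal (real n)} w) sequentially"
        using eventually_ge_at_top[of n0]
      proof eventually_elim
        case (elim n)
        then have "q w < ennreal (real n)"
          by (intro less_le_trans[OF n0] ennreal_leI) simp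
        then show ?case by (simp add: indicator_def)
      qed
      from Lim_transform_eventually[OF tendsto_const this]
      have "liminf (\<lambda>n. X w * indicator {w. q w < ennreal (real n)} w) = X w"
        by (rule lim_imp_Liminf[OF sequentially_bot])
      then show ?case by simp
    qed
  qed
  also have "\<dots> \<le> liminf (\<lambda>n. \<integral>\<^sup>+w. X w * indicator {w. q w < ennreal (real n)} w \<partial>M)"
  proof (rule nn_integral_liminf)
    fix n
    have "(\<lambda>w. X w * indicator {w \<in> space M. q w < ennreal (real n)} w) \<in> borel_measurable M"
      by measurable
    then show "(\<lambda>w. X w * indicator {w. q w < ennreal (real n)} w) \<in> borel_measurable M"
      by (rule measurable_cong[THEN iffD1, rotated]) (simp add: indicator_def)
  qed
  also have "\<dots> \<le> liminf (\<lambda>n::nat. C)"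
    by (rule Liminf_mono, rule always_eventually, rule allI, rule bound)
  also have "\<dots> = C"
    by (rule lim_imp_Liminf[OF sequentially_bot tendsto_const])
  finally show ?thesis .
qed

context complete_filtered_prob_space
begin

context
  fixes W
  assumes wiener: "wiener_process M F W"
begin

text \<open>Energies converge because the integrands converge in \<open>L\<^sup>2\<close> of time
  for almost every path.\<close>

lemma ito_limit_approximation:
  assumes "ito_limit W H a b J"
  shows "\<exists>X I Q. (\<forall>m. elementary W a b (X m) (I m) (Q m)) \<and>
    (AE w in M. (\<lambda>m. energy a b (\<lambda>u w. X m u w - H u w) w) \<longlonglongrightarrow> 0) \<and>
    (AE w in M. (\<lambda>m. I m w) \<longlonglongrightarrow> J w) \<and>
    (AE w in M. (\<lambda>m. ennreal (Q m w)) \<longlonglongrightarrow> energy a b H w)"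
proof -
  obtain X I Q where 1: "\<And>m. elementary W a b (X m) (I m) (Q m)"
      "AE w in M. (\<lambda>m. energy a b (\<lambda>u w. X m u w - H u w) w) \<longlonglongrightarrow> 0"
      "AE w in M. (\<lambda>m. I m w) \<longlonglongrightarrow> J w"
    using assms(1) unfolding ito_limit_def by blast
  have "AE w in M. (\<lambda>m. ennreal (Q m w)) \<longlonglongrightarrow> energy a b H w"
    using 1(2) ito_limitD(6)[OF assms] AE_space
  proof eventually_elim
    case (elim w)
    have e: "energy a b (\<lambda>u w. X m u w - H u w) w = (\<integral>\<^sup>+u. ennreal ((X m u w - indicator {a..b} u * H u w)\<^sup>2) \<partial>lborel)" for m
      unfolding energy_eq by (intro nn_integral_cong) (auto simp: indicator_def elementary_support[OF 1(1)])
    have "(\<lambda>m. \<integral>\<^sup>+u. ennreal ((X m u w)\<^sup>2) \<partial>lborel) \<longlonglongrightarrow> (\<integral>\<^sup>+u. ennreal ((indicator {a..b} u * H u w)\<^sup>2) \<partial>lborel)"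
    proof (rule nn_integral_square_tendsto)
      show "(\<lambda>u. X m u w) \<in> borel_measurable lborel" for m
        using elementary_nn_energy[OF 1(1)] by simp
      show "(\<lambda>u. indicator {a..b} u * H u w) \<in> borel_measurable lborel"
        by (rule jointly_measurable_section[OF ito_limitD(4)[OF assms] elim(3)])
      show "(\<integral>\<^sup>+u. ennreal ((indicator {a..b} u * H u w)\<^sup>2) \<partial>lborel) < \<infinity>"
        using elim(2) by (simp add: energy_eq)
      show "(\<lambda>m. \<integral>\<^sup>+u. ennreal ((X m u w - indicator {a..b} u * H u w)\<^sup>2) \<partial>lborel) \<longlonglongrightarrow> 0"
        using elim(1) by (simp add: e)
    qed
    then show ?case
      using elementary_nn_energy[OF 1(1)] by (simp add: energy_eq)
  qed
  with 1 show ?thesis by blast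
qed

text \<open>On the event that the energy of \<open>H\<close> is below \<open>R\<close>, the energies
  of the approximations are eventually below \<open>R\<close> and truncation does not change the
  integrals. The bounds \<open>q m\<close> converge and are uniformly bounded, so dominated
  convergence applies to them.\<close>

lemma ito_limit_truncated_approximation:
  assumes "ito_limit W H a b J" "0 \<le> R"
  shows "\<exists>X I Q. (\<forall>m. elementary W a b (X m) (I m) (Q m)) \<and>
    (AE w in M. energy a b H w < ennreal R \<longrightarrow> (\<lambda>m. I m w) \<longlonglongrightarrow> J w) \<and>
    (\<exists>q. (\<forall>m. q m \<in> borel_measurable M \<and> (\<forall>w. 0 \<le> q m w \<and> Q m w \<le> q m w \<and> q m w \<le> R)) \<and>
      (AE w in M. (\<lambda>m. q m w) \<longlonglongrightarrow> min R (enn2real (energy a b H w))))"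
proof -
  obtain X I Q where 1: "\<And>m. elementary W a b (X m) (I m) (Q m)"
    and I: "AE w in M. (\<lambda>m. I m w) \<longlonglongrightarrow> J w"
    and Q: "AE w in M. (\<lambda>m. ennreal (Q m w)) \<longlonglongrightarrow> energy a b H w"
    using ito_limit_approximation[OF assms(1)] by blast
  have "\<forall>m. \<exists>p. elementary W a b (fst p) (fst (snd p)) (snd (snd p)) \<and>
    (\<forall>w. snd (snd p) w \<le> min R (Q m w) \<and> (Q m w \<le> R \<longrightarrow> fst (snd p) w = I m w))"
  proof
    fix m
    obtain X' I' Q' where "elementary W a b X' I' Q' \<and> (\<forall>w. Q' w \<le> min R (Q m w) \<and> (Q m w \<le> R \<longrightarrow> I' w = I m w))"
      using elementary_truncate[OF 1(1) assms(2), of m] by blast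
    then show "\<exists>p. elementary W a b (fst p) (fst (snd p)) (snd (snd p)) \<and>
        (\<forall>w. snd (snd p) w \<le> min R (Q m w) \<and> (Q m w \<le> R \<longrightarrow> fst (snd p) w = I m w))"
      by (intro exI[of _ "(X', I', Q')"]) simp
  qed
  from choice[OF this] obtain p where p: "\<And>m. elementary W a b (fst (p m)) (fst (snd (p m))) (snd (snd (p m)))"
    "\<And>m w. snd (snd (p m)) w \<le> min R (Q m w)" "\<And>m w. Q m w \<le> R \<Longrightarrow> fst (snd (p m)) w = I m w" by blast
  have Q0: "0 \<le> Q m w" for m w using elementary_energy[OF 1(1)] by blast
  have QM: "Q m \<in> borel_measurable M" for m
    using elementary_energy[OF 1(1)] measurable_F_M by blast
  have "AE w in M. energy a b H w < ennreal R \<longrightarrow> (\<lambda>m. fst (snd (p m)) w) \<longlonglongrightarrow> J w"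
    using I Q
  proof eventually_elim
    case (elim w)
    show ?case
    proof
      assume "energy a b H w < ennreal R"
      then have "eventually (\<lambda>m. ennreal (Q m w) < ennreal R) sequentially"
        by (rule order_tendstoD(2)[OF elim(2)])
      then have "eventually (\<lambda>m. I m w = fst (snd (p m)) w) sequentially"
      proof (rule eventually_mono)
        fix m assume "ennreal (Q m w) < ennreal R"
        then have "Q m w \<le> R" using Q0[of m w] by (simp add: ennreal_less_iff)
        then show "I m w = fst (snd (p m)) w" using p(3) by simp
      qed
      then show "(\<lambda>m. fst (snd (p m)) w) \<longlonglongrightarrow> J w"
        by (rule Lim_transform_eventually[OF elim(1)])
    qed
  qed
  moreover have "AE w in M. (\<lambda>m. min R (Q m w)) \<longlonglongrightarrow> min R (enn2real (energy a b H w))"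
    using Q ito_limitD(6)[OF assms(1)]
  proof eventually_elim
    case (elim w)
    have "(\<lambda>m. enn2real (ennreal (Q m w))) \<longlonglongrightarrow> enn2real (energy a b H w)"
      using elim by (intro tendsto_enn2real) auto
    then show ?case using Q0 by (intro tendsto_min tendsto_const) simp
  qed
  ultimately show ?thesis
    using p(1,2) Q0 QM assms(2)
    by (intro exI[of _ "\<lambda>m. fst (p m)"] exI[of _ "\<lambda>m. fst (snd (p m))"] exI[of _ "\<lambda>m. snd (snd (p m))"]
        conjI exI[of _ "\<lambda>m w. min R (Q m w)"]) auto
qed

text \<open>Fatou's lemma on the left and dominated convergence on the right. Only the inequality
  between moments of order \<open>2 k\<close> of the elementary integrals and of order
  \<open>k\<close> of their energies is used, so \<open>k = 1\<close> and \<open>k = 2\<close> need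
  one proof.\<close>

lemma ito_limit_truncated_power:
  assumes mom: "\<And>X I Q. elementary W a b X I Q \<Longrightarrow>
      (\<integral>\<^sup>+w. ennreal (I w ^ (2 * k)) \<partial>M) \<le> ennreal c * (\<integral>\<^sup>+w. ennreal (Q w ^ k) \<partial>M)"
    and il: "ito_limit W H a b J" and R: "0 \<le> R"
  shows "(\<integral>\<^sup>+w. ennreal (J w ^ (2 * k)) * indicator {w. energy a b H w < ennreal R} w \<partial>M)
    \<le> ennreal c * (\<integral>\<^sup>+w. ennreal (min R (enn2real (energy a b H w)) ^ k) \<partial>M)"
proof -
  obtain X I Q q where 1: "\<And>m. elementary W a b (X m) (I m) (Q m)"
    and I: "AE w in M. energy a b H w < ennreal R \<longrightarrow> (\<lambda>m. I m w) \<longlonglongrightarrow> J w"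
    and q: "\<And>m. q m \<in> borel_measurable M" "\<And>m w. 0 \<le> q m w" "\<And>m w. Q m w \<le> q m w" "\<And>m w. q m w \<le> R"
    and ql: "AE w in M. (\<lambda>m. q m w) \<longlonglongrightarrow> min R (enn2real (energy a b H w))"
    using ito_limit_truncated_approximation[OF il R] by blast
  note [measurable] = q(1) energy_measurable[OF ito_limitD(4)[OF il]]
  have IM [measurable]: "I m \<in> borel_measurable M" for m
    using elementary_adapted[OF 1(1) wiener] ito_limitD(1)[OF il] measurable_F_M by blast
  have "(\<integral>\<^sup>+w. ennreal (J w ^ (2 * k)) * indicator {w. energy a b H w < ennreal R} w \<partial>M)
    \<le> (\<integral>\<^sup>+w. liminf (\<lambda>m. ennreal (I m w ^ (2 * k))) \<partial>M)"
  proof (rule nn_integral_mono_AE)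
    show "AE w in M. ennreal (J w ^ (2 * k)) * indicator {w. energy a b H w < ennreal R} w
      \<le> liminf (\<lambda>m. ennreal (I m w ^ (2 * k)))"
      using I
    proof eventually_elim
      case (elim w)
      show ?case
      proof (cases "energy a b H w < ennreal R")
        case True
        then have "(\<lambda>m. ennreal (I m w ^ (2 * k))) \<longlonglongrightarrow> ennreal (J w ^ (2 * k))"
          using elim by (intro tendsto_ennrealI tendsto_power) simp
        then have "liminf (\<lambda>m. ennreal (I m w ^ (2 * k))) = ennreal (J w ^ (2 * k))"
          by (rule lim_imp_Liminf[OF sequentially_bot])
        then show ?thesis by (simp add: indicator_def)
      qed simp
    qed
  qed
  also have "\<dots> \<le> liminf (\<lambda>m. \<integral>\<^sup>+w. ennreal (I m w ^ (2 * k)) \<partial>M)"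
    by (rule nn_integral_liminf) measurable
  also have "\<dots> \<le> liminf (\<lambda>m. ennreal c * (\<integral>\<^sup>+w. ennreal (q m w ^ k) \<partial>M))"
  proof (rule Liminf_mono, rule always_eventually, rule allI)
    fix m
    have Q0: "0 \<le> Q m w" for w using elementary_energy[OF 1(1)] by blast
    have "(\<integral>\<^sup>+w. ennreal (Q m w ^ k) \<partial>M) \<le> (\<integral>\<^sup>+w. ennreal (q m w ^ k) \<partial>M)"
      by (intro nn_integral_mono ennreal_leI power_mono q Q0)
    then show "(\<integral>\<^sup>+w. ennreal (I m w ^ (2 * k)) \<partial>M) \<le> ennreal c * (\<integral>\<^sup>+w. ennreal (q m w ^ k) \<partial>M)"
      using order_trans[OF mom[OF 1(1)] mult_left_mono] by simp
  qed
  also have "\<dots> = ennreal c * (\<integral>\<^sup>+w. ennreal (min R (enn2real (energy a b H w)) ^ k) \<partial>M)"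
  proof (rule lim_imp_Liminf[OF sequentially_bot], rule ennreal_tendsto_cmult)
    show "(\<lambda>m. \<integral>\<^sup>+w. ennreal (q m w ^ k) \<partial>M) \<longlonglongrightarrow> (\<integral>\<^sup>+w. ennreal (min R (enn2real (energy a b H w)) ^ k) \<partial>M)"
    proof (rule nn_integral_dominated_convergence[where w="\<lambda>_. ennreal (R ^ k)"])
      show "AE w in M. ennreal (q m w ^ k) \<le> ennreal (R ^ k)" for m
        by (intro AE_I2 ennreal_leI power_mono q)
      show "AE w in M. (\<lambda>m. ennreal (q m w ^ k)) \<longlonglongrightarrow> ennreal (min R (enn2real (energy a b H w)) ^ k)"
        using ql by eventually_elim (intro tendsto_ennrealI tendsto_power)
      show "(\<integral>\<^sup>+w. ennreal (R ^ k) \<partial>M) < \<infinity>" by (simp add: emeasure_space_1)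
    qed measurable
  qed simp
  finally show ?thesis .
qed

lemma ito_limit_power:
  assumes mom: "\<And>X I Q. elementary W a b X I Q \<Longrightarrow>
      (\<integral>\<^sup>+w. ennreal (I w ^ (2 * k)) \<partial>M) \<le> ennreal c * (\<integral>\<^sup>+w. ennreal (Q w ^ k) \<partial>M)"
    and il: "ito_limit W H a b J"
  shows "(\<integral>\<^sup>+w. ennreal (J w ^ (2 * k)) \<partial>M) \<le> ennreal c * (\<integral>\<^sup>+w. energy a b H w ^ k \<partial>M)"
proof -
  note [measurable] = ito_limitD(5)[OF il] energy_measurable[OF ito_limitD(4)[OF il]]
  show ?thesis
  proof (rule nn_integral_le_of_truncations[where q="energy a b H"])
    show "AE w in M. energy a b H w < \<infinity>" by (rule ito_limitD(6)[OF il])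
    fix n :: nat
    have "(\<integral>\<^sup>+w. ennreal (min (real n) (enn2real (energy a b H w)) ^ k) \<partial>M) \<le> (\<integral>\<^sup>+w. energy a b H w ^ k \<partial>M)"
    proof (rule nn_integral_mono_AE)
      show "AE w in M. ennreal (min (real n) (enn2real (energy a b H w)) ^ k) \<le> energy a b H w ^ k"
        using ito_limitD(6)[OF il]
      proof eventually_elim
        case (elim w)
        have "ennreal (min (real n) (enn2real (energy a b H w)) ^ k) \<le> ennreal (enn2real (energy a b H w) ^ k)"
          by (intro ennreal_leI power_mono) auto
        also have "\<dots> = energy a b H w ^ k" using elim by (simp add: ennreal_power[symmetric])
        finally show ?case .
      qed
    qed
    then show "(\<integral>\<^sup>+w. ennreal (J w ^ (2 * k)) * indicator {w. energy a b H w < ennreal (real n)} w \<partial>M)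
      \<le> ennreal c * (\<integral>\<^sup>+w. energy a b H w ^ k \<partial>M)"
      using order_trans[OF ito_limit_truncated_power[OF mom il, where R="real n"] mult_left_mono] by simp
  qed measurable
qed

text \<open>The estimate that replaces stopping: an integral restricted to the event of small energy
  is bounded by the truncated energy, even if the energy is not integrable.\<close>

lemma ito_truncated_second_moment:
  assumes "ito_limit W H a b J" "0 \<le> R"
  shows "(\<integral>\<^sup>+w. ennreal ((J w)\<^sup>2) * indicator {w. energy a b H w < ennreal R} w \<partial>M)
    \<le> (\<integral>\<^sup>+w. min (ennreal R) (energy a b H w) \<partial>M)"
proof -
  have "(\<integral>\<^sup>+w. ennreal (J w ^ (2 * 1)) * indicator {w. energy a b H w < ennreal R} w \<partial>M)
    \<le> ennreal 1 * (\<integral>\<^sup>+w. ennreal (min R (enn2real (energy a b H w)) ^ 1) \<partial>M)"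
    by (rule ito_limit_truncated_power[OF elementary_second_moment[OF _ wiener] assms])
       (use ito_limitD(1)[OF assms(1)] in auto)
  also have "(\<integral>\<^sup>+w. ennreal (min R (enn2real (energy a b H w)) ^ 1) \<partial>M) = (\<integral>\<^sup>+w. min (ennreal R) (energy a b H w) \<partial>M)"
  proof (rule nn_integral_cong_AE)
    show "AE w in M. ennreal (min R (enn2real (energy a b H w)) ^ 1) = min (ennreal R) (energy a b H w)"
      using ito_limitD(6)[OF assms(1)]
    proof eventually_elim
      case (elim w)
      then obtain x where x: "energy a b H w = ennreal x" "0 \<le> x" by (cases "energy a b H w") auto
      then show ?case by (cases "R \<le> x") (simp_all add: min_def assms(2) ennreal_le_iff)
    qed
  qed
  finally show ?thesis by simp
qed

lemma ito_second_moment: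
  assumes "ito_limit W H a b J"
  shows "(\<integral>\<^sup>+w. ennreal ((J w)\<^sup>2) \<partial>M) \<le> (\<integral>\<^sup>+w. energy a b H w \<partial>M)"
proof -
  have "(\<integral>\<^sup>+w. ennreal (J w ^ (2 * 1)) \<partial>M) \<le> ennreal 1 * (\<integral>\<^sup>+w. energy a b H w ^ 1 \<partial>M)"
    by (rule ito_limit_power[OF elementary_second_moment[OF _ wiener] assms])
       (use ito_limitD(1)[OF assms(1)] in auto)
  then show ?thesis by simp
qed

lemma ito_fourth_moment:
  assumes "ito_limit W H a b J"
  shows "(\<integral>\<^sup>+w. ennreal (J w ^ 4) \<partial>M) \<le> ennreal 42 * (\<integral>\<^sup>+w. (energy a b H w)\<^sup>2 \<partial>M)"
proof -
  have "(\<integral>\<^sup>+w. ennreal (J w ^ (2 * 2)) \<partial>M) \<le> ennreal 42 * (\<integral>\<^sup>+w. energy a b H w ^ 2 \<partial>M)"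
    by (rule ito_limit_power[OF elementary_fourth_moment[OF _ wiener] assms])
       (use ito_limitD(1)[OF assms(1)] in auto)
  then show ?thesis by simp
qed

text \<open>Elementary integrals with energies truncated at level \<open>K\<close> have mean zero
  and bounded second moments; the tails of \<open>J\<close> and of the approximations cost at most
  \<open>O(1/K)\<close>, and \<open>K\<close> is arbitrary.\<close>

lemma ito_mean_zero:
  assumes il: "ito_limit W H a b J" and fin: "(\<integral>\<^sup>+w. energy a b H w \<partial>M) < \<infinity>"
  shows "expectation J = 0"
proof -
  define e where "e w = enn2real (energy a b H w)" for w
  have em [measurable]: "energy a b H \<in> borel_measurable M" by (rule energy_measurable[OF ito_limitD(4)[OF il]])
  have eM [measurable]: "e \<in> borel_measurable M" unfolding e_def by measurable
  have Jm [measurable]: "J \<in> borel_measurable M" by (rule ito_limitD(5)[OF il])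
  have e0: "0 \<le> e w" for w by (simp add: e_def)
  have ee: "AE w in M. energy a b H w = ennreal (e w)"
    using ito_limitD(6)[OF il] by eventually_elim (simp add: e_def)
  have ne: "(\<integral>\<^sup>+w. ennreal (e w) \<partial>M) = (\<integral>\<^sup>+w. energy a b H w \<partial>M)"
    by (rule nn_integral_cong_AE) (use ee in \<open>auto elim: eventually_mono\<close>)
  have ie: "integrable M e"
    by (rule integrableI_nonneg) (use fin ne in \<open>auto simp: e_def\<close>)
  define E where "E = expectation e"
  have E0: "0 \<le> E" unfolding E_def by (rule Bochner_Integration.integral_nonneg) (simp add: e_def)
  have nE: "(\<integral>\<^sup>+w. energy a b H w \<partial>M) = ennreal E"
    unfolding ne[symmetric] E_def using ie e0 by (intro nn_integral_eq_integral) auto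
  have iJ2: "integrable M (\<lambda>w. (J w)\<^sup>2)"
    by (rule integrableI_nonneg) (use ito_second_moment[OF il] nE in \<open>auto simp: le_less_trans\<close>)
  have EJ2: "expectation (\<lambda>w. (J w)\<^sup>2) \<le> E"
    using ito_second_moment[OF il] iJ2 E0 unfolding nE by (simp add: nn_integral_eq_integral)
  have iJ: "integrable M J" by (rule square_integrable_imp_integrable[OF Jm iJ2])
  \<comment> \<open>The truncation level \<open>K\<close> enters only through the tails.\<close>
  have bound: "\<bar>expectation J\<bar> \<le> 5 * E / K" if K: "K > 0" for K
  proof -
    have K2: "0 \<le> K\<^sup>2" by simp
    obtain X I Q q where 1: "\<And>m. elementary W a b (X m) (I m) (Q m)"
      and I: "AE w in M. energy a b H w < ennreal (K\<^sup>2) \<longrightarrow> (\<lambda>m. I m w) \<longlonglongrightarrow> J w"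
      and q: "\<And>m. q m \<in> borel_measurable M" "\<And>m w. 0 \<le> q m w" "\<And>m w. Q m w \<le> q m w" "\<And>m w. q m w \<le> K\<^sup>2"
      and ql: "AE w in M. (\<lambda>m. q m w) \<longlonglongrightarrow> min (K\<^sup>2) (enn2real (energy a b H w))"
      using ito_limit_truncated_approximation[OF il K2] by blast
    note [measurable] = q(1)
    have a0: "0 \<le> a" by (rule ito_limitD(1)[OF il])
    have IM [measurable]: "I m \<in> borel_measurable M" for m
      using elementary_adapted[OF 1(1) wiener a0] measurable_F_M by blast
    have QM [measurable]: "Q m \<in> borel_measurable M" and Q0: "0 \<le> Q m w" for m w
      using elementary_energy[OF 1(1)] measurable_F_M by blast+
    have iq: "integrable M (q m)" for m
      by (rule integrable_const_bound[of _ "K\<^sup>2"]) (use q in auto)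
    have iQ: "integrable M (Q m)" for m
      by (rule integrable_const_bound[of _ "K\<^sup>2"]) (use Q0 order_trans[OF q(3,4)] in auto)
    note mo = elementary_moments[OF 1(1) wiener a0]
    have iI2: "integrable M (\<lambda>w. (I m w)\<^sup>2)" for m
      using integrable_power_bounded[of "I m" "\<lambda>_. 1" 2 1] mo[of m] by simp
    have iI: "integrable M (I m)" for m by (rule square_integrable_imp_integrable[OF IM iI2])
    have EI2: "expectation (\<lambda>w. (I m w)\<^sup>2) \<le> expectation (q m)" for m
      using mo[of m] integral_mono[OF iQ[of m] iq[of m] q(3)] by simp
    define A where "A = {w \<in> space M. K\<^sup>2 \<le> e w}"
    have [measurable]: "A \<in> sets M" unfolding A_def by measurable
    have iA: "integrable M (indicator A :: 'a \<Rightarrow> real)"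
      by (rule integrable_real_indicator) (simp_all add: emeasure_eq_measure)
    define g where "g m w = min \<bar>J w - I m w\<bar> K * indicator (space M - A) w" for m w
    have gM [measurable]: "g m \<in> borel_measurable M" for m unfolding g_def by measurable
    have g0: "0 \<le> g m w" "g m w \<le> K" for m w using K by (auto simp: g_def indicator_def)
    have ig: "integrable M (g m)" for m
      by (rule integrable_const_bound[of _ K]) (use g0 in auto)
    have PA: "prob A \<le> E / K\<^sup>2"
      unfolding A_def E_def by (rule integral_Markov_inequality_measure[OF ie sets.empty_sets]) (use e0 K in auto)
    have main: "\<bar>expectation J\<bar> \<le> E / K + expectation (g m) + (2 * E + 2 * expectation (q m)) / K" for m
    proof -
      have "\<bar>expectation J\<bar> = \<bar>expectation (\<lambda>w. J w - I m w)\<bar>" using mo[of m] iI iJ by simp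
      also have "\<dots> \<le> expectation (\<lambda>w. \<bar>J w - I m w\<bar>)" by (rule integral_abs_bound)
      also have "\<dots> \<le> expectation (\<lambda>w. K * indicator A w + g m w + (2 * (J w)\<^sup>2 + 2 * (I m w)\<^sup>2) / K)"
      proof (rule integral_mono)
        fix w assume w: "w \<in> space M"
        let ?d = "\<bar>J w - I m w\<bar>"
        have "?d \<le> min ?d K + ?d\<^sup>2 / K"
        proof (cases "?d \<le> K")
          case False
          then have "K * ?d \<le> ?d * ?d" by (intro mult_right_mono) auto
          then have "?d \<le> ?d\<^sup>2 / K" using K by (simp add: field_simps power2_eq_square)
          then show ?thesis using K by simp
        qed (use K in simp)
        moreover have "min ?d K \<le> K * indicator A w + g m w"
          using w K by (auto simp: g_def indicator_def)
        moreover have "?d\<^sup>2 \<le> 2 * (J w)\<^sup>2 + 2 * (I m w)\<^sup>2"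
          using zero_le_power2[of "J w + I m w"] by (simp add: power2_eq_square algebra_simps)
        then have "?d\<^sup>2 / K \<le> (2 * (J w)\<^sup>2 + 2 * (I m w)\<^sup>2) / K" using K by (intro divide_right_mono) auto
        ultimately show "?d \<le> K * indicator A w + g m w + (2 * (J w)\<^sup>2 + 2 * (I m w)\<^sup>2) / K" by linarith
      qed (use iI iJ iJ2 iI2 ig iA in auto)
      also have "\<dots> = K * prob A + expectation (g m) + (2 * expectation (\<lambda>w. (J w)\<^sup>2) + 2 * expectation (\<lambda>w. (I m w)\<^sup>2)) / K"
      proof -
        have i1: "integrable M (\<lambda>w. K * indicator A w)" by (rule integrable_mult_right) (rule iA)
        have i3: "integrable M (\<lambda>w. (2 * (J w)\<^sup>2 + 2 * (I m w)\<^sup>2) / K)"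
          using iJ2 iI2[of m] by (intro Bochner_Integration.integrable_add integrable_divide integrable_mult_right) auto
        have "expectation (\<lambda>w. (2 * (J w)\<^sup>2 + 2 * (I m w)\<^sup>2) / K) = (2 * expectation (\<lambda>w. (J w)\<^sup>2) + 2 * expectation (\<lambda>w. (I m w)\<^sup>2)) / K"
          using iJ2 iI2[of m] by simp
        moreover have "expectation (\<lambda>w. K * indicator A w) = K * prob A" by simp
        ultimately show ?thesis
          unfolding Bochner_Integration.integral_add[OF Bochner_Integration.integrable_add[OF i1 ig] i3]
            Bochner_Integration.integral_add[OF i1 ig] by simp
      qed
      also have "\<dots> \<le> E / K + expectation (g m) + (2 * E + 2 * expectation (q m)) / K"
      proof (intro add_mono divide_right_mono order_refl mult_left_mono EJ2 EI2)
        have "K * prob A \<le> K * (E / K\<^sup>2)" using PA K by (intro mult_left_mono) auto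
        then show "K * prob A \<le> E / K" using K by (simp add: power2_eq_square)
      qed (use K in auto)
      finally show ?thesis .
    qed
    have gl: "(\<lambda>m. expectation (g m)) \<longlonglongrightarrow> expectation (\<lambda>w. 0)"
    proof (rule integral_dominated_convergence[where w="\<lambda>_. K"])
      show "AE w in M. (\<lambda>m. g m w) \<longlonglongrightarrow> 0"
        using I ee AE_space
      proof eventually_elim
        case (elim w)
        show ?case
        proof (cases "w \<in> A")
          case True then show ?thesis by (simp add: g_def)
        next
          case False
          then have "e w < K\<^sup>2" using elim(3) by (simp add: A_def)
          then have "energy a b H w < ennreal (K\<^sup>2)"
            unfolding elim(2) using e0 by (simp add: ennreal_less_iff)
          with elim(1) have "(\<lambda>m. I m w) \<longlonglongrightarrow> J w" by blast
          then have l: "(\<lambda>m. \<bar>J w - I m w\<bar>) \<longlonglongrightarrow> \<bar>J w - J w\<bar>"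
            by (intro tendsto_rabs tendsto_diff tendsto_const)
          have "(\<lambda>m. g m w) \<longlonglongrightarrow> min \<bar>J w - J w\<bar> K * indicator (space M - A) w"
            unfolding g_def by (intro tendsto_mult_right tendsto_min l tendsto_const)
          then show ?thesis using K by simp
        qed
      qed
      show "AE w in M. norm (g m w) \<le> K" for m using g0[of m] by simp
    qed simp_all
    have ql': "(\<lambda>m. expectation (q m)) \<longlonglongrightarrow> expectation (\<lambda>w. min (K\<^sup>2) (e w))"
    proof (rule integral_dominated_convergence[where w="\<lambda>_. K\<^sup>2"])
      show "AE w in M. (\<lambda>m. q m w) \<longlonglongrightarrow> min (K\<^sup>2) (e w)" using ql by (simp add: e_def)
      show "AE w in M. norm (q m w) \<le> K\<^sup>2" for m using q by auto
    qed auto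
    have imin: "integrable M (\<lambda>w. min (K\<^sup>2) (e w))"
      by (rule integrable_const_bound[of _ "K\<^sup>2"]) (use e0 in \<open>auto simp: abs_of_nonneg\<close>)
    have minE: "expectation (\<lambda>w. min (K\<^sup>2) (e w)) \<le> E"
      unfolding E_def by (rule integral_mono[OF imin ie]) simp
    have "(\<lambda>m. E / K + expectation (g m) + (2 * E + 2 * expectation (q m)) / K) \<longlonglongrightarrow>
      E / K + expectation (\<lambda>w. 0) + (2 * E + 2 * expectation (\<lambda>w. min (K\<^sup>2) (e w))) / K"
      using K by (intro tendsto_add tendsto_divide tendsto_mult tendsto_const gl ql') simp
    then have "\<bar>expectation J\<bar> \<le> E / K + expectation (\<lambda>w. 0) + (2 * E + 2 * expectation (\<lambda>w. min (K\<^sup>2) (e w))) / K"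
      by (rule LIMSEQ_le_const) (use main in blast)
    also have "\<dots> \<le> E / K + 0 + (2 * E + 2 * E) / K"
      using minE K by (intro add_mono divide_right_mono) auto
    also have "\<dots> = 5 * E / K" by (simp add: add_divide_distrib[symmetric])
    finally show ?thesis .
  qed
  have "\<bar>expectation J\<bar> \<le> 0"
  proof (rule field_le_epsilon)
    fix \<epsilon> :: real assume "\<epsilon> > 0"
    then have "0 < (5 * E + 1) / \<epsilon>" using E0 by simp
    from bound[OF this] have "\<bar>expectation J\<bar> \<le> 5 * E * \<epsilon> / (5 * E + 1)" by simp
    also have "\<dots> \<le> \<epsilon>"
    proof -
      have "5 * E * \<epsilon> \<le> \<epsilon> * (5 * E + 1)" using \<open>\<epsilon> > 0\<close> by (simp add: algebra_simps)
      then show ?thesis using E0 by (simp add: pos_divide_le_eq)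
    qed
    finally show "\<bar>expectation J\<bar> \<le> 0 + \<epsilon>" by simp
  qed
  then show ?thesis by simp
qed

text \<open>After truncation at level one the energies are dominated, so the second moments of the
  integrals tend to zero, and truncation is eventually inactive on almost every path.\<close>

lemma elementary_null_subsequence:
  assumes Z: "\<And>m. elementary W a b (Z m) (I m) (Q m)" and a: "0 \<le> a"
    and Q: "AE w in M. (\<lambda>m. ennreal (Q m w)) \<longlonglongrightarrow> 0"
  shows "\<exists>r::nat\<Rightarrow>nat. strict_mono r \<and> (AE w in M. (\<lambda>m. I (r m) w) \<longlonglongrightarrow> 0)"
proof -
  have "\<forall>m. \<exists>p. elementary W a b (fst p) (fst (snd p)) (snd (snd p)) \<and>
    (\<forall>w. snd (snd p) w \<le> min 1 (Q m w) \<and> (Q m w \<le> 1 \<longrightarrow> fst (snd p) w = I m w))"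
  proof
    fix m
    obtain X' I' Q' where "elementary W a b X' I' Q' \<and> (\<forall>w. Q' w \<le> min 1 (Q m w) \<and> (Q m w \<le> 1 \<longrightarrow> I' w = I m w))"
      using elementary_truncate[OF Z zero_le_one, of m] by blast
    then show "\<exists>p. elementary W a b (fst p) (fst (snd p)) (snd (snd p)) \<and>
        (\<forall>w. snd (snd p) w \<le> min 1 (Q m w) \<and> (Q m w \<le> 1 \<longrightarrow> fst (snd p) w = I m w))"
      by (intro exI[of _ "(X', I', Q')"]) simp
  qed
  from choice[OF this] obtain p where p: "\<And>m. elementary W a b (fst (p m)) (fst (snd (p m))) (snd (snd (p m)))"
    "\<And>m w. snd (snd (p m)) w \<le> min 1 (Q m w)" "\<And>m w. Q m w \<le> 1 \<Longrightarrow> fst (snd (p m)) w = I m w" by blast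
  define K where "K m = fst (snd (p m))" for m
  define S where "S m = snd (snd (p m))" for m
  have el: "elementary W a b (fst (p m)) (K m) (S m)" for m using p(1) by (simp add: K_def S_def)
  have SQ: "S m w \<le> min 1 (Q m w)" for m w using p(2) by (simp add: S_def)
  have KI: "Q m w \<le> 1 \<Longrightarrow> K m w = I m w" for m w using p(3) by (simp add: K_def)
  have KM [measurable]: "K m \<in> borel_measurable M" for m
    using elementary_adapted[OF el wiener a] measurable_F_M by blast
  have SM [measurable]: "S m \<in> borel_measurable M" and S0: "0 \<le> S m w" for m w
    using elementary_energy[OF el] measurable_F_M by blast+
  have Q0: "0 \<le> Q m w" for m w
    using elementary_energy[OF Z] by blast
  note mo = elementary_moments[OF el wiener a]
  have iK2: "integrable M (\<lambda>w. (K m w)\<^sup>2)" for m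
    using integrable_power_bounded[of "K m" "\<lambda>_. 1" 2 1] mo[of m] by simp
  have QL: "AE w in M. (\<lambda>m. Q m w) \<longlonglongrightarrow> 0"
    using Q by eventually_elim (use Q0 in \<open>simp add: tendsto_ennreal_iff ennreal_0[symmetric] del: ennreal_0\<close>)
  have "(\<lambda>m. expectation (S m)) \<longlonglongrightarrow> expectation (\<lambda>w. 0)"
  proof (rule integral_dominated_convergence[where w="\<lambda>_. 1"])
    show "AE w in M. (\<lambda>m. S m w) \<longlonglongrightarrow> 0"
      using QL
    proof eventually_elim
      case (elim w)
      show ?case by (rule tendsto_sandwich[OF _ _ tendsto_const elim]) (use S0 SQ in auto)
    qed
    show "AE w in M. norm (S m w) \<le> 1" for m using S0 SQ[of m] by auto
  qed auto
  then have "(\<lambda>m. expectation (\<lambda>w. norm ((K m w)\<^sup>2))) \<longlonglongrightarrow> 0" using mo by simp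
  from tendsto_L1_AE_subseq[OF iK2 this] obtain r where r: "strict_mono r"
    "AE w in M. (\<lambda>m. (K (r m) w)\<^sup>2) \<longlonglongrightarrow> 0" by blast
  have "AE w in M. (\<lambda>m. I (r m) w) \<longlonglongrightarrow> 0"
    using r(2) QL
  proof eventually_elim
    case (elim w)
    have "(\<lambda>m. sqrt ((K (r m) w)\<^sup>2)) \<longlonglongrightarrow> sqrt 0" by (rule tendsto_real_sqrt[OF elim(1)])
    then have k: "(\<lambda>m. K (r m) w) \<longlonglongrightarrow> 0" by (simp add: tendsto_rabs_zero_iff)
    have "(\<lambda>m. Q (r m) w) \<longlonglongrightarrow> 0" using LIMSEQ_subseq_LIMSEQ[OF elim(2) r(1)] by (simp add: comp_def)
    then have "eventually (\<lambda>m. Q (r m) w < 1) sequentially" by (rule order_tendstoD(2)) simp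
    then have "eventually (\<lambda>m. K (r m) w = I (r m) w) sequentially"
      by (rule eventually_mono) (simp add: KI)
    then show ?case by (rule Lim_transform_eventually[OF k])
  qed
  with r(1) show ?thesis by blast
qed

lemma elementary_split_restrict:
  assumes el: "elementary W a b X I Q" and c: "a \<le> c" "c \<le> b"
  shows "\<exists>I1 Q1 Q2. elementary W a c (\<lambda>u w. X u w * indicator {..c} u) I1 Q1 \<and>
    elementary W c b (\<lambda>u w. X u w * indicator {c<..} u) (\<lambda>w. I w - I1 w) Q2"
proof -
  obtain X1 I1 Q1 X2 I2 Q2 where *: "elementary W a c X1 I1 Q1" "elementary W c b X2 I2 Q2"
    "X = (\<lambda>u w. X1 u w + X2 u w)" "I = (\<lambda>w. I1 w + I2 w)"
    using elementary_split[OF el c] by blast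
  have "(\<lambda>u w. X u w * indicator {..c} u) = X1"
    using elementary_support[OF *(1)] elementary_support[OF *(2)] by (auto simp: *(3) fun_eq_iff indicator_def)
  moreover have "(\<lambda>u w. X u w * indicator {c<..} u) = X2"
    using elementary_support[OF *(1)] elementary_support[OF *(2)] by (auto simp: *(3) fun_eq_iff indicator_def)
  moreover have "(\<lambda>w. I w - I1 w) = I2" by (simp add: *(4))
  ultimately show ?thesis using *(1,2) by blast
qed

text \<open>The approximations on \<open>[a,t]\<close> are split at \<open>s\<close>. Their parts on
  \<open>[a,s]\<close> and the approximations on \<open>[a,s]\<close> differ by elementary processes
  with vanishing energy, so the integrals have the same limit along a subsequence; thus
  \<open>J1\<close> is the limit of the left parts.\<close>

lemma ito_limit_increment:
  assumes il1: "ito_limit W H a s J1" and il2: "ito_limit W H a t J2" and st: "s \<le> t"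
  shows "ito_limit W H s t (\<lambda>w. J2 w - J1 w)"
proof -
  note d1 = ito_limitD[OF il1] and d2 = ito_limitD[OF il2]
  obtain Y K R where 1: "\<And>m. elementary W a s (Y m) (K m) (R m)"
      "AE w in M. (\<lambda>m. energy a s (\<lambda>u w. Y m u w - H u w) w) \<longlonglongrightarrow> 0"
      "AE w in M. (\<lambda>m. K m w) \<longlonglongrightarrow> J1 w"
    using il1 unfolding ito_limit_def by blast
  obtain X I Q where 2: "\<And>m. elementary W a t (X m) (I m) (Q m)"
      "AE w in M. (\<lambda>m. energy a t (\<lambda>u w. X m u w - H u w) w) \<longlonglongrightarrow> 0"
      "AE w in M. (\<lambda>m. I m w) \<longlonglongrightarrow> J2 w"
    using il2 unfolding ito_limit_def by blast
  define X1 where "X1 m u w = X m u w * indicator {..s} u" for m u w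
  define X2 where "X2 m u w = X m u w * indicator {s<..} u" for m u w
  have "\<forall>m. \<exists>I1. \<exists>Q1 Q2. elementary W a s (X1 m) I1 Q1 \<and> elementary W s t (X2 m) (\<lambda>w. I m w - I1 w) Q2"
    unfolding X1_def[abs_def] X2_def[abs_def] by (intro allI elementary_split_restrict[OF 2(1) d1(2) st])
  from choice[OF this] obtain I1 where "\<forall>m. \<exists>Q1 Q2. elementary W a s (X1 m) (I1 m) Q1 \<and> elementary W s t (X2 m) (\<lambda>w. I m w - I1 m w) Q2"
    by blast
  from choice[OF this] obtain Q1 where "\<forall>m. \<exists>Q2. elementary W a s (X1 m) (I1 m) (Q1 m) \<and> elementary W s t (X2 m) (\<lambda>w. I m w - I1 m w) Q2"
    by blast
  from choice[OF this] obtain Q2 where Q2: "\<forall>m. elementary W a s (X1 m) (I1 m) (Q1 m) \<and> elementary W s t (X2 m) (\<lambda>w. I m w - I1 m w) (Q2 m)"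
    by blast
  define I2 where "I2 m w = I m w - I1 m w" for m w
  have e1: "elementary W a s (X1 m) (I1 m) (Q1 m)" and e2: "elementary W s t (X2 m) (I2 m) (Q2 m)" for m
    using Q2 by (simp_all add: I2_def[abs_def])
  have XX: "X m u w = X1 m u w + X2 m u w" and II: "I m w = I1 m w + I2 m w" for m u w
    by (auto simp: X1_def X2_def I2_def indicator_def)
  have "\<exists>S. \<forall>m. elementary W a s (\<lambda>u w. X1 m u w - Y m u w) (\<lambda>w. I1 m w - K m w) (S m)"
    by (intro choice allI elementary_diff[OF 1(1) e1])
  then obtain S where S: "\<And>m. elementary W a s (\<lambda>u w. X1 m u w - Y m u w) (\<lambda>w. I1 m w - K m w) (S m)" by blast
  have j: "jointly_measurable M a s (\<lambda>u w. X1 m u w - H u w)" "jointly_measurable M a s (\<lambda>u w. Y m u w - H u w)" for m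
    by (rule jointly_measurable_diff[OF jointly_measurable_F_M[OF elementary_jointly_measurable[OF e1]] d1(4)]
       jointly_measurable_diff[OF jointly_measurable_F_M[OF elementary_jointly_measurable[OF 1(1)]] d1(4)])+
  have SL: "AE w in M. (\<lambda>m. ennreal (S m w)) \<longlonglongrightarrow> 0"
    using 1(2) 2(2) AE_space
  proof eventually_elim
    case (elim w)
    have "(\<lambda>m. 2 * energy a t (\<lambda>u w. X m u w - H u w) w + 2 * energy a s (\<lambda>u w. Y m u w - H u w) w) \<longlonglongrightarrow> 2 * 0 + 2 * 0"
      by (intro tendsto_add ennreal_tendsto_cmult elim) auto
    then have l: "(\<lambda>m. 2 * energy a t (\<lambda>u w. X m u w - H u w) w + 2 * energy a s (\<lambda>u w. Y m u w - H u w) w) \<longlonglongrightarrow> 0" by simp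
    have "ennreal (S m w) \<le> 2 * energy a t (\<lambda>u w. X m u w - H u w) w + 2 * energy a s (\<lambda>u w. Y m u w - H u w) w" for m
    proof -
      have "ennreal (S m w) = (\<integral>\<^sup>+u. ennreal ((X1 m u w - Y m u w)\<^sup>2) \<partial>lborel)"
        using elementary_nn_energy[OF S[of m], of w] by simp
      also have "\<dots> = energy a s (\<lambda>u w. X1 m u w - Y m u w) w"
        unfolding energy_eq
      proof (rule nn_integral_cong)
        fix u
        show "ennreal ((X1 m u w - Y m u w)\<^sup>2) = ennreal ((indicator {a..s} u * (X1 m u w - Y m u w))\<^sup>2)"
          using elementary_support[OF S[of m], of u w] by (cases "u \<in> {a..s}") auto
      qed
      also have "\<dots> \<le> 2 * energy a s (\<lambda>u w. X1 m u w - H u w) w + 2 * energy a s (\<lambda>u w. Y m u w - H u w) w"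
        using energy_diff_le[OF j(1)[of m] j(2)[of m] elim(3)] by simp
      also have "energy a s (\<lambda>u w. X1 m u w - H u w) w = energy a s (\<lambda>u w. X m u w - H u w) w"
        unfolding energy_def XX
        by (intro nn_integral_cong) (auto simp: indicator_def elementary_support[OF e2])
      also have "\<dots> \<le> energy a t (\<lambda>u w. X m u w - H u w) w" by (rule energy_subset[OF order_refl st])
      finally show ?thesis by (simp add: mult_left_mono add_right_mono)
    qed
    then show ?case by (intro ennreal_tendsto_zero_le[OF l])
  qed
  from elementary_null_subsequence[OF S d1(1) SL] obtain r :: "nat \<Rightarrow> nat" where r: "strict_mono r"
    "AE w in M. (\<lambda>m. I1 (r m) w - K (r m) w) \<longlonglongrightarrow> 0" by blast
  show ?thesis
  proof (rule ito_limitI[of s t H _ W "\<lambda>m. X2 (r m)" "\<lambda>m. I2 (r m)" "\<lambda>m. Q2 (r m)"])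
    show "0 \<le> s" using d1(1,2) by simp
    show "jointly_measurable (F t) s t H" by (rule jointly_measurable_subset[OF d2(3) d1(2) order_refl])
    show "(\<lambda>w. J2 w - J1 w) \<in> borel_measurable M" using d1(5) d2(5) by simp
    show "AE w in M. energy s t H w < \<infinity>"
      using d2(6) by eventually_elim (rule le_less_trans[OF energy_subset[OF d1(2) order_refl]])
    show "elementary W s t (X2 (r m)) (I2 (r m)) (Q2 (r m))" for m by (rule e2)
    show "AE w in M. (\<lambda>m. energy s t (\<lambda>u w. X2 (r m) u w - H u w) w) \<longlonglongrightarrow> 0"
      using 2(2)
    proof eventually_elim
      case (elim w)
      have l: "(\<lambda>m. energy a t (\<lambda>u w. X (r m) u w - H u w) w) \<longlonglongrightarrow> 0"
        using LIMSEQ_subseq_LIMSEQ[OF elim r(1)] by (simp add: comp_def)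
      have "energy s t (\<lambda>u w. X2 (r m) u w - H u w) w = energy s t (\<lambda>u w. X (r m) u w - H u w) w" for m
        unfolding energy_def XX
      proof (intro nn_integral_cong_AE, rule AE_mp[OF AE_lborel_singleton[of s]], rule AE_I2, intro impI)
        fix u assume "u \<noteq> s"
        then show "ennreal ((X2 (r m) u w - H u w)\<^sup>2) * indicator {s..t} u =
            ennreal ((X1 (r m) u w + X2 (r m) u w - H u w)\<^sup>2) * indicator {s..t} u"
          by (auto simp: indicator_def elementary_support[OF e1])
      qed
      then have "energy s t (\<lambda>u w. X2 (r m) u w - H u w) w \<le> energy a t (\<lambda>u w. X (r m) u w - H u w) w" for m
        using energy_subset[OF d1(2) order_refl] by metis
      then show ?case by (intro ennreal_tendsto_zero_le[OF l])
    qed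
    show "AE w in M. (\<lambda>m. I2 (r m) w) \<longlonglongrightarrow> J2 w - J1 w"
      using 1(3) 2(3) r(2)
    proof eventually_elim
      case (elim w)
      have k: "(\<lambda>m. K (r m) w) \<longlonglongrightarrow> J1 w" "(\<lambda>m. I (r m) w) \<longlonglongrightarrow> J2 w"
        using LIMSEQ_subseq_LIMSEQ[OF elim(1) r(1)] LIMSEQ_subseq_LIMSEQ[OF elim(2) r(1)] by (simp_all add: comp_def)
      have "(\<lambda>m. I (r m) w - ((I1 (r m) w - K (r m) w) + K (r m) w)) \<longlonglongrightarrow> J2 w - (0 + J1 w)"
        by (intro tendsto_diff tendsto_add k elim(3))
      then show ?case by (simp add: II)
    qed
  qed
qed

end
end

section \<open>Gronwall inequality with grid terms\<close>

lemma nn_integral_square_le: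
  assumes [measurable]: "f \<in> borel_measurable N" "A \<in> sets N" and m: "emeasure N A \<le> ennreal m" "0 \<le> m"
  shows "(\<integral>\<^sup>+x\<in>A. f x \<partial>N)\<^sup>2 \<le> ennreal m * (\<integral>\<^sup>+x\<in>A. (f x)\<^sup>2 \<partial>N)"
proof -
  let ?I = "\<integral>\<^sup>+x\<in>A. f x \<partial>N" and ?S = "\<integral>\<^sup>+x\<in>A. (f x)\<^sup>2 \<partial>N"
  have pt: "f x \<le> ennreal (\<eta> / 2) + ennreal (1 / (2 * \<eta>)) * (f x)\<^sup>2" if "\<eta> > 0" for \<eta> x
  proof (cases "f x")
    case (real r)
    have "0 \<le> (r - \<eta>)\<^sup>2 / (2 * \<eta>)" using that by simp
    also have "\<dots> = \<eta> / 2 + 1 / (2 * \<eta>) * r\<^sup>2 - r" using that by (simp add: power2_eq_square field_simps)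
    finally have "r \<le> \<eta> / 2 + 1 / (2 * \<eta>) * r\<^sup>2" by simp
    then have "ennreal r \<le> ennreal (\<eta> / 2 + 1 / (2 * \<eta>) * r\<^sup>2)" by (rule ennreal_leI)
    also have "\<dots> = ennreal (\<eta> / 2) + ennreal (1 / (2 * \<eta>)) * (ennreal r)\<^sup>2"
    proof -
      have "ennreal (1 / (2 * \<eta>) * r\<^sup>2) = ennreal (1 / (2 * \<eta>)) * (ennreal r)\<^sup>2"
        using that by (subst ennreal_mult) (simp_all add: ennreal_power[OF real(1)])
      then show ?thesis using that by (subst ennreal_plus) simp_all
    qed
    finally show ?thesis using real by simp
  next
    case top
    then show ?thesis using that by (simp add: ennreal_mult_top power2_eq_square ennreal_eq_0_iff)
  qed
  have ineq: "?I \<le> ennreal (\<eta> / 2 * m) + ennreal (1 / (2 * \<eta>)) * ?S" if "\<eta> > 0" for \<eta>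
  proof -
    have "?I \<le> (\<integral>\<^sup>+x. ennreal (\<eta> / 2) * indicator A x + ennreal (1 / (2 * \<eta>)) * ((f x)\<^sup>2 * indicator A x) \<partial>N)"
      by (rule nn_integral_mono) (use pt[OF that] in \<open>auto simp: indicator_def\<close>)
    also have "\<dots> = ennreal (\<eta> / 2) * emeasure N A + ennreal (1 / (2 * \<eta>)) * ?S"
      by (simp add: nn_integral_add nn_integral_cmult)
    also have "\<dots> \<le> ennreal (\<eta> / 2) * ennreal m + ennreal (1 / (2 * \<eta>)) * ?S"
      by (intro add_right_mono mult_left_mono m) simp
    also have "ennreal (\<eta> / 2) * ennreal m = ennreal (\<eta> / 2 * m)"
      using that by (intro ennreal_mult'[symmetric]) simp
    finally show ?thesis .
  qed
  show ?thesis
  proof (cases ?S)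
    case top
    show ?thesis
    proof (cases "m = 0")
      case True
      then have "emeasure N A = 0" using m by simp
      then have "AE x in N. x \<notin> A" by (intro AE_not_in) (auto simp: null_sets_def)
      then have "?I = (\<integral>\<^sup>+x. 0 \<partial>N)" by (intro nn_integral_cong_AE) (auto elim!: eventually_mono)
      then show ?thesis by simp
    next
      case False
      then show ?thesis using top m(2) by (simp add: ennreal_mult_top ennreal_eq_0_iff)
    qed
  next
    case (real s)
    have rl: "r \<le> \<eta> / 2 * m + s / (2 * \<eta>)" if "?I = ennreal r" "\<eta> > 0" for r \<eta>
    proof -
      have "ennreal r \<le> ennreal (\<eta> / 2 * m) + ennreal (1 / (2 * \<eta>)) * ennreal s"
        using ineq[OF that(2)] that(1) real by simp
      also have "\<dots> = ennreal (\<eta> / 2 * m + 1 / (2 * \<eta>) * s)"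
        using that(2) m(2) real(1) by (simp add: ennreal_mult'[symmetric] ennreal_plus[symmetric] del: ennreal_plus)
      finally show ?thesis using that(2) m(2) real(1) by (subst (asm) ennreal_le_iff) auto
    qed
    have "ennreal (1 / 2 * m) + ennreal (1 / (2 * 1)) * ?S < \<top>"
      unfolding real(2) by (simp only: ennreal_add_less_top ennreal_mult_less_top ennreal_less_top simp_thms)
    then have "?I < \<top>" by (rule le_less_trans[OF ineq[OF zero_less_one]])
    then obtain r where r: "?I = ennreal r" "0 \<le> r" by (cases ?I) auto
    have "r\<^sup>2 \<le> m * s"
    proof (cases "r = 0")
      case True then show ?thesis using m(2) real(1) by simp
    next
      case False
      then have r0: "r > 0" using r(2) by simp
      show ?thesis
      proof (cases "m = 0")
        case True
        have "(s + 1) / r > 0" using r0 real(1) by simp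
        from rl[OF r(1) this] have "r \<le> s / (2 * ((s + 1) / r))" using True by simp
        also have "\<dots> = r * (s / (2 * (s + 1)))" using r0 by simp
        also have "\<dots> < r * 1" using r0 real(1) by (intro mult_strict_left_mono) (simp_all add: field_simps)
        finally show ?thesis by simp
      next
        case False
        then have "r / m > 0" using m(2) r0 by simp
        from rl[OF r(1) this] have "r \<le> r / m / 2 * m + s / (2 * (r / m))" .
        also have "\<dots> = r / 2 + s * m / (2 * r)" using False r0 by simp
        finally have "r * r \<le> (r / 2 + s * m / (2 * r)) * r" using r0 by (intro mult_right_mono) auto
        also have "\<dots> = r * r / 2 + s * m / 2" using r0 by (simp add: distrib_right)
        finally show ?thesis by (simp add: power2_eq_square mult.commute)
      qed
    qed
    then have "ennreal (r\<^sup>2) \<le> ennreal (m * s)" by (rule ennreal_leI)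
    then show ?thesis using r real m(2) by (simp add: ennreal_power ennreal_mult)
  qed
qed

text \<open>The value at \<open>T\<close> of the weight \<open>exp (\<beta> t + \<gamma> D
  m)\<close> with \<open>m\<close> the number of grid points of width \<open>D\<close> before
  \<open>t\<close>, doubled; here \<open>\<beta> = 4 C\<close> and \<open>\<gamma> = 4 C exp
  (\<beta> T)\<close>.\<close>

definition gronwall_factor :: "real \<Rightarrow> real \<Rightarrow> real" where
  "gronwall_factor C T = 2 * exp (4 * C * T + 4 * C * exp (4 * C * T) * T)"

text \<open>The integral equation of the approximation evaluates the solution at the grid points, so
  the time integral is accompanied by a Riemann sum. In the weight of \<open>gronwall_factor\<close>
  the exponential in \<open>t\<close> absorbs the integral and the factor that grows at every grid
  point absorbs the sum, each up to a quarter of the supremum of the weighted function. That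
  supremum is finite by the boundedness hypothesis and can therefore be moved to the left.\<close>

lemma gronwall_with_grid:
  fixes v :: "real \<Rightarrow> ennreal"
  assumes T: "T > 0" and n: "n > 0" and C: "C0 \<ge> 0" "C1 > 0"
    and bounded: "\<And>t. t \<in> {0..T} \<Longrightarrow> v t \<le> ennreal B" and t: "t \<in> {0..T}"
    and le: "\<And>t. t \<in> {0..T} \<Longrightarrow> v t \<le> ennreal C0 + ennreal C1 *
      ((\<Sum>i | i < n \<and> real i * (T / real n) < t. ennreal (T / real n) * v (real i * (T / real n))) + (\<integral>\<^sup>+u\<in>{0..t}. v u \<partial>lborel))"
  shows "v t \<le> ennreal (gronwall_factor C1 T * C0)"
proof -
  define D where "D = T / real n"
  \<comment> \<open>The grid weight has to outgrow the exponential weight of a whole interval, hence \<open>exp (\<beta> T)\<close> in its rate.\<close>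
  define \<beta> where "\<beta> = 4 * C1"
  define \<gamma> where "\<gamma> = 4 * C1 * exp (\<beta> * T)"
  define I where "I t = {i. i < n \<and> real i * D < t}" for t
  define \<rho> where "\<rho> t = exp (\<beta> * t + \<gamma> * D * real (card (I t)))" for t
  have D: "D > 0" "real n * D = T" using T n by (auto simp: D_def)
  have bg: "\<beta> > 0" "\<gamma> > 0" using C(2) by (auto simp: \<beta>_def \<gamma>_def)
  have finI: "finite (I t)" for t by (rule finite_subset[of _ "{..<n}"]) (auto simp: I_def)
  have cardn: "card (I t) \<le> n" for t using card_mono[of "{..<n}" "I t"] by (auto simp: I_def)
  have Icard: "I t = {..<card (I t)}" for t
  proof -
    have down: "j \<in> I t" if "i \<in> I t" "j \<le> i" for i j
    proof -
      have "real j * D \<le> real i * D" using that(2) D by (intro mult_right_mono) auto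
      then show ?thesis using that by (auto simp: I_def)
    qed
    have ex: "n \<notin> I t" by (simp add: I_def)
    define N where "N = (LEAST i. i \<notin> I t)"
    have "i \<in> I t \<longleftrightarrow> i < N" for i
    proof
      show "i \<in> I t" if "i < N" using not_less_Least[OF that[unfolded N_def]] by blast
      have "N \<notin> I t" unfolding N_def by (rule LeastI[of _ n]) (rule ex)
      then show "i < N" if "i \<in> I t" using down[OF that, of N] by (cases "i < N") auto
    qed
    then have "I t = {..<N}" by auto
    then show ?thesis by simp
  qed
  have Imono: "card (I s) \<le> card (I t)" if "s \<le> t" for s t
    using that by (intro card_mono finI) (auto simp: I_def)
  have Igrid: "card (I (real i * D)) = i" if "i < n" for i
  proof -
    have "I (real i * D) = {..<i}" using that D by (auto simp: I_def)
    then show ?thesis by simp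
  qed
  have \<rho>1: "\<rho> t \<ge> 1" if "0 \<le> t" for t using that bg D by (simp add: \<rho>_def)
  have \<rho>b: "2 * \<rho> t \<le> gronwall_factor C1 T" if "t \<le> T" for t
  proof -
    have "\<beta> * t + \<gamma> * D * real (card (I t)) \<le> \<beta> * T + \<gamma> * D * real n"
      using that bg D cardn by (intro add_mono mult_left_mono) auto
    also have "\<dots> = \<beta> * T + \<gamma> * T" using D(2) by (simp add: mult_ac)
    finally show ?thesis by (simp add: \<rho>_def gronwall_factor_def \<beta>_def \<gamma>_def)
  qed
  have sumb: "C1 * (\<Sum>i\<in>I t. D * \<rho> (real i * D)) \<le> \<rho> t / 4" if t: "0 \<le> t" "t \<le> T" for t
  proof (cases "card (I t)")
    case 0
    then have "I t = {}" using finI by simp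
    then show ?thesis by (simp add: \<rho>_def)
  next
    case (Suc N)
    let ?g = "(\<beta> + \<gamma>) * D"
    have g: "?g > 0" using bg D by simp
    have "(\<Sum>i\<in>I t. D * \<rho> (real i * D)) = (\<Sum>i<Suc N. D * exp (?g * real i))"
    proof (rule sum.cong)
      show "I t = {..<Suc N}" using Icard[of t] Suc by simp
      fix i assume "i \<in> {..<Suc N}"
      then have "i < n" using cardn[of t] Suc by simp
      then show "D * \<rho> (real i * D) = D * exp (?g * real i)"
        unfolding \<rho>_def Igrid[OF \<open>i < n\<close>] by (simp add: algebra_simps)
    qed
    also have "\<dots> \<le> exp (?g * real (Suc N)) / (\<beta> + \<gamma>)"
    proof -
      have "(\<Sum>i<K. D * exp (?g * real i)) \<le> exp (?g * real K) / (\<beta> + \<gamma>)" for K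
      proof (induction K)
        case (Suc K)
        have "exp (?g * real K) * (1 + ?g) \<le> exp (?g * real K) * exp ?g"
          by (intro mult_left_mono exp_ge_add_one_self) auto
        also have "\<dots> = exp (?g * real (Suc K))" by (simp add: exp_add[symmetric] algebra_simps)
        finally have "exp (?g * real K) * (1 + ?g) / (\<beta> + \<gamma>) \<le> exp (?g * real (Suc K)) / (\<beta> + \<gamma>)"
          using bg by (intro divide_right_mono) auto
        moreover have "exp (?g * real K) * (1 + ?g) / (\<beta> + \<gamma>) = exp (?g * real K) / (\<beta> + \<gamma>) + D * exp (?g * real K)"
          using bg by (simp add: field_simps)
        ultimately show ?case using Suc by simp
      qed (use bg in simp)
      then show ?thesis by blast
    qed
    also have "\<dots> \<le> (exp (\<beta> * T) * \<rho> t) / \<gamma>"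
    proof (rule frac_le)
      have "N \<in> I t" using Icard[of t] Suc by simp
      then have "real N * D < t" "real (Suc N) * D \<le> t + D" by (auto simp: I_def algebra_simps)
      moreover have "1 * D \<le> real n * D" using D n by (intro mult_right_mono) auto
      then have "D \<le> T" using D by simp
      ultimately have "real (Suc N) * D \<le> t + T" by simp
      then have "\<beta> * (real (Suc N) * D) \<le> \<beta> * (t + T)" using bg by (intro mult_left_mono) auto
      then have "?g * real (Suc N) \<le> \<beta> * T + (\<beta> * t + \<gamma> * D * real (card (I t)))"
        unfolding Suc by (simp add: algebra_simps)
      then show "exp (?g * real (Suc N)) \<le> exp (\<beta> * T) * \<rho> t"
        unfolding \<rho>_def exp_add[symmetric] by simp
    qed (use bg in \<open>auto simp: \<rho>_def\<close>)
    finally have "C1 * (\<Sum>i\<in>I t. D * \<rho> (real i * D)) \<le> C1 * ((exp (\<beta> * T) * \<rho> t) / \<gamma>)"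
      using C(2) by (intro mult_left_mono) auto
    then show ?thesis using C(2) by (simp add: \<gamma>_def)
  qed
  have intb: "(\<integral>\<^sup>+u\<in>{0..t}. ennreal (\<rho> u) \<partial>lborel) \<le> ennreal (\<rho> t / (4 * C1))" if t: "0 \<le> t" for t
  proof -
    let ?c = "exp (\<gamma> * D * real (card (I t)))"
    have "(\<integral>\<^sup>+u\<in>{0..t}. ennreal (\<rho> u) \<partial>lborel) \<le> (\<integral>\<^sup>+u\<in>{0..t}. ennreal (?c * exp (\<beta> * u)) \<partial>lborel)"
    proof (rule nn_integral_mono)
      fix u
      have "\<rho> u \<le> ?c * exp (\<beta> * u)" if "u \<le> t"
        using Imono[OF that] bg D by (simp add: \<rho>_def exp_add[symmetric])
      then show "ennreal (\<rho> u) * indicator {0..t} u \<le> ennreal (?c * exp (\<beta> * u)) * indicator {0..t} u"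
        by (auto simp: indicator_def intro!: ennreal_leI)
    qed
    also have "\<dots> = ennreal (?c * exp (\<beta> * t) / \<beta> - ?c * exp (\<beta> * 0) / \<beta>)"
    proof (rule nn_integral_FTC_Icc[OF _ _ _ t])
      fix u
      have "((\<lambda>u. ?c * exp (\<beta> * u) / \<beta>) has_real_derivative ?c * (exp (\<beta> * u) * (\<beta> * 1)) / \<beta>) (at u)"
        by (intro DERIV_cdivide DERIV_cmult DERIV_fun_exp DERIV_cmult DERIV_ident)
      then show "((\<lambda>u. ?c * exp (\<beta> * u) / \<beta>) has_real_derivative ?c * exp (\<beta> * u)) (at u)"
        using bg by simp
    qed simp_all
    also have "\<dots> \<le> ennreal (\<rho> t / (4 * C1))"
    proof (rule ennreal_leI)
      have "?c * exp (\<beta> * t) / \<beta> = \<rho> t / (4 * C1)" by (simp add: \<rho>_def exp_add \<beta>_def mult.commute)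
      moreover have "0 \<le> ?c * exp (\<beta> * 0) / \<beta>" using bg by simp
      ultimately show "?c * exp (\<beta> * t) / \<beta> - ?c * exp (\<beta> * 0) / \<beta> \<le> \<rho> t / (4 * C1)" by linarith
    qed
    finally show ?thesis .
  qed
  have step: "v t \<le> ennreal ((C0 + m / 2) * \<rho> t)"
    if m: "0 \<le> m" "\<And>t. t \<in> {0..T} \<Longrightarrow> v t \<le> ennreal (m * \<rho> t)" and t: "t \<in> {0..T}" for m t
  proof -
    have \<rho>0: "0 \<le> \<rho> t" for t by (simp add: \<rho>_def)
    have a: "(\<Sum>i\<in>I t. ennreal D * v (real i * D)) \<le> ennreal (m * (\<Sum>i\<in>I t. D * \<rho> (real i * D)))"
    proof -
      have "(\<Sum>i\<in>I t. ennreal D * v (real i * D)) \<le> (\<Sum>i\<in>I t. ennreal (m * (D * \<rho> (real i * D))))"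
      proof (rule sum_mono)
        fix i assume "i \<in> I t"
        then have "real i * D \<in> {0..T}" using D t by (auto simp: I_def)
        then have "ennreal D * v (real i * D) \<le> ennreal D * ennreal (m * \<rho> (real i * D))"
          by (intro mult_left_mono m) auto
        also have "\<dots> = ennreal (m * (D * \<rho> (real i * D)))" using D by (simp add: ennreal_mult'[symmetric] mult_ac)
        finally show "ennreal D * v (real i * D) \<le> ennreal (m * (D * \<rho> (real i * D)))" .
      qed
      also have "\<dots> = ennreal (\<Sum>i\<in>I t. m * (D * \<rho> (real i * D)))"
        using m(1) D \<rho>0 by (intro sum_ennreal) auto
      finally show ?thesis by (simp add: sum_distrib_left)
    qed
    have b: "(\<integral>\<^sup>+u\<in>{0..t}. v u \<partial>lborel) \<le> ennreal (m * (\<rho> t / (4 * C1)))"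
    proof -
      have "(\<integral>\<^sup>+u\<in>{0..t}. v u \<partial>lborel) \<le> (\<integral>\<^sup>+u. ennreal m * (ennreal (\<rho> u) * indicator {0..t} u) \<partial>lborel)"
      proof (rule nn_integral_mono)
        fix u
        show "v u * indicator {0..t} u \<le> ennreal m * (ennreal (\<rho> u) * indicator {0..t} u)"
        proof (cases "u \<in> {0..t}")
          case True
          then have "v u \<le> ennreal m * ennreal (\<rho> u)"
            using m(2)[of u] t ennreal_mult'[OF m(1), of "\<rho> u"] by simp
          then show ?thesis using True by simp
        qed simp
      qed
      also have "\<dots> = ennreal m * (\<integral>\<^sup>+u\<in>{0..t}. ennreal (\<rho> u) \<partial>lborel)"
      proof (rule nn_integral_cmult)
        have "mono (\<lambda>u. real (card (I u)))" using Imono by (auto simp: mono_def)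
        then have [measurable]: "(\<lambda>u. real (card (I u))) \<in> borel_measurable borel" by (rule borel_measurable_mono)
        show "(\<lambda>u. ennreal (\<rho> u) * indicator {0..t} u) \<in> borel_measurable lborel"
          unfolding \<rho>_def by measurable
      qed
      also have "\<dots> \<le> ennreal m * ennreal (\<rho> t / (4 * C1))" using t by (intro mult_left_mono intb) auto
      also have "\<dots> = ennreal (m * (\<rho> t / (4 * C1)))" by (rule ennreal_mult'[symmetric, OF m(1)])
      finally show ?thesis .
    qed
    have "v t \<le> ennreal C0 + ennreal C1 * ((\<Sum>i\<in>I t. ennreal D * v (real i * D)) + (\<integral>\<^sup>+u\<in>{0..t}. v u \<partial>lborel))"
      using le[OF t] by (simp add: I_def D_def)
    also have "\<dots> \<le> ennreal C0 + ennreal C1 * (ennreal (m * (\<Sum>i\<in>I t. D * \<rho> (real i * D))) + ennreal (m * (\<rho> t / (4 * C1))))"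
      by (intro add_left_mono mult_left_mono add_mono a b) simp
    also have "\<dots> = ennreal (C0 + C1 * (m * (\<Sum>i\<in>I t. D * \<rho> (real i * D)) + m * (\<rho> t / (4 * C1))))"
    proof -
      have "0 \<le> m * (\<Sum>i\<in>I t. D * \<rho> (real i * D))" using m(1) D \<rho>0 by (intro mult_nonneg_nonneg sum_nonneg) auto
      moreover have "0 \<le> m * (\<rho> t / (4 * C1))" using m(1) C \<rho>0 by simp
      ultimately show ?thesis using C
        by (simp only: ennreal_plus[symmetric] ennreal_mult'[symmetric] add_nonneg_nonneg mult_nonneg_nonneg less_imp_le)
    qed
    also have "\<dots> \<le> ennreal ((C0 + m / 2) * \<rho> t)"
    proof (rule ennreal_leI)
      have "C1 * (m * (\<Sum>i\<in>I t. D * \<rho> (real i * D))) \<le> m * (\<rho> t / 4)"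
        using mult_left_mono[OF sumb m(1), of t] t by (simp add: mult_ac)
      moreover have "C1 * (m * (\<rho> t / (4 * C1))) = m * (\<rho> t / 4)" using C by simp
      moreover have "C0 * 1 \<le> C0 * \<rho> t" using C \<rho>1 t by (intro mult_left_mono) auto
      ultimately show "C0 + C1 * (m * (\<Sum>i\<in>I t. D * \<rho> (real i * D)) + m * (\<rho> t / (4 * C1))) \<le> (C0 + m / 2) * \<rho> t"
        by (simp add: algebra_simps)
    qed
    finally show ?thesis .
  qed
  have B0: "v t \<le> ennreal (\<bar>B\<bar> * \<rho> t)" if "t \<in> {0..T}" for t
  proof -
    have "\<bar>B\<bar> * 1 \<le> \<bar>B\<bar> * \<rho> t" using \<rho>1[of t] that by (intro mult_left_mono) auto
    then have "B \<le> \<bar>B\<bar> * \<rho> t" by simp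
    then show ?thesis by (intro order_trans[OF bounded[OF that]] ennreal_leI)
  qed
  have iter: "v t \<le> ennreal ((2 * C0 + \<bar>B\<bar> / 2 ^ k) * \<rho> t)" if "t \<in> {0..T}" for t k
    using that
  proof (induction k arbitrary: t)
    case 0
    have "\<bar>B\<bar> * \<rho> t \<le> (2 * C0 + \<bar>B\<bar>) * \<rho> t"
      using C by (intro mult_right_mono) (auto simp: \<rho>_def)
    then have "v t \<le> ennreal ((2 * C0 + \<bar>B\<bar>) * \<rho> t)" by (intro order_trans[OF B0[OF 0]] ennreal_leI)
    then show ?case by simp
  next
    case (Suc k)
    have "v t \<le> ennreal ((C0 + (2 * C0 + \<bar>B\<bar> / 2 ^ k) / 2) * \<rho> t)"
      by (rule step[OF _ Suc.IH Suc.prems]) (use C in auto)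
    then show ?case by (simp add: field_simps)
  qed
  have "(\<lambda>k. ennreal ((2 * C0 + \<bar>B\<bar> / 2 ^ k) * \<rho> t)) \<longlonglongrightarrow> ennreal ((2 * C0 + 0) * \<rho> t)"
    by (intro tendsto_ennrealI tendsto_mult_right tendsto_add tendsto_const LIMSEQ_divide_realpow_zero) simp
  then have "v t \<le> ennreal ((2 * C0 + 0) * \<rho> t)"
    by (rule LIMSEQ_le_const) (use iter[OF t] in blast)
  also have "\<dots> \<le> ennreal (gronwall_factor C1 T * C0)"
    using mult_right_mono[OF \<rho>b C(1), of t] t by (intro ennreal_leI) (simp add: mult_ac)
  finally show ?thesis .
qed

section \<open>Second moments by localisation\<close>

text \<open>If the running integral reaches \<open>R\<close>, it has grown to at least
  \<open>R\<close> by the first such time, and before that time the indicator is one.\<close>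

lemma min_nn_integral_le_stopped:
  fixes S :: "real \<Rightarrow> ennreal"
  assumes [measurable]: "S \<in> borel_measurable borel" and fin: "(\<integral>\<^sup>+u\<in>{0..t}. S u \<partial>lborel) < \<infinity>" and t: "0 \<le> t"
  shows "min R (\<integral>\<^sup>+u\<in>{0..t}. S u \<partial>lborel) \<le>
    (\<integral>\<^sup>+u\<in>{0..t}. S u * indicator {u. (\<integral>\<^sup>+v\<in>{0..u}. S v \<partial>lborel) < R} u \<partial>lborel)"
proof -
  define Q where "Q u = (\<integral>\<^sup>+v\<in>{0..u}. S v \<partial>lborel)" for u
  have Qmono: "Q u \<le> Q w" if "u \<le> w" for u w
    unfolding Q_def using that by (intro nn_integral_mono) (auto simp: indicator_def)
  show ?thesis
  proof (cases "Q t < R")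
    case True
    have "Q t = (\<integral>\<^sup>+u\<in>{0..t}. S u * indicator {u. Q u < R} u \<partial>lborel)"
      unfolding Q_def[of t]
    proof (rule nn_integral_cong)
      fix u
      have "u \<le> t \<Longrightarrow> Q u < R" using Qmono[of u t] True by simp
      then show "S u * indicator {0..t} u = S u * indicator {u. Q u < R} u * indicator {0..t} u"
        by (auto simp: indicator_def)
    qed
    then show ?thesis by (simp add: Q_def)
  next
    case False
    define G where "G = {u \<in> {0..t}. R \<le> Q u}"
    define \<tau> where "\<tau> = Inf G"
    have tG: "t \<in> G" using False t by (auto simp: G_def)
    have bdd: "bdd_below G" by (auto simp: G_def intro!: bdd_belowI[of _ 0])
    have \<tau>: "0 \<le> \<tau>" "\<tau> \<le> t"
      unfolding \<tau>_def by (auto intro!: cInf_greatest cInf_lower tG bdd) (use tG in \<open>auto simp: G_def\<close>)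
    have before: "Q u < R" if "0 \<le> u" "u < \<tau>" for u
    proof (rule ccontr)
      assume "\<not> Q u < R"
      then have "u \<in> G" using that \<tau> by (auto simp: G_def)
      then have "\<tau> \<le> u" unfolding \<tau>_def by (rule cInf_lower[OF _ bdd])
      then show False using that by simp
    qed
    define w where "w k = min t (\<tau> + 1 / real (Suc k))" for k
    have w: "\<tau> \<le> w k" "w k \<le> t" for k using \<tau> by (auto simp: w_def)
    have Rw: "R \<le> Q (w k)" for k
    proof (cases "w k = t")
      case True then show ?thesis using tG by (auto simp: G_def)
    next
      case False
      then have "\<tau> < w k" by (auto simp: w_def)
      then obtain x where "x \<in> G" "x < w k" unfolding \<tau>_def using cInf_less_iff[OF _ bdd] tG by blast
      then show ?thesis using Qmono[of x "w k"] by (auto simp: G_def)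
    qed
    have wl: "w \<longlonglongrightarrow> \<tau>"
    proof -
      have "(\<lambda>k. min t (\<tau> + 1 / real (Suc k))) \<longlonglongrightarrow> min t (\<tau> + 0)"
        by (intro tendsto_min tendsto_add tendsto_const LIMSEQ_inverse_real_of_nat[unfolded inverse_eq_divide])
      moreover have "min t (\<tau> + 0) = \<tau>" using \<tau> by simp
      ultimately show ?thesis unfolding w_def by (simp only:)
    qed
    have "(\<lambda>k. Q (w k)) \<longlonglongrightarrow> Q \<tau>"
      unfolding Q_def
    proof (rule nn_integral_dominated_convergence[where w="\<lambda>u. S u * indicator {0..t} u"])
      show "AE u in lborel. S u * indicator {0..w k} u \<le> S u * indicator {0..t} u" for k
        using w[of k] by (auto simp: indicator_def)
      show "AE u in lborel. (\<lambda>k. S u * indicator {0..w k} u) \<longlonglongrightarrow> S u * indicator {0..\<tau>} u"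
      proof (rule AE_I2)
        fix u
        show "(\<lambda>k. S u * indicator {0..w k} u) \<longlonglongrightarrow> S u * indicator {0..\<tau>} u"
        proof (cases "u \<le> \<tau>")
          case True
          then have "indicator {0..w k} u = (indicator {0..\<tau>} u :: ennreal)" for k
            using w(1)[of k] by (auto simp: indicator_def)
          then show ?thesis by simp
        next
          case False
          then have "eventually (\<lambda>k. w k < u) sequentially" by (intro order_tendstoD(2)[OF wl]) simp
          then have "eventually (\<lambda>k. S u * indicator {0..\<tau>} u = S u * indicator {0..w k} u) sequentially"
            by (rule eventually_mono) (use False in \<open>auto simp: indicator_def\<close>)
          then show ?thesis by (rule Lim_transform_eventually[OF tendsto_const])
        qed
      qed
      show "(\<integral>\<^sup>+u\<in>{0..t}. S u \<partial>lborel) < \<infinity>" by (rule fin)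
    qed measurable
    then have "R \<le> Q \<tau>" by (rule LIMSEQ_le_const) (use Rw in blast)
    also have "Q \<tau> \<le> (\<integral>\<^sup>+u\<in>{0..t}. S u * indicator {u. Q u < R} u \<partial>lborel)"
      unfolding Q_def[of \<tau>]
    proof (rule nn_integral_mono_AE, rule AE_mp[OF AE_lborel_singleton[of \<tau>]], rule AE_I2, intro impI)
      fix u assume "u \<noteq> \<tau>"
      then show "S u * indicator {0..\<tau>} u \<le> S u * indicator {u. Q u < R} u * indicator {0..t} u"
        using before[of u] \<tau> by (auto simp: indicator_def)
    qed
    finally show ?thesis by (simp add: Q_def min.coboundedI1)
  qed
qed

lemma ennreal_square_add_le: "(x + y)\<^sup>2 \<le> 2 * x\<^sup>2 + 2 * (y::ennreal)\<^sup>2"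
proof (cases x; cases y)
  fix r q assume "x = ennreal r" "y = ennreal q" and rq: "0 \<le> r" "0 \<le> q"
  have "(r + q)\<^sup>2 \<le> 2 * r\<^sup>2 + 2 * q\<^sup>2"
    using zero_le_power2[of "r - q"] by (simp add: power2_eq_square algebra_simps)
  then have "ennreal ((r + q)\<^sup>2) \<le> ennreal (2 * r\<^sup>2 + 2 * q\<^sup>2)" by (rule ennreal_leI)
  also have "\<dots> = 2 * (ennreal r)\<^sup>2 + 2 * (ennreal q)\<^sup>2"
    using rq by (simp add: ennreal_power ennreal_mult')
  also have "ennreal ((r + q)\<^sup>2) = (ennreal r + ennreal q)\<^sup>2"
    using rq by (simp add: ennreal_power[symmetric])
  finally show ?thesis using \<open>x = ennreal r\<close> \<open>y = ennreal q\<close> by simp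
qed (simp_all add: power2_eq_square ennreal_mult_top)

text \<open>The Cauchy-Schwarz inequality for a Riemann sum over cells of total length at most
  \<open>T\<close>.\<close>

lemma sum_square_le_ennreal:
  fixes f :: "nat \<Rightarrow> ennreal"
  assumes "finite I" "real (card I) * D \<le> T" "0 \<le> D"
  shows "(\<Sum>i\<in>I. ennreal D * f i)\<^sup>2 \<le> ennreal T * (\<Sum>i\<in>I. ennreal D * (f i)\<^sup>2)"
proof -
  have count: "(\<integral>\<^sup>+i\<in>I. g i \<partial>count_space UNIV) = sum g I" for g :: "nat \<Rightarrow> ennreal"
    by (subst nn_integral_count_space'[OF assms(1)]) (auto intro!: sum.cong)
  have "emeasure (count_space UNIV) I = ennreal (real (card I))"
    using assms(1) by (simp add: ennreal_of_nat_eq_real_of_nat)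
  then have "(\<integral>\<^sup>+i\<in>I. ennreal D * f i \<partial>count_space UNIV)\<^sup>2
     \<le> ennreal (real (card I)) * (\<integral>\<^sup>+i\<in>I. (ennreal D * f i)\<^sup>2 \<partial>count_space UNIV)"
    by (intro nn_integral_square_le) auto
  then have "(\<Sum>i\<in>I. ennreal D * f i)\<^sup>2 \<le> ennreal (real (card I)) * (\<Sum>i\<in>I. (ennreal D * f i)\<^sup>2)"
    unfolding count .
  also have "(\<Sum>i\<in>I. (ennreal D * f i)\<^sup>2) = ennreal D * (\<Sum>i\<in>I. ennreal D * (f i)\<^sup>2)"
    by (simp add: sum_distrib_left power2_eq_square mult_ac)
  also have "ennreal (real (card I)) * (ennreal D * (\<Sum>i\<in>I. ennreal D * (f i)\<^sup>2)) =
      ennreal (real (card I) * D) * (\<Sum>i\<in>I. ennreal D * (f i)\<^sup>2)"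
    using assms(3) by (simp add: ennreal_mult mult_ac)
  also have "\<dots> \<le> ennreal T * (\<Sum>i\<in>I. ennreal D * (f i)\<^sup>2)"
    by (intro mult_right_mono ennreal_leI assms(2)) simp
  finally show ?thesis .
qed

text \<open>The constant produced by the Gronwall inequality in \<open>second_moment_bound\<close>,
  which depends on the data only through bounds that are uniform in the grid.\<close>

definition moment_bound :: "real \<Rightarrow> real \<Rightarrow> real \<Rightarrow> real \<Rightarrow> real" where
  "moment_bound c K s T = gronwall_factor (8 * K\<^sup>2 * T + 16 * s) T * (2 * c\<^sup>2 + 16 * s * T)"

lemma jointly_measurable_nn:
  assumes "jointly_measurable M a b S"
  shows "(\<lambda>x. ennreal (indicator {a..b} (fst x) * S (fst x) (snd x))) \<in> borel_measurable (lborel \<Otimes>\<^sub>M M)"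
  using assms unfolding jointly_measurable_def split_beta' by (rule measurable_compose) measurable

context complete_filtered_prob_space
begin

lemma nn_integral_interval_measurable:
  fixes g :: "real \<Rightarrow> 'a \<Rightarrow> ennreal"
  assumes g: "(\<lambda>x. g (fst x) (snd x)) \<in> borel_measurable (lborel \<Otimes>\<^sub>M M)"
  shows "(\<lambda>w. \<integral>\<^sup>+u\<in>{a..b}. g u w \<partial>lborel) \<in> borel_measurable M"
proof -
  have "(\<lambda>y. g (snd y) (fst y)) \<in> borel_measurable (M \<Otimes>\<^sub>M lborel)"
    using measurable_compose[OF measurable_pair_swap' g] by (simp add: split_beta')
  then have "(\<lambda>(w, u). g u w * indicator {a..b} u) \<in> borel_measurable (M \<Otimes>\<^sub>M lborel)"
    unfolding split_beta' by measurable
  then show ?thesis by (rule lborel.borel_measurable_nn_integral)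
qed

lemma nn_integral_interval_commute:
  fixes g :: "real \<Rightarrow> 'a \<Rightarrow> ennreal"
  assumes [measurable]: "(\<lambda>x. g (fst x) (snd x)) \<in> borel_measurable (lborel \<Otimes>\<^sub>M M)"
  shows "(\<integral>\<^sup>+w. (\<integral>\<^sup>+u\<in>{a..b}. g u w \<partial>lborel) \<partial>M) = (\<integral>\<^sup>+u\<in>{a..b}. (\<integral>\<^sup>+w. g u w \<partial>M) \<partial>lborel)"
proof -
  interpret P: pair_sigma_finite lborel M by unfold_locales
  have gM: "g u \<in> borel_measurable M" for u
    using measurable_compose[OF measurable_Pair1' assms, of u] by simp
  have "(\<integral>\<^sup>+w. (\<integral>\<^sup>+u\<in>{a..b}. g u w \<partial>lborel) \<partial>M) = (\<integral>\<^sup>+u. (\<integral>\<^sup>+w. g u w * indicator {a..b} u \<partial>M) \<partial>lborel)"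
    by (rule P.Fubini') (simp add: split_beta')
  also have "\<dots> = (\<integral>\<^sup>+u\<in>{a..b}. (\<integral>\<^sup>+w. g u w \<partial>M) \<partial>lborel)"
    by (intro nn_integral_cong nn_integral_multc gM)
  finally show ?thesis .
qed

text \<open>No moment of \<open>S\<close> is assumed, so Gronwall's lemma is applied to
  \<open>S\<close> restricted to the event that its running time integral is below a level. On that
  event the noise has small energy and is controlled by \<open>ito_truncated_second_moment\<close>.
  The bound does not depend on the level.\<close>

lemma second_moment_bound:
  fixes S H1 H2 J1 J2 :: "real \<Rightarrow> 'a \<Rightarrow> real"
  assumes W: "wiener_process M F W1" "wiener_process M F W2"
    and T: "T > 0" and n: "n > 0" and c: "c \<ge> 0" and K: "K \<ge> 0" and s: "s > 0"
    and Sj: "jointly_measurable M 0 T S" and SM: "\<And>t. t \<in> {0..T} \<Longrightarrow> S t \<in> borel_measurable M"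
    and S0: "AE w in M. \<forall>t\<in>{0..T}. 0 \<le> S t w"
    and fin: "AE w in M. (\<integral>\<^sup>+u\<in>{0..T}. ennreal (S u w) \<partial>lborel) < \<infinity>"
    and il: "\<And>t. t \<in> {0..T} \<Longrightarrow> ito_limit W1 H1 0 t (J1 t)" "\<And>t. t \<in> {0..T} \<Longrightarrow> ito_limit W2 H2 0 t (J2 t)"
    and H: "AE w in M. \<forall>u\<in>{0..T}. (H1 u w)\<^sup>2 \<le> s * S u w \<and> (H2 u w)\<^sup>2 \<le> s * S u w"
    and le: "\<And>t. t \<in> {0..T} \<Longrightarrow> AE w in M. ennreal (S t w) \<le> ennreal c + (ennreal K *
      ((\<Sum>i | i < n \<and> real i * (T / real n) < t. ennreal (T / real n) * ennreal (S (real i * (T / real n)) w))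
        + (\<integral>\<^sup>+u\<in>{0..t}. ennreal (S u w) \<partial>lborel)) + (ennreal \<bar>J1 t w\<bar> + ennreal \<bar>J2 t w\<bar>))"
    and t: "t \<in> {0..T}"
  shows "(\<integral>\<^sup>+w. ennreal ((S t w)\<^sup>2) \<partial>M) \<le> ennreal (moment_bound c K s T)"
proof -
  define D where "D = T / real n"
  define I where "I t = {i. i < n \<and> real i * D < t}" for t
  have D: "D > 0" "real n * D = T" using T n by (auto simp: D_def)
  have finI: "finite (I t)" for t by (rule finite_subset[of _ "{..<n}"]) (auto simp: I_def)
  have cardI: "real (card (I t)) * D \<le> T" for t
  proof -
    have "card (I t) \<le> n" using card_mono[of "{..<n}" "I t"] by (auto simp: I_def)
    then have "real (card (I t)) * D \<le> real n * D" using D by (intro mult_right_mono) auto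
    then show ?thesis using D by simp
  qed
  have grid: "real i * D \<in> {0..T}" if "i \<in> I t" "t \<in> {0..T}" for i t using that D by (auto simp: I_def)
  define S' where "S' u w = ennreal (indicator {0..T} u * S u w)" for u w
  define Q where "Q t w = (\<integral>\<^sup>+u\<in>{0..t}. S' u w \<partial>lborel)" for t w
  have S'm [measurable]: "(\<lambda>x. S' (fst x) (snd x)) \<in> borel_measurable (lborel \<Otimes>\<^sub>M M)"
    unfolding S'_def by (rule jointly_measurable_nn[OF Sj])
  have Qm [measurable]: "(\<lambda>x. Q (fst x) (snd x)) \<in> borel_measurable (lborel \<Otimes>\<^sub>M M)"
  proof -
    have "(\<lambda>(x, v). S' v (snd x) * (if 0 \<le> v \<and> v \<le> fst x then 1 else 0)) \<in> borel_measurable ((lborel \<Otimes>\<^sub>M M) \<Otimes>\<^sub>M lborel)"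
    proof -
      have "(\<lambda>y. S' (snd y) (snd (fst y))) \<in> borel_measurable ((lborel \<Otimes>\<^sub>M M) \<Otimes>\<^sub>M lborel)"
        using measurable_compose[of "\<lambda>y. (snd y, snd (fst y))" "(lborel \<Otimes>\<^sub>M M) \<Otimes>\<^sub>M lborel" "lborel \<Otimes>\<^sub>M M", OF _ S'm]
        by simp
      then show ?thesis unfolding split_beta' by measurable
    qed
    then have "(\<lambda>x. \<integral>\<^sup>+v. S' v (snd x) * (if 0 \<le> v \<and> v \<le> fst x then 1 else 0) \<partial>lborel) \<in> borel_measurable (lborel \<Otimes>\<^sub>M M)"
      by (rule lborel.borel_measurable_nn_integral)
    moreover have "Q (fst x) (snd x) = (\<integral>\<^sup>+v. S' v (snd x) * (if 0 \<le> v \<and> v \<le> fst x then 1 else 0) \<partial>lborel)" for x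
      unfolding Q_def by (intro nn_integral_cong) (simp add: indicator_def)
    ultimately show ?thesis by simp
  qed
  have QM [measurable]: "Q t \<in> borel_measurable M" for t
    using measurable_compose[OF measurable_Pair1' Qm, of t] by simp
  have S's [measurable]: "(\<lambda>u. S' u w) \<in> borel_measurable lborel" if "w \<in> space M" for w
    using measurable_compose[OF measurable_Pair2'[OF that] S'm] by simp
  have S't: "S' u w = ennreal (S u w)" if "u \<in> {0..T}" for u w using that by (simp add: S'_def)
  have Qeq: "Q t w = (\<integral>\<^sup>+u\<in>{0..t}. ennreal (S u w) \<partial>lborel)" if "t \<le> T" for t w
    unfolding Q_def using that by (intro nn_integral_cong) (auto simp: indicator_def S'_def)
  have Qmono: "Q u w \<le> Q v w" if "u \<le> v" for u v w
    unfolding Q_def using that by (intro nn_integral_mono) (auto simp: indicator_def)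
  have Qfin: "AE w in M. Q t w < \<infinity>" if "t \<le> T" for t
    using fin by eventually_elim (use Qmono[OF that] Qeq[of T] in \<open>auto intro: le_less_trans\<close>)
  have trunc: "(\<integral>\<^sup>+w. ennreal ((S t w)\<^sup>2) * indicator {w. Q t w < ennreal (real N)} w \<partial>M) \<le> ennreal (moment_bound c K s T)"
    for N :: nat
  proof -
    define R where "R = real N"
    have R: "R \<ge> 0" by (simp add: R_def)
    \<comment> \<open>The indicator of the event that the running integral is below the level at time \<open>t\<close>; it decreases in \<open>t\<close>.\<close>
    define \<kappa> :: "real \<Rightarrow> 'a \<Rightarrow> ennreal" where "\<kappa> t w = (if Q t w < ennreal R then 1 else 0)" for t w
    define f where "f t w = S' t w * \<kappa> t w" for t w
    define v where "v t = (\<integral>\<^sup>+w. (f t w)\<^sup>2 \<partial>M)" for t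
    have fm [measurable]: "(\<lambda>x. f (fst x) (snd x)) \<in> borel_measurable (lborel \<Otimes>\<^sub>M M)"
      unfolding f_def \<kappa>_def by measurable
    have fM [measurable]: "f t \<in> borel_measurable M" for t
      using measurable_compose[OF measurable_Pair1' fm, of t] by simp
    have fs [measurable]: "(\<lambda>u. f u w) \<in> borel_measurable lborel" if "w \<in> space M" for w
      using measurable_compose[OF measurable_Pair2'[OF that] fm] by simp
    have \<kappa>mono: "\<kappa> t w = 1 \<Longrightarrow> u \<le> t \<Longrightarrow> \<kappa> u w = 1" for u t w
      using Qmono[of u t w] by (auto simp: \<kappa>_def split: if_splits)
    have pt: "AE w in M. f t w \<le> ennreal c + (ennreal K * ((\<Sum>i\<in>I t. ennreal D * f (real i * D) w)
        + min (ennreal R) (\<integral>\<^sup>+u\<in>{0..t}. f u w \<partial>lborel)) + (ennreal \<bar>J1 t w\<bar> * \<kappa> t w + ennreal \<bar>J2 t w\<bar> * \<kappa> t w))"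
      if t: "t \<in> {0..T}" for t
      using le[OF t]
    proof eventually_elim
      case (elim w)
      show ?case
      proof (cases "\<kappa> t w = 1")
        case True
        have fu: "f u w = ennreal (S u w)" if "0 \<le> u" "u \<le> t" for u
          using \<kappa>mono[OF True that(2)] that t by (simp add: f_def S't)
        have "(\<integral>\<^sup>+u\<in>{0..t}. f u w \<partial>lborel) = (\<integral>\<^sup>+u\<in>{0..t}. ennreal (S u w) \<partial>lborel)"
          by (intro nn_integral_cong) (auto simp: indicator_def fu)
        moreover have "Q t w < ennreal R" using True by (simp add: \<kappa>_def split: if_splits)
        ultimately have i: "min (ennreal R) (\<integral>\<^sup>+u\<in>{0..t}. f u w \<partial>lborel) = (\<integral>\<^sup>+u\<in>{0..t}. ennreal (S u w) \<partial>lborel)"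
          using Qeq[of t w] t by simp
        have "(\<Sum>i\<in>I t. ennreal D * f (real i * D) w) = (\<Sum>i\<in>I t. ennreal D * ennreal (S (real i * D) w))"
          by (intro sum.cong refl) (use D in \<open>simp add: fu I_def\<close>)
        moreover have "f t w = ennreal (S t w)" using t by (intro fu) auto
        ultimately show ?thesis using elim unfolding i True D_def[symmetric] I_def by simp
      next
        case False
        then have "\<kappa> t w = 0" by (simp add: \<kappa>_def split: if_splits)
        then show ?thesis by (simp add: f_def)
      qed
    qed
    have stopped: "AE w in M. min (ennreal R) (Q t w) \<le> (\<integral>\<^sup>+u\<in>{0..t}. f u w \<partial>lborel)" if t: "t \<in> {0..T}" for t
    proof -
      have "AE w in M. Q t w < \<infinity>" using t by (intro Qfin) auto
      then show ?thesis using AE_space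
      proof eventually_elim
        case (elim w)
        have "min (ennreal R) (\<integral>\<^sup>+u\<in>{0..t}. S' u w \<partial>lborel) \<le>
          (\<integral>\<^sup>+u\<in>{0..t}. S' u w * indicator {u. (\<integral>\<^sup>+v\<in>{0..u}. S' v w \<partial>lborel) < ennreal R} u \<partial>lborel)"
          using S's[OF elim(2)] elim(1) t by (intro min_nn_integral_le_stopped) (auto simp: Q_def)
        also have "\<dots> = (\<integral>\<^sup>+u\<in>{0..t}. f u w \<partial>lborel)"
          by (intro nn_integral_cong) (simp add: f_def \<kappa>_def Q_def indicator_def)
        finally show ?case by (simp add: Q_def)
      qed
    qed
    have Jb: "(\<integral>\<^sup>+w. (ennreal \<bar>J w\<bar> * \<kappa> t w)\<^sup>2 \<partial>M) \<le> ennreal s * (\<integral>\<^sup>+w. min (ennreal R) (Q t w) \<partial>M)"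
      if w: "wiener_process M F W" and il: "ito_limit W H 0 t J" and t: "t \<in> {0..T}"
        and H: "AE w in M. \<forall>u\<in>{0..T}. (H u w)\<^sup>2 \<le> s * S u w" for W H J t
    proof -
      have e: "AE w in M. energy 0 t H w \<le> ennreal s * Q t w"
        using H AE_space
      proof eventually_elim
        case (elim w)
        have [measurable]: "(\<lambda>u. S' u w) \<in> borel_measurable lborel" by (rule S's[OF elim(2)])
        have "energy 0 t H w \<le> (\<integral>\<^sup>+u. ennreal s * (S' u w * indicator {0..t} u) \<partial>lborel)"
          unfolding energy_def
        proof (rule nn_integral_mono)
          fix u
          show "ennreal ((H u w)\<^sup>2) * indicator {0..t} u \<le> ennreal s * (S' u w * indicator {0..t} u)"
          proof (cases "u \<in> {0..t}")
            case True
            then have "(H u w)\<^sup>2 \<le> s * S u w" using elim t by auto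
            then have "ennreal ((H u w)\<^sup>2) \<le> ennreal (s * S u w)" by (rule ennreal_leI)
            also have "\<dots> = ennreal s * S' u w" using s True t by (simp add: S't ennreal_mult')
            finally show ?thesis using True by simp
          qed simp
        qed
        also have "\<dots> = ennreal s * Q t w" unfolding Q_def by (rule nn_integral_cmult) measurable
        finally show ?case .
      qed
      have "(\<integral>\<^sup>+w. (ennreal \<bar>J w\<bar> * \<kappa> t w)\<^sup>2 \<partial>M) \<le>
        (\<integral>\<^sup>+w. ennreal ((J w)\<^sup>2) * indicator {w. energy 0 t H w < ennreal (s * R)} w \<partial>M)"
      proof (rule nn_integral_mono_AE)
        show "AE w in M. (ennreal \<bar>J w\<bar> * \<kappa> t w)\<^sup>2 \<le> ennreal ((J w)\<^sup>2) * indicator {w. energy 0 t H w < ennreal (s * R)} w"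
          using e
        proof eventually_elim
          case (elim w)
          show ?case
          proof (cases "Q t w < ennreal R")
            case True
            have "ennreal s * Q t w < ennreal s * ennreal R"
              using True s by (intro ennreal_mult_strict_left_mono) auto
            then have "energy 0 t H w < ennreal (s * R)"
              using elim s by (simp add: ennreal_mult')
            then show ?thesis using True by (simp add: \<kappa>_def ennreal_power)
          qed (simp add: \<kappa>_def)
        qed
      qed
      also have "\<dots> \<le> (\<integral>\<^sup>+w. min (ennreal (s * R)) (energy 0 t H w) \<partial>M)"
        using s R by (intro ito_truncated_second_moment[OF w il]) auto
      also have "\<dots> \<le> (\<integral>\<^sup>+w. ennreal s * min (ennreal R) (Q t w) \<partial>M)"
      proof (rule nn_integral_mono_AE)
        show "AE w in M. min (ennreal (s * R)) (energy 0 t H w) \<le> ennreal s * min (ennreal R) (Q t w)"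
          using e
        proof eventually_elim
          case (elim w)
          show ?case
          proof (cases "ennreal R \<le> Q t w")
            case True
            then show ?thesis using s by (simp add: min_absorb1 ennreal_mult' min.coboundedI1)
          next
            case False
            then show ?thesis using elim by (simp add: min_absorb2 min.coboundedI2)
          qed
        qed
      qed
      also have "\<dots> = ennreal s * (\<integral>\<^sup>+w. min (ennreal R) (Q t w) \<partial>M)" by (rule nn_integral_cmult) measurable
      finally show ?thesis .
    qed
    define G where "G t = (\<integral>\<^sup>+w. (min (ennreal R) (\<integral>\<^sup>+u\<in>{0..t}. f u w \<partial>lborel))\<^sup>2 \<partial>M)" for t
    define P where "P t = (\<integral>\<^sup>+w. min (ennreal R) (Q t w) \<partial>M)" for t
    have [measurable]: "(\<lambda>w. \<integral>\<^sup>+u\<in>{0..t}. f u w \<partial>lborel) \<in> borel_measurable M" for t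
      by (rule nn_integral_interval_measurable[OF fm])
    have main: "v t \<le> ennreal (2 * c\<^sup>2) + (ennreal (8 * K\<^sup>2 * T) * (\<Sum>i\<in>I t. ennreal D * v (real i * D))
        + (ennreal (8 * K\<^sup>2) * G t + ennreal (16 * s) * P t))" if t: "t \<in> {0..T}" for t
    proof -
      let ?x = "\<lambda>w. \<Sum>i\<in>I t. ennreal D * f (real i * D) w" and ?y = "\<lambda>w. min (ennreal R) (\<integral>\<^sup>+u\<in>{0..t}. f u w \<partial>lborel)"
      let ?p = "\<lambda>w. ennreal \<bar>J1 t w\<bar> * \<kappa> t w" and ?q = "\<lambda>w. ennreal \<bar>J2 t w\<bar> * \<kappa> t w"
      have [measurable]: "J1 t \<in> borel_measurable M" "J2 t \<in> borel_measurable M"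
        using il t ito_limitD(5) by blast+
      have [measurable]: "\<kappa> t \<in> borel_measurable M" unfolding \<kappa>_def by measurable
      have ar: "2 * (2 * (k * (2 * x + 2 * y)) + 2 * (2 * p + 2 * q)) = 8 * k * x + (8 * k * y + (8 * p + 8 * q))"
        for k x y p q :: ennreal
        by (simp add: distrib_left mult.assoc mult.left_commute[of k] add.assoc)
      have sq: "(f t w)\<^sup>2 \<le> 2 * (ennreal c)\<^sup>2 + (8 * (ennreal K)\<^sup>2 * (?x w)\<^sup>2 + (8 * (ennreal K)\<^sup>2 * (?y w)\<^sup>2 + (8 * (?p w)\<^sup>2 + 8 * (?q w)\<^sup>2)))"
        if "f t w \<le> ennreal c + (ennreal K * (?x w + ?y w) + (?p w + ?q w))" for w
      proof -
        have k: "(ennreal K * (?x w + ?y w))\<^sup>2 \<le> (ennreal K)\<^sup>2 * (2 * (?x w)\<^sup>2 + 2 * (?y w)\<^sup>2)"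
          unfolding power_mult_distrib[of "ennreal K"] by (intro mult_left_mono ennreal_square_add_le) simp
        have "(f t w)\<^sup>2 \<le> (ennreal c + (ennreal K * (?x w + ?y w) + (?p w + ?q w)))\<^sup>2"
          by (intro power_mono that) simp
        also have "\<dots> \<le> 2 * (ennreal c)\<^sup>2 + 2 * (ennreal K * (?x w + ?y w) + (?p w + ?q w))\<^sup>2"
          by (rule ennreal_square_add_le)
        also have "\<dots> \<le> 2 * (ennreal c)\<^sup>2 + 2 * (2 * (ennreal K * (?x w + ?y w))\<^sup>2 + 2 * (?p w + ?q w)\<^sup>2)"
          by (intro add_left_mono mult_left_mono ennreal_square_add_le) simp
        also have "\<dots> \<le> 2 * (ennreal c)\<^sup>2 + 2 * (2 * ((ennreal K)\<^sup>2 * (2 * (?x w)\<^sup>2 + 2 * (?y w)\<^sup>2)) + 2 * (2 * (?p w)\<^sup>2 + 2 * (?q w)\<^sup>2))"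
          by (intro add_left_mono add_mono mult_left_mono k ennreal_square_add_le) simp_all
        also have "\<dots> = 2 * (ennreal c)\<^sup>2 + (8 * (ennreal K)\<^sup>2 * (?x w)\<^sup>2 + (8 * (ennreal K)\<^sup>2 * (?y w)\<^sup>2 + (8 * (?p w)\<^sup>2 + 8 * (?q w)\<^sup>2)))"
          using ar by simp
        finally show ?thesis .
      qed
      have "v t \<le> (\<integral>\<^sup>+w. 2 * (ennreal c)\<^sup>2 + (8 * (ennreal K)\<^sup>2 * (?x w)\<^sup>2 + (8 * (ennreal K)\<^sup>2 * (?y w)\<^sup>2 + (8 * (?p w)\<^sup>2 + 8 * (?q w)\<^sup>2))) \<partial>M)"
        unfolding v_def by (intro nn_integral_mono_AE eventually_mono[OF pt[OF t]] sq)
      also have "\<dots> = 2 * (ennreal c)\<^sup>2 + (8 * (ennreal K)\<^sup>2 * (\<integral>\<^sup>+w. (?x w)\<^sup>2 \<partial>M) + (8 * (ennreal K)\<^sup>2 * G t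
        + (8 * (\<integral>\<^sup>+w. (?p w)\<^sup>2 \<partial>M) + 8 * (\<integral>\<^sup>+w. (?q w)\<^sup>2 \<partial>M))))"
        unfolding G_def by (simp add: nn_integral_add nn_integral_cmult emeasure_space_1)
      also have "\<dots> \<le> 2 * (ennreal c)\<^sup>2 + (8 * (ennreal K)\<^sup>2 * (ennreal T * (\<Sum>i\<in>I t. ennreal D * v (real i * D))) + (8 * (ennreal K)\<^sup>2 * G t
        + (8 * (ennreal s * P t) + 8 * (ennreal s * P t))))"
      proof (intro add_left_mono add_mono mult_left_mono order_refl)
        have "(\<integral>\<^sup>+w. (?x w)\<^sup>2 \<partial>M) \<le> (\<integral>\<^sup>+w. ennreal T * (\<Sum>i\<in>I t. ennreal D * (f (real i * D) w)\<^sup>2) \<partial>M)"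
          using D by (intro nn_integral_mono sum_square_le_ennreal finI cardI) auto
        also have "\<dots> = ennreal T * (\<Sum>i\<in>I t. ennreal D * v (real i * D))"
          unfolding v_def by (simp add: nn_integral_cmult nn_integral_sum)
        finally show "(\<integral>\<^sup>+w. (?x w)\<^sup>2 \<partial>M) \<le> ennreal T * (\<Sum>i\<in>I t. ennreal D * v (real i * D))" .
        show "(\<integral>\<^sup>+w. (?p w)\<^sup>2 \<partial>M) \<le> ennreal s * P t"
          unfolding P_def by (rule Jb[OF W(1) il(1)[OF t] t]) (use H in \<open>auto elim: eventually_mono\<close>)
        show "(\<integral>\<^sup>+w. (?q w)\<^sup>2 \<partial>M) \<le> ennreal s * P t"
          unfolding P_def by (rule Jb[OF W(2) il(2)[OF t] t]) (use H in \<open>auto elim: eventually_mono\<close>)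
      qed simp_all
      also have "\<dots> = ennreal (2 * c\<^sup>2) + (ennreal (8 * K\<^sup>2 * T) * (\<Sum>i\<in>I t. ennreal D * v (real i * D))
        + (ennreal (8 * K\<^sup>2) * G t + ennreal (16 * s) * P t))"
      proof -
        have "8 * (ennreal s * P t) + 8 * (ennreal s * P t) = 16 * (ennreal s * P t)"
          by (simp add: distrib_right[symmetric])
        moreover have "ennreal (16 * s) = 16 * ennreal s" using s by (simp add: ennreal_mult)
        moreover have "ennreal (8 * K\<^sup>2) = 8 * (ennreal K)\<^sup>2" using K by (simp add: ennreal_mult ennreal_power)
        moreover have "ennreal (8 * K\<^sup>2 * T) = 8 * (ennreal K)\<^sup>2 * ennreal T" using K T by (simp add: ennreal_mult ennreal_power)
        moreover have "ennreal (2 * c\<^sup>2) = 2 * (ennreal c)\<^sup>2" using c by (simp add: ennreal_mult ennreal_power)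
        ultimately show ?thesis by (simp add: mult.assoc)
      qed
      finally show ?thesis .
    qed
    have PR: "P t \<le> ennreal R" for t
    proof -
      have "P t \<le> (\<integral>\<^sup>+w. ennreal R \<partial>M)" unfolding P_def by (intro nn_integral_mono) simp
      then show ?thesis by (simp add: emeasure_space_1)
    qed
    have GR: "G t \<le> (ennreal R)\<^sup>2" for t
    proof -
      have "G t \<le> (\<integral>\<^sup>+w. (ennreal R)\<^sup>2 \<partial>M)" unfolding G_def by (intro nn_integral_mono power_mono) simp_all
      then show ?thesis by (simp add: emeasure_space_1)
    qed
    define B where "B = ennreal (2 * c\<^sup>2) + (ennreal (8 * K\<^sup>2 * T) * (\<Sum>i<n. ennreal D * v (real i * D))
        + (ennreal (8 * K\<^sup>2) * (ennreal R)\<^sup>2 + ennreal (16 * s) * ennreal R))"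
    have crude: "v t \<le> ennreal (2 * c\<^sup>2) + (ennreal (8 * K\<^sup>2 * T) * (\<Sum>i\<in>I t. ennreal D * v (real i * D))
        + (ennreal (8 * K\<^sup>2) * (ennreal R)\<^sup>2 + ennreal (16 * s) * ennreal R))" if t: "t \<in> {0..T}" for t
      by (rule order_trans[OF main[OF t]]) (intro add_left_mono add_mono mult_left_mono GR PR, simp_all)
    have vgrid: "i < n \<Longrightarrow> v (real i * D) < \<top>" for i
    proof (induction i rule: less_induct)
      case (less i)
      have "real i * D \<le> real n * D" using less.prems D by (intro mult_right_mono) auto
      then have ti: "real i * D \<in> {0..T}" using D by simp
      have "j < i" if "j \<in> I (real i * D)" for j using that D by (auto simp: I_def)
      then have "(\<Sum>j\<in>I (real i * D). ennreal D * v (real j * D)) < \<top>"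
        using less by (intro ennreal_sum_less_top[THEN iffD2, OF finI] ballI) (auto simp: ennreal_mult_less_top I_def)
      then show ?case
        by (intro le_less_trans[OF crude[OF ti]]) (simp add: ennreal_mult_less_top power_less_top_ennreal)
    qed
    have Bfin: "B < \<top>"
      unfolding B_def using vgrid by (simp add: ennreal_mult_less_top power_less_top_ennreal)
    have vB: "v t \<le> ennreal (enn2real B)" if t: "t \<in> {0..T}" for t
    proof -
      have "(\<Sum>i\<in>I t. ennreal D * v (real i * D)) \<le> (\<Sum>i<n. ennreal D * v (real i * D))"
        by (intro sum_mono2) (auto simp: I_def)
      then have "v t \<le> B"
        unfolding B_def by (intro order_trans[OF crude[OF t]] add_left_mono add_right_mono mult_left_mono) simp_all
      then show ?thesis using Bfin by simp
    qed
    have int_le: "G t \<le> ennreal T * (\<integral>\<^sup>+u\<in>{0..t}. v u \<partial>lborel)"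
      "P t \<le> ennreal T + (\<integral>\<^sup>+u\<in>{0..t}. v u \<partial>lborel)" if t: "t \<in> {0..T}" for t
    proof -
      have f2: "(\<lambda>x. (f (fst x) (snd x))\<^sup>2) \<in> borel_measurable (lborel \<Otimes>\<^sub>M M)" by measurable
      have len: "emeasure lborel {0..t} \<le> ennreal T" using t by (simp add: ennreal_leI)
      have "G t \<le> (\<integral>\<^sup>+w. ennreal T * (\<integral>\<^sup>+u\<in>{0..t}. (f u w)\<^sup>2 \<partial>lborel) \<partial>M)"
        unfolding G_def
      proof (rule nn_integral_mono)
        fix w assume w: "w \<in> space M"
        have "(min (ennreal R) (\<integral>\<^sup>+u\<in>{0..t}. f u w \<partial>lborel))\<^sup>2 \<le> (\<integral>\<^sup>+u\<in>{0..t}. f u w \<partial>lborel)\<^sup>2"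
          by (intro power_mono) simp_all
        also have "\<dots> \<le> ennreal T * (\<integral>\<^sup>+u\<in>{0..t}. (f u w)\<^sup>2 \<partial>lborel)"
          using T by (intro nn_integral_square_le fs[OF w] len) auto
        finally show "(min (ennreal R) (\<integral>\<^sup>+u\<in>{0..t}. f u w \<partial>lborel))\<^sup>2 \<le> ennreal T * (\<integral>\<^sup>+u\<in>{0..t}. (f u w)\<^sup>2 \<partial>lborel)" .
      qed
      also have "\<dots> = ennreal T * (\<integral>\<^sup>+w. (\<integral>\<^sup>+u\<in>{0..t}. (f u w)\<^sup>2 \<partial>lborel) \<partial>M)"
        by (rule nn_integral_cmult[OF nn_integral_interval_measurable[OF f2]])
      also have "\<dots> = ennreal T * (\<integral>\<^sup>+u\<in>{0..t}. v u \<partial>lborel)" unfolding nn_integral_interval_commute[OF f2] v_def ..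
      finally show "G t \<le> ennreal T * (\<integral>\<^sup>+u\<in>{0..t}. v u \<partial>lborel)" .
      have vm: "v \<in> borel_measurable lborel"
        unfolding v_def using borel_measurable_nn_integral[of "\<lambda>u w. (f u w)\<^sup>2" lborel] f2 by (simp add: split_beta')
      have "P t \<le> (\<integral>\<^sup>+w. (\<integral>\<^sup>+u\<in>{0..t}. f u w \<partial>lborel) \<partial>M)"
        unfolding P_def by (intro nn_integral_mono_AE stopped t)
      also have "\<dots> = (\<integral>\<^sup>+u\<in>{0..t}. (\<integral>\<^sup>+w. f u w \<partial>M) \<partial>lborel)" by (rule nn_integral_interval_commute[OF fm])
      also have "\<dots> \<le> (\<integral>\<^sup>+u. 1 * indicator {0..t} u + v u * indicator {0..t} u \<partial>lborel)"
      proof (rule nn_integral_mono)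
        fix u
        have "x \<le> 1 + x\<^sup>2" for x :: ennreal
        proof (cases "x \<le> 1")
          case True then show ?thesis by (simp add: add_increasing2)
        next
          case False
          then have "1 * x \<le> x * x" by (intro mult_right_mono) auto
          then show ?thesis by (simp add: power2_eq_square add_increasing)
        qed
        then have "(\<integral>\<^sup>+w. f u w \<partial>M) \<le> (\<integral>\<^sup>+w. 1 + (f u w)\<^sup>2 \<partial>M)" by (intro nn_integral_mono)
        also have "\<dots> = 1 + v u" unfolding v_def by (simp add: nn_integral_add emeasure_space_1)
        finally show "(\<integral>\<^sup>+w. f u w \<partial>M) * indicator {0..t} u \<le> 1 * indicator {0..t} u + v u * indicator {0..t} u"
          by (auto simp: indicator_def)
      qed
      also have "\<dots> = emeasure lborel {0..t} + (\<integral>\<^sup>+u\<in>{0..t}. v u \<partial>lborel)"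
        using vm by (subst nn_integral_add) auto
      also have "\<dots> \<le> ennreal T + (\<integral>\<^sup>+u\<in>{0..t}. v u \<partial>lborel)" by (intro add_right_mono len)
      finally show "P t \<le> ennreal T + (\<integral>\<^sup>+u\<in>{0..t}. v u \<partial>lborel)" .
    qed
    have "v t \<le> ennreal (moment_bound c K s T)"
      unfolding moment_bound_def
    proof (rule gronwall_with_grid[OF T n _ _ vB t])
      show "0 \<le> 2 * c\<^sup>2 + 16 * s * T" using s T by simp
      show "0 < 8 * K\<^sup>2 * T + 16 * s" using s T by (simp add: add_nonneg_pos)
      fix t assume t: "t \<in> {0..T}"
      let ?x = "\<Sum>i\<in>I t. ennreal D * v (real i * D)" and ?y = "\<integral>\<^sup>+u\<in>{0..t}. v u \<partial>lborel"
      have "v t \<le> ennreal (2 * c\<^sup>2) + (ennreal (8 * K\<^sup>2 * T) * ?x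
        + (ennreal (8 * K\<^sup>2) * (ennreal T * ?y) + ennreal (16 * s) * (ennreal T + ?y)))"
        by (intro order_trans[OF main[OF t]] add_left_mono add_mono mult_left_mono int_le t) simp_all
      also have "\<dots> = ennreal (2 * c\<^sup>2) + ennreal (16 * s * T) + (ennreal (8 * K\<^sup>2 * T) * ?x + (ennreal (8 * K\<^sup>2 * T) + ennreal (16 * s)) * ?y)"
        using T s by (simp add: ennreal_mult algebra_simps)
      also have "\<dots> \<le> ennreal (2 * c\<^sup>2) + ennreal (16 * s * T) + ((ennreal (8 * K\<^sup>2 * T) + ennreal (16 * s)) * ?x + (ennreal (8 * K\<^sup>2 * T) + ennreal (16 * s)) * ?y)"
        by (intro add_left_mono add_right_mono mult_right_mono) simp_all
      also have "\<dots> = ennreal (2 * c\<^sup>2 + 16 * s * T) + ennreal (8 * K\<^sup>2 * T + 16 * s) * (?x + ?y)"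
        using T s by (simp add: distrib_left)
      finally show "v t \<le> ennreal (2 * c\<^sup>2 + 16 * s * T) + ennreal (8 * K\<^sup>2 * T + 16 * s) *
        ((\<Sum>i | i < n \<and> real i * (T / real n) < t. ennreal (T / real n) * v (real i * (T / real n))) + ?y)"
        by (simp add: D_def I_def)
    qed
    moreover have "v t = (\<integral>\<^sup>+w. ennreal ((S t w)\<^sup>2) * indicator {w. Q t w < ennreal (real N)} w \<partial>M)"
      unfolding v_def
    proof (rule nn_integral_cong_AE)
      show "AE w in M. (f t w)\<^sup>2 = ennreal ((S t w)\<^sup>2) * indicator {w. Q t w < ennreal (real N)} w"
        using S0 by eventually_elim (use t in \<open>simp add: f_def \<kappa>_def R_def S't ennreal_power indicator_def\<close>)
    qed
    ultimately show ?thesis by simp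
  qed
  show ?thesis
  proof (rule nn_integral_le_of_truncations[where q="Q t"])
    show "(\<lambda>w. ennreal ((S t w)\<^sup>2)) \<in> borel_measurable M" using SM[OF t] by measurable
    show "AE w in M. Q t w < \<infinity>" using t by (intro Qfin) auto
  qed (use trunc in auto)
qed

end

section \<open>A smooth approximation of the absolute value\<close>

text \<open>The second antiderivative of \<open>smooth_delta r\<close>, normalised to vanish to
  first order at zero. It replaces the piecewise function of Yamada and Watanabe by an explicit
  smooth one.\<close>

definition smooth_abs :: "real \<Rightarrow> real \<Rightarrow> real" where
  "smooth_abs r v = (v * arsinh (v / r) - sqrt (v\<^sup>2 + r\<^sup>2) + r) / ln (1 / r)"

definition smooth_sgn :: "real \<Rightarrow> real \<Rightarrow> real" where
  "smooth_sgn r v = arsinh (v / r) / ln (1 / r)"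

definition smooth_delta :: "real \<Rightarrow> real \<Rightarrow> real" where
  "smooth_delta r v = 1 / (ln (1 / r) * sqrt (v\<^sup>2 + r\<^sup>2))"

context
  fixes r :: real
  assumes r: "0 < r" "r < 1"
begin

lemma ln_inverse_pos: "0 < ln (1 / r)" using r by simp

lemma sqrt_scale: "sqrt ((v / r)\<^sup>2 + 1) = sqrt (v\<^sup>2 + r\<^sup>2) / r"
proof -
  have "(v / r)\<^sup>2 + 1 = (v\<^sup>2 + r\<^sup>2) / r\<^sup>2" using r by (simp add: power_divide add_divide_distrib)
  then show ?thesis using r by (simp add: real_sqrt_divide)
qed

lemma smooth_sgn_deriv: "(smooth_sgn r has_real_derivative smooth_delta r v) (at v)"
proof -
  have "((\<lambda>v. arsinh (v / r) / ln (1 / r)) has_real_derivative (1 / sqrt ((v / r)\<^sup>2 + 1)) * (1 / r) / ln (1 / r)) (at v)"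
    by (intro DERIV_cdivide DERIV_chain2[where f=arsinh] arsinh_real_has_field_derivative DERIV_cdivide DERIV_ident)
  then show ?thesis unfolding sqrt_scale smooth_sgn_def[abs_def] smooth_delta_def using r by (simp add: mult.commute)
qed

lemma smooth_abs_deriv: "(smooth_abs r has_real_derivative smooth_sgn r v) (at v)"
proof -
  have pos: "0 < v\<^sup>2 + r\<^sup>2" using r by (simp add: add_nonneg_pos)
  have 1: "((\<lambda>v. arsinh (v / r)) has_real_derivative (1 / sqrt ((v / r)\<^sup>2 + 1)) * (1 / r)) (at v)"
    by (intro DERIV_chain2[where f=arsinh] arsinh_real_has_field_derivative DERIV_cdivide DERIV_ident)
  have 2: "((\<lambda>v. sqrt (v\<^sup>2 + r\<^sup>2)) has_real_derivative v / sqrt (v\<^sup>2 + r\<^sup>2)) (at v)"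
    using pos by (auto intro!: derivative_eq_intros simp: field_simps)
  have "((\<lambda>v. (v * arsinh (v / r) - sqrt (v\<^sup>2 + r\<^sup>2) + r) / ln (1 / r)) has_real_derivative
     (1 * arsinh (v / r) + (1 / sqrt ((v / r)\<^sup>2 + 1)) * (1 / r) * v - v / sqrt (v\<^sup>2 + r\<^sup>2) + 0) / ln (1 / r)) (at v)"
    by (intro DERIV_cdivide DERIV_add DERIV_diff DERIV_mult 1 2 DERIV_ident DERIV_const)
  then show ?thesis unfolding sqrt_scale smooth_abs_def[abs_def] smooth_sgn_def using r by simp
qed

text \<open>The last bound is the point of the construction: against a quadratic variation of size
  \<open>\<bar>v\<bar>\<close> the second derivative only costs \<open>1 / ln (1/r)\<close>.\<close>

lemma smooth_delta_bounds:
  "0 \<le> smooth_delta r v" "smooth_delta r v \<le> 1 / (ln (1 / r) * r)" "smooth_delta r v * \<bar>v\<bar> \<le> 1 / ln (1 / r)"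
proof -
  let ?L = "ln (1 / r)" and ?s = "sqrt (v\<^sup>2 + r\<^sup>2)"
  note L = ln_inverse_pos
  have s: "r \<le> ?s" "\<bar>v\<bar> \<le> ?s" "0 < ?s"
  proof -
    show "r \<le> ?s" by (rule real_le_rsqrt) simp
    then show "0 < ?s" using r by linarith
    show "\<bar>v\<bar> \<le> ?s" by (rule real_le_rsqrt) simp
  qed
  show "0 \<le> smooth_delta r v" using L s by (simp add: smooth_delta_def)
  show "smooth_delta r v \<le> 1 / (?L * r)"
    unfolding smooth_delta_def using L s r by (intro divide_left_mono mult_left_mono mult_pos_pos) auto
  have "\<bar>v\<bar> / ?s / ?L \<le> 1 / ?L" using L s by (intro divide_right_mono) (auto simp: divide_le_eq)
  then show "smooth_delta r v * \<bar>v\<bar> \<le> 1 / ?L" by (simp add: smooth_delta_def mult.commute)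
qed

lemma smooth_delta_lipschitz: "smooth_delta r u \<le> smooth_delta r v + \<bar>u - v\<bar> / (ln (1 / r) * r\<^sup>2)"
proof -
  let ?L = "ln (1 / r)" and ?s = "sqrt (u\<^sup>2 + r\<^sup>2)" and ?t = "sqrt (v\<^sup>2 + r\<^sup>2)"
  note L = ln_inverse_pos
  have s: "r \<le> ?s" "r \<le> ?t" by (rule real_le_rsqrt, simp)+
  have "?t \<le> ?s + \<bar>u - v\<bar>"
    using real_sqrt_sum_squares_triangle_ineq[of u "v - u" r 0] by (simp add: abs_minus_commute)
  moreover have "?s * ?t > 0" using s r by (intro mult_pos_pos) linarith+
  moreover have "1 / ?s - 1 / ?t = (?t - ?s) / (?s * ?t)"
  proof -
    have "?s \<noteq> 0" "?t \<noteq> 0" using s r by linarith+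
    from diff_frac_eq[OF this, of 1 1] show ?thesis by simp
  qed
  ultimately have "1 / ?s - 1 / ?t \<le> \<bar>u - v\<bar> / (?s * ?t)"
    by (simp add: divide_right_mono)
  also have "\<dots> \<le> \<bar>u - v\<bar> / (r * r)"
    using s r by (intro divide_left_mono mult_mono mult_pos_pos) (auto simp: sum_power2_gt_zero_iff intro: order_trans[of 0 r])
  finally have "(1 / ?s - 1 / ?t) / ?L \<le> (\<bar>u - v\<bar> / (r * r)) / ?L" using L by (intro divide_right_mono) auto
  then show ?thesis by (simp add: smooth_delta_def diff_divide_distrib power2_eq_square mult_ac)
qed

lemma smooth_abs_taylor:
  obtains t where "\<bar>t - v\<bar> \<le> \<bar>x\<bar>" "smooth_abs r (v + x) = smooth_abs r v + smooth_sgn r v * x + smooth_delta r t / 2 * x\<^sup>2"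
proof (cases "x = 0")
  case True
  then show ?thesis using that[of v] by simp
next
  case False
  define diff where "diff m = (if m = 0 then smooth_abs r else if m = (1::nat) then smooth_sgn r else smooth_delta r)" for m
  have D: "\<forall>m t. m < 2 \<and> v - \<bar>x\<bar> \<le> t \<and> t \<le> v + \<bar>x\<bar> \<longrightarrow> DERIV (diff m) t :> diff (Suc m) t"
    using smooth_abs_deriv smooth_sgn_deriv by (auto simp: diff_def less_2_cases_iff)
  obtain t where t: "if v + x < v then v + x < t \<and> t < v else v < t \<and> t < v + x"
    "smooth_abs r (v + x) = (\<Sum>m<2. (diff m v / fact m) * (v + x - v) ^ m) + (diff 2 t / fact 2) * (v + x - v)\<^sup>2"
  proof -
    have "\<exists>t. (if v + x < v then v + x < t \<and> t < v else v < t \<and> t < v + x) \<and>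
      smooth_abs r (v + x) = (\<Sum>m<2. (diff m v / fact m) * (v + x - v) ^ m) + (diff 2 t / fact 2) * (v + x - v) ^ 2"
      by (rule Taylor[OF _ _ D]) (use False in \<open>auto simp: diff_def\<close>)
    then show ?thesis using that by blast
  qed
  show ?thesis
  proof (rule that[of t])
    show "\<bar>t - v\<bar> \<le> \<bar>x\<bar>" using t(1) by (auto split: if_splits)
    show "smooth_abs r (v + x) = smooth_abs r v + smooth_sgn r v * x + smooth_delta r t / 2 * x\<^sup>2"
      using t(2) by (simp add: diff_def numeral_2_eq_2)
  qed
qed

text \<open>Taylor's formula with the second derivative moved from the intermediate point to
  \<open>v\<close> by its Lipschitz bound.\<close>

lemma smooth_abs_expansion:
  "smooth_abs r (v + x) \<le> smooth_abs r v + smooth_sgn r v * x + smooth_delta r v / 2 * x\<^sup>2 + \<bar>x\<bar> ^ 3 / (2 * ln (1 / r) * r\<^sup>2)"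
proof -
  note L = ln_inverse_pos
  obtain t where t: "\<bar>t - v\<bar> \<le> \<bar>x\<bar>" "smooth_abs r (v + x) = smooth_abs r v + smooth_sgn r v * x + smooth_delta r t / 2 * x\<^sup>2"
    by (rule smooth_abs_taylor)
  have "smooth_delta r t \<le> smooth_delta r v + \<bar>x\<bar> / (ln (1 / r) * r\<^sup>2)"
    using smooth_delta_lipschitz[of t v] divide_right_mono[OF t(1), of "ln (1 / r) * r\<^sup>2"] L r by simp
  then have "smooth_delta r t / 2 * x\<^sup>2 \<le> (smooth_delta r v + \<bar>x\<bar> / (ln (1 / r) * r\<^sup>2)) / 2 * x\<^sup>2"
    by (intro mult_right_mono divide_right_mono) auto
  also have "\<dots> = smooth_delta r v / 2 * x\<^sup>2 + \<bar>x\<bar> ^ 3 / (2 * ln (1 / r) * r\<^sup>2)"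
  proof -
    have "\<bar>x\<bar> ^ 3 = \<bar>x\<bar> * x\<^sup>2" by (simp add: power3_eq_cube power2_eq_square abs_mult_self_eq mult.assoc)
    then show ?thesis by (simp add: add_divide_distrib distrib_right mult.assoc)
  qed
  finally show ?thesis using t(2) by simp
qed

text \<open>The tangent inequality at \<open>v\<close>; used to remove the drift part of an
  increment without expanding it.\<close>

lemma smooth_abs_convex: "smooth_abs r v \<le> smooth_abs r (v - x) + smooth_sgn r v * x"
proof -
  obtain t where "smooth_abs r (v + - x) = smooth_abs r v + smooth_sgn r v * (- x) + smooth_delta r t / 2 * (- x)\<^sup>2"
    by (rule smooth_abs_taylor)
  moreover have "0 \<le> smooth_delta r t / 2 * (- x)\<^sup>2" using smooth_delta_bounds(1)[of t] by simp
  ultimately show ?thesis by simp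
qed

lemma smooth_abs_0 [simp]: "smooth_abs r 0 = 0"
  using r by (simp add: smooth_abs_def)

lemma abs_smooth_sgn: "\<bar>smooth_sgn r v\<bar> = arsinh (\<bar>v\<bar> / r) / ln (1 / r)"
proof -
  have "\<bar>arsinh (v / r)\<bar> = arsinh (\<bar>v\<bar> / r)"
  proof (cases "0 \<le> v")
    case True
    then have "0 \<le> v / r" using r by simp
    then have "0 \<le> arsinh (v / r)" using arsinh_real_neg_iff[of "v / r"] by linarith
    then show ?thesis using True by simp
  next
    case False
    then have "v / r < 0" using r by (simp add: divide_neg_pos)
    then have "arsinh (v / r) < 0" by (rule arsinh_real_neg_iff[THEN iffD2])
    moreover have "arsinh (\<bar>v\<bar> / r) = - arsinh (v / r)" using False arsinh_minus_real[of "v / r"] by simp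
    ultimately show ?thesis by linarith
  qed
  then show ?thesis using ln_inverse_pos by (simp add: smooth_sgn_def)
qed

lemma abs_smooth_sgn_le: "\<bar>smooth_sgn r v\<bar> \<le> 1 + 2 * \<bar>v\<bar> / ln (1 / r)"
proof -
  note L = ln_inverse_pos
  have "sqrt ((\<bar>v\<bar> / r)\<^sup>2 + 1) \<le> \<bar>v\<bar> / r + 1"
    using r by (intro real_le_lsqrt) (auto simp: power2_eq_square algebra_simps)
  then have "arsinh (\<bar>v\<bar> / r) \<le> ln (\<bar>v\<bar> / r + (\<bar>v\<bar> / r + 1))"
    unfolding arsinh_real_def using r arsinh_real_aux[of "\<bar>v\<bar> / r"] by (subst ln_le_cancel_iff) (auto intro: add_nonneg_pos)
  also have "\<bar>v\<bar> / r + (\<bar>v\<bar> / r + 1) = 1 / r * (2 * \<bar>v\<bar> + r)" using r by (simp add: field_simps)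
  also have "ln \<dots> = ln (1 / r) + ln (2 * \<bar>v\<bar> + r)" using r by (subst ln_mult) (auto intro: add_nonneg_pos)
  also have "ln (2 * \<bar>v\<bar> + r) \<le> 2 * \<bar>v\<bar> + r - 1" using r by (intro ln_le_minus_one) (auto intro: add_nonneg_pos)
  finally have "arsinh (\<bar>v\<bar> / r) \<le> ln (1 / r) + 2 * \<bar>v\<bar>" using r by simp
  then have "arsinh (\<bar>v\<bar> / r) / ln (1 / r) \<le> (ln (1 / r) + 2 * \<bar>v\<bar>) / ln (1 / r)"
    using L by (intro divide_right_mono) auto
  then show ?thesis unfolding abs_smooth_sgn using L by (simp add: add_divide_distrib)
qed

text \<open>The logarithmic normalisation makes the slope at least one outside a neighbourhood of
  zero whose contribution is \<open>1 / ln (1/r)\<close>.\<close>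

lemma abs_le_smooth_abs: "\<bar>v\<bar> \<le> smooth_abs r v + 1 / ln (1 / r)"
proof (cases "v = 0")
  case True then show ?thesis using ln_inverse_pos by simp
next
  case False
  let ?L = "ln (1 / r)"
  note L = ln_inverse_pos
  have v: "0 < \<bar>v\<bar>" using False by simp
  have "v * arsinh (v / r) = \<bar>v\<bar> * arsinh (\<bar>v\<bar> / r)"
    using arsinh_minus_real[of "v / r"] by (cases "0 \<le> v") auto
  moreover have "?L + ln \<bar>v\<bar> \<le> arsinh (\<bar>v\<bar> / r)"
  proof -
    have "?L + ln \<bar>v\<bar> = ln (\<bar>v\<bar> / r)" using r v ln_mult[of "1 / r" "\<bar>v\<bar>"] by simp
    also have "\<dots> \<le> ln (\<bar>v\<bar> / r + sqrt ((\<bar>v\<bar> / r)\<^sup>2 + 1))"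
      using r v by (subst ln_le_cancel_iff) (auto intro: add_pos_nonneg)
    finally show ?thesis by (simp add: arsinh_real_def)
  qed
  then have "\<bar>v\<bar> * (?L + ln \<bar>v\<bar>) \<le> \<bar>v\<bar> * arsinh (\<bar>v\<bar> / r)" by (intro mult_left_mono) auto
  moreover have "\<bar>v\<bar> - 1 \<le> \<bar>v\<bar> * ln \<bar>v\<bar>"
  proof -
    have "ln (1 / \<bar>v\<bar>) \<le> 1 / \<bar>v\<bar> - 1" using v by (intro ln_le_minus_one) simp
    then have "\<bar>v\<bar> * (1 - 1 / \<bar>v\<bar>) \<le> \<bar>v\<bar> * ln \<bar>v\<bar>" using v by (intro mult_left_mono) (auto simp: ln_div)
    then show ?thesis using v by (simp add: right_diff_distrib)
  qed
  moreover have "sqrt (v\<^sup>2 + r\<^sup>2) \<le> \<bar>v\<bar> + r"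
    using sqrt_sum_squares_le_sum_abs[of v r] r by simp
  ultimately have "\<bar>v\<bar> * ?L - 1 \<le> v * arsinh (v / r) - sqrt (v\<^sup>2 + r\<^sup>2) + r"
    by (simp add: distrib_left)
  then have "(\<bar>v\<bar> * ?L - 1) / ?L \<le> smooth_abs r v"
    unfolding smooth_abs_def using L by (intro divide_right_mono) auto
  then show ?thesis using L by (simp add: diff_divide_distrib)
qed

lemma abs_smooth_abs_le: "\<bar>smooth_abs r v\<bar> \<le> 1 / ln (1 / r) + \<bar>v\<bar> + 2 * v\<^sup>2 / ln (1 / r)"
proof -
  have "smooth_abs r v \<le> smooth_abs r (v - v) + smooth_sgn r v * v" by (rule smooth_abs_convex)
  also have "\<dots> \<le> \<bar>smooth_sgn r v\<bar> * \<bar>v\<bar>" by (simp add: abs_mult[symmetric])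
  also have "\<dots> \<le> (1 + 2 * \<bar>v\<bar> / ln (1 / r)) * \<bar>v\<bar>" by (intro mult_right_mono abs_smooth_sgn_le) simp
  also have "\<dots> = \<bar>v\<bar> + 2 * v\<^sup>2 / ln (1 / r)" by (simp add: distrib_right power2_eq_square)
  finally have u: "smooth_abs r v \<le> \<bar>v\<bar> + 2 * v\<^sup>2 / ln (1 / r)" .
  have "0 \<le> 1 / ln (1 / r)" "0 \<le> 2 * v\<^sup>2 / ln (1 / r)" using ln_inverse_pos by simp_all
  then show ?thesis using u abs_le_smooth_abs[of v] by linarith
qed

lemma smooth_measurable:
  "smooth_abs r \<in> borel_measurable borel" "smooth_sgn r \<in> borel_measurable borel" "smooth_delta r \<in> borel_measurable borel"
proof -
  show "smooth_abs r \<in> borel_measurable borel"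
    using DERIV_isCont[OF smooth_abs_deriv] by (intro borel_measurable_continuous_onI continuous_at_imp_continuous_on) auto
  show "smooth_sgn r \<in> borel_measurable borel"
    using DERIV_isCont[OF smooth_sgn_deriv] by (intro borel_measurable_continuous_onI continuous_at_imp_continuous_on) auto
  show "smooth_delta r \<in> borel_measurable borel"
    unfolding smooth_delta_def[abs_def] by measurable
qed

end

section \<open>The estimate of Yamada and Watanabe\<close>

lemma jointly_measurable_at:
  assumes "jointly_measurable N a b H" "u \<in> {a..b}"
  shows "H u \<in> borel_measurable N"
  using measurable_compose[OF measurable_Pair1' assms(1)[unfolded jointly_measurable_def], of u] assms(2) by simp

lemma abs_le_one_plus_square: "\<bar>x\<bar> \<le> 1 + (x::real)\<^sup>2"
proof -
  have "0 \<le> (\<bar>x\<bar> - 1)\<^sup>2" by simp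
  then have "2 * \<bar>x\<bar> \<le> 1 + x\<^sup>2" by (simp add: power2_diff)
  then show ?thesis using abs_ge_zero[of x] by linarith
qed

lemma two_mult_le: "2 * (x * y) \<le> \<eta> * x\<^sup>2 + y\<^sup>2 / \<eta>" if "\<eta> > 0" for x y \<eta> :: real
proof -
  have "0 \<le> (\<eta> * x - y)\<^sup>2 / \<eta>" using that by simp
  also have "\<dots> = \<eta> * x\<^sup>2 + y\<^sup>2 / \<eta> - 2 * (x * y)" using that by (simp add: power2_eq_square field_simps)
  finally show ?thesis by simp
qed

context complete_filtered_prob_space
begin

lemma expectation_le_of_nn_integral:
  fixes f :: "'a \<Rightarrow> real"
  assumes f: "f \<in> borel_measurable M" "\<And>w. 0 \<le> f w" and le: "(\<integral>\<^sup>+w. ennreal (f w) \<partial>M) \<le> ennreal C" "0 \<le> C"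
  shows "integrable M f" "expectation f \<le> C"
proof -
  show i: "integrable M f"
    by (rule integrableI_nonneg) (use f le(1) in \<open>auto intro: le_less_trans\<close>)
  then have "ennreal (expectation f) \<le> ennreal C" using le(1) f(2) by (simp add: nn_integral_eq_integral)
  then show "expectation f \<le> C" using le(2) by simp
qed

lemma first_moment_le:
  assumes "X \<in> borel_measurable M" "(\<integral>\<^sup>+w. ennreal ((X w)\<^sup>2) \<partial>M) \<le> ennreal C" "0 \<le> C"
  shows "(\<integral>\<^sup>+w. ennreal \<bar>X w\<bar> \<partial>M) \<le> ennreal (1 + C)"
proof -
  have [measurable]: "X \<in> borel_measurable M" by fact
  have "(\<integral>\<^sup>+w. ennreal \<bar>X w\<bar> \<partial>M) \<le> (\<integral>\<^sup>+w. 1 + ennreal ((X w)\<^sup>2) \<partial>M)"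
  proof (rule nn_integral_mono)
    fix w
    have "ennreal \<bar>X w\<bar> \<le> ennreal (1 + (X w)\<^sup>2)" by (rule ennreal_leI[OF abs_le_one_plus_square])
    then show "ennreal \<bar>X w\<bar> \<le> 1 + ennreal ((X w)\<^sup>2)" by simp
  qed
  also have "\<dots> = 1 + (\<integral>\<^sup>+w. ennreal ((X w)\<^sup>2) \<partial>M)" by (simp add: nn_integral_add emeasure_space_1)
  also have "\<dots> \<le> 1 + ennreal C" by (intro add_left_mono assms(2))
  finally show ?thesis using assms(3) by simp
qed

text \<open>Tonelli's theorem for means of time integrals.\<close>

lemma nn_integral_time_commute:
  assumes "jointly_measurable M a b X" "a \<le> s" "t \<le> b"
  shows "(\<integral>\<^sup>+w. (\<integral>\<^sup>+u\<in>{s..t}. ennreal (X u w) \<partial>lborel) \<partial>M) = (\<integral>\<^sup>+u\<in>{s..t}. (\<integral>\<^sup>+w. ennreal (X u w) \<partial>M) \<partial>lborel)"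
    "(\<lambda>w. \<integral>\<^sup>+u\<in>{s..t}. ennreal (X u w) \<partial>lborel) \<in> borel_measurable M"
proof -
  have m: "(\<lambda>x. ennreal (indicator {s..t} (fst x) * X (fst x) (snd x))) \<in> borel_measurable (lborel \<Otimes>\<^sub>M M)"
    by (rule jointly_measurable_nn[OF jointly_measurable_subset[OF assms]])
  have e: "(\<integral>\<^sup>+u\<in>{s..t}. ennreal (X u w) \<partial>lborel) = (\<integral>\<^sup>+u\<in>{s..t}. ennreal (indicator {s..t} u * X u w) \<partial>lborel)" for w
    by (intro nn_integral_cong) (auto simp: indicator_def)
  show "(\<lambda>w. \<integral>\<^sup>+u\<in>{s..t}. ennreal (X u w) \<partial>lborel) \<in> borel_measurable M"
    unfolding e by (rule nn_integral_interval_measurable[OF m])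
  have "(\<integral>\<^sup>+w. (\<integral>\<^sup>+u\<in>{s..t}. ennreal (X u w) \<partial>lborel) \<partial>M) = (\<integral>\<^sup>+u\<in>{s..t}. (\<integral>\<^sup>+w. ennreal (indicator {s..t} u * X u w) \<partial>M) \<partial>lborel)"
    unfolding e by (rule nn_integral_interval_commute[OF m])
  also have "\<dots> = (\<integral>\<^sup>+u\<in>{s..t}. (\<integral>\<^sup>+w. ennreal (X u w) \<partial>M) \<partial>lborel)"
    by (intro nn_integral_cong) (auto simp: indicator_def)
  finally show "(\<integral>\<^sup>+w. (\<integral>\<^sup>+u\<in>{s..t}. ennreal (X u w) \<partial>lborel) \<partial>M) = (\<integral>\<^sup>+u\<in>{s..t}. (\<integral>\<^sup>+w. ennreal (X u w) \<partial>M) \<partial>lborel)" .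
qed

lemma nn_integral_interval_le:
  fixes v :: "real \<Rightarrow> ennreal"
  assumes "\<And>u. u \<in> {s..t} \<Longrightarrow> v u \<le> ennreal K" "0 \<le> K" "s \<le> t"
  shows "(\<integral>\<^sup>+u\<in>{s..t}. v u \<partial>lborel) \<le> ennreal ((t - s) * K)"
proof -
  have "(\<integral>\<^sup>+u\<in>{s..t}. v u \<partial>lborel) \<le> (\<integral>\<^sup>+u. ennreal K * indicator {s..t} u \<partial>lborel)"
    using assms(1) by (intro nn_integral_mono) (auto simp: indicator_def)
  also have "\<dots> = ennreal K * ennreal (t - s)" using assms(3) by (simp add: nn_integral_cmult_indicator)
  also have "\<dots> = ennreal ((t - s) * K)" using assms by (simp add: ennreal_mult'' mult.commute)
  finally show ?thesis .
qed

text \<open>The Cauchy-Schwarz inequality in time.\<close>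

lemma time_integral_square_le:
  assumes X: "jointly_measurable M a b X" "a \<le> s" "s \<le> t" "t \<le> b"
  shows "(\<integral>\<^sup>+w. (\<integral>\<^sup>+u\<in>{s..t}. ennreal \<bar>X u w\<bar> \<partial>lborel)\<^sup>2 \<partial>M) \<le>
    ennreal (t - s) * (\<integral>\<^sup>+u\<in>{s..t}. (\<integral>\<^sup>+w. ennreal ((X u w)\<^sup>2) \<partial>M) \<partial>lborel)"
proof -
  have j2: "jointly_measurable M a b (\<lambda>u w. (X u w)\<^sup>2)"
    by (rule jointly_measurable_compose[OF X(1)]) measurable
  have "(\<integral>\<^sup>+w. (\<integral>\<^sup>+u\<in>{s..t}. ennreal \<bar>X u w\<bar> \<partial>lborel)\<^sup>2 \<partial>M) \<le>
    (\<integral>\<^sup>+w. ennreal (t - s) * (\<integral>\<^sup>+u\<in>{s..t}. ennreal ((X u w)\<^sup>2) \<partial>lborel) \<partial>M)"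
  proof (rule nn_integral_mono)
    fix w assume w: "w \<in> space M"
    note [measurable] = jointly_measurable_section[OF jointly_measurable_subset[OF X(1,2,4)] w]
    have "(\<integral>\<^sup>+u\<in>{s..t}. ennreal \<bar>X u w\<bar> \<partial>lborel) = (\<integral>\<^sup>+u\<in>{s..t}. ennreal \<bar>indicator {s..t} u * X u w\<bar> \<partial>lborel)"
      by (intro nn_integral_cong) (auto simp: indicator_def)
    moreover have "(\<integral>\<^sup>+u\<in>{s..t}. ennreal \<bar>indicator {s..t} u * X u w\<bar> \<partial>lborel)\<^sup>2 \<le>
        ennreal (t - s) * (\<integral>\<^sup>+u\<in>{s..t}. (ennreal \<bar>indicator {s..t} u * X u w\<bar>)\<^sup>2 \<partial>lborel)"
      using X(3) by (intro nn_integral_square_le) auto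
    moreover have "(\<integral>\<^sup>+u\<in>{s..t}. (ennreal \<bar>indicator {s..t} u * X u w\<bar>)\<^sup>2 \<partial>lborel) = (\<integral>\<^sup>+u\<in>{s..t}. ennreal ((X u w)\<^sup>2) \<partial>lborel)"
      by (intro nn_integral_cong) (auto simp: indicator_def ennreal_power)
    ultimately show "(\<integral>\<^sup>+u\<in>{s..t}. ennreal \<bar>X u w\<bar> \<partial>lborel)\<^sup>2 \<le> ennreal (t - s) * (\<integral>\<^sup>+u\<in>{s..t}. ennreal ((X u w)\<^sup>2) \<partial>lborel)"
      by simp
  qed
  also have "\<dots> = ennreal (t - s) * (\<integral>\<^sup>+w. (\<integral>\<^sup>+u\<in>{s..t}. ennreal ((X u w)\<^sup>2) \<partial>lborel) \<partial>M)"
    by (rule nn_integral_cmult[OF nn_integral_time_commute(2)[OF j2 X(2,4)]])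
  also have "\<dots> = ennreal (t - s) * (\<integral>\<^sup>+u\<in>{s..t}. (\<integral>\<^sup>+w. ennreal ((X u w)\<^sup>2) \<partial>M) \<partial>lborel)"
    unfolding nn_integral_time_commute(1)[OF j2 X(2,4)] ..
  finally show ?thesis .
qed

lemma energy_le_time_integral:
  assumes z: "jointly_measurable M a b z" "a \<le> s" "t \<le> b" "0 \<le> g"
    and H: "\<And>u. u \<in> {s..t} \<Longrightarrow> (H u w)\<^sup>2 \<le> g * \<bar>z u w\<bar>" and w: "w \<in> space M"
  shows "energy s t H w \<le> ennreal g * (\<integral>\<^sup>+u\<in>{s..t}. ennreal \<bar>z u w\<bar> \<partial>lborel)"
proof -
  note [measurable] = jointly_measurable_section[OF jointly_measurable_subset[OF z(1-3)] w]
  have "energy s t H w \<le> (\<integral>\<^sup>+u. ennreal g * ennreal \<bar>indicator {s..t} u * z u w\<bar> \<partial>lborel)"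
    unfolding energy_def
  proof (rule nn_integral_mono)
    fix u
    show "ennreal ((H u w)\<^sup>2) * indicator {s..t} u \<le> ennreal g * ennreal \<bar>indicator {s..t} u * z u w\<bar>"
    proof (cases "u \<in> {s..t}")
      case True
      then show ?thesis using ennreal_leI[OF H[OF True]] z(4) by (simp add: ennreal_mult')
    qed simp
  qed
  also have "\<dots> = ennreal g * (\<integral>\<^sup>+u. ennreal \<bar>indicator {s..t} u * z u w\<bar> \<partial>lborel)"
    by (rule nn_integral_cmult) measurable
  also have "(\<integral>\<^sup>+u. ennreal \<bar>indicator {s..t} u * z u w\<bar> \<partial>lborel) = (\<integral>\<^sup>+u\<in>{s..t}. ennreal \<bar>z u w\<bar> \<partial>lborel)"
    by (intro nn_integral_cong) (auto simp: indicator_def)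
  finally show ?thesis .
qed

text \<open>A weight known at the left end may be moved under the integral if it is bounded; a
  general weight is approximated by its truncations.\<close>

lemma ito_weighted_mean_zero:
  assumes W: "wiener_process M F W" and il: "ito_limit W H a b J"
    and fin: "(\<integral>\<^sup>+w. energy a b H w \<partial>M) < \<infinity>"
    and \<zeta>: "\<zeta> \<in> borel_measurable (F a)" and i: "integrable M (\<lambda>w. \<zeta> w * J w)"
  shows "expectation (\<lambda>w. \<zeta> w * J w) = 0"
proof -
  define c where "c n w = max (- real n) (min (real n) (\<zeta> w))" for n w
  have cF: "c n \<in> borel_measurable (F a)" for n unfolding c_def using \<zeta> by measurable
  have cb: "\<bar>c n w\<bar> \<le> real n" "\<bar>c n w\<bar> \<le> \<bar>\<zeta> w\<bar>" for n w by (auto simp: c_def)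
  note JM [measurable] = ito_limitD(5)[OF il]
  note cM [measurable] = cF[THEN measurable_F_M]
  note \<zeta>M [measurable] = \<zeta>[THEN measurable_F_M]
  have z: "expectation (\<lambda>w. c n w * J w) = 0" for n
  proof (rule ito_mean_zero[OF W ito_limit_scale[OF il cF cb(1)]])
    have "(\<integral>\<^sup>+w. energy a b (\<lambda>u w. c n w * H u w) w \<partial>M) \<le> (\<integral>\<^sup>+w. ennreal ((real n)\<^sup>2) * energy a b H w \<partial>M)"
    proof (rule nn_integral_mono)
      fix w assume w: "w \<in> space M"
      note [measurable] = jointly_measurable_section[OF ito_limitD(4)[OF il] w]
      have "energy a b (\<lambda>u w. c n w * H u w) w \<le> (\<integral>\<^sup>+u. ennreal ((real n)\<^sup>2) * ennreal ((indicator {a..b} u * H u w)\<^sup>2) \<partial>lborel)"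
        unfolding energy_eq
      proof (rule nn_integral_mono)
        fix u
        have "(c n w)\<^sup>2 \<le> (real n)\<^sup>2" using cb(1)[of n w] by (simp add: abs_le_square_iff[symmetric])
        then have "(c n w)\<^sup>2 * (indicator {a..b} u * H u w)\<^sup>2 \<le> (real n)\<^sup>2 * (indicator {a..b} u * H u w)\<^sup>2"
          by (intro mult_right_mono) auto
        moreover have "(indicator {a..b} u * (c n w * H u w))\<^sup>2 = (c n w)\<^sup>2 * (indicator {a..b} u * H u w)\<^sup>2"
          by (simp add: power_mult_distrib mult_ac)
        ultimately have "ennreal ((indicator {a..b} u * (c n w * H u w))\<^sup>2) \<le> ennreal ((real n)\<^sup>2 * (indicator {a..b} u * H u w)\<^sup>2)"
          by (intro ennreal_leI) simp
        then show "ennreal ((indicator {a..b} u * (c n w * H u w))\<^sup>2) \<le> ennreal ((real n)\<^sup>2) * ennreal ((indicator {a..b} u * H u w)\<^sup>2)"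
          by (subst ennreal_mult'[symmetric]) auto
      qed
      also have "\<dots> = ennreal ((real n)\<^sup>2) * energy a b H w"
        unfolding energy_eq by (rule nn_integral_cmult) measurable
      finally show "energy a b (\<lambda>u w. c n w * H u w) w \<le> ennreal ((real n)\<^sup>2) * energy a b H w" .
    qed
    also have "\<dots> = ennreal ((real n)\<^sup>2) * (\<integral>\<^sup>+w. energy a b H w \<partial>M)"
      by (rule nn_integral_cmult[OF energy_measurable[OF ito_limitD(4)[OF il]]])
    also have "\<dots> < \<infinity>" using fin by (simp add: ennreal_mult_less_top)
    finally show "(\<integral>\<^sup>+w. energy a b (\<lambda>u w. c n w * H u w) w \<partial>M) < \<infinity>" .
  qed
  have "(\<lambda>n. expectation (\<lambda>w. c n w * J w)) \<longlonglongrightarrow> expectation (\<lambda>w. \<zeta> w * J w)"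
  proof (rule integral_dominated_convergence[where w="\<lambda>w. norm (\<zeta> w * J w)"])
    show "integrable M (\<lambda>w. norm (\<zeta> w * J w))" using i by (rule integrable_norm)
    show "AE w in M. norm (c n w * J w) \<le> norm (\<zeta> w * J w)" for n
      using cb(2) by (intro AE_I2) (simp add: abs_mult mult_right_mono)
    show "AE w in M. (\<lambda>n. c n w * J w) \<longlonglongrightarrow> \<zeta> w * J w"
    proof (rule AE_I2)
      fix w
      obtain n0 where n0: "\<bar>\<zeta> w\<bar> \<le> real n0" using real_arch_simple by blast
      have "eventually (\<lambda>n. \<zeta> w * J w = c n w * J w) sequentially"
        using eventually_ge_at_top[of n0]
      proof eventually_elim
        case (elim n)
        then have "\<bar>\<zeta> w\<bar> \<le> real n" using n0 by linarith
        then have "c n w = \<zeta> w" unfolding c_def by linarith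
        then show ?case by simp
      qed
      then show "(\<lambda>n. c n w * J w) \<longlonglongrightarrow> \<zeta> w * J w" by (rule Lim_transform_eventually[OF tendsto_const])
    qed
  qed measurable
  then show ?thesis unfolding z by (simp add: LIMSEQ_const_iff)
qed

context
  fixes W :: "real \<Rightarrow> 'a \<Rightarrow> real" and H J V z b :: "real \<Rightarrow> 'a \<Rightarrow> real" and T g C d :: real
  assumes W: "wiener_process M F W"
    and pos: "0 < T" "0 \<le> g" "0 \<le> C" "0 \<le> d"
    and VF: "\<And>t. t \<in> {0..T} \<Longrightarrow> V t \<in> borel_measurable (F t)"
    and V2: "\<And>t. t \<in> {0..T} \<Longrightarrow> (\<integral>\<^sup>+w. ennreal ((V t w)\<^sup>2) \<partial>M) \<le> ennreal C"
    and zj: "jointly_measurable M 0 T z"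
    and z2: "\<And>t. t \<in> {0..T} \<Longrightarrow> (\<integral>\<^sup>+w. ennreal ((z t w)\<^sup>2) \<partial>M) \<le> ennreal C"
    and bj: "jointly_measurable M 0 T b"
    and b2: "\<And>t. t \<in> {0..T} \<Longrightarrow> (\<integral>\<^sup>+w. ennreal ((b t w)\<^sup>2) \<partial>M) \<le> ennreal C"
    and zV: "\<And>t. t \<in> {0..T} \<Longrightarrow> (\<integral>\<^sup>+w. ennreal \<bar>z t w - V t w\<bar> \<partial>M) \<le> ennreal d"
    and il: "\<And>t. t \<in> {0..T} \<Longrightarrow> ito_limit W H 0 t (J t)"
    and H: "AE w in M. \<forall>u\<in>{0..T}. (H u w)\<^sup>2 \<le> g * \<bar>z u w\<bar>"
    and inc: "\<And>s t. 0 \<le> s \<Longrightarrow> s \<le> t \<Longrightarrow> t \<le> T \<Longrightarrow>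
      AE w in M. ennreal \<bar>V t w - V s w - (J t w - J s w)\<bar> \<le> (\<integral>\<^sup>+u\<in>{s..t}. ennreal \<bar>b u w\<bar> \<partial>lborel)"
    and V0: "AE w in M. V 0 w = 0"
begin

lemma VM: "t \<in> {0..T} \<Longrightarrow> V t \<in> borel_measurable M"
  using VF measurable_F_M by blast

lemma zM: "t \<in> {0..T} \<Longrightarrow> z t \<in> borel_measurable M"
  by (rule jointly_measurable_at[OF zj])

lemma bM: "t \<in> {0..T} \<Longrightarrow> b t \<in> borel_measurable M"
  by (rule jointly_measurable_at[OF bj])

lemma JM: "t \<in> {0..T} \<Longrightarrow> J t \<in> borel_measurable M"
  using il ito_limitD(5) by blast

lemma b1: "t \<in> {0..T} \<Longrightarrow> (\<integral>\<^sup>+w. ennreal \<bar>b t w\<bar> \<partial>M) \<le> ennreal (1 + C)"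
  by (rule first_moment_le[OF bM b2 pos(3)])

lemma z1: "t \<in> {0..T} \<Longrightarrow> (\<integral>\<^sup>+w. ennreal \<bar>z t w\<bar> \<partial>M) \<le> ennreal (1 + C)"
  by (rule first_moment_le[OF zM z2 pos(3)])

lemma zj_abs: "jointly_measurable M 0 T (\<lambda>u w. \<bar>z u w\<bar>)"
  by (rule jointly_measurable_compose[OF zj]) measurable

lemma bj_abs: "jointly_measurable M 0 T (\<lambda>u w. \<bar>b u w\<bar>)"
  by (rule jointly_measurable_compose[OF bj]) measurable

lemma noise_increment: "0 \<le> s \<Longrightarrow> s \<le> t \<Longrightarrow> t \<le> T \<Longrightarrow> ito_limit W H s t (\<lambda>w. J t w - J s w)"
  using ito_limit_increment[OF W il il, of s t] by auto

lemma energy_bound: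
  assumes "0 \<le> s" "s \<le> t" "t \<le> T"
  shows "AE w in M. energy s t H w \<le> ennreal g * (\<integral>\<^sup>+u\<in>{s..t}. ennreal \<bar>z u w\<bar> \<partial>lborel)"
  using H AE_space
proof eventually_elim
  case (elim w)
  show ?case by (rule energy_le_time_integral[OF zj _ _ pos(2) _ elim(2)]) (use assms elim in auto)
qed

lemma energy_mean:
  assumes st: "0 \<le> s" "s \<le> t" "t \<le> T"
  shows "(\<integral>\<^sup>+w. energy s t H w \<partial>M) \<le> ennreal (g * ((t - s) * (1 + C)))"
proof -
  have "(\<integral>\<^sup>+w. energy s t H w \<partial>M) \<le> (\<integral>\<^sup>+w. ennreal g * (\<integral>\<^sup>+u\<in>{s..t}. ennreal \<bar>z u w\<bar> \<partial>lborel) \<partial>M)"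
    by (rule nn_integral_mono_AE[OF energy_bound[OF st]])
  also have "\<dots> = ennreal g * (\<integral>\<^sup>+w. (\<integral>\<^sup>+u\<in>{s..t}. ennreal \<bar>z u w\<bar> \<partial>lborel) \<partial>M)"
    by (rule nn_integral_cmult[OF nn_integral_time_commute(2)[OF zj_abs st(1,3)]])
  also have "\<dots> = ennreal g * (\<integral>\<^sup>+u\<in>{s..t}. (\<integral>\<^sup>+w. ennreal \<bar>z u w\<bar> \<partial>M) \<partial>lborel)"
    unfolding nn_integral_time_commute(1)[OF zj_abs st(1,3)] ..
  also have "\<dots> \<le> ennreal g * ennreal ((t - s) * (1 + C))"
    using st pos by (intro mult_left_mono nn_integral_interval_le z1) auto
  finally show ?thesis using pos by (simp add: ennreal_mult')
qed

lemma energy_square_mean: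
  assumes st: "0 \<le> s" "s \<le> t" "t \<le> T"
  shows "(\<integral>\<^sup>+w. (energy s t H w)\<^sup>2 \<partial>M) \<le> ennreal (g\<^sup>2 * ((t - s)\<^sup>2 * C))"
proof -
  have "(\<integral>\<^sup>+w. (energy s t H w)\<^sup>2 \<partial>M) \<le> (\<integral>\<^sup>+w. ennreal (g\<^sup>2) * (\<integral>\<^sup>+u\<in>{s..t}. ennreal \<bar>z u w\<bar> \<partial>lborel)\<^sup>2 \<partial>M)"
  proof (rule nn_integral_mono_AE)
    show "AE w in M. (energy s t H w)\<^sup>2 \<le> ennreal (g\<^sup>2) * (\<integral>\<^sup>+u\<in>{s..t}. ennreal \<bar>z u w\<bar> \<partial>lborel)\<^sup>2"
      using energy_bound[OF st]
    proof eventually_elim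
      case (elim w)
      have "(energy s t H w)\<^sup>2 \<le> (ennreal g * (\<integral>\<^sup>+u\<in>{s..t}. ennreal \<bar>z u w\<bar> \<partial>lborel))\<^sup>2"
        by (rule power_mono[OF elim]) simp
      then show ?case using pos by (simp add: power_mult_distrib ennreal_power)
    qed
  qed
  also have "\<dots> = ennreal (g\<^sup>2) * (\<integral>\<^sup>+w. (\<integral>\<^sup>+u\<in>{s..t}. ennreal \<bar>z u w\<bar> \<partial>lborel)\<^sup>2 \<partial>M)"
    by (rule nn_integral_cmult, rule measurable_compose[OF nn_integral_time_commute(2)[OF zj_abs st(1,3)], of "\<lambda>x. x\<^sup>2"]) measurable
  also have "\<dots> \<le> ennreal (g\<^sup>2) * (ennreal (t - s) * (\<integral>\<^sup>+u\<in>{s..t}. (\<integral>\<^sup>+w. ennreal ((z u w)\<^sup>2) \<partial>M) \<partial>lborel))"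
    by (intro mult_left_mono time_integral_square_le[OF zj st]) simp
  also have "\<dots> \<le> ennreal (g\<^sup>2) * (ennreal (t - s) * ennreal ((t - s) * C))"
    using st pos by (intro mult_left_mono nn_integral_interval_le z2) auto
  also have "\<dots> = ennreal (g\<^sup>2 * ((t - s)\<^sup>2 * C))"
    using st pos by (simp add: ennreal_mult'[symmetric] power2_eq_square mult.assoc)
  finally show ?thesis .
qed

lemma noise_moments:
  assumes st: "0 \<le> s" "s \<le> t" "t \<le> T"
  defines "D \<equiv> \<lambda>w. J t w - J s w"
  shows "integrable M (\<lambda>w. (D w)\<^sup>2)" "expectation (\<lambda>w. (D w)\<^sup>2) \<le> g * ((t - s) * (1 + C))"
    "integrable M (\<lambda>w. D w ^ 4)" "expectation (\<lambda>w. D w ^ 4) \<le> 42 * (g\<^sup>2 * ((t - s)\<^sup>2 * C))"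
proof -
  note il' = noise_increment[OF st]
  have DM [measurable]: "D \<in> borel_measurable M" unfolding D_def by (rule ito_limitD(5)[OF il'])
  have a: "(\<integral>\<^sup>+w. ennreal ((D w)\<^sup>2) \<partial>M) \<le> ennreal (g * ((t - s) * (1 + C)))"
    unfolding D_def by (rule order_trans[OF ito_second_moment[OF W il'] energy_mean[OF st]])
  have "(\<integral>\<^sup>+w. ennreal (D w ^ 4) \<partial>M) \<le> ennreal 42 * ennreal (g\<^sup>2 * ((t - s)\<^sup>2 * C))"
    unfolding D_def by (rule order_trans[OF ito_fourth_moment[OF W il'] mult_left_mono[OF energy_square_mean[OF st]]]) simp
  also have "\<dots> = ennreal (42 * (g\<^sup>2 * ((t - s)\<^sup>2 * C)))" by (rule ennreal_mult'[symmetric]) simp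
  finally have b: "(\<integral>\<^sup>+w. ennreal (D w ^ 4) \<partial>M) \<le> ennreal (42 * (g\<^sup>2 * ((t - s)\<^sup>2 * C)))" .
  show "integrable M (\<lambda>w. (D w)\<^sup>2)" "expectation (\<lambda>w. (D w)\<^sup>2) \<le> g * ((t - s) * (1 + C))"
    using pos st by (auto intro!: expectation_le_of_nn_integral a)
  show "integrable M (\<lambda>w. D w ^ 4)" "expectation (\<lambda>w. D w ^ 4) \<le> 42 * (g\<^sup>2 * ((t - s)\<^sup>2 * C))"
    using pos st by (auto intro!: expectation_le_of_nn_integral b)
qed

text \<open>As a real number, so that it can be added up over a mesh and subtracted.\<close>

definition drift_mean :: "real \<Rightarrow> real \<Rightarrow> real" where
  "drift_mean s t = enn2real (\<integral>\<^sup>+u\<in>{s..t}. (\<integral>\<^sup>+w. ennreal \<bar>b u w\<bar> \<partial>M) \<partial>lborel)"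

lemma drift_mean:
  assumes st: "0 \<le> s" "s \<le> t" "t \<le> T"
  shows "(\<integral>\<^sup>+u\<in>{s..t}. (\<integral>\<^sup>+w. ennreal \<bar>b u w\<bar> \<partial>M) \<partial>lborel) = ennreal (drift_mean s t)"
    "0 \<le> drift_mean s t" "drift_mean s t \<le> (t - s) * (1 + C)"
proof -
  have le: "(\<integral>\<^sup>+u\<in>{s..t}. (\<integral>\<^sup>+w. ennreal \<bar>b u w\<bar> \<partial>M) \<partial>lborel) \<le> ennreal ((t - s) * (1 + C))"
    using st pos by (intro nn_integral_interval_le b1) auto
  then have "(\<integral>\<^sup>+u\<in>{s..t}. (\<integral>\<^sup>+w. ennreal \<bar>b u w\<bar> \<partial>M) \<partial>lborel) < \<top>"
    using ennreal_less_top le_less_trans by blast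
  then show e: "(\<integral>\<^sup>+u\<in>{s..t}. (\<integral>\<^sup>+w. ennreal \<bar>b u w\<bar> \<partial>M) \<partial>lborel) = ennreal (drift_mean s t)"
    by (simp add: drift_mean_def)
  show "0 \<le> drift_mean s t" by (simp add: drift_mean_def)
  show "drift_mean s t \<le> (t - s) * (1 + C)"
    using le unfolding e using st pos by (subst (asm) ennreal_le_iff) auto
qed

lemma drift_mean_add:
  assumes "0 \<le> s" "s \<le> t" "t \<le> u" "u \<le> T"
  shows "drift_mean s u = drift_mean s t + drift_mean t u"
proof -
  have m: "(\<lambda>u. (\<integral>\<^sup>+w. ennreal (indicator {0..T} u * \<bar>b u w\<bar>) \<partial>M)) \<in> borel_measurable lborel"
    using borel_measurable_nn_integral[of "\<lambda>u w. ennreal (indicator {0..T} u * \<bar>b u w\<bar>)" lborel] jointly_measurable_nn[OF bj_abs]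
    by (simp add: split_beta')
  let ?m = "\<lambda>u. (\<integral>\<^sup>+w. ennreal (indicator {0..T} u * \<bar>b u w\<bar>) \<partial>M)"
  have e: "(\<integral>\<^sup>+u\<in>{x..y}. (\<integral>\<^sup>+w. ennreal \<bar>b u w\<bar> \<partial>M) \<partial>lborel) = (\<integral>\<^sup>+u\<in>{x..y}. ?m u \<partial>lborel)" if "0 \<le> x" "y \<le> T" for x y
    using that by (intro nn_integral_cong) (auto simp: indicator_def)
  have "(\<integral>\<^sup>+v\<in>{s..u}. ?m v \<partial>lborel) = (\<integral>\<^sup>+v. ?m v * indicator {s..t} v + ?m v * indicator {t..u} v \<partial>lborel)"
  proof (intro nn_integral_cong_AE, rule AE_mp[OF AE_lborel_singleton[of t]], rule AE_I2, intro impI)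
    fix v assume "v \<noteq> t"
    then show "?m v * indicator {s..u} v = ?m v * indicator {s..t} v + ?m v * indicator {t..u} v"
      using assms by (auto simp: indicator_def)
  qed
  also have "\<dots> = (\<integral>\<^sup>+v\<in>{s..t}. ?m v \<partial>lborel) + (\<integral>\<^sup>+v\<in>{t..u}. ?m v \<partial>lborel)"
    using m by (intro nn_integral_add) auto
  finally have "ennreal (drift_mean s u) = ennreal (drift_mean s t) + ennreal (drift_mean t u)"
    using assms by (simp add: e[symmetric] drift_mean(1))
  then have "ennreal (drift_mean s u) = ennreal (drift_mean s t + drift_mean t u)"
    using assms by (simp add: drift_mean(2))
  then show ?thesis using assms drift_mean(2) by (subst (asm) ennreal_inj) (auto intro: add_nonneg_nonneg)
qed

lemma drift_increment:
  assumes st: "0 \<le> s" "s \<le> t" "t \<le> T"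
  defines "B \<equiv> \<lambda>w. V t w - V s w - (J t w - J s w)"
  shows "B \<in> borel_measurable M" "integrable M B" "expectation (\<lambda>w. \<bar>B w\<bar>) \<le> drift_mean s t"
    "integrable M (\<lambda>w. (B w)\<^sup>2)" "expectation (\<lambda>w. (B w)\<^sup>2) \<le> (t - s)\<^sup>2 * C"
proof -
  have [measurable]: "V t \<in> borel_measurable M" "V s \<in> borel_measurable M" "J t \<in> borel_measurable M" "J s \<in> borel_measurable M"
    using st by (auto intro: VM JM)
  show BM [measurable]: "B \<in> borel_measurable M" unfolding B_def by measurable
  have B: "AE w in M. ennreal \<bar>B w\<bar> \<le> (\<integral>\<^sup>+u\<in>{s..t}. ennreal \<bar>b u w\<bar> \<partial>lborel)"
    unfolding B_def by (rule inc[OF st])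
  have "(\<integral>\<^sup>+w. ennreal \<bar>B w\<bar> \<partial>M) \<le> ennreal (drift_mean s t)"
    using nn_integral_mono_AE[OF B] unfolding nn_integral_time_commute(1)[OF bj_abs st(1,3)] drift_mean(1)[OF st] .
  from expectation_le_of_nn_integral[OF _ _ this drift_mean(2)[OF st]]
  have "integrable M (\<lambda>w. \<bar>B w\<bar>)" "expectation (\<lambda>w. \<bar>B w\<bar>) \<le> drift_mean s t" by auto
  then show "integrable M B" "expectation (\<lambda>w. \<bar>B w\<bar>) \<le> drift_mean s t"
    using integrable_abs_cancel[OF _ BM] by auto
  have "(\<integral>\<^sup>+w. ennreal ((B w)\<^sup>2) \<partial>M) \<le> (\<integral>\<^sup>+w. (\<integral>\<^sup>+u\<in>{s..t}. ennreal \<bar>b u w\<bar> \<partial>lborel)\<^sup>2 \<partial>M)"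
  proof (rule nn_integral_mono_AE)
    show "AE w in M. ennreal ((B w)\<^sup>2) \<le> (\<integral>\<^sup>+u\<in>{s..t}. ennreal \<bar>b u w\<bar> \<partial>lborel)\<^sup>2"
      using B
    proof eventually_elim
      case (elim w)
      have "(ennreal \<bar>B w\<bar>)\<^sup>2 \<le> (\<integral>\<^sup>+u\<in>{s..t}. ennreal \<bar>b u w\<bar> \<partial>lborel)\<^sup>2" by (rule power_mono[OF elim]) simp
      then show ?case by (simp add: ennreal_power)
    qed
  qed
  also have "\<dots> \<le> ennreal (t - s) * (\<integral>\<^sup>+u\<in>{s..t}. (\<integral>\<^sup>+w. ennreal ((b u w)\<^sup>2) \<partial>M) \<partial>lborel)"
    by (rule time_integral_square_le[OF bj st])
  also have "\<dots> \<le> ennreal (t - s) * ennreal ((t - s) * C)"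
    using st pos by (intro mult_left_mono nn_integral_interval_le b2) auto
  also have "\<dots> = ennreal ((t - s)\<^sup>2 * C)"
    using st pos by (simp add: ennreal_mult'[symmetric] power2_eq_square mult.assoc)
  finally have le: "(\<integral>\<^sup>+w. ennreal ((B w)\<^sup>2) \<partial>M) \<le> ennreal ((t - s)\<^sup>2 * C)" .
  show "integrable M (\<lambda>w. (B w)\<^sup>2)" "expectation (\<lambda>w. (B w)\<^sup>2) \<le> (t - s)\<^sup>2 * C"
    using pos st by (auto intro!: expectation_le_of_nn_integral le)
qed

text \<open>Collects the drift and noise contributions to the increment of \<open>V\<close> over a
  step, divided by the square root of the step length.\<close>

definition drift_const :: real where "drift_const = sqrt T * (1 + C) + (1 + g * (1 + C)) / 2"
text \<open>Bounds the third absolute moment of the noise over a step through \<open>2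
  \<bar>D\<bar>^3 \<le> sqrt h D\<^sup>2 + D^4 / sqrt h\<close>.\<close>

definition cube_const :: real where "cube_const = (g * (1 + C) + 42 * g\<^sup>2 * C) / 2"

text \<open>The quadratic variation at time \<open>u\<close> is governed by \<open>z\<close> at time
  \<open>u\<close>, but \<open>smooth_delta\<close> is evaluated at \<open>V\<close> at the
  beginning of the step; the mismatch is the distance \<open>d\<close> of \<open>z\<close> and
  \<open>V\<close> plus an increment over the step.\<close>

lemma lagged_difference:
  assumes st: "0 \<le> s" "s \<le> u" "u \<le> s + h" "u \<le> T" and h: "0 < h" "h \<le> T"
  shows "(\<integral>\<^sup>+w. ennreal \<bar>z u w - V s w\<bar> \<partial>M) \<le> ennreal (d + drift_const * sqrt h)"
proof -
  let ?D = "\<lambda>w. J u w - J s w" and ?B = "\<lambda>w. V u w - V s w - (J u w - J s w)"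
  have us: "s \<in> {0..T}" "u \<in> {0..T}" using st by auto
  note D = noise_moments[OF st(1,2,4)] and B = drift_increment[OF st(1,2,4)]
  have [measurable]: "?D \<in> borel_measurable M" using JM us by auto
  note [measurable] = zM[OF us(2)] VM[OF us(1)] VM[OF us(2)]
  have iD: "integrable M ?D" by (rule square_integrable_imp_integrable[OF _ D(1)]) measurable
  have sh: "0 < sqrt h" using h by simp
  have e: "expectation (\<lambda>w. \<bar>?B w\<bar> + \<bar>?D w\<bar>) \<le> drift_const * sqrt h"
  proof -
    have "expectation (\<lambda>w. \<bar>?D w\<bar>) \<le> expectation (\<lambda>w. (sqrt h + (?D w)\<^sup>2 / sqrt h) / 2)"
    proof (rule integral_mono)
      show "integrable M (\<lambda>w. \<bar>?D w\<bar>)" using iD by (rule integrable_abs)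
      show "integrable M (\<lambda>w. (sqrt h + (?D w)\<^sup>2 / sqrt h) / 2)" using D(1) by simp
      fix w
      have "2 * (1 * \<bar>?D w\<bar>) \<le> sqrt h * 1\<^sup>2 + \<bar>?D w\<bar>\<^sup>2 / sqrt h" by (rule two_mult_le[OF sh])
      then show "\<bar>?D w\<bar> \<le> (sqrt h + (?D w)\<^sup>2 / sqrt h) / 2" by simp
    qed
    also have "\<dots> = (sqrt h + expectation (\<lambda>w. (?D w)\<^sup>2) / sqrt h) / 2" using D(1) by (simp add: prob_space)
    also have "\<dots> \<le> (sqrt h + (g * (h * (1 + C))) / sqrt h) / 2"
    proof -
      have "g * ((u - s) * (1 + C)) \<le> g * (h * (1 + C))"
        using st pos by (intro mult_left_mono mult_right_mono) auto
      then show ?thesis using D(2) sh by (intro divide_right_mono add_left_mono) auto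
    qed
    also have "\<dots> = sqrt h * (1 + g * (1 + C)) / 2"
    proof -
      have "h / sqrt h = sqrt h" using h by (simp add: real_div_sqrt)
      then have "(g * (h * (1 + C))) / sqrt h = g * (1 + C) * sqrt h"
        by (metis (no_types, opaque_lifting) mult.assoc mult.commute times_divide_eq_right)
      then show ?thesis by (simp add: distrib_left mult_ac)
    qed
    finally have 1: "expectation (\<lambda>w. \<bar>?D w\<bar>) \<le> sqrt h * (1 + g * (1 + C)) / 2" .
    have "expectation (\<lambda>w. \<bar>?B w\<bar>) \<le> (u - s) * (1 + C)"
      using B(3) drift_mean(3)[OF st(1,2,4)] by linarith
    also have "\<dots> \<le> h * (1 + C)" using st pos by (intro mult_right_mono) auto
    also have "\<dots> = sqrt h * sqrt h * (1 + C)" using h by simp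
    also have "\<dots> \<le> sqrt T * sqrt h * (1 + C)" using h pos by (intro mult_right_mono) auto
    finally have 2: "expectation (\<lambda>w. \<bar>?B w\<bar>) \<le> sqrt T * sqrt h * (1 + C)" .
    have "expectation (\<lambda>w. \<bar>?B w\<bar> + \<bar>?D w\<bar>) = expectation (\<lambda>w. \<bar>?B w\<bar>) + expectation (\<lambda>w. \<bar>?D w\<bar>)"
      by (intro Bochner_Integration.integral_add integrable_abs iD B(2))
    moreover have "drift_const * sqrt h = sqrt T * sqrt h * (1 + C) + sqrt h * (1 + g * (1 + C)) / 2"
      unfolding drift_const_def distrib_right by simp
    ultimately show ?thesis using 1 2 by linarith
  qed
  have "(\<integral>\<^sup>+w. ennreal \<bar>z u w - V s w\<bar> \<partial>M) \<le> (\<integral>\<^sup>+w. ennreal \<bar>z u w - V u w\<bar> + ennreal (\<bar>?B w\<bar> + \<bar>?D w\<bar>) \<partial>M)"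
    by (rule nn_integral_mono) (simp add: ennreal_plus[symmetric] ennreal_leI del: ennreal_plus)
  also have "\<dots> = (\<integral>\<^sup>+w. ennreal \<bar>z u w - V u w\<bar> \<partial>M) + (\<integral>\<^sup>+w. ennreal (\<bar>?B w\<bar> + \<bar>?D w\<bar>) \<partial>M)"
    using B(1) by (intro nn_integral_add) measurable
  also have "\<dots> \<le> ennreal d + ennreal (drift_const * sqrt h)"
  proof (rule add_mono[OF zV[OF us(2)]])
    have "(\<integral>\<^sup>+w. ennreal (\<bar>?B w\<bar> + \<bar>?D w\<bar>) \<partial>M) = ennreal (expectation (\<lambda>w. \<bar>?B w\<bar> + \<bar>?D w\<bar>))"
      by (intro nn_integral_eq_integral Bochner_Integration.integrable_add integrable_abs iD B(2)) simp
    then show "(\<integral>\<^sup>+w. ennreal (\<bar>?B w\<bar> + \<bar>?D w\<bar>) \<partial>M) \<le> ennreal (drift_const * sqrt h)" using e by (simp add: ennreal_leI)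
  qed
  also have "\<dots> = ennreal (d + drift_const * sqrt h)"
    using pos h by (intro ennreal_plus[symmetric]) (auto simp: drift_const_def)
  finally show ?thesis .
qed

text \<open>The square root of \<open>smooth_delta r (V s)\<close> is bounded and known at time
  \<open>s\<close>, so it can be moved inside the Ito integral and the second moment bound applies
  to the weighted integrand. Its energy is at most \<open>g\<close> times \<open>smooth_delta r (V
  s) \<bar>z u\<bar>\<close>, in which \<open>\<bar>z u\<bar>\<close> is compared with
  \<open>\<bar>V s\<bar>\<close>.\<close>

lemma quadratic_term:
  assumes st: "0 \<le> s" "s < t" "t \<le> T" and r: "0 < r" "r < 1"
  defines "h \<equiv> t - s"
  shows "integrable M (\<lambda>w. smooth_delta r (V s w) * (J t w - J s w)\<^sup>2)"
    "expectation (\<lambda>w. smooth_delta r (V s w) * (J t w - J s w)\<^sup>2) \<le>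
      h * (g / ln (1 / r) + g * (d + drift_const * sqrt h) / (ln (1 / r) * r))"
proof -
  let ?L = "ln (1 / r)" and ?D = "\<lambda>w. J t w - J s w"
  have st': "0 \<le> s" "s \<le> t" "t \<le> T" and sT: "s \<in> {0..T}" using st by auto
  have h: "0 < h" "h \<le> T" using st by (auto simp: h_def)
  note L = ln_inverse_pos[OF r]
  note [measurable] = smooth_measurable[OF r]
  define \<zeta> where "\<zeta> w = sqrt (smooth_delta r (V s w))" for w
  note VFs [measurable] = VF[OF sT]
  have \<zeta>F: "\<zeta> \<in> borel_measurable (F s)" unfolding \<zeta>_def by measurable
  have \<zeta>2: "(\<zeta> w)\<^sup>2 = smooth_delta r (V s w)" for w
    using smooth_delta_bounds(1)[OF r] by (simp add: \<zeta>_def)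
  have \<zeta>b: "\<bar>\<zeta> w\<bar> \<le> sqrt (1 / (?L * r))" for w
    using smooth_delta_bounds[OF r, of "V s w"] by (simp add: \<zeta>_def)
  define y where "y u w = 1 / ?L + \<bar>z u w - V s w\<bar> / (?L * r)" for u w
  have yj: "jointly_measurable M 0 T y"
  proof -
    have 1: "jointly_measurable M 0 T (\<lambda>u w. z u w - V s w)"
      by (intro jointly_measurable_diff zj jointly_measurable_const VM sT)
    show ?thesis unfolding y_def
      by (rule jointly_measurable_compose[OF 1, of "\<lambda>x. 1 / ?L + \<bar>x\<bar> / (?L * r)"]) measurable
  qed
  have y0: "0 \<le> y u w" for u w using L r by (simp add: y_def)
  note ils = ito_limit_scale[OF noise_increment[OF st'] \<zeta>F \<zeta>b]
  have "(\<integral>\<^sup>+w. ennreal ((\<zeta> w * ?D w)\<^sup>2) \<partial>M) \<le> (\<integral>\<^sup>+w. energy s t (\<lambda>u w. \<zeta> w * H u w) w \<partial>M)"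
    by (rule ito_second_moment[OF W ils])
  also have "\<dots> \<le> (\<integral>\<^sup>+w. ennreal g * (\<integral>\<^sup>+u\<in>{s..t}. ennreal \<bar>y u w\<bar> \<partial>lborel) \<partial>M)"
  proof (rule nn_integral_mono_AE)
    show "AE w in M. energy s t (\<lambda>u w. \<zeta> w * H u w) w \<le> ennreal g * (\<integral>\<^sup>+u\<in>{s..t}. ennreal \<bar>y u w\<bar> \<partial>lborel)"
      using H AE_space
    proof eventually_elim
      case (elim w)
      show ?case
      proof (rule energy_le_time_integral[OF yj st'(1,3) pos(2) _ elim(2)])
        fix u assume "u \<in> {s..t}"
        then have "(H u w)\<^sup>2 \<le> g * \<bar>z u w\<bar>" using elim st by auto
        then have "(\<zeta> w * H u w)\<^sup>2 \<le> smooth_delta r (V s w) * (g * \<bar>z u w\<bar>)"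
          unfolding power_mult_distrib \<zeta>2 using smooth_delta_bounds(1)[OF r] by (intro mult_left_mono) auto
        also have "\<dots> = g * (smooth_delta r (V s w) * \<bar>z u w\<bar>)" by simp
        also have "\<dots> \<le> g * y u w"
        proof (rule mult_left_mono[OF _ pos(2)])
          have "smooth_delta r (V s w) * \<bar>z u w\<bar> \<le> smooth_delta r (V s w) * (\<bar>V s w\<bar> + \<bar>z u w - V s w\<bar>)"
            using smooth_delta_bounds(1)[OF r] by (intro mult_left_mono) auto
          also have "\<dots> = smooth_delta r (V s w) * \<bar>V s w\<bar> + smooth_delta r (V s w) * \<bar>z u w - V s w\<bar>" by (rule distrib_left)
          also have "\<dots> \<le> 1 / ?L + 1 / (?L * r) * \<bar>z u w - V s w\<bar>"
            using smooth_delta_bounds[OF r] by (intro add_mono mult_right_mono) auto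
          finally show "smooth_delta r (V s w) * \<bar>z u w\<bar> \<le> y u w" by (simp add: y_def)
        qed
        finally show "(\<zeta> w * H u w)\<^sup>2 \<le> g * \<bar>y u w\<bar>" using y0 by simp
      qed
    qed
  qed
  also have "\<dots> = ennreal g * (\<integral>\<^sup>+u\<in>{s..t}. (\<integral>\<^sup>+w. ennreal (y u w) \<partial>M) \<partial>lborel)"
    using nn_integral_cmult[OF nn_integral_time_commute(2)[OF yj st'(1,3)]] nn_integral_time_commute(1)[OF yj st'(1,3)] y0
    by simp
  also have "\<dots> \<le> ennreal g * ennreal ((t - s) * (1 / ?L + (d + drift_const * sqrt h) / (?L * r)))"
  proof (intro mult_left_mono nn_integral_interval_le)
    fix u assume u: "u \<in> {s..t}"
    have uT: "u \<in> {0..T}" using u st by auto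
    note [measurable] = zM[OF uT] VM[OF sT]
    have "(\<integral>\<^sup>+w. ennreal (y u w) \<partial>M) = (\<integral>\<^sup>+w. ennreal (1 / ?L) + ennreal (1 / (?L * r)) * ennreal \<bar>z u w - V s w\<bar> \<partial>M)"
      using L r by (intro nn_integral_cong) (simp add: y_def ennreal_mult'[symmetric])
    also have "\<dots> = ennreal (1 / ?L) + ennreal (1 / (?L * r)) * (\<integral>\<^sup>+w. ennreal \<bar>z u w - V s w\<bar> \<partial>M)"
      by (simp add: nn_integral_add nn_integral_cmult emeasure_space_1)
    also have "\<dots> \<le> ennreal (1 / ?L) + ennreal (1 / (?L * r)) * ennreal (d + drift_const * sqrt h)"
      using u st h by (intro add_left_mono mult_left_mono lagged_difference) (auto simp: h_def)
    also have "\<dots> = ennreal (1 / ?L + (d + drift_const * sqrt h) / (?L * r))"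
    proof -
      have "ennreal (1 / (?L * r)) * ennreal (d + drift_const * sqrt h) = ennreal ((d + drift_const * sqrt h) / (?L * r))"
        using L r by (subst ennreal_mult'[symmetric]) auto
      moreover have "0 \<le> (d + drift_const * sqrt h) / (?L * r)" using L r pos h by (simp add: drift_const_def)
      ultimately show ?thesis using L by (simp add: ennreal_plus)
    qed
    finally show "(\<integral>\<^sup>+w. ennreal (y u w) \<partial>M) \<le> ennreal (1 / ?L + (d + drift_const * sqrt h) / (?L * r))" .
  qed (use L r pos h st in \<open>auto simp: drift_const_def\<close>)
  also have "\<dots> = ennreal (h * (g / ?L + g * (d + drift_const * sqrt h) / (?L * r)))"
    unfolding ennreal_mult'[OF pos(2), symmetric] by (simp add: h_def algebra_simps)
  finally have le: "(\<integral>\<^sup>+w. ennreal (smooth_delta r (V s w) * (?D w)\<^sup>2) \<partial>M) \<le>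
    ennreal (h * (g / ?L + g * (d + drift_const * sqrt h) / (?L * r)))"
    by (simp add: power_mult_distrib \<zeta>2)
  note [measurable] = ito_limitD(5)[OF noise_increment[OF st']] VM[OF sT]
  have m: "(\<lambda>w. smooth_delta r (V s w) * (?D w)\<^sup>2) \<in> borel_measurable M" by measurable
  have n: "0 \<le> smooth_delta r (V s w) * (?D w)\<^sup>2" for w using smooth_delta_bounds(1)[OF r] by simp
  have p: "0 \<le> h * (g / ?L + g * (d + drift_const * sqrt h) / (?L * r))" using h L r pos by (simp add: drift_const_def)
  show "integrable M (\<lambda>w. smooth_delta r (V s w) * (?D w)\<^sup>2)"
    by (rule expectation_le_of_nn_integral[OF m n le p])
  show "expectation (\<lambda>w. smooth_delta r (V s w) * (?D w)\<^sup>2) \<le> h * (g / ?L + g * (d + drift_const * sqrt h) / (?L * r))"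
    by (rule expectation_le_of_nn_integral[OF m n le p])
qed

lemma V_integrable:
  assumes "t \<in> {0..T}"
  shows "integrable M (\<lambda>w. (V t w)\<^sup>2)" "expectation (\<lambda>w. (V t w)\<^sup>2) \<le> C" "integrable M (V t)"
proof -
  note [measurable] = VM[OF assms]
  show i: "integrable M (\<lambda>w. (V t w)\<^sup>2)" and "expectation (\<lambda>w. (V t w)\<^sup>2) \<le> C"
    using V2[OF assms] pos(3) by (auto intro!: expectation_le_of_nn_integral)
  show "integrable M (V t)" by (rule square_integrable_imp_integrable[OF _ i]) measurable
qed

lemma smooth_abs_integrable:
  assumes "t \<in> {0..T}" and r: "0 < r" "r < 1"
  shows "integrable M (\<lambda>w. smooth_abs r (V t w))"
proof (rule Bochner_Integration.integrable_bound)
  note [measurable] = VM[OF assms(1)] smooth_measurable[OF r]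
  show "integrable M (\<lambda>w. 1 / ln (1 / r) + \<bar>V t w\<bar> + 2 * (V t w)\<^sup>2 / ln (1 / r))"
    using V_integrable[OF assms(1)] by (intro Bochner_Integration.integrable_add integrable_divide integrable_mult_right integrable_abs) auto
  show "AE w in M. norm (smooth_abs r (V t w)) \<le> norm (1 / ln (1 / r) + \<bar>V t w\<bar> + 2 * (V t w)\<^sup>2 / ln (1 / r))"
    by (rule AE_I2, simp only: real_norm_def) (rule order_trans[OF abs_smooth_abs_le[OF r] abs_ge_self])
  show "(\<lambda>w. smooth_abs r (V t w)) \<in> borel_measurable M" by measurable
qed

text \<open>One step of the mesh. The drift part of the increment is removed by convexity; its
  coefficient \<open>smooth_sgn r\<close> is at most one up to \<open>O(1 / ln (1/r))\<close>. The
  noise part is expanded to second order: the linear term has mean zero, the quadratic one is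
  \<open>quadratic_term\<close>, and the cubic remainder is \<open>O(h^(3/2))\<close> by the fourth
  moment.\<close>

lemma smooth_abs_step:
  assumes st: "0 \<le> s" "s < t" "t \<le> T" and r: "0 < r" "r < 1"
  defines "h \<equiv> t - s" and "L \<equiv> ln (1 / r)"
  shows "expectation (\<lambda>w. smooth_abs r (V t w)) \<le> expectation (\<lambda>w. smooth_abs r (V s w)) + drift_mean s t +
    h * ((2 * C + g / 2) / L + g * d / (2 * (L * r)) + sqrt h * (g * drift_const / (2 * (L * r)) + cube_const / (2 * L * r\<^sup>2)))"
proof -
  let ?D = "\<lambda>w. J t w - J s w" and ?B = "\<lambda>w. V t w - V s w - (J t w - J s w)"
  have st': "0 \<le> s" "s \<le> t" "t \<le> T" and sT: "s \<in> {0..T}" and tT: "t \<in> {0..T}" using st by auto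
  have h: "0 < h" "h \<le> T" using st by (auto simp: h_def)
  have L: "0 < L" unfolding L_def by (rule ln_inverse_pos[OF r])
  have sh: "0 < sqrt h" using h by simp
  note D = noise_moments[OF st'] and B = drift_increment[OF st'] and q = quadratic_term[OF st r]
  note [measurable] = smooth_measurable[OF r] VM[OF sT] VM[OF tT]
  have DM [measurable]: "?D \<in> borel_measurable M" by (rule ito_limitD(5)[OF noise_increment[OF st']])
  have BM [measurable]: "?B \<in> borel_measurable M" by (rule B(1))
  note iV = V_integrable[OF tT] and iVs = V_integrable[OF sT]
  have iprod: "integrable M (\<lambda>w. \<bar>X w * Y w\<bar>)" if "integrable M (\<lambda>w. (X w)\<^sup>2)" "integrable M (\<lambda>w. (Y w)\<^sup>2)"
    and [measurable]: "X \<in> borel_measurable M" "Y \<in> borel_measurable M" for X Y :: "'a \<Rightarrow> real"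
  proof (rule Bochner_Integration.integrable_bound)
    show "integrable M (\<lambda>w. (X w)\<^sup>2 + (Y w)\<^sup>2)" using that by simp
    show "AE w in M. norm \<bar>X w * Y w\<bar> \<le> norm ((X w)\<^sup>2 + (Y w)\<^sup>2)"
    proof (rule AE_I2)
      fix w
      have "2 * (\<bar>X w\<bar> * \<bar>Y w\<bar>) \<le> (X w)\<^sup>2 + (Y w)\<^sup>2" using two_mult_le[of 1 "\<bar>X w\<bar>" "\<bar>Y w\<bar>"] by simp
      moreover have "0 \<le> \<bar>X w\<bar> * \<bar>Y w\<bar>" by simp
      ultimately have "\<bar>X w\<bar> * \<bar>Y w\<bar> \<le> (X w)\<^sup>2 + (Y w)\<^sup>2" by linarith
      then show "norm \<bar>X w * Y w\<bar> \<le> norm ((X w)\<^sup>2 + (Y w)\<^sup>2)" by (simp add: abs_mult)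
    qed
  qed measurable
  have sgn2: "integrable M (\<lambda>w. (smooth_sgn r (V s w))\<^sup>2)"
  proof (rule Bochner_Integration.integrable_bound)
    show "integrable M (\<lambda>w. 2 + 8 / L\<^sup>2 * (V s w)\<^sup>2)" using iVs(1) by simp
    show "AE w in M. norm ((smooth_sgn r (V s w))\<^sup>2) \<le> norm (2 + 8 / L\<^sup>2 * (V s w)\<^sup>2)"
    proof (rule AE_I2)
      fix w
      have "\<bar>smooth_sgn r (V s w)\<bar>\<^sup>2 \<le> (1 + 2 * \<bar>V s w\<bar> / L)\<^sup>2"
        unfolding L_def by (intro power_mono abs_smooth_sgn_le[OF r]) simp
      also have "\<dots> \<le> 2 * 1\<^sup>2 + 2 * (2 * \<bar>V s w\<bar> / L)\<^sup>2"
        using zero_le_power2[of "1 - 2 * \<bar>V s w\<bar> / L"] unfolding power2_sum power2_diff by linarith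
      also have "\<dots> = 2 + 8 / L\<^sup>2 * (V s w)\<^sup>2" by (simp add: power_mult_distrib power_divide)
      finally show "norm ((smooth_sgn r (V s w))\<^sup>2) \<le> norm (2 + 8 / L\<^sup>2 * (V s w)\<^sup>2)" by simp
    qed
  qed measurable
  have i1: "integrable M (\<lambda>w. smooth_sgn r (V s w) * ?D w)"
    by (rule integrable_abs_cancel[OF iprod[OF sgn2 D(1)]]) measurable
  have e1: "expectation (\<lambda>w. smooth_sgn r (V s w) * ?D w) = 0"
  proof (rule ito_weighted_mean_zero[OF W noise_increment[OF st'] _ _ i1])
    show "(\<integral>\<^sup>+w. energy s t H w \<partial>M) < \<infinity>" using energy_mean[OF st'] by (simp add: le_less_trans)
    show "(\<lambda>w. smooth_sgn r (V s w)) \<in> borel_measurable (F s)" using VF[OF sT] by measurable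
  qed
  have cube: "\<bar>x\<bar> ^ 3 \<le> (sqrt h * x\<^sup>2 + x ^ 4 / sqrt h) / 2" for x :: real
  proof -
    have "2 * (\<bar>x\<bar> * x\<^sup>2) \<le> sqrt h * \<bar>x\<bar>\<^sup>2 + (x\<^sup>2)\<^sup>2 / sqrt h" by (rule two_mult_le[OF sh])
    moreover have "\<bar>x\<bar> ^ 3 = \<bar>x\<bar> * x\<^sup>2" by (simp add: power3_eq_cube power2_eq_square mult.assoc)
    moreover have "(x\<^sup>2)\<^sup>2 = x ^ 4" by simp
    ultimately show ?thesis by simp
  qed
  have ic: "integrable M (\<lambda>w. (sqrt h * (?D w)\<^sup>2 + ?D w ^ 4 / sqrt h) / 2)" using D(1,3) by simp
  have i3: "integrable M (\<lambda>w. \<bar>?D w\<bar> ^ 3)"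
    by (rule Bochner_Integration.integrable_bound[OF ic]) (use cube in \<open>auto intro!: AE_I2 intro: order_trans[OF _ abs_ge_self]\<close>)
  have e3: "expectation (\<lambda>w. \<bar>?D w\<bar> ^ 3) \<le> h * sqrt h * cube_const"
  proof -
    have "expectation (\<lambda>w. \<bar>?D w\<bar> ^ 3) \<le> expectation (\<lambda>w. (sqrt h * (?D w)\<^sup>2 + ?D w ^ 4 / sqrt h) / 2)"
      by (rule integral_mono[OF i3 ic cube])
    also have "\<dots> = (sqrt h * expectation (\<lambda>w. (?D w)\<^sup>2) + expectation (\<lambda>w. ?D w ^ 4) / sqrt h) / 2"
      using D(1,3) by simp
    also have "\<dots> \<le> (sqrt h * (g * (h * (1 + C))) + 42 * (g\<^sup>2 * (h\<^sup>2 * C)) / sqrt h) / 2"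
      using D(2,4) sh unfolding h_def by (intro divide_right_mono add_mono mult_left_mono) auto
    also have "42 * (g\<^sup>2 * (h\<^sup>2 * C)) / sqrt h = h * sqrt h * (42 * g\<^sup>2 * C)"
    proof -
      have "h\<^sup>2 / sqrt h = h * (h / sqrt h)" by (simp add: power2_eq_square)
      also have "\<dots> = h * sqrt h" using h by (simp add: real_div_sqrt)
      finally have "h\<^sup>2 / sqrt h = h * sqrt h" .
      moreover have "42 * (g\<^sup>2 * (h\<^sup>2 * C)) / sqrt h = (h\<^sup>2 / sqrt h) * (42 * g\<^sup>2 * C)" by simp
      ultimately show ?thesis by simp
    qed
    finally show ?thesis by (simp add: cube_const_def algebra_simps)
  qed
  have ib: "integrable M (\<lambda>w. \<bar>V t w * ?B w\<bar>)" by (rule iprod[OF iV(1) B(4)]) measurable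
  have eb: "expectation (\<lambda>w. \<bar>V t w * ?B w\<bar>) \<le> h * C"
  proof -
    have "expectation (\<lambda>w. \<bar>V t w * ?B w\<bar>) \<le> expectation (\<lambda>w. (h * (V t w)\<^sup>2 + (?B w)\<^sup>2 / h) / 2)"
    proof (rule integral_mono[OF ib])
      show "integrable M (\<lambda>w. (h * (V t w)\<^sup>2 + (?B w)\<^sup>2 / h) / 2)" using iV(1) B(4) by simp
      fix w
      show "\<bar>V t w * ?B w\<bar> \<le> (h * (V t w)\<^sup>2 + (?B w)\<^sup>2 / h) / 2"
        using two_mult_le[OF h(1), of "\<bar>V t w\<bar>" "\<bar>?B w\<bar>"] by (simp add: abs_mult)
    qed
    also have "\<dots> = (h * expectation (\<lambda>w. (V t w)\<^sup>2) + expectation (\<lambda>w. (?B w)\<^sup>2) / h) / 2"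
      using iV(1) B(4) by simp
    also have "\<dots> \<le> (h * C + (h\<^sup>2 * C) / h) / 2"
      using iV(2) B(5) h unfolding h_def by (intro divide_right_mono add_mono mult_left_mono) auto
    also have "\<dots> = h * C" using h by (simp add: power2_eq_square)
    finally show ?thesis .
  qed
  have pt: "smooth_abs r (V t w) \<le> smooth_abs r (V s w) + smooth_sgn r (V s w) * ?D w + smooth_delta r (V s w) * (?D w)\<^sup>2 / 2
      + \<bar>?D w\<bar> ^ 3 / (2 * L * r\<^sup>2) + \<bar>?B w\<bar> + 2 / L * \<bar>V t w * ?B w\<bar>" for w
  proof -
    have "smooth_abs r (V t w) \<le> smooth_abs r (V t w - ?B w) + smooth_sgn r (V t w) * ?B w"
      by (rule smooth_abs_convex[OF r])
    moreover have "V t w - ?B w = V s w + ?D w" by simp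
    moreover have "smooth_abs r (V s w + ?D w) \<le> smooth_abs r (V s w) + smooth_sgn r (V s w) * ?D w + smooth_delta r (V s w) / 2 * (?D w)\<^sup>2 + \<bar>?D w\<bar> ^ 3 / (2 * L * r\<^sup>2)"
      unfolding L_def by (rule smooth_abs_expansion[OF r])
    moreover have "smooth_sgn r (V t w) * ?B w \<le> \<bar>?B w\<bar> + 2 / L * \<bar>V t w * ?B w\<bar>"
    proof -
      have "smooth_sgn r (V t w) * ?B w \<le> \<bar>smooth_sgn r (V t w)\<bar> * \<bar>?B w\<bar>" by (simp add: abs_mult[symmetric])
      also have "\<dots> \<le> (1 + 2 * \<bar>V t w\<bar> / L) * \<bar>?B w\<bar>"
        unfolding L_def by (intro mult_right_mono abs_smooth_sgn_le[OF r]) simp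
      also have "\<dots> = \<bar>?B w\<bar> + 2 / L * \<bar>V t w * ?B w\<bar>" by (simp add: abs_mult distrib_right)
      finally show ?thesis .
    qed
    ultimately show ?thesis by simp
  qed
  note iphi = smooth_abs_integrable[OF sT r]
  have iB: "integrable M (\<lambda>w. \<bar>?B w\<bar>)" by (rule integrable_abs[OF B(2)])
  have iq: "integrable M (\<lambda>w. smooth_delta r (V s w) * (?D w)\<^sup>2 / 2)" by (rule integrable_divide) (rule q(1))
  have ic3: "integrable M (\<lambda>w. \<bar>?D w\<bar> ^ 3 / (2 * L * r\<^sup>2))" by (rule integrable_divide) (rule i3)
  have ibb: "integrable M (\<lambda>w. 2 / L * \<bar>V t w * ?B w\<bar>)" by (rule integrable_mult_right) (rule ib)
  note j1 = Bochner_Integration.integrable_add[OF iphi i1]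
  note j2 = Bochner_Integration.integrable_add[OF j1 iq]
  note j3 = Bochner_Integration.integrable_add[OF j2 ic3]
  note j4 = Bochner_Integration.integrable_add[OF j3 iB]
  note j5 = Bochner_Integration.integrable_add[OF j4 ibb]
  have "expectation (\<lambda>w. smooth_abs r (V t w)) \<le> expectation (\<lambda>w. smooth_abs r (V s w) + smooth_sgn r (V s w) * ?D w + smooth_delta r (V s w) * (?D w)\<^sup>2 / 2
      + \<bar>?D w\<bar> ^ 3 / (2 * L * r\<^sup>2) + \<bar>?B w\<bar> + 2 / L * \<bar>V t w * ?B w\<bar>)"
    by (rule integral_mono[OF smooth_abs_integrable[OF tT r] j5 pt])
  also have "\<dots> = expectation (\<lambda>w. smooth_abs r (V s w)) + 0 + expectation (\<lambda>w. smooth_delta r (V s w) * (?D w)\<^sup>2) / 2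
      + expectation (\<lambda>w. \<bar>?D w\<bar> ^ 3) / (2 * L * r\<^sup>2) + expectation (\<lambda>w. \<bar>?B w\<bar>) + 2 / L * expectation (\<lambda>w. \<bar>V t w * ?B w\<bar>)"
    unfolding Bochner_Integration.integral_add[OF j4 ibb] Bochner_Integration.integral_add[OF j3 iB]
      Bochner_Integration.integral_add[OF j2 ic3] Bochner_Integration.integral_add[OF j1 iq] Bochner_Integration.integral_add[OF iphi i1] e1
    by simp
  also have "\<dots> \<le> expectation (\<lambda>w. smooth_abs r (V s w)) + 0 + h * (g / L + g * (d + drift_const * sqrt h) / (L * r)) / 2
      + h * sqrt h * cube_const / (2 * L * r\<^sup>2) + drift_mean s t + 2 / L * (h * C)"
    using q(2) e3 B(3) eb L r unfolding h_def[symmetric] L_def[symmetric]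
    by (intro add_mono divide_right_mono mult_left_mono order_refl) auto
  also have "\<dots> = expectation (\<lambda>w. smooth_abs r (V s w)) + drift_mean s t +
    h * ((2 * C + g / 2) / L + g * d / (2 * (L * r)) + sqrt h * (g * drift_const / (2 * (L * r)) + cube_const / (2 * L * r\<^sup>2)))"
    by (simp add: add_divide_distrib distrib_left distrib_right mult_ac)
  finally show ?thesis .
qed

text \<open>Summation of \<open>smooth_abs_step\<close> over a uniform mesh; the terms of order
  \<open>sqrt h\<close> disappear as the mesh is refined while \<open>r\<close> stays fixed.\<close>

lemma yamada_estimate:
  assumes t: "t \<in> {0..T}" and r: "0 < r" "r < 1"
  shows "(\<integral>\<^sup>+w. ennreal \<bar>V t w\<bar> \<partial>M) \<le> (\<integral>\<^sup>+u\<in>{0..t}. (\<integral>\<^sup>+w. ennreal \<bar>b u w\<bar> \<partial>M) \<partial>lborel) +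
    ennreal ((1 + T * (2 * C + g / 2)) / ln (1 / r) + T * g * d / (2 * (ln (1 / r) * r)))"
proof (cases "t = 0")
  case True
  have "(\<integral>\<^sup>+w. ennreal \<bar>V t w\<bar> \<partial>M) = (\<integral>\<^sup>+w. 0 \<partial>M)"
    unfolding True by (rule nn_integral_cong_AE) (use V0 in \<open>auto elim: eventually_mono\<close>)
  then show ?thesis by simp
next
  case False
  then have t0: "0 < t" "t \<le> T" using t by auto
  define L where "L = ln (1 / r)"
  have L: "0 < L" unfolding L_def by (rule ln_inverse_pos[OF r])
  define a where "a = (2 * C + g / 2) / L + g * d / (2 * (L * r))"
  define c where "c = g * drift_const / (2 * (L * r)) + cube_const / (2 * L * r\<^sup>2)"
  have phi0: "expectation (\<lambda>w. smooth_abs r (V 0 w)) = 0"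
  proof -
    have "expectation (\<lambda>w. smooth_abs r (V 0 w)) = expectation (\<lambda>w. 0)"
      using VM[of 0] smooth_measurable(1)[OF r] pos V0
      by (intro integral_cong_AE) (auto elim: eventually_mono simp: smooth_abs_0[OF r])
    then show ?thesis by simp
  qed
  \<comment> \<open>The step bound is summed over \<open>Suc N\<close> equal steps.\<close>
  have mesh: "expectation (\<lambda>w. smooth_abs r (V t w)) \<le> drift_mean 0 t + t * (a + sqrt (t / real (Suc N)) * c)" for N
  proof -
    define h where "h = t / real (Suc N)"
    have h: "0 < h" "real (Suc N) * h = t" using t0 by (auto simp: h_def)
    have "expectation (\<lambda>w. smooth_abs r (V (real k * h) w)) \<le> drift_mean 0 (real k * h) + real k * h * (a + sqrt h * c)"
      if "k \<le> Suc N" for k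
      using that
    proof (induction k)
      case 0
      then show ?case using phi0 drift_mean(2)[of 0 0] pos by simp
    next
      case (Suc k)
      have "real (Suc k) * h \<le> real (Suc N) * h" using Suc.prems h by (intro mult_right_mono) auto
      then have kT: "real (Suc k) * h \<le> T" unfolding h(2) using t0(2) by linarith
      have k: "0 \<le> real k * h" "real k * h < real (Suc k) * h" using h by auto
      have hh: "real (Suc k) * h - real k * h = h" by (simp add: algebra_simps)
      have "expectation (\<lambda>w. smooth_abs r (V (real (Suc k) * h) w)) \<le> expectation (\<lambda>w. smooth_abs r (V (real k * h) w)) +
        drift_mean (real k * h) (real (Suc k) * h) + h * (a + sqrt h * c)"
        using smooth_abs_step[OF k kT r] unfolding hh a_def c_def L_def .
      also have "\<dots> \<le> drift_mean 0 (real k * h) + real k * h * (a + sqrt h * c) + drift_mean (real k * h) (real (Suc k) * h) + h * (a + sqrt h * c)"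
        using Suc by simp
      also have "\<dots> = drift_mean 0 (real (Suc k) * h) + real (Suc k) * h * (a + sqrt h * c)"
        using drift_mean_add[of 0 "real k * h" "real (Suc k) * h"] k kT by (simp add: algebra_simps)
      finally show ?case .
    qed
    from this[of "Suc N"] show ?thesis unfolding h(2) by (simp add: h_def)
  qed
  have "(\<lambda>N. drift_mean 0 t + t * (a + sqrt (t / real (Suc N)) * c)) \<longlonglongrightarrow> drift_mean 0 t + t * (a + sqrt 0 * c)"
  proof (intro tendsto_add tendsto_mult tendsto_const tendsto_real_sqrt)
    have "(\<lambda>N. t * inverse (real (Suc N))) \<longlonglongrightarrow> t * 0"
      by (intro tendsto_mult tendsto_const LIMSEQ_inverse_real_of_nat)
    then show "(\<lambda>N. t / real (Suc N)) \<longlonglongrightarrow> 0" by (simp add: divide_inverse)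
  qed
  then have lim: "expectation (\<lambda>w. smooth_abs r (V t w)) \<le> drift_mean 0 t + t * (a + sqrt 0 * c)"
    by (rule LIMSEQ_le_const) (use mesh in blast)
  have a0: "0 \<le> a" using L r pos by (simp add: a_def)
  have "expectation (\<lambda>w. \<bar>V t w\<bar>) \<le> expectation (\<lambda>w. smooth_abs r (V t w) + 1 / L)"
    unfolding L_def
    by (intro integral_mono integrable_abs V_integrable t Bochner_Integration.integrable_add smooth_abs_integrable r abs_le_smooth_abs[OF r]) simp
  also have "\<dots> = expectation (\<lambda>w. smooth_abs r (V t w)) + 1 / L"
    using smooth_abs_integrable[OF t r] by (simp add: prob_space)
  also have "\<dots> \<le> drift_mean 0 t + T * a + 1 / L"
    using lim mult_right_mono[OF t0(2) a0] by simp
  also have "\<dots> = drift_mean 0 t + ((1 + T * (2 * C + g / 2)) / L + T * g * d / (2 * (L * r)))"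
    by (simp add: a_def add_divide_distrib distrib_left)
  finally have e: "expectation (\<lambda>w. \<bar>V t w\<bar>) \<le> drift_mean 0 t + ((1 + T * (2 * C + g / 2)) / L + T * g * d / (2 * (L * r)))" .
  have "(\<integral>\<^sup>+w. ennreal \<bar>V t w\<bar> \<partial>M) = ennreal (expectation (\<lambda>w. \<bar>V t w\<bar>))"
    by (intro nn_integral_eq_integral integrable_abs V_integrable t) simp
  also have "\<dots> \<le> ennreal (drift_mean 0 t + ((1 + T * (2 * C + g / 2)) / L + T * g * d / (2 * (L * r))))"
    by (rule ennreal_leI[OF e])
  also have "\<dots> = ennreal (drift_mean 0 t) + ennreal ((1 + T * (2 * C + g / 2)) / L + T * g * d / (2 * (L * r)))"
    using L r pos t0 by (intro ennreal_plus drift_mean(2)) auto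
  also have "ennreal (drift_mean 0 t) = (\<integral>\<^sup>+u\<in>{0..t}. (\<integral>\<^sup>+w. ennreal \<bar>b u w\<bar> \<partial>M) \<partial>lborel)"
    using t0 by (intro drift_mean(1)[symmetric]) auto
  finally show ?thesis by (simp add: L_def)
qed

end
end

section \<open>Solutions as integral equations with jumps on a grid\<close>

lemma set_integral_split:
  fixes f :: "real \<Rightarrow> real"
  assumes "set_integrable lborel {a..b} f" "a \<le> c" "c \<le> b"
  shows "(LINT u:{a..b}|lborel. f u) = (LINT u:{a..c}|lborel. f u) + (LINT u:{c..b}|lborel. f u)"
proof -
  have i: "set_integrable lborel {a..c} f" "set_integrable lborel {c..b} f"
    using assms by (auto intro: set_integrable_subset)
  have "f integrable_on {a..b}" by (rule set_borel_integral_eq_integral(1)[OF assms(1)])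
  then have "integral {a..b} f = integral {a..c} f + integral {c..b} f"
    using assms by (intro Henstock_Kurzweil_Integration.integral_combine[symmetric])
  then show ?thesis using assms(1) i by (simp add: set_borel_integral_eq_integral(2))
qed

lemma set_integrable_concat:
  fixes f :: "real \<Rightarrow> real"
  assumes "set_integrable lborel {a..c} f" "set_integrable lborel {c..b} f" "a \<le> c" "c \<le> b"
  shows "set_integrable lborel {a..b} f"
proof -
  have "{a..b} = {a..c} \<union> {c..b}" using assms by auto
  then show ?thesis using set_integrable_Un[OF assms(1,2)] by simp
qed

lemma abs_set_integral_le:
  fixes f :: "real \<Rightarrow> real"
  assumes "set_integrable lborel A f"
  shows "ennreal \<bar>LINT u:A|lborel. f u\<bar> \<le> (\<integral>\<^sup>+u\<in>A. ennreal \<bar>f u\<bar> \<partial>lborel)"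
proof -
  have "ennreal (norm (LINT u:A|lborel. f u)) \<le> (\<integral>\<^sup>+u. ennreal (norm (indicator A u *\<^sub>R f u)) \<partial>lborel)"
    unfolding set_lebesgue_integral_def by (rule integral_norm_bound_ennreal) (use assms in \<open>simp add: set_integrable_def\<close>)
  also have "\<dots> = (\<integral>\<^sup>+u\<in>A. ennreal \<bar>f u\<bar> \<partial>lborel)"
    by (intro nn_integral_cong) (auto simp: indicator_def)
  finally show ?thesis by simp
qed

lemma set_integral_measurable:
  assumes "jointly_measurable N a b X"
  shows "(\<lambda>w. LINT u:{a..b}|lborel. X u w) \<in> borel_measurable N"
proof -
  have "(\<lambda>x. indicator {a..b} (fst x) * X (fst x) (snd x)) \<in> borel_measurable (lborel \<Otimes>\<^sub>M N)"
    using assms by (simp add: jointly_measurable_def split_beta')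
  from measurable_compose[OF measurable_pair_swap' this]
  have "(\<lambda>(w, u). indicator {a..b} u * X u w) \<in> borel_measurable (N \<Otimes>\<^sub>M lborel)"
    by (simp add: split_beta')
  then have "(\<lambda>w. \<integral>u. indicator {a..b} u * X u w \<partial>lborel) \<in> borel_measurable N"
    by (rule lborel.borel_measurable_lebesgue_integral)
  then show ?thesis by (simp add: set_lebesgue_integral_def)
qed

text \<open>The inequality is strict because a correction at a grid point acts immediately to the
  right of it, not at the point itself.\<close>

definition grid_before :: "nat \<Rightarrow> real \<Rightarrow> real \<Rightarrow> nat set" where
  "grid_before n T t = {i. i < n \<and> real i * (T / real n) < t}"

lemma finite_grid_before [simp]: "finite (grid_before n T t)"
  by (rule finite_subset[of _ "{..<n}"]) (auto simp: grid_before_def)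

lemma grid_before_0: "0 < T \<Longrightarrow> grid_before n T 0 = {}"
  by (auto simp: grid_before_def not_less)

lemma grid_before_step:
  assumes "0 < T" "j < n" "real j * (T / real n) < t" "t \<le> real (Suc j) * (T / real n)"
  shows "grid_before n T t = insert j (grid_before n T (real j * (T / real n)))" "j \<notin> grid_before n T (real j * (T / real n))"
proof -
  have D: "0 < T / real n" using assms by simp
  have "real i * (T / real n) < t \<longleftrightarrow> i \<le> j" for i
  proof
    assume "i \<le> j"
    then have "real i * (T / real n) \<le> real j * (T / real n)" using D by (intro mult_right_mono) auto
    then show "real i * (T / real n) < t" using assms by linarith
  next
    assume "real i * (T / real n) < t"
    then have "real i * (T / real n) < real (Suc j) * (T / real n)" using assms by linarith
    then have "real i < real (Suc j)" using D by (rule mult_right_less_imp_less[OF _ less_imp_le])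
    then show "i \<le> j" by simp
  qed
  moreover have "real i * (T / real n) < real j * (T / real n) \<longleftrightarrow> i < j" for i
    using D by (metis mult_less_cancel_right_pos of_nat_less_iff)
  ultimately show "grid_before n T t = insert j (grid_before n T (real j * (T / real n)))"
     "j \<notin> grid_before n T (real j * (T / real n))"
    using assms(2) by (auto simp: grid_before_def)
qed

lemma grid_cell:
  assumes "0 < T" "0 < t" "t \<le> T" "0 < (n::nat)"
  obtains j where "j < n" "real j * (T / real n) < t" "t \<le> real (Suc j) * (T / real n)"
proof -
  have D: "0 < T / real n" "real n * (T / real n) = T" using assms by simp_all
  define k where "k = (LEAST k. t \<le> real k * (T / real n))"
  have ex: "t \<le> real n * (T / real n)" using assms D by simp
  have k1: "t \<le> real k * (T / real n)" unfolding k_def by (rule LeastI[of _ n]) (rule ex)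
  have k2: "k \<le> n" unfolding k_def by (rule Least_le) (rule ex)
  have "k \<noteq> 0" using k1 assms by (auto intro: ccontr)
  then obtain j where j: "k = Suc j" by (cases k) auto
  have "\<not> t \<le> real j * (T / real n)" using not_less_Least[of j "\<lambda>k. t \<le> real k * (T / real n)"] j k_def by simp
  then show ?thesis using that[of j] j k1 k2 by simp
qed

context complete_filtered_prob_space
begin

text \<open>Completeness: null sets belong to the initial \<sigma>-algebra.\<close>

lemma AE_const_measurable:
  assumes "AE w in M. X w = (c::real)"
  shows "X \<in> borel_measurable (F 0)"
proof (rule measurableI)
  fix A :: "real set" assume A: "A \<in> sets borel"
  obtain N where N: "N \<in> null_sets M" "{w \<in> space M. X w \<noteq> c} \<subseteq> N"
    using assms by (auto elim!: AE_E simp: null_sets_def)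
  have null: "B \<in> sets (F 0)" if "B \<subseteq> N" for B
  proof -
    have "B \<in> null_sets M" using complete2[OF that N(1)] .
    then show ?thesis using null_sets_F0 by blast
  qed
  show "X -` A \<inter> space (F 0) \<in> sets (F 0)"
  proof (cases "c \<in> A")
    case True
    have "space M - X -` A \<subseteq> N" using N(2) True by auto
    then have "space (F 0) - (space M - X -` A) \<in> sets (F 0)" by (intro sets.compl_sets null)
    moreover have "space (F 0) - (space M - X -` A) = X -` A \<inter> space (F 0)" by (auto simp: space_F)
    ultimately show ?thesis by simp
  next
    case False
    then have "X -` A \<inter> space (F 0) \<subseteq> N" using N(2) by (auto simp: space_F)
    then show ?thesis by (rule null)
  qed
qed simp

text \<open>The definition asserts measurability jointly in time only for the integrand
  \<open>\<sigma> sqrt z\<close>; it passes to \<open>z\<close> because the square root, extended to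
  negative arguments as an odd function, is injective. Integrability of \<open>z\<close> follows
  from the finite energy of \<open>\<sigma> sqrt z\<close>, which is \<open>\<sigma>\<^sup>2\<close>
  times the time integral of \<open>z\<close>.\<close>

lemma sqrt_diffusion_facts:
  assumes W: "wiener_process M F W" and sd: "sqrt_diffusion M F W \<sigma> a b z0 drift z" and ab: "0 \<le> a" "a < b" "0 < \<sigma>"
  shows "\<And>t. t \<in> {a<..b} \<Longrightarrow> z t \<in> borel_measurable (F t)"
    and "AE w in M. \<forall>t\<in>{a<..b}. 0 \<le> z t w"
    and "AE w in M. set_integrable lborel {a..b} (\<lambda>s. drift s w)"
    and "\<And>t. t \<in> {a<..b} \<Longrightarrow> jointly_measurable (F t) a t z"
    and "\<And>t. t \<in> {a<..b} \<Longrightarrow> \<exists>J. ito_limit W (\<lambda>s w. \<sigma> * sqrt (z s w)) a t J \<and>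
          (AE w in M. z t w = z0 w + (LINT s:{a..t}|lborel. drift s w) + J w)"
    and "AE w in M. set_integrable lborel {a..b} (\<lambda>s. z s w)"
proof -
  note sd' = sd[unfolded sqrt_diffusion_def]
  show "\<And>t. t \<in> {a<..b} \<Longrightarrow> z t \<in> borel_measurable (F t)" "AE w in M. \<forall>t\<in>{a<..b}. 0 \<le> z t w"
    "AE w in M. set_integrable lborel {a..b} (\<lambda>s. drift s w)"
    using sd' by blast+
  show ex: "\<exists>J. ito_limit W (\<lambda>s w. \<sigma> * sqrt (z s w)) a t J \<and>
          (AE w in M. z t w = z0 w + (LINT s:{a..t}|lborel. drift s w) + J w)" if "t \<in> {a<..b}" for t
  proof -
    obtain J where "has_ito_integral M F W (\<lambda>s w. \<sigma> * sqrt (z s w)) a t J"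
      "AE w in M. z t w = z0 w + (LINT s:{a..t}|lborel. drift s w) + J w"
      using sd' \<open>t \<in> {a<..b}\<close> by blast
    then show ?thesis using has_ito_integral_ito_limit[OF W _ ab(1)] by blast
  qed
  have inv: "v * \<bar>v\<bar> = z s w" if "v = \<sigma> * sqrt (z s w) / \<sigma>" for v s w
    using that ab(3) by (cases "0 \<le> z s w") (auto simp: abs_of_nonneg abs_of_nonpos real_sqrt_le_0_iff)
  show jm: "jointly_measurable (F t) a t z" if t: "t \<in> {a<..b}" for t
  proof -
    obtain J where J: "ito_limit W (\<lambda>s w. \<sigma> * sqrt (z s w)) a t J" using ex[OF t] by blast
    have "jointly_measurable (F t) a t (\<lambda>s w. (\<sigma> * sqrt (z s w) / \<sigma>) * \<bar>\<sigma> * sqrt (z s w) / \<sigma>\<bar>)"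
      by (rule jointly_measurable_compose[OF ito_limitD(3)[OF J], of "\<lambda>v. v / \<sigma> * \<bar>v / \<sigma>\<bar>"]) measurable
    then show ?thesis by (rule jointly_measurable_cong) (rule inv[OF refl])
  qed
  have bI: "b \<in> {a<..b}" using ab by simp
  obtain J where J: "ito_limit W (\<lambda>s w. \<sigma> * sqrt (z s w)) a b J" using ex[OF bI] by blast
  show "AE w in M. set_integrable lborel {a..b} (\<lambda>s. z s w)"
    using ito_limitD(6)[OF J] AE_space
  proof eventually_elim
    case (elim w)
    have m: "(\<lambda>u. indicator {a..b} u * z u w) \<in> borel_measurable lborel"
      using jointly_measurable_section[OF jointly_measurable_F_M[OF jm[OF bI]] elim(2)] .
    have m': "(\<lambda>u. ennreal (norm (indicator {a..b} u * z u w))) \<in> borel_measurable lborel"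
      by (rule measurable_compose[OF m, of "\<lambda>x. ennreal (norm x)"]) measurable
    have "ennreal (\<sigma>\<^sup>2) * (\<integral>\<^sup>+u. ennreal (norm (indicator {a..b} u * z u w)) \<partial>lborel) =
      (\<integral>\<^sup>+u. ennreal (\<sigma>\<^sup>2) * ennreal (norm (indicator {a..b} u * z u w)) \<partial>lborel)"
      by (rule nn_integral_cmult[OF m', symmetric])
    also have "\<dots> = energy a b (\<lambda>s w. \<sigma> * sqrt (z s w)) w"
      unfolding energy_def
    proof (rule nn_integral_cong)
      fix u
      have "(\<sigma> * sqrt (z u w))\<^sup>2 = \<sigma>\<^sup>2 * \<bar>z u w\<bar>"
        by (simp add: power_mult_distrib power2_eq_square[of "sqrt (z u w)"])
      then show "ennreal (\<sigma>\<^sup>2) * ennreal (norm (indicator {a..b} u * z u w)) = ennreal ((\<sigma> * sqrt (z u w))\<^sup>2) * indicator {a..b} u"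
        by (auto simp: indicator_def ennreal_mult')
    qed
    finally have "ennreal (\<sigma>\<^sup>2) * (\<integral>\<^sup>+u. ennreal (norm (indicator {a..b} u * z u w)) \<partial>lborel) < \<infinity>" using elim(1) by simp
    then have "(\<integral>\<^sup>+u. ennreal (norm (indicator {a..b} u * z u w)) \<partial>lborel) < \<infinity>"
      using ab(3) by (auto simp: ennreal_mult_less_top)
    then show ?case unfolding set_integrable_def using m by (intro integrableI_bounded) auto
  qed
qed

text \<open>One equation on \<open>[0,T]\<close> for both the exact and the approximate components.
  The jump \<open>c i\<close> is added immediately after the grid point \<open>i T / n\<close>; for
  the exact model there is a single cell and the jump is zero. The noise integrals \<open>J
  t\<close> all start at zero.\<close>

definition cir_component :: "(real \<Rightarrow> 'a \<Rightarrow> real) \<Rightarrow> real \<Rightarrow> nat \<Rightarrow> real \<Rightarrow> real \<Rightarrow> (nat \<Rightarrow> 'a \<Rightarrow> real) \<Rightarrow>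
    (real \<Rightarrow> 'a \<Rightarrow> real) \<Rightarrow> (real \<Rightarrow> 'a \<Rightarrow> real) \<Rightarrow> (real \<Rightarrow> 'a \<Rightarrow> real) \<Rightarrow> bool" where
  "cir_component W \<sigma> n T y0 c drift y J \<longleftrightarrow>
    (\<forall>t\<in>{0..T}. y t \<in> borel_measurable (F t) \<and> jointly_measurable (F t) 0 t y \<and>
       ito_limit W (\<lambda>u w. \<sigma> * sqrt (y u w)) 0 t (J t) \<and>
       (AE w in M. y t w = y0 + (\<Sum>i\<in>grid_before n T t. c i w) + (LINT u:{0..t}|lborel. drift u w) + J t w)) \<and>
    (AE w in M. \<forall>t\<in>{0..T}. 0 \<le> y t w) \<and>
    (AE w in M. set_integrable lborel {0..T} (\<lambda>u. y u w)) \<and>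
    (AE w in M. set_integrable lborel {0..T} (\<lambda>u. drift u w))"

text \<open>The diffusions on the cells are chained from left to right: each starts at the value
  reached at the end of the previous cell plus the jump, and the Ito integrals are
  concatenated.\<close>

lemma cir_component_exists:
  assumes W: "wiener_process M F W" and T: "0 < T" and n: "0 < n" and \<sigma>: "0 < \<sigma>"
    and sd: "\<And>j. j < n \<Longrightarrow> sqrt_diffusion M F W \<sigma> (real j * (T / real n)) (real (Suc j) * (T / real n)) (z0 j) drift y"
    and z0: "\<And>j. j < n \<Longrightarrow> AE w in M. z0 j w = y (real j * (T / real n)) w + c j w"
    and y0: "AE w in M. y 0 w = y0" "0 \<le> y0"
  shows "\<exists>J. cir_component W \<sigma> n T y0 c drift y J"
proof -
  define D where "D = T / real n"
  have D: "0 < D" "real n * D = T" using T n by (auto simp: D_def)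
  have cell: "0 \<le> real j * D" "real j * D < real (Suc j) * D" for j using D by auto
  note f = sqrt_diffusion_facts[OF W sd[folded D_def] cell \<sigma>]
  note z0D = z0[folded D_def]
  have jm0: "jointly_measurable (F 0) 0 0 y"
    by (rule jointly_measurable_cong[OF jointly_measurable_const[OF AE_const_measurable[OF y0(1)]]]) simp
  define I where "I = grid_before n T"
  have step: "I t = insert j (I (real j * D))" "j \<notin> I (real j * D)" if "j < n" "real j * D < t" "t \<le> real (Suc j) * D" for j t
    using grid_before_step[OF T that(1)] that(2,3) unfolding I_def D_def by auto
  \<comment> \<open>Induction over the cells that are already covered.\<close>
  have ind: "j \<le> n \<Longrightarrow>
    (AE w in M. (\<forall>t\<in>{0..real j * D}. 0 \<le> y t w) \<and> set_integrable lborel {0..real j * D} (\<lambda>u. y u w) \<and>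
        set_integrable lborel {0..real j * D} (\<lambda>u. drift u w)) \<and>
    (\<forall>t\<in>{0..real j * D}. \<exists>J. y t \<in> borel_measurable (F t) \<and> jointly_measurable (F t) 0 t y \<and>
       ito_limit W (\<lambda>u w. \<sigma> * sqrt (y u w)) 0 t J \<and>
       (AE w in M. y t w = y0 + (\<Sum>i\<in>I t. c i w) + (LINT u:{0..t}|lborel. drift u w) + J w))" for j
  proof (induction j)
    case 0
    have null: "set_integrable lborel {0..0::real} g" "(LINT u:{0..0::real}|lborel. g u) = 0" for g :: "real \<Rightarrow> real"
    proof -
      have "AE u in lborel. indicator {0..0::real} u *\<^sub>R g u = 0"
        using AE_lborel_singleton[of "0::real"] by eventually_elim (simp add: indicator_def)
      moreover have "(\<lambda>u. indicator {0..0::real} u *\<^sub>R g u) = (\<lambda>u. indicator {0} u *\<^sub>R g 0)"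
        by (auto simp: indicator_def fun_eq_iff)
      moreover have "integrable lborel (\<lambda>u. indicator {0::real} u *\<^sub>R g 0)" by simp
      ultimately show "set_integrable lborel {0..0::real} g" "(LINT u:{0..0::real}|lborel. g u) = 0"
        by (simp_all add: set_integrable_def set_lebesgue_integral_def)
    qed
    have "AE w in M. 0 \<le> y 0 w" using y0(1) by eventually_elim (use y0(2) in simp)
    moreover have "\<exists>J. ito_limit W (\<lambda>u w. \<sigma> * sqrt (y u w)) 0 0 J \<and>
       (AE w in M. y 0 w = y0 + (\<Sum>i\<in>I 0. c i w) + (LINT u:{0..0}|lborel. drift u w) + J w)"
    proof (intro exI conjI)
      have "jointly_measurable (F 0) 0 0 (\<lambda>u w. \<sigma> * sqrt (y u w))"
        by (rule jointly_measurable_compose[OF jm0, of "\<lambda>v. \<sigma> * sqrt v"]) measurable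
      then show "ito_limit W (\<lambda>u w. \<sigma> * sqrt (y u w)) 0 0 (\<lambda>_. 0)" by (intro ito_limit_empty) auto
      show "AE w in M. y 0 w = y0 + (\<Sum>i\<in>I 0. c i w) + (LINT u:{0..0}|lborel. drift u w) + 0"
        using y0(1) unfolding null I_def grid_before_0[OF T] by simp
    qed
    ultimately show ?case using null(1) jm0 AE_const_measurable[OF y0(1)] by simp
  next
    case (Suc j)
    then have j: "j < n" by simp
    let ?a = "real j * D" and ?b = "real (Suc j) * D"
    note IH = Suc.IH[OF less_imp_le[OF j]]
    have ab: "0 \<le> ?a" "?a < ?b" using D by auto
    have "AE w in M. (\<forall>t\<in>{0..?b}. 0 \<le> y t w) \<and> set_integrable lborel {0..?b} (\<lambda>u. y u w) \<and>
        set_integrable lborel {0..?b} (\<lambda>u. drift u w)"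
      using IH[THEN conjunct1] f(2)[OF j] f(3)[OF j] f(6)[OF j]
    proof eventually_elim
      case (elim w)
      note e1 = elim(1)[THEN conjunct1] and e2 = elim(1)[THEN conjunct2, THEN conjunct1] and e3 = elim(1)[THEN conjunct2, THEN conjunct2]
      have "0 \<le> y t w" if "t \<in> {0..?b}" for t
      proof (cases "t \<le> ?a")
        case True
        then have "t \<in> {0..?a}" using that by simp
        then show ?thesis by (rule bspec[OF e1])
      next
        case False
        then have "t \<in> {?a<..?b}" using that by simp
        then show ?thesis by (rule bspec[OF elim(2)])
      qed
      then show ?case
        by (intro conjI ballI set_integrable_concat[OF e2 elim(4) ab(1) less_imp_le[OF ab(2)]]
          set_integrable_concat[OF e3 elim(3) ab(1) less_imp_le[OF ab(2)]])
    qed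
    note AEb = this
    have main: "\<forall>t\<in>{0..?b}. \<exists>J. y t \<in> borel_measurable (F t) \<and> jointly_measurable (F t) 0 t y \<and>
       ito_limit W (\<lambda>u w. \<sigma> * sqrt (y u w)) 0 t J \<and>
       (AE w in M. y t w = y0 + (\<Sum>i\<in>I t. c i w) + (LINT u:{0..t}|lborel. drift u w) + J w)"
    proof
      fix t assume t: "t \<in> {0..?b}"
      show "\<exists>J. y t \<in> borel_measurable (F t) \<and> jointly_measurable (F t) 0 t y \<and>
       ito_limit W (\<lambda>u w. \<sigma> * sqrt (y u w)) 0 t J \<and>
       (AE w in M. y t w = y0 + (\<Sum>i\<in>I t. c i w) + (LINT u:{0..t}|lborel. drift u w) + J w)"
    proof (cases "t \<le> ?a")
      case True
      then have "t \<in> {0..?a}" using t by simp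
      then show ?thesis by (rule bspec[OF IH[THEN conjunct2]])
    next
      case False
      then have t': "?a < t" "t \<le> ?b" "t \<in> {?a<..?b}" using t by auto
      have "?a \<in> {0..?a}" using ab by simp
      then obtain J1 where J1: "jointly_measurable (F ?a) 0 ?a y" "ito_limit W (\<lambda>u w. \<sigma> * sqrt (y u w)) 0 ?a J1"
         "AE w in M. y ?a w = y0 + (\<Sum>i\<in>I ?a. c i w) + (LINT u:{0..?a}|lborel. drift u w) + J1 w"
        using bspec[OF IH[THEN conjunct2] \<open>?a \<in> {0..?a}\<close>] by blast
      obtain J2 where J2: "ito_limit W (\<lambda>u w. \<sigma> * sqrt (y u w)) ?a t J2"
         "AE w in M. y t w = z0 j w + (LINT u:{?a..t}|lborel. drift u w) + J2 w"
        using f(5)[OF j t'(3)] by blast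
      have "AE w in M. y t w = y0 + (\<Sum>i\<in>I t. c i w) + (LINT u:{0..t}|lborel. drift u w) + (J1 w + J2 w)"
        using J1(3) J2(2) z0D[OF j] AEb
      proof eventually_elim
        case (elim w)
        have "set_integrable lborel {0..t} (\<lambda>u. drift u w)"
          using elim(4) t by (auto intro: set_integrable_subset)
        then have "(LINT u:{0..t}|lborel. drift u w) = (LINT u:{0..?a}|lborel. drift u w) + (LINT u:{?a..t}|lborel. drift u w)"
          using ab t' by (intro set_integral_split) auto
        moreover have "(\<Sum>i\<in>I t. c i w) = c j w + (\<Sum>i\<in>I ?a. c i w)"
          unfolding step(1)[OF j t'(1,2)] using step(2)[OF j t'(1,2)] by (subst sum.insert) (auto simp: I_def)
        ultimately show ?case using elim by simp
      qed
      moreover have "jointly_measurable (F t) 0 t y"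
        by (rule jointly_measurable_concat[OF jointly_measurable_F_mono[OF J1(1)] f(4)[OF j t'(3)]]) (use ab t' in auto)
      ultimately show ?thesis
        by (intro exI[of _ "\<lambda>w. J1 w + J2 w"] conjI f(1)[OF j t'(3)] ito_limit_concat[OF J1(2) J2(1)])
    qed
    qed
    show ?case by (rule conjI[OF AEb main])
  qed
  note ind' = ind[OF order_refl, unfolded D(2)]
  from ind'[THEN conjunct2] have "\<forall>t. \<exists>J. t \<in> {0..T} \<longrightarrow> (y t \<in> borel_measurable (F t) \<and> jointly_measurable (F t) 0 t y \<and>
       ito_limit W (\<lambda>u w. \<sigma> * sqrt (y u w)) 0 t J \<and>
       (AE w in M. y t w = y0 + (\<Sum>i\<in>I t. c i w) + (LINT u:{0..t}|lborel. drift u w) + J w))" by blast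
  from choice[OF this] obtain J where "\<forall>t\<in>{0..T}. y t \<in> borel_measurable (F t) \<and> jointly_measurable (F t) 0 t y \<and>
       ito_limit W (\<lambda>u w. \<sigma> * sqrt (y u w)) 0 t (J t) \<and>
       (AE w in M. y t w = y0 + (\<Sum>i\<in>I t. c i w) + (LINT u:{0..t}|lborel. drift u w) + J t w)" by blast
  then have "cir_component W \<sigma> n T y0 c drift y J"
    unfolding cir_component_def I_def using ind'[THEN conjunct1] by auto
  then show ?thesis by blast
qed

lemma cir_componentD:
  assumes "cir_component W \<sigma> n T y0 c drift y J" and T: "0 < T"
  shows "\<And>t. t \<in> {0..T} \<Longrightarrow> y t \<in> borel_measurable (F t)" "\<And>t. t \<in> {0..T} \<Longrightarrow> y t \<in> borel_measurable M"
    "\<And>t. t \<in> {0..T} \<Longrightarrow> jointly_measurable (F t) 0 t y" "jointly_measurable M 0 T y"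
    "\<And>t. t \<in> {0..T} \<Longrightarrow> ito_limit W (\<lambda>u w. \<sigma> * sqrt (y u w)) 0 t (J t)"
    "\<And>t. t \<in> {0..T} \<Longrightarrow> AE w in M. y t w = y0 + (\<Sum>i\<in>grid_before n T t. c i w) + (LINT u:{0..t}|lborel. drift u w) + J t w"
    "AE w in M. \<forall>t\<in>{0..T}. 0 \<le> y t w" "AE w in M. set_integrable lborel {0..T} (\<lambda>u. y u w)"
    "AE w in M. set_integrable lborel {0..T} (\<lambda>u. drift u w)"
proof -
  note c = assms(1)[unfolded cir_component_def]
  show "\<And>t. t \<in> {0..T} \<Longrightarrow> y t \<in> borel_measurable (F t)" "\<And>t. t \<in> {0..T} \<Longrightarrow> jointly_measurable (F t) 0 t y"
    "\<And>t. t \<in> {0..T} \<Longrightarrow> ito_limit W (\<lambda>u w. \<sigma> * sqrt (y u w)) 0 t (J t)"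
    "\<And>t. t \<in> {0..T} \<Longrightarrow> AE w in M. y t w = y0 + (\<Sum>i\<in>grid_before n T t. c i w) + (LINT u:{0..t}|lborel. drift u w) + J t w"
    "AE w in M. \<forall>t\<in>{0..T}. 0 \<le> y t w" "AE w in M. set_integrable lborel {0..T} (\<lambda>u. y u w)"
    "AE w in M. set_integrable lborel {0..T} (\<lambda>u. drift u w)"
    using c by blast+
  then show "\<And>t. t \<in> {0..T} \<Longrightarrow> y t \<in> borel_measurable M" "jointly_measurable M 0 T y"
    using T by (auto intro: measurable_F_M jointly_measurable_F_M[of T])
qed

text \<open>The sum of the two nonnegative components dominates every drift and jump term and the
  squares of both noise coefficients, so it satisfies the hypotheses of
  \<open>second_moment_bound\<close>.\<close>

lemma pair_second_moment:
  assumes W: "wiener_process M F W1" "wiener_process M F W2"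
    and c1: "cir_component W1 \<sigma>1 n T y10 c1 drift1 y1 J1" and c2: "cir_component W2 \<sigma>2 n T y20 c2 drift2 y2 J2"
    and T: "0 < T" and n: "0 < n" and \<sigma>: "0 < \<sigma>1" and y0: "0 \<le> y10" "0 \<le> y20" and q: "0 \<le> q" "0 \<le> \<kappa>"
    and jump: "AE w in M. \<forall>i<n. \<bar>c1 i w\<bar> \<le> T / real n * (q + \<kappa> * (y1 (real i * (T / real n)) w + y2 (real i * (T / real n)) w))
      \<and> \<bar>c2 i w\<bar> \<le> T / real n * (q + \<kappa> * (y1 (real i * (T / real n)) w + y2 (real i * (T / real n)) w))"
    and drift: "AE w in M. \<forall>u\<in>{0..T}. \<bar>drift1 u w\<bar> \<le> q + \<kappa> * (y1 u w + y2 u w) \<and> \<bar>drift2 u w\<bar> \<le> q + \<kappa> * (y1 u w + y2 u w)"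
    and t: "t \<in> {0..T}"
  shows "(\<integral>\<^sup>+w. ennreal ((y1 t w + y2 t w)\<^sup>2) \<partial>M) \<le> ennreal (moment_bound (y10 + y20 + 4 * q * T) (2 * \<kappa>) (\<sigma>1\<^sup>2 + \<sigma>2\<^sup>2) T)"
proof -
  define D where "D = T / real n"
  have D: "0 < D" "real n * D = T" using T n by (auto simp: D_def)
  note d1 = cir_componentD[OF c1 T] and d2 = cir_componentD[OF c2 T]
  define S where "S u w = y1 u w + y2 u w" for u w
  have "(\<integral>\<^sup>+w. ennreal ((S t w)\<^sup>2) \<partial>M) \<le> ennreal (moment_bound (y10 + y20 + 4 * q * T) (2 * \<kappa>) (\<sigma>1\<^sup>2 + \<sigma>2\<^sup>2) T)"
  proof (rule second_moment_bound[OF W T n, where ?H1.0="\<lambda>u w. \<sigma>1 * sqrt (y1 u w)" and ?H2.0="\<lambda>u w. \<sigma>2 * sqrt (y2 u w)" and ?J1.0=J1 and ?J2.0=J2])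
    show "0 \<le> y10 + y20 + 4 * q * T" "0 \<le> 2 * \<kappa>" "0 < \<sigma>1\<^sup>2 + \<sigma>2\<^sup>2"
      using y0 q T \<sigma> by (auto intro: add_pos_nonneg)
    show "jointly_measurable M 0 T S" unfolding S_def by (rule jointly_measurable_add[OF d1(4) d2(4)])
    show "S t \<in> borel_measurable M" if "t \<in> {0..T}" for t
      using d1(2)[OF that] d2(2)[OF that] unfolding S_def by measurable
    show "AE w in M. \<forall>t\<in>{0..T}. 0 \<le> S t w"
      using d1(7) d2(7) by eventually_elim (auto simp: S_def)
    show "AE w in M. (\<integral>\<^sup>+u\<in>{0..T}. ennreal (S u w) \<partial>lborel) < \<infinity>"
      using d1(8) d2(8)
    proof eventually_elim
      case (elim w)
      have "set_integrable lborel {0..T} (\<lambda>u. S u w)" unfolding S_def by (rule set_integral_add[OF elim])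
      then have "(\<integral>\<^sup>+u. ennreal (norm (indicator {0..T} u *\<^sub>R S u w)) \<partial>lborel) < \<infinity>"
        by (simp add: set_integrable_def integrable_iff_bounded)
      moreover have "(\<integral>\<^sup>+u\<in>{0..T}. ennreal (S u w) \<partial>lborel) \<le> (\<integral>\<^sup>+u. ennreal (norm (indicator {0..T} u *\<^sub>R S u w)) \<partial>lborel)"
        by (intro nn_integral_mono) (auto simp: indicator_def intro!: ennreal_leI)
      ultimately show ?case by (rule le_less_trans[rotated])
    qed
    show "ito_limit W1 (\<lambda>u w. \<sigma>1 * sqrt (y1 u w)) 0 t (J1 t)" "ito_limit W2 (\<lambda>u w. \<sigma>2 * sqrt (y2 u w)) 0 t (J2 t)"
      if "t \<in> {0..T}" for t using d1(5)[OF that] d2(5)[OF that] .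
    show "AE w in M. \<forall>u\<in>{0..T}. (\<sigma>1 * sqrt (y1 u w))\<^sup>2 \<le> (\<sigma>1\<^sup>2 + \<sigma>2\<^sup>2) * S u w \<and> (\<sigma>2 * sqrt (y2 u w))\<^sup>2 \<le> (\<sigma>1\<^sup>2 + \<sigma>2\<^sup>2) * S u w"
      using d1(7) d2(7)
    proof eventually_elim
      case (elim w)
      have "(\<sigma>1 * sqrt (y1 u w))\<^sup>2 \<le> (\<sigma>1\<^sup>2 + \<sigma>2\<^sup>2) * S u w" "(\<sigma>2 * sqrt (y2 u w))\<^sup>2 \<le> (\<sigma>1\<^sup>2 + \<sigma>2\<^sup>2) * S u w" if "u \<in> {0..T}" for u
      proof -
        have p: "0 \<le> y1 u w" "0 \<le> y2 u w" using elim that by auto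
        have "(\<sigma>1 * sqrt (y1 u w))\<^sup>2 = \<sigma>1\<^sup>2 * y1 u w" "(\<sigma>2 * sqrt (y2 u w))\<^sup>2 = \<sigma>2\<^sup>2 * y2 u w"
          using p by (simp_all add: power_mult_distrib)
        moreover have "\<sigma>1\<^sup>2 * y1 u w \<le> (\<sigma>1\<^sup>2 + \<sigma>2\<^sup>2) * S u w" "\<sigma>2\<^sup>2 * y2 u w \<le> (\<sigma>1\<^sup>2 + \<sigma>2\<^sup>2) * S u w"
          using p unfolding S_def by (auto intro!: mult_mono)
        ultimately show "(\<sigma>1 * sqrt (y1 u w))\<^sup>2 \<le> (\<sigma>1\<^sup>2 + \<sigma>2\<^sup>2) * S u w" "(\<sigma>2 * sqrt (y2 u w))\<^sup>2 \<le> (\<sigma>1\<^sup>2 + \<sigma>2\<^sup>2) * S u w" by simp_all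
      qed
      then show ?case by blast
    qed
    show "t \<in> {0..T}" by (rule t)
    fix t assume t: "t \<in> {0..T}"
    let ?I = "grid_before n T t"
    show "AE w in M. ennreal (S t w) \<le> ennreal (y10 + y20 + 4 * q * T) + (ennreal (2 * \<kappa>) *
      ((\<Sum>i | i < n \<and> real i * (T / real n) < t. ennreal (T / real n) * ennreal (S (real i * (T / real n)) w))
        + (\<integral>\<^sup>+u\<in>{0..t}. ennreal (S u w) \<partial>lborel)) + (ennreal \<bar>J1 t w\<bar> + ennreal \<bar>J2 t w\<bar>))"
      using d1(6)[OF t] d2(6)[OF t] d1(7) d2(7) d1(8) d2(8) d1(9) d2(9) jump drift
    proof eventually_elim
      case (elim w)
      have S0: "0 \<le> S u w" if "u \<in> {0..T}" for u using elim(3,4) that by (auto simp: S_def)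
      have sub: "{0..t} \<subseteq> {0..T}" using t by auto
      have iS: "set_integrable lborel {0..t} (\<lambda>u. S u w)"
        unfolding S_def using set_integral_add(1)[OF elim(5,6)] sub by (auto intro: set_integrable_subset)
      have id: "set_integrable lborel {0..t} (\<lambda>u. drift1 u w)" "set_integrable lborel {0..t} (\<lambda>u. drift2 u w)"
        using elim(7,8) sub by (auto intro: set_integrable_subset)
      have cst: "set_integrable lborel {0..t} (\<lambda>u. a)" for a :: real
        unfolding set_integrable_def by (intro integrable_scaleR_left integrable_real_indicator) (auto simp: emeasure_lborel_Icc_eq)
      have ic: "set_integrable lborel {0..t} (\<lambda>u. 2 * (q + \<kappa> * S u w))"
        using iS cst by (intro set_integrable_mult_right set_integral_add(1)) auto
      define X where "X = (\<Sum>i\<in>?I. D * S (real i * D) w)"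
      define Y where "Y = (LINT u:{0..t}|lborel. S u w)"
      have gridT: "real i * D \<in> {0..T}" if "i \<in> ?I" for i using that t D by (auto simp: grid_before_def D_def)
      have X0: "0 \<le> X" unfolding X_def using S0 gridT D by (intro sum_nonneg mult_nonneg_nonneg) auto
      have Y0: "0 \<le> Y" unfolding Y_def set_lebesgue_integral_def
        using S0 sub by (intro Bochner_Integration.integral_nonneg) (auto simp: indicator_def)
      have cardI: "real (card ?I) * D \<le> T"
      proof -
        have "card ?I \<le> n" using card_mono[of "{..<n}" ?I] by (auto simp: grid_before_def)
        then have "real (card ?I) * D \<le> real n * D" using D by (intro mult_right_mono) auto
        then show ?thesis using D by simp
      qed
      have "(\<Sum>i\<in>?I. c1 i w) + (\<Sum>i\<in>?I. c2 i w) = (\<Sum>i\<in>?I. c1 i w + c2 i w)" by (simp add: sum.distrib)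
      also have "\<dots> \<le> (\<Sum>i\<in>?I. 2 * q * D + 2 * \<kappa> * (D * S (real i * D) w))"
      proof (rule sum_mono)
        fix i assume "i \<in> ?I"
        then have i: "i < n" by (simp add: grid_before_def)
        have c: "\<bar>c1 i w\<bar> \<le> D * (q + \<kappa> * S (real i * D) w)" "\<bar>c2 i w\<bar> \<le> D * (q + \<kappa> * S (real i * D) w)"
          using elim(9)[rule_format, OF i] unfolding S_def D_def by blast+
        have "c1 i w + c2 i w \<le> D * (q + \<kappa> * S (real i * D) w) + D * (q + \<kappa> * S (real i * D) w)"
          by (rule add_mono[OF abs_le_D1[OF c(1)] abs_le_D1[OF c(2)]])
        also have "\<dots> = 2 * q * D + 2 * \<kappa> * (D * S (real i * D) w)" by (simp add: algebra_simps)
        finally show "c1 i w + c2 i w \<le> 2 * q * D + 2 * \<kappa> * (D * S (real i * D) w)" .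
      qed
      also have "\<dots> = 2 * q * (real (card ?I) * D) + 2 * \<kappa> * X"
        unfolding X_def by (simp add: sum.distrib sum_distrib_left)
      also have "\<dots> \<le> 2 * q * T + 2 * \<kappa> * X" using cardI q by (intro add_right_mono mult_left_mono) auto
      finally have sums: "(\<Sum>i\<in>?I. c1 i w) + (\<Sum>i\<in>?I. c2 i w) \<le> 2 * q * T + 2 * \<kappa> * X" .
      have "(LINT u:{0..t}|lborel. drift1 u w) + (LINT u:{0..t}|lborel. drift2 u w) = (LINT u:{0..t}|lborel. drift1 u w + drift2 u w)"
        by (rule set_integral_add(2)[OF id, symmetric])
      also have "\<dots> \<le> (LINT u:{0..t}|lborel. 2 * (q + \<kappa> * S u w))"
      proof (rule set_integral_mono[OF set_integral_add(1)[OF id] ic])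
        fix u assume "u \<in> {0..t}"
        then have "u \<in> {0..T}" using sub by blast
        from bspec[OF elim(10) this] have c: "\<bar>drift1 u w\<bar> \<le> q + \<kappa> * S u w" "\<bar>drift2 u w\<bar> \<le> q + \<kappa> * S u w"
          unfolding S_def by blast+
        have "drift1 u w + drift2 u w \<le> (q + \<kappa> * S u w) + (q + \<kappa> * S u w)"
          by (rule add_mono[OF abs_le_D1[OF c(1)] abs_le_D1[OF c(2)]])
        then show "drift1 u w + drift2 u w \<le> 2 * (q + \<kappa> * S u w)" by simp
      qed
      also have "\<dots> = 2 * (q * t + \<kappa> * Y)"
      proof -
        have "(LINT u:{0..t}|lborel. q) = q * t" using t by (simp add: set_lebesgue_integral_def)
        moreover have "(LINT u:{0..t}|lborel. 2 * (q + \<kappa> * S u w)) = 2 * (LINT u:{0..t}|lborel. q + \<kappa> * S u w)"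
          by (rule set_integral_mult_right)
        moreover have "(LINT u:{0..t}|lborel. q + \<kappa> * S u w) = (LINT u:{0..t}|lborel. q) + (LINT u:{0..t}|lborel. \<kappa> * S u w)"
          using iS by (intro set_integral_add(2) cst set_integrable_mult_right)
        moreover have "(LINT u:{0..t}|lborel. \<kappa> * S u w) = \<kappa> * Y" unfolding Y_def by (rule set_integral_mult_right)
        ultimately show ?thesis by (simp only:)
      qed
      also have "\<dots> \<le> 2 * (q * T + \<kappa> * Y)" using t q by (intro mult_left_mono add_right_mono) auto
      finally have drifts: "(LINT u:{0..t}|lborel. drift1 u w) + (LINT u:{0..t}|lborel. drift2 u w) \<le> 2 * (q * T + \<kappa> * Y)" .
      have "S t w \<le> (y10 + y20 + 4 * q * T) + (2 * \<kappa> * (X + Y) + (\<bar>J1 t w\<bar> + \<bar>J2 t w\<bar>))"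
        unfolding S_def elim(1,2) using sums drifts by (simp add: algebra_simps)
      then have "ennreal (S t w) \<le> ennreal ((y10 + y20 + 4 * q * T) + (2 * \<kappa> * (X + Y) + (\<bar>J1 t w\<bar> + \<bar>J2 t w\<bar>)))"
        by (rule ennreal_leI)
      also have "\<dots> = ennreal (y10 + y20 + 4 * q * T) + (ennreal (2 * \<kappa>) * (ennreal X + ennreal Y) + (ennreal \<bar>J1 t w\<bar> + ennreal \<bar>J2 t w\<bar>))"
      proof -
        have "ennreal (2 * \<kappa> * (X + Y)) = ennreal (2 * \<kappa>) * (ennreal X + ennreal Y)"
          using q X0 Y0 by (subst ennreal_mult') (auto simp: ennreal_plus)
        moreover have "0 \<le> 2 * \<kappa> * (X + Y)" "0 \<le> y10 + y20 + 4 * q * T" using q X0 Y0 y0 T by auto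
        ultimately show ?thesis by (simp only: ennreal_plus abs_ge_zero add_nonneg_nonneg)
      qed
      also have "ennreal X = (\<Sum>i | i < n \<and> real i * (T / real n) < t. ennreal (T / real n) * ennreal (S (real i * (T / real n)) w))"
      proof -
        have "ennreal X = (\<Sum>i\<in>?I. ennreal (D * S (real i * D) w))"
          unfolding X_def using S0 gridT D by (intro sum_ennreal[symmetric] mult_nonneg_nonneg) auto
        also have "\<dots> = (\<Sum>i\<in>?I. ennreal D * ennreal (S (real i * D) w))"
          using D by (intro sum.cong refl ennreal_mult') auto
        finally show ?thesis by (simp add: grid_before_def D_def)
      qed
      also have "ennreal Y = (\<integral>\<^sup>+u\<in>{0..t}. ennreal (S u w) \<partial>lborel)"
      proof -
        have "(\<integral>\<^sup>+u. ennreal (indicator {0..t} u *\<^sub>R S u w) \<partial>lborel) = ennreal Y"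
          unfolding Y_def set_lebesgue_integral_def
          using iS S0 sub by (intro nn_integral_eq_integral AE_I2) (auto simp: set_integrable_def indicator_def)
        moreover have "(\<integral>\<^sup>+u. ennreal (indicator {0..t} u *\<^sub>R S u w) \<partial>lborel) = (\<integral>\<^sup>+u\<in>{0..t}. ennreal (S u w) \<partial>lborel)"
          by (intro nn_integral_cong) (auto simp: indicator_def)
        ultimately show ?thesis by simp
      qed
      finally show ?case .
    qed
  qed
  then show ?thesis by (simp add: S_def)
qed

end

section \<open>Error from freezing the drift on the grid\<close>

lemma set_integral_point: "(LINT u:{a..a::real}|lborel. (f u::real)) = 0"
proof -
  have "AE u in lborel. indicator {a..a} u *\<^sub>R f u = 0"
    using AE_lborel_singleton[of a] by eventually_elim (simp add: indicator_def)
  then show ?thesis unfolding set_lebesgue_integral_def by (rule integral_eq_zero_AE)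
qed

lemma set_integrable_subinterval:
  fixes f :: "real \<Rightarrow> real"
  assumes "set_integrable lborel {a..b} f" "a \<le> c" "d \<le> b"
  shows "set_integrable lborel {c..d} f"
  using assms by (auto intro: set_integrable_subset)

lemma ennreal_square_add3_le: "(x + (y + z))\<^sup>2 \<le> 4 * (x\<^sup>2 + (y\<^sup>2 + (z::ennreal)\<^sup>2))"
proof -
  have "(x + (y + z))\<^sup>2 \<le> 2 * x\<^sup>2 + 2 * (y + z)\<^sup>2" by (rule ennreal_square_add_le)
  also have "\<dots> \<le> 2 * x\<^sup>2 + 2 * (2 * y\<^sup>2 + 2 * z\<^sup>2)"
    by (intro add_left_mono mult_left_mono ennreal_square_add_le) simp
  also have "\<dots> = 2 * x\<^sup>2 + 4 * (y\<^sup>2 + z\<^sup>2)" by (simp add: distrib_left mult.assoc[symmetric])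
  also have "\<dots> \<le> 4 * x\<^sup>2 + 4 * (y\<^sup>2 + z\<^sup>2)" by (intro add_right_mono mult_right_mono) simp_all
  finally show ?thesis by (simp add: distrib_left)
qed

lemma ennreal_four_sum:
  assumes "0 \<le> a" "0 \<le> b" "0 \<le> c"
  shows "4 * (ennreal a + (ennreal b + ennreal c)) = ennreal (4 * (a + (b + c)))"
proof -
  have "ennreal (4 * (a + (b + c))) = ennreal 4 * ennreal (a + (b + c))" by (rule ennreal_mult') simp
  also have "ennreal (a + (b + c)) = ennreal a + (ennreal b + ennreal c)"
    using assms by (simp add: ennreal_plus)
  finally show ?thesis by simp
qed

context complete_filtered_prob_space
begin

lemma nn_integral_three_squares:
  assumes [measurable]: "A \<in> borel_measurable M" "B \<in> borel_measurable M" "D \<in> borel_measurable M"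
    and le: "AE w in M. ennreal \<bar>X w\<bar> \<le> A w + (B w + D w)"
    and b: "(\<integral>\<^sup>+w. (A w)\<^sup>2 \<partial>M) \<le> a" "(\<integral>\<^sup>+w. (B w)\<^sup>2 \<partial>M) \<le> b" "(\<integral>\<^sup>+w. (D w)\<^sup>2 \<partial>M) \<le> d"
  shows "(\<integral>\<^sup>+w. ennreal ((X w)\<^sup>2) \<partial>M) \<le> 4 * (a + (b + d))"
proof -
  have "(\<integral>\<^sup>+w. ennreal ((X w)\<^sup>2) \<partial>M) \<le> (\<integral>\<^sup>+w. 4 * ((A w)\<^sup>2 + ((B w)\<^sup>2 + (D w)\<^sup>2)) \<partial>M)"
  proof (rule nn_integral_mono_AE)
    show "AE w in M. ennreal ((X w)\<^sup>2) \<le> 4 * ((A w)\<^sup>2 + ((B w)\<^sup>2 + (D w)\<^sup>2))"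
      using le
    proof eventually_elim
      case (elim w)
      have "(ennreal \<bar>X w\<bar>)\<^sup>2 \<le> (A w + (B w + D w))\<^sup>2" by (rule power_mono[OF elim]) simp
      then have "ennreal ((X w)\<^sup>2) \<le> (A w + (B w + D w))\<^sup>2" by (simp add: ennreal_power)
      then show ?case by (rule order_trans[OF _ ennreal_square_add3_le])
    qed
  qed
  also have "\<dots> = 4 * ((\<integral>\<^sup>+w. (A w)\<^sup>2 \<partial>M) + ((\<integral>\<^sup>+w. (B w)\<^sup>2 \<partial>M) + (\<integral>\<^sup>+w. (D w)\<^sup>2 \<partial>M)))"
    by (simp add: nn_integral_cmult nn_integral_add)
  also have "\<dots> \<le> 4 * (a + (b + d))" by (intro mult_left_mono add_mono b) simp
  finally show ?thesis .
qed

lemma time_integral_square_bound: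
  assumes X: "jointly_measurable M a b X" "a \<le> s" "s \<le> t" "t \<le> b" and C: "0 \<le> C"
    and b: "\<And>u. u \<in> {s..t} \<Longrightarrow> (\<integral>\<^sup>+w. ennreal ((X u w)\<^sup>2) \<partial>M) \<le> ennreal C"
  shows "(\<integral>\<^sup>+w. (\<integral>\<^sup>+u\<in>{s..t}. ennreal \<bar>X u w\<bar> \<partial>lborel)\<^sup>2 \<partial>M) \<le> ennreal ((t - s)\<^sup>2 * C)"
proof -
  have "(\<integral>\<^sup>+w. (\<integral>\<^sup>+u\<in>{s..t}. ennreal \<bar>X u w\<bar> \<partial>lborel)\<^sup>2 \<partial>M) \<le>
    ennreal (t - s) * (\<integral>\<^sup>+u\<in>{s..t}. (\<integral>\<^sup>+w. ennreal ((X u w)\<^sup>2) \<partial>M) \<partial>lborel)"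
    by (rule time_integral_square_le[OF X])
  also have "\<dots> \<le> ennreal (t - s) * ennreal ((t - s) * C)"
    using X C by (intro mult_left_mono nn_integral_interval_le b) auto
  also have "\<dots> = ennreal ((t - s)\<^sup>2 * C)"
    using X C by (simp add: ennreal_mult'[symmetric] power2_eq_square mult.assoc)
  finally show ?thesis .
qed

text \<open>Within a cell the increment consists of one jump of size \<open>O(T/n)\<close>, a drift
  integral over at most \<open>T/n\<close> and a noise of energy \<open>O(T/n)\<close>.\<close>

lemma component_oscillation:
  assumes W: "wiener_process M F W" and c: "cir_component W \<sigma> n T y0 c drift y J"
    and T: "0 < T" and n: "0 < n" and C: "0 \<le> C0" "0 \<le> C1"
    and y2: "\<And>u. u \<in> {0..T} \<Longrightarrow> (\<integral>\<^sup>+w. ennreal ((y u w)\<^sup>2) \<partial>M) \<le> ennreal C0"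
    and Gj: "jointly_measurable M 0 T G"
    and G2: "\<And>u. u \<in> {0..T} \<Longrightarrow> (\<integral>\<^sup>+w. ennreal ((G u w)\<^sup>2) \<partial>M) \<le> ennreal C1"
    and jump: "AE w in M. \<forall>i<n. \<bar>c i w\<bar> \<le> T / real n * G (real i * (T / real n)) w"
    and drift: "AE w in M. \<forall>u\<in>{0..T}. \<bar>drift u w\<bar> \<le> G u w"
    and i: "i < n" and s: "real i * (T / real n) < s" "s \<le> real (Suc i) * (T / real n)"
  shows "(\<integral>\<^sup>+w. ennreal ((y s w - y (real i * (T / real n)) w)\<^sup>2) \<partial>M) \<le>
    ennreal (T / real n * (8 * T * C1 + 4 * \<sigma>\<^sup>2 * (1 + C0)))"
proof -
  define D where "D = T / real n"
  have D: "0 < D" "real n * D = T" "D \<le> T"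
  proof -
    show "0 < D" "real n * D = T" using T n by (auto simp: D_def)
    then have "1 * D \<le> real n * D" using n by (intro mult_right_mono) auto
    then show "D \<le> T" using \<open>real n * D = T\<close> by simp
  qed
  define a where "a = real i * D"
  have s': "a < s" "s \<le> real (Suc i) * D" using s by (simp_all add: D_def a_def)
  have le: "real (Suc i) * D \<le> real n * D" using i D by (intro mult_right_mono) auto
  have sT: "0 \<le> a" "a \<le> s" "s \<le> T" "a \<in> {0..T}" "s \<in> {0..T}" "s - a \<le> D"
  proof -
    have e: "real (Suc i) * D = a + D" by (simp add: a_def algebra_simps)
    show a: "0 \<le> a" using D by (simp add: a_def)
    show as: "a \<le> s" "s \<le> T" "s - a \<le> D" using s' le D(2) e by linarith+
    have s0: "0 \<le> s" "a \<le> T" using a as by linarith+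
    show "a \<in> {0..T}" unfolding atLeastAtMost_iff by (rule conjI[OF a s0(2)])
    show "s \<in> {0..T}" unfolding atLeastAtMost_iff by (rule conjI[OF s0(1) as(2)])
  qed
  note d = cir_componentD[OF c T]
  have ilJ: "ito_limit W (\<lambda>u w. \<sigma> * sqrt (y u w)) a s (\<lambda>w. J s w - J a w)"
    by (rule ito_limit_increment[OF W d(5)[OF sT(4)] d(5)[OF sT(5)] sT(2)])
  have Gabs: "jointly_measurable M 0 T (\<lambda>u w. \<bar>G u w\<bar>)"
    by (rule jointly_measurable_compose[OF Gj]) measurable
  have "(\<integral>\<^sup>+w. ennreal ((y s w - y a w)\<^sup>2) \<partial>M) \<le>
    4 * (ennreal (D\<^sup>2 * C1) + (ennreal ((s - a)\<^sup>2 * C1) + ennreal (\<sigma>\<^sup>2 * (D * (1 + C0)))))"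
  proof (rule nn_integral_three_squares)
    show "(\<lambda>w. ennreal (D * \<bar>G a w\<bar>)) \<in> borel_measurable M"
      using jointly_measurable_at[OF Gj sT(4)] by measurable
    show "(\<lambda>w. \<integral>\<^sup>+u\<in>{a..s}. ennreal \<bar>G u w\<bar> \<partial>lborel) \<in> borel_measurable M"
      by (rule nn_integral_time_commute(2)[OF Gabs sT(1,3)])
    show "(\<lambda>w. ennreal \<bar>J s w - J a w\<bar>) \<in> borel_measurable M"
      using ito_limitD(5)[OF ilJ] by measurable
    show "AE w in M. ennreal \<bar>y s w - y a w\<bar> \<le> ennreal (D * \<bar>G a w\<bar>) +
        ((\<integral>\<^sup>+u\<in>{a..s}. ennreal \<bar>G u w\<bar> \<partial>lborel) + ennreal \<bar>J s w - J a w\<bar>)"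
      using d(6)[OF sT(4)] d(6)[OF sT(5)] d(9) jump drift
    proof eventually_elim
      case (elim w)
      have id: "set_integrable lborel {0..s} (\<lambda>u. drift u w)" "set_integrable lborel {a..s} (\<lambda>u. drift u w)"
        using sT by (auto intro!: set_integrable_subinterval[OF elim(3)])
      have "(LINT u:{0..s}|lborel. drift u w) = (LINT u:{0..a}|lborel. drift u w) + (LINT u:{a..s}|lborel. drift u w)"
        by (rule set_integral_split[OF id(1) sT(1,2)])
      moreover have "(\<Sum>i\<in>grid_before n T s. c i w) = c i w + (\<Sum>i\<in>grid_before n T a. c i w)"
        using grid_before_step[OF T i s] by (simp add: D_def a_def)
      ultimately have e: "y s w - y a w = c i w + (LINT u:{a..s}|lborel. drift u w) + (J s w - J a w)"
        using elim(1,2) by simp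
      have "\<bar>c i w\<bar> \<le> D * G a w" using elim(4) i by (auto simp: D_def a_def)
      also have "\<dots> \<le> D * \<bar>G a w\<bar>" using D by (intro mult_left_mono) auto
      finally have c1: "ennreal \<bar>c i w\<bar> \<le> ennreal (D * \<bar>G a w\<bar>)" by (rule ennreal_leI)
      have c2: "ennreal \<bar>LINT u:{a..s}|lborel. drift u w\<bar> \<le> (\<integral>\<^sup>+u\<in>{a..s}. ennreal \<bar>G u w\<bar> \<partial>lborel)"
      proof (rule order_trans[OF abs_set_integral_le[OF id(2)]], rule nn_integral_mono)
        fix u
        show "ennreal \<bar>drift u w\<bar> * indicator {a..s} u \<le> ennreal \<bar>G u w\<bar> * indicator {a..s} u"
        proof (cases "u \<in> {a..s}")
          case True
          then have "u \<in> {0..T}" using sT by auto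
          then have "\<bar>drift u w\<bar> \<le> G u w" by (rule bspec[OF elim(5)])
          then have "\<bar>drift u w\<bar> \<le> \<bar>G u w\<bar>" by linarith
          then show ?thesis using True by (simp add: ennreal_leI)
        qed simp
      qed
      have "ennreal \<bar>y s w - y a w\<bar> \<le> ennreal (\<bar>c i w\<bar> + (\<bar>LINT u:{a..s}|lborel. drift u w\<bar> + \<bar>J s w - J a w\<bar>))"
        unfolding e by (intro ennreal_leI) linarith
      also have "\<dots> = ennreal \<bar>c i w\<bar> + (ennreal \<bar>LINT u:{a..s}|lborel. drift u w\<bar> + ennreal \<bar>J s w - J a w\<bar>)"
        by (simp add: ennreal_plus)
      also have "\<dots> \<le> ennreal (D * \<bar>G a w\<bar>) + ((\<integral>\<^sup>+u\<in>{a..s}. ennreal \<bar>G u w\<bar> \<partial>lborel) + ennreal \<bar>J s w - J a w\<bar>)"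
        by (intro add_mono c1 c2 order_refl)
      finally show ?case .
    qed
    have "(\<integral>\<^sup>+w. (ennreal (D * \<bar>G a w\<bar>))\<^sup>2 \<partial>M) = (\<integral>\<^sup>+w. ennreal (D\<^sup>2) * ennreal ((G a w)\<^sup>2) \<partial>M)"
      using D by (intro nn_integral_cong) (simp add: ennreal_power power_mult_distrib ennreal_mult'[symmetric])
    also have "\<dots> = ennreal (D\<^sup>2) * (\<integral>\<^sup>+w. ennreal ((G a w)\<^sup>2) \<partial>M)"
      using jointly_measurable_at[OF Gj sT(4)] by (intro nn_integral_cmult) measurable
    also have "\<dots> \<le> ennreal (D\<^sup>2) * ennreal C1" by (intro mult_left_mono G2 sT(4)) simp
    also have "\<dots> = ennreal (D\<^sup>2 * C1)" by (rule ennreal_mult'[symmetric]) simp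
    finally show "(\<integral>\<^sup>+w. (ennreal (D * \<bar>G a w\<bar>))\<^sup>2 \<partial>M) \<le> ennreal (D\<^sup>2 * C1)" .
    show "(\<integral>\<^sup>+w. (\<integral>\<^sup>+u\<in>{a..s}. ennreal \<bar>G u w\<bar> \<partial>lborel)\<^sup>2 \<partial>M) \<le> ennreal ((s - a)\<^sup>2 * C1)"
      using sT by (intro time_integral_square_bound[OF Gj sT(1,2,3) C(2)] G2) auto
    have "(\<integral>\<^sup>+w. (ennreal \<bar>J s w - J a w\<bar>)\<^sup>2 \<partial>M) = (\<integral>\<^sup>+w. ennreal ((J s w - J a w)\<^sup>2) \<partial>M)"
      by (intro nn_integral_cong) (simp add: ennreal_power)
    also have "\<dots> \<le> (\<integral>\<^sup>+w. energy a s (\<lambda>u w. \<sigma> * sqrt (y u w)) w \<partial>M)"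
      by (rule ito_second_moment[OF W ilJ])
    also have "\<dots> \<le> (\<integral>\<^sup>+w. ennreal (\<sigma>\<^sup>2) * (\<integral>\<^sup>+u\<in>{a..s}. ennreal \<bar>y u w\<bar> \<partial>lborel) \<partial>M)"
    proof (rule nn_integral_mono)
      fix w assume w: "w \<in> space M"
      show "energy a s (\<lambda>u w. \<sigma> * sqrt (y u w)) w \<le> ennreal (\<sigma>\<^sup>2) * (\<integral>\<^sup>+u\<in>{a..s}. ennreal \<bar>y u w\<bar> \<partial>lborel)"
        by (rule energy_le_time_integral[OF d(4) sT(1,3) _ _ w])
           (auto simp: power_mult_distrib power2_eq_square[of "sqrt _"])
    qed
    also have "\<dots> = ennreal (\<sigma>\<^sup>2) * (\<integral>\<^sup>+u\<in>{a..s}. (\<integral>\<^sup>+w. ennreal \<bar>y u w\<bar> \<partial>M) \<partial>lborel)"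
    proof -
      have ya: "jointly_measurable M 0 T (\<lambda>u w. \<bar>y u w\<bar>)" by (rule jointly_measurable_compose[OF d(4)]) measurable
      show ?thesis
        unfolding nn_integral_cmult[OF nn_integral_time_commute(2)[OF ya sT(1,3)]] nn_integral_time_commute(1)[OF ya sT(1,3)] ..
    qed
    also have "\<dots> \<le> ennreal (\<sigma>\<^sup>2) * ennreal ((s - a) * (1 + C0))"
      using sT C by (intro mult_left_mono nn_integral_interval_le first_moment_le d(2) y2) auto
    also have "\<dots> \<le> ennreal (\<sigma>\<^sup>2) * ennreal (D * (1 + C0))"
      using sT C by (intro mult_left_mono ennreal_leI mult_right_mono) auto
    also have "\<dots> = ennreal (\<sigma>\<^sup>2 * (D * (1 + C0)))" by (rule ennreal_mult'[symmetric]) simp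
    finally show "(\<integral>\<^sup>+w. (ennreal \<bar>J s w - J a w\<bar>)\<^sup>2 \<partial>M) \<le> ennreal (\<sigma>\<^sup>2 * (D * (1 + C0)))" .
  qed
  also have "\<dots> = ennreal (4 * (D\<^sup>2 * C1 + ((s - a)\<^sup>2 * C1 + \<sigma>\<^sup>2 * (D * (1 + C0)))))"
    using C D by (intro ennreal_four_sum) auto
  also have "\<dots> \<le> ennreal (D * (8 * T * C1 + 4 * \<sigma>\<^sup>2 * (1 + C0)))"
  proof (rule ennreal_leI)
    have DD: "D\<^sup>2 \<le> D * T" using D by (simp add: power2_eq_square mult_left_mono)
    have "(s - a)\<^sup>2 \<le> D\<^sup>2" using sT by (intro power_mono) auto
    then have "(s - a)\<^sup>2 * C1 \<le> D * T * C1" "D\<^sup>2 * C1 \<le> D * T * C1" using DD C by (auto intro!: mult_right_mono)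
    then show "4 * (D\<^sup>2 * C1 + ((s - a)\<^sup>2 * C1 + \<sigma>\<^sup>2 * (D * (1 + C0)))) \<le> D * (8 * T * C1 + 4 * \<sigma>\<^sup>2 * (1 + C0))"
      by (simp add: algebra_simps)
  qed
  finally show ?thesis by (simp add: D_def a_def)
qed

text \<open>On complete cells the Riemann sum integrates the oscillation of \<open>f\<close>; in the
  cell that contains \<open>t\<close> the whole of \<open>T / n * f\<close> has already been added,
  which costs one further term of order \<open>T/n\<close>.\<close>

lemma frozen_drift_error:
  assumes T: "0 < T" and n: "0 < n" and C: "0 \<le> C1" "0 \<le> B"
    and fj: "jointly_measurable M 0 T f" and fi: "AE w in M. set_integrable lborel {0..T} (\<lambda>u. f u w)"
    and f2: "\<And>u. u \<in> {0..T} \<Longrightarrow> (\<integral>\<^sup>+w. ennreal ((f u w)\<^sup>2) \<partial>M) \<le> ennreal C1"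
    and osc: "\<And>i u. i < n \<Longrightarrow> real i * (T / real n) < u \<Longrightarrow> u \<le> real (Suc i) * (T / real n) \<Longrightarrow>
      (\<integral>\<^sup>+w. ennreal ((f u w - f (real i * (T / real n)) w)\<^sup>2) \<partial>M) \<le> ennreal (T / real n * B)"
    and t: "t \<in> {0..T}"
  shows "(\<integral>\<^sup>+w. ennreal (((LINT u:{0..t}|lborel. f u w) - (\<Sum>i\<in>grid_before n T t. T / real n * f (real i * (T / real n)) w))\<^sup>2) \<partial>M)
    \<le> ennreal (T / real n * (4 * T\<^sup>2 * B + 8 * T * C1))"
proof (cases "t = 0")
  case True
  have "(\<integral>\<^sup>+w. ennreal (((LINT u:{0..0::real}|lborel. f u w) - 0)\<^sup>2) \<partial>M) = (\<integral>\<^sup>+w. 0 \<partial>M)"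
  proof (rule nn_integral_cong)
    fix w
    show "ennreal (((LINT u:{0..0::real}|lborel. f u w) - 0)\<^sup>2) = 0" using set_integral_point[of 0 "\<lambda>u. f u w"] by simp
  qed
  then show ?thesis unfolding True grid_before_0[OF T] by simp
next
  case False
  then have t0: "0 < t" "t \<le> T" using t by auto
  define D where "D = T / real n"
  have D: "0 < D" "real n * D = T" "D \<le> T"
  proof -
    show "0 < D" "real n * D = T" using T n by (auto simp: D_def)
    then have "1 * D \<le> real n * D" using n by (intro mult_right_mono) auto
    then show "D \<le> T" using \<open>real n * D = T\<close> by simp
  qed
  obtain j where j: "j < n" "real j * D < t" "t \<le> real (Suc j) * D"
    using grid_cell[OF T t0 n] unfolding D_def by blast
  have gridT: "real i * D \<in> {0..T}" if "i \<le> n" for i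
  proof -
    have "real i * D \<le> real n * D" using that D by (intro mult_right_mono) auto
    then show ?thesis using D by simp
  qed
  have jT: "real j * D \<in> {0..T}" using j by (intro gridT) auto
  have I: "grid_before n T (real i * D) = {..<i}" if "i \<le> n" for i
    using that D unfolding grid_before_def D_def[symmetric] by auto
  have It: "grid_before n T t = insert j {..<j}"
    using grid_before_step(1)[OF T j(1), folded D_def, OF j(2,3)] I[of j] j by simp
  \<comment> \<open>The deviation from the value at the left end of cell \<open>i\<close>.\<close>
  define g where "g i u w = f u w - f (real i * D) w" for i u w
  have gj: "jointly_measurable M 0 T (g i)" if "i \<le> n" for i
    unfolding g_def by (intro jointly_measurable_diff fj jointly_measurable_const jointly_measurable_at[OF fj gridT[OF that]])
  have gabs: "jointly_measurable M 0 T (\<lambda>u w. \<bar>g i u w\<bar>)" if "i \<le> n" for i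
    by (rule jointly_measurable_compose[OF gj[OF that]]) measurable
  have fabs: "jointly_measurable M 0 T (\<lambda>u w. \<bar>f u w\<bar>)"
    by (rule jointly_measurable_compose[OF fj]) measurable
  let ?r = "\<lambda>i w. \<integral>\<^sup>+u\<in>{real i * D..real (Suc i) * D}. ennreal \<bar>g i u w\<bar> \<partial>lborel"
  have cellT: "0 \<le> real i * D" "real i * D \<le> real (Suc i) * D" "real (Suc i) * D \<le> T" if "i < n" for i
    using D gridT[of "Suc i"] that by auto
  have rM: "?r i \<in> borel_measurable M" if "i < n" for i
    by (rule nn_integral_time_commute(2)[OF gabs cellT(1,3)[OF that]]) (use that in simp)
  have "(\<integral>\<^sup>+w. ennreal (((LINT u:{0..t}|lborel. f u w) - (\<Sum>i\<in>grid_before n T t. D * f (real i * D) w))\<^sup>2) \<partial>M)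
    \<le> 4 * (ennreal (T\<^sup>2 * (D * B)) + (ennreal ((t - real j * D)\<^sup>2 * C1) + ennreal (D\<^sup>2 * C1)))"
  proof (rule nn_integral_three_squares)
    show "(\<lambda>w. \<Sum>i<j. ?r i w) \<in> borel_measurable M" using rM j by (intro borel_measurable_sum) auto
    show "(\<lambda>w. \<integral>\<^sup>+u\<in>{real j * D..t}. ennreal \<bar>f u w\<bar> \<partial>lborel) \<in> borel_measurable M"
      using jT t0 by (intro nn_integral_time_commute(2)[OF fabs]) auto
    show "(\<lambda>w. ennreal (D * \<bar>f (real j * D) w\<bar>)) \<in> borel_measurable M"
      using jointly_measurable_at[OF fj jT] by measurable
    show "AE w in M. ennreal \<bar>(LINT u:{0..t}|lborel. f u w) - (\<Sum>i\<in>grid_before n T t. D * f (real i * D) w)\<bar> \<le>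
      (\<Sum>i<j. ?r i w) + ((\<integral>\<^sup>+u\<in>{real j * D..t}. ennreal \<bar>f u w\<bar> \<partial>lborel) + ennreal (D * \<bar>f (real j * D) w\<bar>))"
      using fi
    proof eventually_elim
      case (elim w)
      have sub: "set_integrable lborel {a..b} (\<lambda>u. f u w)" if "0 \<le> a" "b \<le> T" for a b
        using elim that by (auto intro: set_integrable_subset)
      have full: "ennreal \<bar>(LINT u:{0..real i * D}|lborel. f u w) - (\<Sum>i<i. D * f (real i * D) w)\<bar> \<le> (\<Sum>i<i. ?r i w)" if "i \<le> n" for i
        using that
      proof (induction i)
        case 0
        show ?case using set_integral_point[of 0 "\<lambda>u. f u w"] by simp
      next
        case (Suc i)
        let ?a = "real i * D" and ?b = "real (Suc i) * D"
        have i: "i < n" using Suc.prems by simp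
        note ab = cellT[OF i]
        have ci: "set_integrable lborel {?a..?b} (\<lambda>u. f (real i * D) w)"
          unfolding set_integrable_def by (intro integrable_scaleR_left integrable_real_indicator) (auto simp: emeasure_lborel_Icc_eq)
        have "(LINT u:{?a..?b}|lborel. f (real i * D) w) = D * f (real i * D) w"
          using ab by (simp add: set_lebesgue_integral_def algebra_simps)
        then have g: "(LINT u:{?a..?b}|lborel. g i u w) = (LINT u:{?a..?b}|lborel. f u w) - D * f (real i * D) w"
          unfolding g_def using set_integral_diff(2)[OF sub[OF ab(1,3)] ci] by simp
        have gi: "set_integrable lborel {?a..?b} (\<lambda>u. g i u w)"
          unfolding g_def by (rule set_integral_diff(1)[OF sub[OF ab(1,3)] ci])
        have "(LINT u:{0..?b}|lborel. f u w) = (LINT u:{0..?a}|lborel. f u w) + (LINT u:{?a..?b}|lborel. f u w)"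
          by (rule set_integral_split[OF sub[OF order_refl ab(3)] ab(1,2)])
        from this have "\<bar>(LINT u:{0..?b}|lborel. f u w) - (\<Sum>i<Suc i. D * f (real i * D) w)\<bar> \<le>
          \<bar>(LINT u:{0..?a}|lborel. f u w) - (\<Sum>i<i. D * f (real i * D) w)\<bar> + \<bar>LINT u:{?a..?b}|lborel. g i u w\<bar>"
          unfolding g sum.lessThan_Suc by linarith
        from ennreal_leI[OF this]
        have "ennreal \<bar>(LINT u:{0..?b}|lborel. f u w) - (\<Sum>i<Suc i. D * f (real i * D) w)\<bar> \<le>
          ennreal \<bar>(LINT u:{0..?a}|lborel. f u w) - (\<Sum>i<i. D * f (real i * D) w)\<bar> + ennreal \<bar>LINT u:{?a..?b}|lborel. g i u w\<bar>"
          by (simp only: ennreal_plus abs_ge_zero)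
        also have "\<dots> \<le> (\<Sum>i<i. ?r i w) + ?r i w"
          using Suc i by (intro add_mono abs_set_integral_le[OF gi]) simp
        finally show ?case by simp
      qed
      have jt: "(LINT u:{0..t}|lborel. f u w) = (LINT u:{0..real j * D}|lborel. f u w) + (LINT u:{real j * D..t}|lborel. f u w)"
        using jT j t0 by (intro set_integral_split sub) auto
      have "\<bar>(LINT u:{0..t}|lborel. f u w) - (\<Sum>i\<in>grid_before n T t. D * f (real i * D) w)\<bar> \<le>
        \<bar>(LINT u:{0..real j * D}|lborel. f u w) - (\<Sum>i<j. D * f (real i * D) w)\<bar> + (\<bar>LINT u:{real j * D..t}|lborel. f u w\<bar> + D * \<bar>f (real j * D) w\<bar>)"
      proof -
        have "\<bar>D * f (real j * D) w\<bar> = D * \<bar>f (real j * D) w\<bar>" using D by (simp add: abs_mult)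
        moreover have "(\<Sum>i\<in>insert j {..<j}. D * f (real i * D) w) = D * f (real j * D) w + (\<Sum>i<j. D * f (real i * D) w)" by simp
        ultimately show ?thesis unfolding It jt by linarith
      qed
      then have "ennreal \<bar>(LINT u:{0..t}|lborel. f u w) - (\<Sum>i\<in>grid_before n T t. D * f (real i * D) w)\<bar> \<le>
        ennreal (\<bar>(LINT u:{0..real j * D}|lborel. f u w) - (\<Sum>i<j. D * f (real i * D) w)\<bar> + (\<bar>LINT u:{real j * D..t}|lborel. f u w\<bar> + D * \<bar>f (real j * D) w\<bar>))"
        by (rule ennreal_leI)
      also have "\<dots> = ennreal \<bar>(LINT u:{0..real j * D}|lborel. f u w) - (\<Sum>i<j. D * f (real i * D) w)\<bar> + (ennreal \<bar>LINT u:{real j * D..t}|lborel. f u w\<bar> + ennreal (D * \<bar>f (real j * D) w\<bar>))"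
        using D by (simp add: ennreal_plus)
      also have "\<dots> \<le> (\<Sum>i<j. ?r i w) + ((\<integral>\<^sup>+u\<in>{real j * D..t}. ennreal \<bar>f u w\<bar> \<partial>lborel) + ennreal (D * \<bar>f (real j * D) w\<bar>))"
        using j jT t0 by (intro add_mono full abs_set_integral_le sub order_refl) auto
      finally show ?case .
    qed
    have r2: "(\<integral>\<^sup>+w. (?r i w)\<^sup>2 \<partial>M) \<le> ennreal (D\<^sup>2 * (D * B))" if i: "i < n" for i
    proof -
      have "(\<integral>\<^sup>+w. ennreal ((g i u w)\<^sup>2) \<partial>M) \<le> ennreal (D * B)" if u: "u \<in> {real i * D..real (Suc i) * D}" for u
      proof (cases "u = real i * D")
        case True then show ?thesis by (simp add: g_def)
      next
        case False then show ?thesis using osc[OF i, of u] u by (simp add: g_def D_def)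
      qed
      then have "(\<integral>\<^sup>+w. (?r i w)\<^sup>2 \<partial>M) \<le> ennreal ((real (Suc i) * D - real i * D)\<^sup>2 * (D * B))"
        using i C D by (intro time_integral_square_bound[OF gj cellT[OF i]]) auto
      moreover have "real (Suc i) * D - real i * D = D" by (simp add: algebra_simps)
      ultimately show ?thesis by simp
    qed
    have "(\<integral>\<^sup>+w. (\<Sum>i<j. ?r i w)\<^sup>2 \<partial>M) \<le> (\<integral>\<^sup>+w. ennreal (real n) * (\<Sum>i<j. (?r i w)\<^sup>2) \<partial>M)"
    proof (rule nn_integral_mono)
      fix w
      show "(\<Sum>i<j. ?r i w)\<^sup>2 \<le> ennreal (real n) * (\<Sum>i<j. (?r i w)\<^sup>2)"
        using sum_square_le_ennreal[of "{..<j}" 1 "real n" "\<lambda>i. ?r i w"] j by simp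
    qed
    also have "\<dots> = ennreal (real n) * (\<Sum>i<j. \<integral>\<^sup>+w. (?r i w)\<^sup>2 \<partial>M)"
    proof -
      have m: "(\<lambda>w. (?r i w)\<^sup>2) \<in> borel_measurable M" if "i \<in> {..<j}" for i
        by (rule measurable_compose[OF rM, of _ "\<lambda>x. x\<^sup>2"]) (use that j in \<open>auto\<close>)
      have ms: "(\<lambda>w. \<Sum>i<j. (?r i w)\<^sup>2) \<in> borel_measurable M" by (rule borel_measurable_sum[OF m])
      have e: "(\<integral>\<^sup>+w. (\<Sum>i<j. (?r i w)\<^sup>2) \<partial>M) = (\<Sum>i<j. \<integral>\<^sup>+w. (?r i w)\<^sup>2 \<partial>M)"
        by (rule nn_integral_sum) (rule m)
      show ?thesis unfolding nn_integral_cmult[OF ms] e ..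
    qed
    also have "\<dots> \<le> ennreal (real n) * (\<Sum>i<j. ennreal (D\<^sup>2 * (D * B)))"
      using j by (intro mult_left_mono sum_mono r2) auto
    also have "\<dots> = ennreal (real n * (real j * (D\<^sup>2 * (D * B))))"
      using C D by (simp add: ennreal_mult' ennreal_of_nat_eq_real_of_nat)
    also have "\<dots> \<le> ennreal (T\<^sup>2 * (D * B))"
    proof (rule ennreal_leI)
      have "real n * (real j * (D\<^sup>2 * (D * B))) \<le> real n * (real n * (D\<^sup>2 * (D * B)))"
        using j C D by (intro mult_left_mono mult_right_mono) auto
      also have "\<dots> = (real n * D)\<^sup>2 * (D * B)" by (simp add: power2_eq_square mult_ac)
      finally show "real n * (real j * (D\<^sup>2 * (D * B))) \<le> T\<^sup>2 * (D * B)" using D by simp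
    qed
    finally show "(\<integral>\<^sup>+w. (\<Sum>i<j. ?r i w)\<^sup>2 \<partial>M) \<le> ennreal (T\<^sup>2 * (D * B))" .
    show "(\<integral>\<^sup>+w. (\<integral>\<^sup>+u\<in>{real j * D..t}. ennreal \<bar>f u w\<bar> \<partial>lborel)\<^sup>2 \<partial>M) \<le> ennreal ((t - real j * D)\<^sup>2 * C1)"
      using jT j t0 by (intro time_integral_square_bound[OF fj _ _ _ C(1)] f2) auto
    have "(\<integral>\<^sup>+w. (ennreal (D * \<bar>f (real j * D) w\<bar>))\<^sup>2 \<partial>M) = (\<integral>\<^sup>+w. ennreal (D\<^sup>2) * ennreal ((f (real j * D) w)\<^sup>2) \<partial>M)"
      using D by (intro nn_integral_cong) (simp add: ennreal_power power_mult_distrib ennreal_mult'[symmetric])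
    also have "\<dots> = ennreal (D\<^sup>2) * (\<integral>\<^sup>+w. ennreal ((f (real j * D) w)\<^sup>2) \<partial>M)"
      using jointly_measurable_at[OF fj jT] by (intro nn_integral_cmult) measurable
    also have "\<dots> \<le> ennreal (D\<^sup>2) * ennreal C1" by (intro mult_left_mono f2 jT) simp
    also have "\<dots> = ennreal (D\<^sup>2 * C1)" by (rule ennreal_mult'[symmetric]) simp
    finally show "(\<integral>\<^sup>+w. (ennreal (D * \<bar>f (real j * D) w\<bar>))\<^sup>2 \<partial>M) \<le> ennreal (D\<^sup>2 * C1)" .
  qed
  also have "\<dots> = ennreal (4 * (T\<^sup>2 * (D * B) + ((t - real j * D)\<^sup>2 * C1 + D\<^sup>2 * C1)))"
    using C D by (intro ennreal_four_sum) auto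
  also have "\<dots> \<le> ennreal (D * (4 * T\<^sup>2 * B + 8 * T * C1))"
  proof (rule ennreal_leI)
    have DD: "D\<^sup>2 \<le> D * T" using D by (simp add: power2_eq_square mult_left_mono)
    have "t - real j * D \<le> D" using j(3) by (simp add: algebra_simps)
    then have "(t - real j * D)\<^sup>2 \<le> D\<^sup>2" using j by (intro power_mono) auto
    then have "(t - real j * D)\<^sup>2 * C1 \<le> D * T * C1" "D\<^sup>2 * C1 \<le> D * T * C1" using DD C by (auto intro!: mult_right_mono)
    then show "4 * (T\<^sup>2 * (D * B) + ((t - real j * D)\<^sup>2 * C1 + D\<^sup>2 * C1)) \<le> D * (4 * T\<^sup>2 * B + 8 * T * C1)"
      by (simp add: algebra_simps)
  qed
  finally show ?thesis by (simp add: D_def)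
qed

end

section \<open>Error of one component\<close>

lemma sqrt_diff_square_le: "0 \<le> x \<Longrightarrow> 0 \<le> y \<Longrightarrow> (sqrt x - sqrt y)\<^sup>2 \<le> \<bar>x - y\<bar>"
proof -
  assume xy: "0 \<le> x" "0 \<le> y"
  have "x - y = (sqrt x - sqrt y) * (sqrt x + sqrt y)" using xy by (simp add: algebra_simps)
  then have "\<bar>x - y\<bar> = \<bar>sqrt x - sqrt y\<bar> * (sqrt x + sqrt y)" using xy by (simp add: abs_mult)
  moreover have "\<bar>sqrt x - sqrt y\<bar> * \<bar>sqrt x - sqrt y\<bar> \<le> \<bar>sqrt x - sqrt y\<bar> * (sqrt x + sqrt y)"
    using xy by (intro mult_left_mono) (auto simp: abs_le_iff)
  ultimately show ?thesis by (simp add: power2_eq_square)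
qed

context complete_filtered_prob_space
begin

text \<open>Jensen's inequality, obtained from \<open>2 \<bar>x\<bar> \<le> d + x\<^sup>2 /
  d\<close>.\<close>

lemma mean_abs_le_root:
  assumes [measurable]: "X \<in> borel_measurable M" and le: "(\<integral>\<^sup>+w. ennreal ((X w)\<^sup>2) \<partial>M) \<le> ennreal (d\<^sup>2)" and d: "0 < d"
  shows "(\<integral>\<^sup>+w. ennreal \<bar>X w\<bar> \<partial>M) \<le> ennreal d"
proof -
  have "(\<integral>\<^sup>+w. ennreal \<bar>X w\<bar> \<partial>M) \<le> (\<integral>\<^sup>+w. ennreal (d / 2) + ennreal (1 / (2 * d)) * ennreal ((X w)\<^sup>2) \<partial>M)"
  proof (rule nn_integral_mono)
    fix w
    have "2 * (1 * \<bar>X w\<bar>) \<le> d * 1\<^sup>2 + \<bar>X w\<bar>\<^sup>2 / d" by (rule two_mult_le[OF d])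
    then have "\<bar>X w\<bar> \<le> d / 2 + 1 / (2 * d) * (X w)\<^sup>2" by simp
    then have "ennreal \<bar>X w\<bar> \<le> ennreal (d / 2 + 1 / (2 * d) * (X w)\<^sup>2)" by (rule ennreal_leI)
    also have "\<dots> = ennreal (d / 2) + ennreal (1 / (2 * d) * (X w)\<^sup>2)" using d by (intro ennreal_plus) auto
    also have "ennreal (1 / (2 * d) * (X w)\<^sup>2) = ennreal (1 / (2 * d)) * ennreal ((X w)\<^sup>2)" using d by (intro ennreal_mult') simp
    finally show "ennreal \<bar>X w\<bar> \<le> ennreal (d / 2) + ennreal (1 / (2 * d)) * ennreal ((X w)\<^sup>2)" .
  qed
  also have "\<dots> = ennreal (d / 2) + ennreal (1 / (2 * d)) * (\<integral>\<^sup>+w. ennreal ((X w)\<^sup>2) \<partial>M)"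
    by (simp add: nn_integral_add nn_integral_cmult emeasure_space_1)
  also have "\<dots> \<le> ennreal (d / 2) + ennreal (1 / (2 * d)) * ennreal (d\<^sup>2)" by (intro add_left_mono mult_left_mono le) simp
  also have "ennreal (1 / (2 * d)) * ennreal (d\<^sup>2) = ennreal (1 / (2 * d) * d\<^sup>2)" using d by (intro ennreal_mult'[symmetric]) simp
  also have "1 / (2 * d) * d\<^sup>2 = d / 2" using d by (simp add: power2_eq_square)
  also have "ennreal (d / 2) + ennreal (d / 2) = ennreal (d / 2 + d / 2)" using d by (intro ennreal_plus[symmetric]) auto
  finally show ?thesis by simp
qed

lemma affine_second_moment:
  assumes [measurable]: "X \<in> borel_measurable M" and le: "(\<integral>\<^sup>+w. ennreal ((X w)\<^sup>2) \<partial>M) \<le> ennreal C" and C: "0 \<le> C"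
  shows "(\<integral>\<^sup>+w. ennreal ((p + r * X w)\<^sup>2) \<partial>M) \<le> ennreal (2 * p\<^sup>2 + 2 * r\<^sup>2 * C)"
proof -
  have "(\<integral>\<^sup>+w. ennreal ((p + r * X w)\<^sup>2) \<partial>M) \<le> (\<integral>\<^sup>+w. ennreal (2 * p\<^sup>2) + ennreal (2 * r\<^sup>2) * ennreal ((X w)\<^sup>2) \<partial>M)"
  proof (rule nn_integral_mono)
    fix w
    have "(p + r * X w)\<^sup>2 \<le> 2 * p\<^sup>2 + 2 * r\<^sup>2 * (X w)\<^sup>2"
      using zero_le_power2[of "p - r * X w"] by (simp add: power2_eq_square algebra_simps)
    then have "ennreal ((p + r * X w)\<^sup>2) \<le> ennreal (2 * p\<^sup>2 + 2 * r\<^sup>2 * (X w)\<^sup>2)" by (rule ennreal_leI)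
    also have "\<dots> = ennreal (2 * p\<^sup>2) + ennreal (2 * r\<^sup>2 * (X w)\<^sup>2)" by (rule ennreal_plus) auto
    also have "ennreal (2 * r\<^sup>2 * (X w)\<^sup>2) = ennreal (2 * r\<^sup>2) * ennreal ((X w)\<^sup>2)" by (rule ennreal_mult') simp
    finally show "ennreal ((p + r * X w)\<^sup>2) \<le> ennreal (2 * p\<^sup>2) + ennreal (2 * r\<^sup>2) * ennreal ((X w)\<^sup>2)" .
  qed
  also have "\<dots> = ennreal (2 * p\<^sup>2) + ennreal (2 * r\<^sup>2) * (\<integral>\<^sup>+w. ennreal ((X w)\<^sup>2) \<partial>M)"
    by (simp add: nn_integral_add nn_integral_cmult emeasure_space_1)
  also have "\<dots> \<le> ennreal (2 * p\<^sup>2) + ennreal (2 * r\<^sup>2) * ennreal C" by (intro add_left_mono mult_left_mono le) simp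
  also have "ennreal (2 * r\<^sup>2) * ennreal C = ennreal (2 * r\<^sup>2 * C)" by (rule ennreal_mult'[symmetric]) simp
  also have "ennreal (2 * p\<^sup>2) + ennreal (2 * r\<^sup>2 * C) = ennreal (2 * p\<^sup>2 + 2 * r\<^sup>2 * C)"
    using C by (intro ennreal_plus[symmetric]) auto
  finally show ?thesis .
qed

lemma component_frozen_drift_error:
  assumes W: "wiener_process M F W" and c: "cir_component W \<sigma> n T y0 c drift y J"
    and T: "0 < T" and n: "0 < n" and C: "0 \<le> C0" "0 \<le> C1"
    and y2: "\<And>u. u \<in> {0..T} \<Longrightarrow> (\<integral>\<^sup>+w. ennreal ((y u w)\<^sup>2) \<partial>M) \<le> ennreal C0"
    and Gj: "jointly_measurable M 0 T G"
    and G2: "\<And>u. u \<in> {0..T} \<Longrightarrow> (\<integral>\<^sup>+w. ennreal ((G u w)\<^sup>2) \<partial>M) \<le> ennreal C1"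
    and jump: "AE w in M. \<forall>i<n. \<bar>c i w\<bar> \<le> T / real n * G (real i * (T / real n)) w"
    and drift: "AE w in M. \<forall>u\<in>{0..T}. \<bar>drift u w\<bar> \<le> G u w"
    and t: "t \<in> {0..T}"
  shows "(\<integral>\<^sup>+w. ennreal (((LINT u:{0..t}|lborel. p + b * y u w) -
      (\<Sum>i\<in>grid_before n T t. T / real n * (p + b * y (real i * (T / real n)) w)))\<^sup>2) \<partial>M)
    \<le> ennreal (T / real n * (4 * T\<^sup>2 * (b\<^sup>2 * (8 * T * C1 + 4 * \<sigma>\<^sup>2 * (1 + C0))) + 8 * T * (2 * p\<^sup>2 + 2 * b\<^sup>2 * C0)))"
proof (rule frozen_drift_error[OF T n, where f="\<lambda>u w. p + b * y u w"])
  note d = cir_componentD[OF c T]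
  let ?B = "8 * T * C1 + 4 * \<sigma>\<^sup>2 * (1 + C0)"
  show "0 \<le> 2 * p\<^sup>2 + 2 * b\<^sup>2 * C0" "0 \<le> b\<^sup>2 * ?B" using C T by auto
  show "jointly_measurable M 0 T (\<lambda>u w. p + b * y u w)"
    by (rule jointly_measurable_compose[OF d(4), of "\<lambda>v. p + b * v"]) measurable
  show "AE w in M. set_integrable lborel {0..T} (\<lambda>u. p + b * y u w)"
    using d(8)
  proof eventually_elim
    case (elim w)
    have "set_integrable lborel {0..T} (\<lambda>u. p)"
      unfolding set_integrable_def by (intro integrable_scaleR_left integrable_real_indicator) (auto simp: emeasure_lborel_Icc_eq)
    then show ?case using elim by (intro set_integral_add(1) set_integrable_mult_right) auto
  qed
  show "(\<integral>\<^sup>+w. ennreal ((p + b * y u w)\<^sup>2) \<partial>M) \<le> ennreal (2 * p\<^sup>2 + 2 * b\<^sup>2 * C0)" if "u \<in> {0..T}" for u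
    by (rule affine_second_moment[OF d(2)[OF that] y2[OF that] C(1)])
  fix i u assume i: "i < n" "real i * (T / real n) < u" "u \<le> real (Suc i) * (T / real n)"
  have D: "0 < T / real n" "real n * (T / real n) = T" using T n by auto
  have "real (Suc i) * (T / real n) \<le> real n * (T / real n)" using i(1) D(1) by (intro mult_right_mono) auto
  then have uT: "u \<le> T" using i(3) D(2) by linarith
  have i0: "0 \<le> real i * (T / real n)" using D(1) by (intro mult_nonneg_nonneg) auto
  have u: "u \<in> {0..T}" "real i * (T / real n) \<in> {0..T}"
    unfolding atLeastAtMost_iff using uT i(2) i0 by linarith+
  have "(\<integral>\<^sup>+w. ennreal ((p + b * y u w - (p + b * y (real i * (T / real n)) w))\<^sup>2) \<partial>M)
    = (\<integral>\<^sup>+w. ennreal (b\<^sup>2) * ennreal ((y u w - y (real i * (T / real n)) w)\<^sup>2) \<partial>M)"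
  proof (rule nn_integral_cong)
    fix w
    have "(p + b * y u w - (p + b * y (real i * (T / real n)) w))\<^sup>2 = b\<^sup>2 * (y u w - y (real i * (T / real n)) w)\<^sup>2"
      unfolding power_mult_distrib[symmetric] by (simp add: right_diff_distrib)
    then show "ennreal ((p + b * y u w - (p + b * y (real i * (T / real n)) w))\<^sup>2) = ennreal (b\<^sup>2) * ennreal ((y u w - y (real i * (T / real n)) w)\<^sup>2)"
      by (simp add: ennreal_mult')
  qed
  also have "\<dots> = ennreal (b\<^sup>2) * (\<integral>\<^sup>+w. ennreal ((y u w - y (real i * (T / real n)) w)\<^sup>2) \<partial>M)"
    using d(2)[OF u(1)] d(2)[OF u(2)] by (intro nn_integral_cmult) measurable
  also have "\<dots> \<le> ennreal (b\<^sup>2) * ennreal (T / real n * ?B)"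
    by (intro mult_left_mono component_oscillation[OF W c T n C y2 Gj G2 jump drift i]) auto
  also have "\<dots> = ennreal (T / real n * (b\<^sup>2 * ?B))"
    by (subst ennreal_mult'[symmetric]) (auto simp: mult_ac)
  finally show "(\<integral>\<^sup>+w. ennreal ((p + b * y u w - (p + b * y (real i * (T / real n)) w))\<^sup>2) \<partial>M) \<le> ennreal (T / real n * (b\<^sup>2 * ?B))" .
qed (rule t)

text \<open>The primed processes are the other component of the model and of the approximation. The
  first bound is \<open>yamada_estimate\<close> for the error minus the frozen drift error, the
  second one is the Ito isometry together with \<open>(sqrt x - sqrt y)\<^sup>2 \<le> \<bar>x -
  y\<bar>\<close>. Both are left as integral inequalities, since each involves the errors of both
  components.\<close>

lemma component_error:
  assumes W: "wiener_process M F W" and T: "0 < T" and n: "2 \<le> n"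
    and cx: "cir_component W \<sigma> 1 T x0 (\<lambda>_ _. 0) (\<lambda>u w. k - a * x u w + b * x' u w) x Jx"
    and cy: "cir_component W \<sigma> n T x0 (\<lambda>i w. T / real n * (k1 + b * y' (real i * (T / real n)) w)) (\<lambda>u w. k2 - a * y u w) y Jy"
    and x0: "AE w in M. x 0 w = x0" "AE w in M. y 0 w = x0" and k: "k = k1 + k2"
    and x'j: "jointly_measurable M 0 T x'" and x'i: "AE w in M. set_integrable lborel {0..T} (\<lambda>u. x' u w)"
    and y'j: "\<And>t. t \<in> {0..T} \<Longrightarrow> jointly_measurable (F t) 0 t y'" and y'F: "\<And>t. t \<in> {0..T} \<Longrightarrow> y' t \<in> borel_measurable (F t)"
    and y'i: "AE w in M. set_integrable lborel {0..T} (\<lambda>u. y' u w)"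
    and C: "0 \<le> C0" "0 \<le> Cb" "0 < K2" and s: "\<sigma>\<^sup>2 \<le> s"
    and x2: "\<And>u. u \<in> {0..T} \<Longrightarrow> (\<integral>\<^sup>+w. ennreal ((x u w)\<^sup>2) \<partial>M) \<le> ennreal C0"
    and y2: "\<And>u. u \<in> {0..T} \<Longrightarrow> (\<integral>\<^sup>+w. ennreal ((y u w)\<^sup>2) \<partial>M) \<le> ennreal C0"
    and b2: "\<And>u. u \<in> {0..T} \<Longrightarrow> (\<integral>\<^sup>+w. ennreal ((b * (x' u w - y' u w) - a * (x u w - y u w))\<^sup>2) \<partial>M) \<le> ennreal Cb"
    and frozen: "\<And>t. t \<in> {0..T} \<Longrightarrow> (\<integral>\<^sup>+w. ennreal (((LINT u:{0..t}|lborel. k1 + b * y' u w) -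
      (\<Sum>i\<in>grid_before n T t. T / real n * (k1 + b * y' (real i * (T / real n)) w)))\<^sup>2) \<partial>M) \<le> ennreal (T / real n * K2)"
    and t: "t \<in> {0..T}"
  defines "C \<equiv> 8 * C0 + 4 * T * K2 + Cb"
  shows "(\<integral>\<^sup>+w. ennreal \<bar>x t w - y t w\<bar> \<partial>M) \<le>
      (\<integral>\<^sup>+u\<in>{0..t}. (\<integral>\<^sup>+w. ennreal \<bar>b * (x' u w - y' u w) - a * (x u w - y u w)\<bar> \<partial>M) \<partial>lborel) +
      ennreal ((2 * (1 + T * (2 * C + s / 2)) + T * s * sqrt (T * K2) + 2 * sqrt (T * K2)) / ln (real n))"
    and "(\<integral>\<^sup>+w. ennreal ((x t w - y t w)\<^sup>2) \<partial>M) \<le> 4 * (ennreal (T / real n * K2) +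
      (ennreal T * (\<integral>\<^sup>+u\<in>{0..t}. (\<integral>\<^sup>+w. ennreal ((b * (x' u w - y' u w) - a * (x u w - y u w))\<^sup>2) \<partial>M) \<partial>lborel) +
       ennreal s * (\<integral>\<^sup>+u\<in>{0..t}. (\<integral>\<^sup>+w. ennreal \<bar>x u w - y u w\<bar> \<partial>M) \<partial>lborel)))"
proof -
  note dx = cir_componentD[OF cx T] and dy = cir_componentD[OF cy T]
  have n0: "0 < real n" "0 < n" using n by auto
  have s0: "0 \<le> s" using s order_trans[OF zero_le_power2] by blast
  define z where "z u w = x u w - y u w" for u w
  define bp where "bp u w = b * (x' u w - y' u w) - a * (x u w - y u w)" for u w
  define H where "H u w = \<sigma> * sqrt (x u w) - \<sigma> * sqrt (y u w)" for u w
  define J where "J t w = Jx t w - Jy t w" for t w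
  define \<delta> where "\<delta> t w = (LINT u:{0..t}|lborel. k1 + b * y' u w) -
    (\<Sum>i\<in>grid_before n T t. T / real n * (k1 + b * y' (real i * (T / real n)) w))" for t w
  define V where "V t w = z t w - \<delta> t w" for t w
  have \<delta>F: "\<delta> t \<in> borel_measurable (F t)" if t: "t \<in> {0..T}" for t
  proof -
    have "jointly_measurable (F t) 0 t (\<lambda>u w. k1 + b * y' u w)"
      by (rule jointly_measurable_compose[OF y'j[OF t], of "\<lambda>v. k1 + b * v"]) measurable
    then have [measurable]: "(\<lambda>w. LINT u:{0..t}|lborel. k1 + b * y' u w) \<in> borel_measurable (F t)"
      by (rule set_integral_measurable)
    have "(\<lambda>w. T / real n * (k1 + b * y' (real i * (T / real n)) w)) \<in> borel_measurable (F t)" if i: "i \<in> grid_before n T t" for i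
    proof -
      have g: "0 \<le> real i * (T / real n)" "real i * (T / real n) < t" using i T by (auto simp: grid_before_def)
      then have "real i * (T / real n) \<in> {0..T}" using t unfolding atLeastAtMost_iff by linarith
      from measurable_F_mono[OF y'F[OF this] less_imp_le[OF g(2)]]
      show ?thesis by measurable
    qed
    then have [measurable]: "(\<lambda>w. \<Sum>i\<in>grid_before n T t. T / real n * (k1 + b * y' (real i * (T / real n)) w)) \<in> borel_measurable (F t)"
      by (rule borel_measurable_sum)
    show ?thesis unfolding \<delta>_def by measurable
  qed
  have \<delta>M: "\<delta> t \<in> borel_measurable M" if "t \<in> {0..T}" for t by (rule measurable_F_M[OF \<delta>F[OF that]])
  have zj: "jointly_measurable M 0 T z" unfolding z_def by (rule jointly_measurable_diff[OF dx(4) dy(4)])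
  have zM: "z t \<in> borel_measurable M" if "t \<in> {0..T}" for t by (rule jointly_measurable_at[OF zj that])
  have y'M: "jointly_measurable M 0 T y'" using y'j[of T] T by (auto intro: jointly_measurable_F_M)
  have bj: "jointly_measurable M 0 T bp"
  proof -
    have "jointly_measurable M 0 T (\<lambda>u w. b * (x' u w - y' u w))"
      by (rule jointly_measurable_compose[OF jointly_measurable_diff[OF x'j y'M], of "\<lambda>v. b * v"]) measurable
    moreover have "jointly_measurable M 0 T (\<lambda>u w. a * (x u w - y u w))"
      by (rule jointly_measurable_compose[OF jointly_measurable_diff[OF dx(4) dy(4)], of "\<lambda>v. a * v"]) measurable
    ultimately show ?thesis unfolding bp_def by (rule jointly_measurable_diff)
  qed
  have bpi: "AE w in M. set_integrable lborel {0..T} (\<lambda>u. bp u w)"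
    using dx(8) dy(8) x'i y'i
    by eventually_elim (simp add: bp_def set_integral_diff(1) set_integrable_mult_right)
  have ilJ: "ito_limit W H 0 t (J t)" if "t \<in> {0..T}" for t
    unfolding H_def J_def by (rule ito_limit_diff[OF dx(5)[OF that] dy(5)[OF that]])
  have HH: "AE w in M. \<forall>u\<in>{0..T}. (H u w)\<^sup>2 \<le> s * \<bar>z u w\<bar>"
    using dx(7) dy(7)
  proof eventually_elim
    case (elim w)
    show ?case
    proof
      fix u assume u: "u \<in> {0..T}"
      have "(H u w)\<^sup>2 = \<sigma>\<^sup>2 * (sqrt (x u w) - sqrt (y u w))\<^sup>2"
        unfolding H_def power_mult_distrib[symmetric] by (simp add: right_diff_distrib)
      also have "\<dots> \<le> s * \<bar>z u w\<bar>"
        unfolding z_def using bspec[OF elim(1) u] bspec[OF elim(2) u] s s0 by (intro mult_mono sqrt_diff_square_le) auto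
      finally show "(H u w)\<^sup>2 \<le> s * \<bar>z u w\<bar>" .
    qed
  qed
  have Veq: "AE w in M. V t w = (LINT u:{0..t}|lborel. bp u w) + J t w" if t: "t \<in> {0..T}" for t
    using dx(6)[OF t] dy(6)[OF t] dx(9) dy(9) y'i
  proof eventually_elim
    case (elim w)
    have t': "0 \<le> t" "t \<le> T" using t by auto
    note i1 = set_integrable_subinterval[OF elim(3) order_refl t'(2)] and i2 = set_integrable_subinterval[OF elim(4) order_refl t'(2)]
    have cst: "set_integrable lborel {0..t} (\<lambda>u. k1)"
      unfolding set_integrable_def by (intro integrable_scaleR_left integrable_real_indicator) (auto simp: emeasure_lborel_Icc_eq)
    have "set_integrable lborel {0..t} (\<lambda>u. b * y' u w)"
      using set_integrable_subinterval[OF elim(5) order_refl t'(2)] by (intro set_integrable_mult_right) auto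
    from set_integral_add(1)[OF cst this] have i3: "set_integrable lborel {0..t} (\<lambda>u. k1 + b * y' u w)" .
    have "(LINT u:{0..t}|lborel. bp u w) = (LINT u:{0..t}|lborel. ((k - a * x u w + b * x' u w) - (k2 - a * y u w)) - (k1 + b * y' u w))"
      by (rule arg_cong[where f="\<lambda>f. set_lebesgue_integral lborel {0..t} f"]) (simp add: bp_def k fun_eq_iff algebra_simps)
    also have "\<dots> = (LINT u:{0..t}|lborel. k - a * x u w + b * x' u w) - (LINT u:{0..t}|lborel. k2 - a * y u w) - (LINT u:{0..t}|lborel. k1 + b * y' u w)"
      unfolding set_integral_diff(2)[OF set_integral_diff(1)[OF i1 i2] i3] set_integral_diff(2)[OF i1 i2] ..
    finally have bpe: "(LINT u:{0..t}|lborel. bp u w) = (LINT u:{0..t}|lborel. k - a * x u w + b * x' u w) - (LINT u:{0..t}|lborel. k2 - a * y u w) - (LINT u:{0..t}|lborel. k1 + b * y' u w)" .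
    have z0: "(\<Sum>i\<in>grid_before 1 T t. 0::real) = 0" by simp
    show ?case unfolding V_def z_def \<delta>_def J_def bpe using elim(1,2) z0 by linarith
  qed
  have \<delta>2: "(\<integral>\<^sup>+w. ennreal ((\<delta> t w)\<^sup>2) \<partial>M) \<le> ennreal (T / real n * K2)" if "t \<in> {0..T}" for t
    unfolding \<delta>_def by (rule frozen[OF that])
  \<comment> \<open>The root mean square of the frozen drift error.\<close>
  define d where "d = sqrt (T * K2) / sqrt (real n)"
  have d: "0 < d" "d\<^sup>2 = T / real n * K2" using T C n0 by (auto simp: d_def power_divide)
  have \<delta>1: "(\<integral>\<^sup>+w. ennreal \<bar>\<delta> t w\<bar> \<partial>M) \<le> ennreal d" if "t \<in> {0..T}" for t
    by (rule mean_abs_le_root[OF \<delta>M[OF that] _ d(1)]) (use \<delta>2[OF that] d(2) in simp)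
  have sqr: "(\<integral>\<^sup>+w. (ennreal \<bar>X w\<bar>)\<^sup>2 \<partial>M) = (\<integral>\<^sup>+w. ennreal ((X w)\<^sup>2) \<partial>M)" for X :: "'a \<Rightarrow> real"
    by (intro nn_integral_cong) (simp add: ennreal_power)
  have tri: "ennreal \<bar>p\<bar> \<le> ennreal \<bar>q\<bar> + (ennreal \<bar>r\<bar> + ennreal \<bar>w\<bar>)" if "\<bar>p\<bar> \<le> \<bar>q\<bar> + (\<bar>r\<bar> + \<bar>w\<bar>)" for p q r w :: real
    using ennreal_leI[OF that] by (simp only: ennreal_plus abs_ge_zero add_nonneg_nonneg)
  have DT: "T / real n * K2 \<le> T * K2"
  proof -
    have "T / real n \<le> T / 1" using T n by (intro divide_left_mono) auto
    then show ?thesis using C by (intro mult_right_mono) auto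
  qed
  have V2: "(\<integral>\<^sup>+w. ennreal ((V t w)\<^sup>2) \<partial>M) \<le> ennreal C" if t: "t \<in> {0..T}" for t
  proof -
    have "(\<integral>\<^sup>+w. ennreal ((V t w)\<^sup>2) \<partial>M) \<le> 4 * (ennreal C0 + (ennreal C0 + ennreal (T / real n * K2)))"
    proof (rule nn_integral_three_squares)
      show "(\<lambda>w. ennreal \<bar>x t w\<bar>) \<in> borel_measurable M" "(\<lambda>w. ennreal \<bar>y t w\<bar>) \<in> borel_measurable M" "(\<lambda>w. ennreal \<bar>\<delta> t w\<bar>) \<in> borel_measurable M"
        using dx(2)[OF t] dy(2)[OF t] \<delta>M[OF t] by measurable
      show "AE w in M. ennreal \<bar>V t w\<bar> \<le> ennreal \<bar>x t w\<bar> + (ennreal \<bar>y t w\<bar> + ennreal \<bar>\<delta> t w\<bar>)"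
        by (intro AE_I2 tri) (simp add: V_def z_def)
      show "(\<integral>\<^sup>+w. (ennreal \<bar>x t w\<bar>)\<^sup>2 \<partial>M) \<le> ennreal C0" "(\<integral>\<^sup>+w. (ennreal \<bar>y t w\<bar>)\<^sup>2 \<partial>M) \<le> ennreal C0"
        "(\<integral>\<^sup>+w. (ennreal \<bar>\<delta> t w\<bar>)\<^sup>2 \<partial>M) \<le> ennreal (T / real n * K2)"
        unfolding sqr by (rule x2[OF t] y2[OF t] \<delta>2[OF t])+
    qed
    also have "\<dots> = ennreal (4 * (C0 + (C0 + T / real n * K2)))" using C T by (intro ennreal_four_sum) auto
    also have "\<dots> \<le> ennreal C" unfolding C_def using DT C by (intro ennreal_leI) simp
    finally show ?thesis .
  qed
  have z2: "(\<integral>\<^sup>+w. ennreal ((z t w)\<^sup>2) \<partial>M) \<le> ennreal C" if t: "t \<in> {0..T}" for t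
  proof -
    have "(\<integral>\<^sup>+w. ennreal ((z t w)\<^sup>2) \<partial>M) \<le> 4 * (ennreal C0 + (ennreal C0 + ennreal 0))"
    proof (rule nn_integral_three_squares[where D="\<lambda>_. 0"])
      show "(\<lambda>w. ennreal \<bar>x t w\<bar>) \<in> borel_measurable M" "(\<lambda>w. ennreal \<bar>y t w\<bar>) \<in> borel_measurable M"
        using dx(2)[OF t] dy(2)[OF t] by measurable
      have "ennreal \<bar>z t w\<bar> \<le> ennreal \<bar>x t w\<bar> + (ennreal \<bar>y t w\<bar> + ennreal \<bar>0\<bar>)" for w
        by (rule tri) (simp add: z_def)
      then show "AE w in M. ennreal \<bar>z t w\<bar> \<le> ennreal \<bar>x t w\<bar> + (ennreal \<bar>y t w\<bar> + 0)" by simp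
      show "(\<integral>\<^sup>+w. (ennreal \<bar>x t w\<bar>)\<^sup>2 \<partial>M) \<le> ennreal C0" "(\<integral>\<^sup>+w. (ennreal \<bar>y t w\<bar>)\<^sup>2 \<partial>M) \<le> ennreal C0"
        unfolding sqr by (rule x2[OF t] y2[OF t])+
    qed simp_all
    also have "\<dots> = ennreal (4 * (C0 + (C0 + 0)))" using C by (intro ennreal_four_sum) auto
    also have "\<dots> \<le> ennreal C" unfolding C_def using C T by (intro ennreal_leI) simp
    finally show ?thesis .
  qed
  have bC: "(\<integral>\<^sup>+w. ennreal ((bp t w)\<^sup>2) \<partial>M) \<le> ennreal C" if t: "t \<in> {0..T}" for t
    unfolding bp_def C_def using C T by (intro order_trans[OF b2[OF t]] ennreal_leI) simp
  have inc: "AE w in M. ennreal \<bar>V t w - V s w - (J t w - J s w)\<bar> \<le> (\<integral>\<^sup>+u\<in>{s..t}. ennreal \<bar>bp u w\<bar> \<partial>lborel)"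
    if st: "0 \<le> s" "s \<le> t" "t \<le> T" for s t
  proof -
    have "s \<in> {0..T}" "t \<in> {0..T}" using st by auto
    from Veq[OF this(1)] Veq[OF this(2)] bpi show ?thesis
    proof eventually_elim
      case (elim w)
      have "(LINT u:{0..t}|lborel. bp u w) = (LINT u:{0..s}|lborel. bp u w) + (LINT u:{s..t}|lborel. bp u w)"
        by (rule set_integral_split[OF set_integrable_subinterval[OF elim(3) order_refl st(3)] st(1,2)])
      then have "V t w - V s w - (J t w - J s w) = (LINT u:{s..t}|lborel. bp u w)" using elim(1,2) by linarith
      then show ?case
        using abs_set_integral_le[OF set_integrable_subinterval[OF elim(3) st(1,3)]] by simp
    qed
  qed
  have V0: "AE w in M. V 0 w = 0"
    using x0
  proof eventually_elim
    case (elim w)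
    have "\<delta> 0 w = 0" unfolding \<delta>_def grid_before_0[OF T] using set_integral_point[of 0 "\<lambda>u. k1 + b * y' u w"] by simp
    then show ?case using elim by (simp add: V_def z_def)
  qed
  \<comment> \<open>With this smoothing parameter \<open>d / r\<close> is bounded and \<open>ln (1 / r)\<close> is half of \<open>ln n\<close>.\<close>
  define r where "r = 1 / sqrt (real n)"
  have sn: "1 < sqrt (real n)" using n by simp
  have r: "0 < r" "r < 1" using sn by (auto simp: r_def)
  have lnn: "0 < ln (real n)" using n by simp
  have L: "ln (1 / r) = ln (real n) / 2" using n0 by (simp add: r_def ln_sqrt)
  have "(\<integral>\<^sup>+w. ennreal \<bar>V t w\<bar> \<partial>M) \<le> (\<integral>\<^sup>+u\<in>{0..t}. (\<integral>\<^sup>+w. ennreal \<bar>bp u w\<bar> \<partial>M) \<partial>lborel) +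
    ennreal ((1 + T * (2 * C + s / 2)) / ln (1 / r) + T * s * d / (2 * (ln (1 / r) * r)))"
  proof (rule yamada_estimate[where W=W and H=H and J=J and V=V and z=z and d=d and T=T and b=bp])
    show "V t \<in> borel_measurable (F t)" if "t \<in> {0..T}" for t
      unfolding V_def z_def using dx(1)[OF that] dy(1)[OF that] \<delta>F[OF that] by measurable
    show "(\<integral>\<^sup>+w. ennreal \<bar>z t w - V t w\<bar> \<partial>M) \<le> ennreal d" if "t \<in> {0..T}" for t
      using \<delta>1[OF that] by (simp add: V_def)
    show "0 \<le> C" using C T by (simp add: C_def)
  qed (fact W T s0 V2 zj z2 bj bC ilJ HH inc V0 t r less_imp_le[OF d(1)])+
  moreover have "(1 + T * (2 * C + s / 2)) / ln (1 / r) + T * s * d / (2 * (ln (1 / r) * r)) =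
     (2 * (1 + T * (2 * C + s / 2)) + T * s * sqrt (T * K2)) / ln (real n)"
  proof -
    have "T * s * d / (2 * (ln (1 / r) * r)) = T * s * sqrt (T * K2) / ln (real n)"
      unfolding L unfolding d_def r_def using sn lnn n0 by (simp add: field_simps)
    moreover have "(1 + T * (2 * C + s / 2)) / ln (1 / r) = 2 * (1 + T * (2 * C + s / 2)) / ln (real n)"
      unfolding L by simp
    ultimately show ?thesis by (simp only: add_divide_distrib)
  qed
  ultimately have VE: "(\<integral>\<^sup>+w. ennreal \<bar>V t w\<bar> \<partial>M) \<le> (\<integral>\<^sup>+u\<in>{0..t}. (\<integral>\<^sup>+w. ennreal \<bar>bp u w\<bar> \<partial>M) \<partial>lborel) +
    ennreal ((2 * (1 + T * (2 * C + s / 2)) + T * s * sqrt (T * K2)) / ln (real n))" by simp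
  have dle: "d \<le> 2 * sqrt (T * K2) / ln (real n)"
  proof -
    have "ln (sqrt (real n)) \<le> sqrt (real n) - 1" using sn by (intro ln_le_minus_one) simp
    then have "ln (real n) \<le> 2 * sqrt (real n)" using n0 by (simp add: ln_sqrt)
    then have "1 / sqrt (real n) \<le> 2 / ln (real n)" using lnn sn by (simp add: field_simps)
    then have "sqrt (T * K2) * (1 / sqrt (real n)) \<le> sqrt (T * K2) * (2 / ln (real n))"
      using T C by (intro mult_left_mono) auto
    then show ?thesis by (simp add: d_def mult.commute)
  qed
  have "(\<integral>\<^sup>+w. ennreal \<bar>x t w - y t w\<bar> \<partial>M) \<le> (\<integral>\<^sup>+w. ennreal \<bar>V t w\<bar> + ennreal \<bar>\<delta> t w\<bar> \<partial>M)"
    by (intro nn_integral_mono) (simp add: V_def z_def ennreal_plus[symmetric] ennreal_leI del: ennreal_plus)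
  also have "\<dots> = (\<integral>\<^sup>+w. ennreal \<bar>V t w\<bar> \<partial>M) + (\<integral>\<^sup>+w. ennreal \<bar>\<delta> t w\<bar> \<partial>M)"
    using zM[OF t] \<delta>M[OF t] unfolding V_def by (intro nn_integral_add; measurable)
  also have "\<dots> \<le> ((\<integral>\<^sup>+u\<in>{0..t}. (\<integral>\<^sup>+w. ennreal \<bar>bp u w\<bar> \<partial>M) \<partial>lborel) +
    ennreal ((2 * (1 + T * (2 * C + s / 2)) + T * s * sqrt (T * K2)) / ln (real n))) + ennreal (2 * sqrt (T * K2) / ln (real n))"
    by (intro add_mono VE order_trans[OF \<delta>1[OF t]] ennreal_leI dle)
  also have "\<dots> = (\<integral>\<^sup>+u\<in>{0..t}. (\<integral>\<^sup>+w. ennreal \<bar>bp u w\<bar> \<partial>M) \<partial>lborel) +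
    ennreal ((2 * (1 + T * (2 * C + s / 2)) + T * s * sqrt (T * K2)) / ln (real n) + 2 * sqrt (T * K2) / ln (real n))"
  proof -
    have "0 \<le> (2 * (1 + T * (2 * C + s / 2)) + T * s * sqrt (T * K2)) / ln (real n)" "0 \<le> 2 * sqrt (T * K2) / ln (real n)"
      using lnn T C s0 by (auto simp: C_def)
    then show ?thesis by (simp only: ennreal_plus add.assoc)
  qed
  finally show "(\<integral>\<^sup>+w. ennreal \<bar>x t w - y t w\<bar> \<partial>M) \<le>
      (\<integral>\<^sup>+u\<in>{0..t}. (\<integral>\<^sup>+w. ennreal \<bar>b * (x' u w - y' u w) - a * (x u w - y u w)\<bar> \<partial>M) \<partial>lborel) +
      ennreal ((2 * (1 + T * (2 * C + s / 2)) + T * s * sqrt (T * K2) + 2 * sqrt (T * K2)) / ln (real n))"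
    by (simp only: bp_def add_divide_distrib)
  have t': "0 \<le> t" "t \<le> T" using t by auto
  have babs: "jointly_measurable M 0 T (\<lambda>u w. \<bar>bp u w\<bar>)" by (rule jointly_measurable_compose[OF bj]) measurable
  have zabs: "jointly_measurable M 0 T (\<lambda>u w. \<bar>z u w\<bar>)" by (rule jointly_measurable_compose[OF zj]) measurable
  have "(\<integral>\<^sup>+w. ennreal ((z t w)\<^sup>2) \<partial>M) \<le> 4 * (ennreal (T / real n * K2) +
      (ennreal T * (\<integral>\<^sup>+u\<in>{0..t}. (\<integral>\<^sup>+w. ennreal ((bp u w)\<^sup>2) \<partial>M) \<partial>lborel) +
       ennreal s * (\<integral>\<^sup>+u\<in>{0..t}. (\<integral>\<^sup>+w. ennreal \<bar>z u w\<bar> \<partial>M) \<partial>lborel)))"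
  proof (rule nn_integral_three_squares)
    show "(\<lambda>w. ennreal \<bar>\<delta> t w\<bar>) \<in> borel_measurable M" using \<delta>M[OF t] by measurable
    show "(\<lambda>w. \<integral>\<^sup>+u\<in>{0..t}. ennreal \<bar>bp u w\<bar> \<partial>lborel) \<in> borel_measurable M"
      by (rule nn_integral_time_commute(2)[OF babs order_refl t'(2)])
    show "(\<lambda>w. ennreal \<bar>J t w\<bar>) \<in> borel_measurable M" using ito_limitD(5)[OF ilJ[OF t]] by measurable
    show "AE w in M. ennreal \<bar>z t w\<bar> \<le> ennreal \<bar>\<delta> t w\<bar> + ((\<integral>\<^sup>+u\<in>{0..t}. ennreal \<bar>bp u w\<bar> \<partial>lborel) + ennreal \<bar>J t w\<bar>)"
      using Veq[OF t] bpi
    proof eventually_elim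
      case (elim w)
      have "z t w = \<delta> t w + ((LINT u:{0..t}|lborel. bp u w) + J t w)" using elim(1) by (simp add: V_def)
      then have "ennreal \<bar>z t w\<bar> \<le> ennreal \<bar>\<delta> t w\<bar> + (ennreal \<bar>LINT u:{0..t}|lborel. bp u w\<bar> + ennreal \<bar>J t w\<bar>)"
        by (intro tri) linarith
      also have "\<dots> \<le> ennreal \<bar>\<delta> t w\<bar> + ((\<integral>\<^sup>+u\<in>{0..t}. ennreal \<bar>bp u w\<bar> \<partial>lborel) + ennreal \<bar>J t w\<bar>)"
        by (intro add_left_mono add_right_mono abs_set_integral_le[OF set_integrable_subinterval[OF elim(2) order_refl t'(2)]])
      finally show ?case .
    qed
    show "(\<integral>\<^sup>+w. (ennreal \<bar>\<delta> t w\<bar>)\<^sup>2 \<partial>M) \<le> ennreal (T / real n * K2)" unfolding sqr by (rule \<delta>2[OF t])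
    show "(\<integral>\<^sup>+w. (\<integral>\<^sup>+u\<in>{0..t}. ennreal \<bar>bp u w\<bar> \<partial>lborel)\<^sup>2 \<partial>M) \<le> ennreal T * (\<integral>\<^sup>+u\<in>{0..t}. (\<integral>\<^sup>+w. ennreal ((bp u w)\<^sup>2) \<partial>M) \<partial>lborel)"
      by (rule order_trans[OF time_integral_square_le[OF bj order_refl t']]) (use t' in \<open>auto intro!: mult_right_mono ennreal_leI\<close>)
    have "(\<integral>\<^sup>+w. (ennreal \<bar>J t w\<bar>)\<^sup>2 \<partial>M) \<le> (\<integral>\<^sup>+w. energy 0 t H w \<partial>M)"
      unfolding sqr by (rule ito_second_moment[OF W ilJ[OF t]])
    also have "\<dots> \<le> (\<integral>\<^sup>+w. ennreal s * (\<integral>\<^sup>+u\<in>{0..t}. ennreal \<bar>z u w\<bar> \<partial>lborel) \<partial>M)"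
    proof (rule nn_integral_mono_AE)
      show "AE w in M. energy 0 t H w \<le> ennreal s * (\<integral>\<^sup>+u\<in>{0..t}. ennreal \<bar>z u w\<bar> \<partial>lborel)"
        using HH AE_space
      proof eventually_elim
        case (elim w)
        show ?case by (rule energy_le_time_integral[OF zj order_refl t'(2) s0 _ elim(2)]) (use elim(1) t' in auto)
      qed
    qed
    also have "\<dots> = ennreal s * (\<integral>\<^sup>+u\<in>{0..t}. (\<integral>\<^sup>+w. ennreal \<bar>z u w\<bar> \<partial>M) \<partial>lborel)"
      unfolding nn_integral_cmult[OF nn_integral_time_commute(2)[OF zabs order_refl t'(2)]] nn_integral_time_commute(1)[OF zabs order_refl t'(2)] ..
    finally show "(\<integral>\<^sup>+w. (ennreal \<bar>J t w\<bar>)\<^sup>2 \<partial>M) \<le> ennreal s * (\<integral>\<^sup>+u\<in>{0..t}. (\<integral>\<^sup>+w. ennreal \<bar>z u w\<bar> \<partial>M) \<partial>lborel)" .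
  qed
  then show "(\<integral>\<^sup>+w. ennreal ((x t w - y t w)\<^sup>2) \<partial>M) \<le> 4 * (ennreal (T / real n * K2) +
      (ennreal T * (\<integral>\<^sup>+u\<in>{0..t}. (\<integral>\<^sup>+w. ennreal ((b * (x' u w - y' u w) - a * (x u w - y u w))\<^sup>2) \<partial>M) \<partial>lborel) +
       ennreal s * (\<integral>\<^sup>+u\<in>{0..t}. (\<integral>\<^sup>+w. ennreal \<bar>x u w - y u w\<bar> \<partial>M) \<partial>lborel)))"
    by (simp only: z_def bp_def)
qed

end

section \<open>Error of the splitting approximation\<close>

text \<open>Adding the two inequalities gives one for the sum; the grid sum of
  \<open>gronwall_with_grid\<close> is nonnegative and may be included at no cost.\<close>

lemma coupled_gronwall:
  fixes p q :: "real \<Rightarrow> ennreal"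
  assumes T: "T > 0" and c: "c \<ge> 0" "K \<ge> 0"
    and bounded: "\<And>t. t \<in> {0..T} \<Longrightarrow> p t \<le> ennreal B" "\<And>t. t \<in> {0..T} \<Longrightarrow> q t \<le> ennreal B"
    and le: "\<And>t. t \<in> {0..T} \<Longrightarrow> p t \<le> ennreal c + ennreal K * (\<integral>\<^sup>+u\<in>{0..t}. (p u + q u) \<partial>lborel)"
      "\<And>t. t \<in> {0..T} \<Longrightarrow> q t \<le> ennreal c + ennreal K * (\<integral>\<^sup>+u\<in>{0..t}. (p u + q u) \<partial>lborel)"
    and t: "t \<in> {0..T}"
  shows "p t + q t \<le> ennreal (gronwall_factor (2 * K + 1) T * (2 * c))"
proof (rule gronwall_with_grid[where n=1 and B="\<bar>B\<bar> + \<bar>B\<bar>" and v="\<lambda>t. p t + q t"])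
  show "p t + q t \<le> ennreal (\<bar>B\<bar> + \<bar>B\<bar>)" if "t \<in> {0..T}" for t
  proof -
    have "ennreal B \<le> ennreal \<bar>B\<bar>" by (intro ennreal_leI) simp
    then have "p t \<le> ennreal \<bar>B\<bar>" "q t \<le> ennreal \<bar>B\<bar>" using bounded[OF that] by (auto intro: order_trans)
    then have "p t + q t \<le> ennreal \<bar>B\<bar> + ennreal \<bar>B\<bar>" by (rule add_mono)
    then show ?thesis by (simp only: ennreal_plus abs_ge_zero)
  qed
  show "p t + q t \<le> ennreal (2 * c) + ennreal (2 * K + 1) *
      ((\<Sum>i | i < 1 \<and> real i * (T / real 1) < t. ennreal (T / real 1) * (p (real i * (T / real 1)) + q (real i * (T / real 1)))) +
       (\<integral>\<^sup>+u\<in>{0..t}. (p u + q u) \<partial>lborel))" if "t \<in> {0..T}" for t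
  proof -
    let ?I = "\<integral>\<^sup>+u\<in>{0..t}. (p u + q u) \<partial>lborel"
    let ?S = "\<Sum>i | i < 1 \<and> real i * (T / real 1) < t. ennreal (T / real 1) * (p (real i * (T / real 1)) + q (real i * (T / real 1)))"
    have "p t + q t \<le> (ennreal c + ennreal K * ?I) + (ennreal c + ennreal K * ?I)"
      by (intro add_mono le that)
    also have "\<dots> = (ennreal c + ennreal c) + (ennreal K + ennreal K) * ?I" by (simp add: distrib_right add_ac)
    also have "\<dots> = ennreal (2 * c) + ennreal (2 * K) * ?I" using c by (simp only: ennreal_plus mult_2)
    also have "\<dots> \<le> ennreal (2 * c) + ennreal (2 * K + 1) * (?S + ?I)"
      by (intro add_left_mono mult_mono ennreal_leI add_increasing[OF zero_le order_refl]) auto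
    finally show ?thesis .
  qed
qed (use T c t in auto)

context complete_filtered_prob_space
begin

lemma mean_measurable_in_time:
  assumes "jointly_measurable M a b S"
  shows "(\<lambda>u. (\<integral>\<^sup>+w. ennreal (S u w) \<partial>M) * indicator {a..b} u) \<in> borel_measurable lborel"
proof -
  have "(\<lambda>u. \<integral>\<^sup>+w. ennreal (indicator {a..b} u * S u w) \<partial>M) \<in> borel_measurable lborel"
    using borel_measurable_nn_integral_fst[OF jointly_measurable_nn[OF assms]] by simp
  also have "(\<lambda>u. \<integral>\<^sup>+w. ennreal (indicator {a..b} u * S u w) \<partial>M) = (\<lambda>u. (\<integral>\<^sup>+w. ennreal (S u w) \<partial>M) * indicator {a..b} u)"
    by (auto simp: fun_eq_iff indicator_def)
  finally show ?thesis .
qed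

lemma time_integral_le_of_means:
  assumes X: "jointly_measurable M 0 T X" and Y: "jointly_measurable M 0 T Y" and t: "t \<le> T"
    and le: "\<And>u. u \<in> {0..t} \<Longrightarrow> g u \<le> c * ((\<integral>\<^sup>+w. ennreal (X u w) \<partial>M) + (\<integral>\<^sup>+w. ennreal (Y u w) \<partial>M))"
  shows "(\<integral>\<^sup>+u\<in>{0..t}. g u \<partial>lborel) \<le> c * (\<integral>\<^sup>+u\<in>{0..t}. ((\<integral>\<^sup>+w. ennreal (X u w) \<partial>M) + (\<integral>\<^sup>+w. ennreal (Y u w) \<partial>M)) \<partial>lborel)"
proof -
  note m = mean_measurable_in_time[OF jointly_measurable_subset[OF X order_refl t]]
    mean_measurable_in_time[OF jointly_measurable_subset[OF Y order_refl t]]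
  have "(\<lambda>u. ((\<integral>\<^sup>+w. ennreal (X u w) \<partial>M) + (\<integral>\<^sup>+w. ennreal (Y u w) \<partial>M)) * indicator {0..t} u) \<in> borel_measurable lborel"
    using borel_measurable_add[OF m] by (simp add: distrib_right)
  from nn_integral_cmult[OF this, of c]
  have "c * (\<integral>\<^sup>+u\<in>{0..t}. ((\<integral>\<^sup>+w. ennreal (X u w) \<partial>M) + (\<integral>\<^sup>+w. ennreal (Y u w) \<partial>M)) \<partial>lborel)
    = (\<integral>\<^sup>+u. c * (((\<integral>\<^sup>+w. ennreal (X u w) \<partial>M) + (\<integral>\<^sup>+w. ennreal (Y u w) \<partial>M)) * indicator {0..t} u) \<partial>lborel)" by simp
  moreover have "(\<integral>\<^sup>+u\<in>{0..t}. g u \<partial>lborel) \<le> \<dots>"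
    using le by (intro nn_integral_mono) (auto simp: indicator_def)
  ultimately show ?thesis by simp
qed

lemma mean_abs_combination_le:
  assumes [measurable]: "X \<in> borel_measurable M" "Y \<in> borel_measurable M" and "\<bar>a\<bar> \<le> K" "\<bar>b\<bar> \<le> K"
  shows "(\<integral>\<^sup>+w. ennreal \<bar>b * Y w - a * X w\<bar> \<partial>M) \<le> ennreal K * ((\<integral>\<^sup>+w. ennreal \<bar>X w\<bar> \<partial>M) + (\<integral>\<^sup>+w. ennreal \<bar>Y w\<bar> \<partial>M))"
proof -
  have K: "0 \<le> K" using assms(3) by linarith
  have "(\<integral>\<^sup>+w. ennreal \<bar>b * Y w - a * X w\<bar> \<partial>M) \<le> (\<integral>\<^sup>+w. ennreal K * (ennreal \<bar>X w\<bar> + ennreal \<bar>Y w\<bar>) \<partial>M)"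
  proof (rule nn_integral_mono)
    fix w
    have "\<bar>b * Y w - a * X w\<bar> \<le> \<bar>b\<bar> * \<bar>Y w\<bar> + \<bar>a\<bar> * \<bar>X w\<bar>" by (simp add: abs_mult[symmetric])
    also have "\<dots> \<le> K * \<bar>Y w\<bar> + K * \<bar>X w\<bar>" using assms(3,4) by (intro add_mono mult_right_mono) auto
    finally have "\<bar>b * Y w - a * X w\<bar> \<le> K * (\<bar>X w\<bar> + \<bar>Y w\<bar>)" by (simp add: distrib_left)
    from ennreal_leI[OF this] show "ennreal \<bar>b * Y w - a * X w\<bar> \<le> ennreal K * (ennreal \<bar>X w\<bar> + ennreal \<bar>Y w\<bar>)"
      using K by (simp only: ennreal_mult ennreal_plus abs_ge_zero add_nonneg_nonneg)
  qed
  then show ?thesis by (simp add: nn_integral_cmult nn_integral_add)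
qed

lemma mean_square_combination_le:
  assumes [measurable]: "X \<in> borel_measurable M" "Y \<in> borel_measurable M" and K: "0 \<le> K"
    and le: "AE w in M. \<bar>Z w\<bar> \<le> K * (\<bar>X w\<bar> + \<bar>Y w\<bar>)"
  shows "(\<integral>\<^sup>+w. ennreal ((Z w)\<^sup>2) \<partial>M) \<le> ennreal (2 * K\<^sup>2) * ((\<integral>\<^sup>+w. ennreal ((X w)\<^sup>2) \<partial>M) + (\<integral>\<^sup>+w. ennreal ((Y w)\<^sup>2) \<partial>M))"
proof -
  have "(\<integral>\<^sup>+w. ennreal ((Z w)\<^sup>2) \<partial>M) \<le> (\<integral>\<^sup>+w. ennreal (2 * K\<^sup>2) * (ennreal ((X w)\<^sup>2) + ennreal ((Y w)\<^sup>2)) \<partial>M)"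
  proof (rule nn_integral_mono_AE, use le in eventually_elim)
    fix w assume "\<bar>Z w\<bar> \<le> K * (\<bar>X w\<bar> + \<bar>Y w\<bar>)"
    then have "\<bar>Z w\<bar>\<^sup>2 \<le> (K * (\<bar>X w\<bar> + \<bar>Y w\<bar>))\<^sup>2" by (intro power_mono) auto
    also have "\<dots> \<le> K\<^sup>2 * (2 * ((X w)\<^sup>2 + (Y w)\<^sup>2))"
    proof -
      have "0 \<le> (\<bar>X w\<bar> - \<bar>Y w\<bar>)\<^sup>2" by simp
      then have "(\<bar>X w\<bar> + \<bar>Y w\<bar>)\<^sup>2 \<le> 2 * ((X w)\<^sup>2 + (Y w)\<^sup>2)" by (simp add: power2_diff power2_sum)
      then show ?thesis unfolding power_mult_distrib by (intro mult_left_mono) auto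
    qed
    finally have "(Z w)\<^sup>2 \<le> (2 * K\<^sup>2) * ((X w)\<^sup>2 + (Y w)\<^sup>2)" by (simp add: algebra_simps)
    from ennreal_leI[OF this] show "ennreal ((Z w)\<^sup>2) \<le> ennreal (2 * K\<^sup>2) * (ennreal ((X w)\<^sup>2) + ennreal ((Y w)\<^sup>2))"
      by (simp only: ennreal_mult ennreal_plus zero_le_power2 add_nonneg_nonneg mult_nonneg_nonneg zero_le_numeral)
  qed
  then show ?thesis by (simp add: nn_integral_cmult nn_integral_add)
qed

lemma nonneg_part_square_le:
  assumes "AE w in M. 0 \<le> X w" "AE w in M. 0 \<le> Y w"
    and "(\<integral>\<^sup>+w. ennreal ((X w + Y w)\<^sup>2) \<partial>M) \<le> ennreal C"
  shows "(\<integral>\<^sup>+w. ennreal ((X w)\<^sup>2) \<partial>M) \<le> ennreal C" "(\<integral>\<^sup>+w. ennreal ((Y w)\<^sup>2) \<partial>M) \<le> ennreal C"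
proof -
  have "(\<integral>\<^sup>+w. ennreal ((X w)\<^sup>2) \<partial>M) \<le> (\<integral>\<^sup>+w. ennreal ((X w + Y w)\<^sup>2) \<partial>M)"
    using assms(1,2) by (intro nn_integral_mono_AE, eventually_elim) (intro ennreal_leI power_mono, auto)
  moreover have "(\<integral>\<^sup>+w. ennreal ((Y w)\<^sup>2) \<partial>M) \<le> (\<integral>\<^sup>+w. ennreal ((X w + Y w)\<^sup>2) \<partial>M)"
    using assms(1,2) by (intro nn_integral_mono_AE, eventually_elim) (intro ennreal_leI power_mono, auto)
  ultimately show "(\<integral>\<^sup>+w. ennreal ((X w)\<^sup>2) \<partial>M) \<le> ennreal C" "(\<integral>\<^sup>+w. ennreal ((Y w)\<^sup>2) \<partial>M) \<le> ennreal C"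
    using assms(3) by (auto intro: order_trans)
qed

text \<open>The constant is built from bounds that hold uniformly in \<open>n\<close>: the second
  moments of all components, the frozen drift errors, and the factors of two applications of
  Gronwall's lemma. The first application bounds the mean absolute errors, the second one uses this
  bound in the mean square inequality.\<close>

lemma splitting_mean_square_error:
  assumes W: "wiener_process M F W1" "wiener_process M F W2"
    and T: "0 < T" and \<sigma>: "0 < \<sigma>1" "0 < \<sigma>2"
    and lam: "0 \<le> lam11" "0 \<le> lam12" "0 \<le> lam21" "0 \<le> lam22"
    and k: "k = k1 + k2" and l: "l = l1 + l2" and pos: "0 \<le> x10" "0 \<le> x20"
    and x: "two_factor_CIR M F W1 W2 T k l \<sigma>1 \<sigma>2 lam11 lam12 lam21 lam22 x10 x20 x1 x2"
  shows "\<exists>B\<ge>0. \<forall>n\<ge>2. \<forall>y1 y2.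
     CIR_splitting_approximation M F W1 W2 T k1 k2 l1 l2 \<sigma>1 \<sigma>2 lam11 lam12 lam21 lam22 x10 x20 n y1 y2 \<longrightarrow>
     (\<forall>t\<in>{0..T}. x1 t \<in> borel_measurable M \<and> x2 t \<in> borel_measurable M \<and>
        y1 t \<in> borel_measurable M \<and> y2 t \<in> borel_measurable M \<and>
        (\<integral>\<^sup>+w. ennreal ((x1 t w - y1 t w)\<^sup>2) \<partial>M) + (\<integral>\<^sup>+w. ennreal ((x2 t w - y2 t w)\<^sup>2) \<partial>M) \<le> ennreal (B / ln (real n)))"
proof -
  define q where "q = \<bar>k\<bar> + \<bar>l\<bar> + \<bar>k1\<bar> + \<bar>l1\<bar> + \<bar>k2\<bar> + \<bar>l2\<bar>"
  define \<kappa> where "\<kappa> = lam11 + lam12 + lam21 + lam22"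
  define s where "s = \<sigma>1\<^sup>2 + \<sigma>2\<^sup>2"
  define C0 where "C0 = moment_bound (x10 + x20 + 4 * q * T) (2 * \<kappa>) s T"
  define C1 where "C1 = 2 * q\<^sup>2 + 2 * \<kappa>\<^sup>2 * C0"
  define K\<^sub>1 where "K\<^sub>1 = 4 * T\<^sup>2 * (lam12\<^sup>2 * (8 * T * C1 + 4 * \<sigma>2\<^sup>2 * (1 + C0))) + 8 * T * (2 * k1\<^sup>2 + 2 * lam12\<^sup>2 * C0)"
  define K\<^sub>2 where "K\<^sub>2 = 4 * T\<^sup>2 * (lam22\<^sup>2 * (8 * T * C1 + 4 * \<sigma>1\<^sup>2 * (1 + C0))) + 8 * T * (2 * l1\<^sup>2 + 2 * lam22\<^sup>2 * C0)"
  define K where "K = K\<^sub>1 + K\<^sub>2 + 1"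
  define Cb where "Cb = 2 * \<kappa>\<^sup>2 * (C0 + C0)"
  define A where "A = 2 * (1 + T * (2 * (8 * C0 + 4 * T * K + Cb) + s / 2)) + T * s * sqrt (T * K) + 2 * sqrt (T * K)"
  \<comment> \<open>Rates of the mean absolute error and of the mean square error.\<close>
  define B1 where "B1 = gronwall_factor (2 * \<kappa> + 1) T * (2 * A)"
  define B2 where "B2 = gronwall_factor (2 * (8 * T * \<kappa>\<^sup>2) + 1) T * (2 * (4 * (T * K + s * (T * B1))))"
  have q0: "0 \<le> q" and \<kappa>0: "0 \<le> \<kappa>" and s0: "0 \<le> s" using lam by (auto simp: q_def \<kappa>_def s_def)
  have qs: "\<bar>k\<bar> \<le> q" "\<bar>l\<bar> \<le> q" "\<bar>k1\<bar> \<le> q" "\<bar>l1\<bar> \<le> q" "\<bar>k2\<bar> \<le> q" "\<bar>l2\<bar> \<le> q" by (auto simp: q_def)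
  have \<kappa>s: "\<bar>lam11\<bar> \<le> \<kappa>" "\<bar>lam12\<bar> \<le> \<kappa>" "\<bar>lam21\<bar> \<le> \<kappa>" "\<bar>lam22\<bar> \<le> \<kappa>" using lam by (auto simp: \<kappa>_def)
  have \<kappa>z: "\<bar>0\<bar> \<le> \<kappa>" using \<kappa>0 by simp
  have \<sigma>s: "\<sigma>1\<^sup>2 \<le> s" "\<sigma>2\<^sup>2 \<le> s" by (auto simp: s_def)
  have C00: "0 \<le> C0" using T s0 by (simp add: C0_def moment_bound_def gronwall_factor_def)
  have C10: "0 \<le> C1" using C00 by (simp add: C1_def)
  have K12: "0 \<le> K\<^sub>1" "0 \<le> K\<^sub>2" unfolding K\<^sub>1_def K\<^sub>2_def using C00 C10 T by (intro add_nonneg_nonneg mult_nonneg_nonneg; simp)+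
  then have K0: "0 < K" "K\<^sub>1 \<le> K" "K\<^sub>2 \<le> K" by (auto simp: K_def)
  have Cb0: "0 \<le> Cb" using C00 by (simp add: Cb_def)
  have A0: "0 \<le> A" unfolding A_def using T C00 K0(1) Cb0 s0 by (intro add_nonneg_nonneg mult_nonneg_nonneg) auto
  have B10: "0 \<le> B1" using A0 by (simp add: B1_def gronwall_factor_def)
  have TK0: "0 \<le> T * K + s * (T * B1)" using T K0(1) s0 B10 by simp
  have B20: "0 \<le> B2" using TK0 unfolding B2_def gronwall_factor_def by (intro mult_nonneg_nonneg) auto
  \<comment> \<open>A drift term of either component is controlled by the sum of the components.\<close>
  have lin: "\<bar>p - a * u + b * v\<bar> \<le> q + \<kappa> * (u + v)"
    if "\<bar>p\<bar> \<le> q" "\<bar>a\<bar> \<le> \<kappa>" "\<bar>b\<bar> \<le> \<kappa>" "0 \<le> u" "0 \<le> v" for p a b u v :: real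
  proof -
    have "\<bar>a * u\<bar> \<le> \<kappa> * u" "\<bar>b * v\<bar> \<le> \<kappa> * v" unfolding abs_mult using that by (auto intro: mult_right_mono)
    then show ?thesis using that(1) unfolding distrib_left by linarith
  qed
  note x' = x[unfolded two_factor_CIR_def]
  have x0: "AE w in M. x1 0 w = x10" "AE w in M. x2 0 w = x20" using x' by auto
  have "\<exists>J. cir_component W1 \<sigma>1 1 T x10 (\<lambda>_ _. 0) (\<lambda>u w. k - lam11 * x1 u w + lam12 * x2 u w) x1 J"
  proof (rule cir_component_exists[where y=x1, OF W(1) T zero_less_one \<sigma>(1)])
    show "sqrt_diffusion M F W1 \<sigma>1 (real j * (T / real 1)) (real (Suc j) * (T / real 1)) (\<lambda>_. x10) (\<lambda>u w. k - lam11 * x1 u w + lam12 * x2 u w) x1" if "j < 1" for j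
      using that x' by simp
    show "AE w in M. x10 = x1 (real j * (T / real 1)) w + 0" if "j < 1" for j
      using x0(1) that by (simp add: eq_commute[of x10])
  qed (fact x0(1) pos(1))+
  then obtain Jx1 where cx1: "cir_component W1 \<sigma>1 1 T x10 (\<lambda>_ _. 0) (\<lambda>u w. k - lam11 * x1 u w + lam12 * x2 u w) x1 Jx1" by blast
  have "\<exists>J. cir_component W2 \<sigma>2 1 T x20 (\<lambda>_ _. 0) (\<lambda>u w. l - lam21 * x2 u w + lam22 * x1 u w) x2 J"
  proof (rule cir_component_exists[where y=x2, OF W(2) T zero_less_one \<sigma>(2)])
    show "sqrt_diffusion M F W2 \<sigma>2 (real j * (T / real 1)) (real (Suc j) * (T / real 1)) (\<lambda>_. x20) (\<lambda>u w. l - lam21 * x2 u w + lam22 * x1 u w) x2" if "j < 1" for j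
      using that x' by simp
    show "AE w in M. x20 = x2 (real j * (T / real 1)) w + 0" if "j < 1" for j
      using x0(2) that by (simp add: eq_commute[of x20])
  qed (fact x0(2) pos(2))+
  then obtain Jx2 where cx2: "cir_component W2 \<sigma>2 1 T x20 (\<lambda>_ _. 0) (\<lambda>u w. l - lam21 * x2 u w + lam22 * x1 u w) x2 Jx2" by blast
  note dx1 = cir_componentD[OF cx1 T] and dx2 = cir_componentD[OF cx2 T]
  have x2m: "(\<integral>\<^sup>+w. ennreal ((x1 t w + x2 t w)\<^sup>2) \<partial>M) \<le> ennreal C0" if t: "t \<in> {0..T}" for t
    unfolding C0_def s_def
  proof (rule pair_second_moment[OF W cx1 cx2 T zero_less_one \<sigma>(1) pos q0 \<kappa>0 _ _ t])
    show "AE w in M. \<forall>i<1. \<bar>0\<bar> \<le> T / real 1 * (q + \<kappa> * (x1 (real i * (T / real 1)) w + x2 (real i * (T / real 1)) w))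
      \<and> \<bar>0\<bar> \<le> T / real 1 * (q + \<kappa> * (x1 (real i * (T / real 1)) w + x2 (real i * (T / real 1)) w))"
      using dx1(7) dx2(7)
    proof eventually_elim
      case (elim w)
      have "0 \<le> x1 0 w" "0 \<le> x2 0 w" using elim T by auto
      then show ?case using T q0 \<kappa>0 by simp
    qed
    show "AE w in M. \<forall>u\<in>{0..T}. \<bar>k - lam11 * x1 u w + lam12 * x2 u w\<bar> \<le> q + \<kappa> * (x1 u w + x2 u w)
      \<and> \<bar>l - lam21 * x2 u w + lam22 * x1 u w\<bar> \<le> q + \<kappa> * (x1 u w + x2 u w)"
      using dx1(7) dx2(7)
    proof eventually_elim
      case (elim w)
      show ?case
      proof
        fix u assume "u \<in> {0..T}"
        then have "0 \<le> x1 u w" "0 \<le> x2 u w" using elim by auto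
        from lin[OF qs(1) \<kappa>s(1,2) this] lin[OF qs(2) \<kappa>s(3,4) this(2,1)]
        show "\<bar>k - lam11 * x1 u w + lam12 * x2 u w\<bar> \<le> q + \<kappa> * (x1 u w + x2 u w)
          \<and> \<bar>l - lam21 * x2 u w + lam22 * x1 u w\<bar> \<le> q + \<kappa> * (x1 u w + x2 u w)" by (simp add: add.commute)
      qed
    qed
  qed
  have AEat: "AE w in M. 0 \<le> Z t w" if "AE w in M. \<forall>t\<in>{0..T}. 0 \<le> Z t w" "t \<in> {0..T}" for Z :: "real \<Rightarrow> 'a \<Rightarrow> real" and t
    using that(1) by eventually_elim (use that(2) in blast)
  have main: "x1 t \<in> borel_measurable M \<and> x2 t \<in> borel_measurable M \<and>
        y1 t \<in> borel_measurable M \<and> y2 t \<in> borel_measurable M \<and>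
        (\<integral>\<^sup>+w. ennreal ((x1 t w - y1 t w)\<^sup>2) \<partial>M) + (\<integral>\<^sup>+w. ennreal ((x2 t w - y2 t w)\<^sup>2) \<partial>M) \<le> ennreal (B2 / ln (real n))"
    if n: "2 \<le> n" and y: "CIR_splitting_approximation M F W1 W2 T k1 k2 l1 l2 \<sigma>1 \<sigma>2 lam11 lam12 lam21 lam22 x10 x20 n y1 y2"
      and t: "t \<in> {0..T}" for n y1 y2 t
  proof -
    have n0: "0 < n" "0 < real n" and lnn: "0 < ln (real n)" using n by auto
    note y' = y[unfolded CIR_splitting_approximation_def Let_def]
    have y0: "AE w in M. y1 0 w = x10" "AE w in M. y2 0 w = x20" using y' by auto
    define c1 where "c1 i w = T / real n * (k1 + lam12 * y2 (real i * (T / real n)) w)" for i w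
    define c2 where "c2 i w = T / real n * (l1 + lam22 * y1 (real i * (T / real n)) w)" for i w
    have "\<exists>J. cir_component W1 \<sigma>1 n T x10 c1 (\<lambda>u w. k2 - lam11 * y1 u w) y1 J"
    proof (rule cir_component_exists[where y=y1, OF W(1) T n0(1) \<sigma>(1)])
      show "sqrt_diffusion M F W1 \<sigma>1 (real j * (T / real n)) (real (Suc j) * (T / real n))
        (\<lambda>w. y1 (real j * (T / real n)) w + T / real n * lam12 * y2 (real j * (T / real n)) w + T / real n * k1)
        (\<lambda>u w. k2 - lam11 * y1 u w) y1" if "j < n" for j using y' that by blast
    qed (simp add: c1_def distrib_left mult.assoc, fact y0(1), fact pos(1))
    then obtain Jy1 where cy1: "cir_component W1 \<sigma>1 n T x10 c1 (\<lambda>u w. k2 - lam11 * y1 u w) y1 Jy1" by blast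
    have "\<exists>J. cir_component W2 \<sigma>2 n T x20 c2 (\<lambda>u w. l2 - lam21 * y2 u w) y2 J"
    proof (rule cir_component_exists[where y=y2, OF W(2) T n0(1) \<sigma>(2)])
      show "sqrt_diffusion M F W2 \<sigma>2 (real j * (T / real n)) (real (Suc j) * (T / real n))
        (\<lambda>w. y2 (real j * (T / real n)) w + T / real n * lam22 * y1 (real j * (T / real n)) w + T / real n * l1)
        (\<lambda>u w. l2 - lam21 * y2 u w) y2" if "j < n" for j using y' that by blast
    qed (simp add: c2_def distrib_left mult.assoc, fact y0(2), fact pos(2))
    then obtain Jy2 where cy2: "cir_component W2 \<sigma>2 n T x20 c2 (\<lambda>u w. l2 - lam21 * y2 u w) y2 Jy2" by blast
    note dy1 = cir_componentD[OF cy1 T] and dy2 = cir_componentD[OF cy2 T]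
    define G where "G u w = q + \<kappa> * (y1 u w + y2 u w)" for u w
    have grid: "real i * (T / real n) \<in> {0..T}" if "i < n" for i
      using that T by (auto simp: field_simps)
    have jump: "AE w in M. \<forall>i<n. \<bar>c1 i w\<bar> \<le> T / real n * G (real i * (T / real n)) w \<and> \<bar>c2 i w\<bar> \<le> T / real n * G (real i * (T / real n)) w"
      using dy1(7) dy2(7)
    proof eventually_elim
      case (elim w)
      show ?case
      proof (intro allI impI)
        fix i assume "i < n"
        from grid[OF this] have "0 \<le> y1 (real i * (T / real n)) w" "0 \<le> y2 (real i * (T / real n)) w" using elim by blast+
        from lin[OF qs(3) \<kappa>z \<kappa>s(2) this] lin[OF qs(4) \<kappa>z \<kappa>s(4) this(2,1)]
        have "\<bar>k1 + lam12 * y2 (real i * (T / real n)) w\<bar> \<le> G (real i * (T / real n)) w"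
          "\<bar>l1 + lam22 * y1 (real i * (T / real n)) w\<bar> \<le> G (real i * (T / real n)) w"
          unfolding G_def by (simp_all add: add.commute)
        then show "\<bar>c1 i w\<bar> \<le> T / real n * G (real i * (T / real n)) w \<and> \<bar>c2 i w\<bar> \<le> T / real n * G (real i * (T / real n)) w"
          unfolding c1_def c2_def abs_mult using T n0 by (intro conjI mult_mono) auto
      qed
    qed
    have drift: "AE w in M. \<forall>u\<in>{0..T}. \<bar>k2 - lam11 * y1 u w\<bar> \<le> G u w \<and> \<bar>l2 - lam21 * y2 u w\<bar> \<le> G u w"
      using dy1(7) dy2(7)
    proof eventually_elim
      case (elim w)
      show ?case
      proof
        fix u assume "u \<in> {0..T}"
        then have "0 \<le> y1 u w" "0 \<le> y2 u w" using elim by auto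
        from lin[OF qs(5) \<kappa>s(1) \<kappa>z this] lin[OF qs(6) \<kappa>s(3) \<kappa>z this(2,1)]
        show "\<bar>k2 - lam11 * y1 u w\<bar> \<le> G u w \<and> \<bar>l2 - lam21 * y2 u w\<bar> \<le> G u w"
          unfolding G_def by (simp add: add.commute)
      qed
    qed
    have y2m: "(\<integral>\<^sup>+w. ennreal ((y1 t w + y2 t w)\<^sup>2) \<partial>M) \<le> ennreal C0" if t: "t \<in> {0..T}" for t
      unfolding C0_def s_def
      by (rule pair_second_moment[where ?y1.0=y1 and ?y2.0=y2 and ?c1.0=c1 and ?c2.0=c2, OF W cy1 cy2 T n0(1) \<sigma>(1) pos q0 \<kappa>0 jump[unfolded G_def] drift[unfolded G_def] t])
    have xC: "(\<integral>\<^sup>+w. ennreal ((x1 t w)\<^sup>2) \<partial>M) \<le> ennreal C0" "(\<integral>\<^sup>+w. ennreal ((x2 t w)\<^sup>2) \<partial>M) \<le> ennreal C0"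
      "(\<integral>\<^sup>+w. ennreal ((y1 t w)\<^sup>2) \<partial>M) \<le> ennreal C0" "(\<integral>\<^sup>+w. ennreal ((y2 t w)\<^sup>2) \<partial>M) \<le> ennreal C0" if t: "t \<in> {0..T}" for t
      using nonneg_part_square_le[OF AEat[OF dx1(7) t] AEat[OF dx2(7) t] x2m[OF t]]
        nonneg_part_square_le[OF AEat[OF dy1(7) t] AEat[OF dy2(7) t] y2m[OF t]] by blast+
    have yj: "jointly_measurable M 0 T (\<lambda>u w. y1 u w + y2 u w)" by (rule jointly_measurable_add[OF dy1(4) dy2(4)])
    have Gj: "jointly_measurable M 0 T G"
      unfolding G_def by (rule jointly_measurable_compose[OF yj, of "\<lambda>v. q + \<kappa> * v"]) measurable
    have G2: "(\<integral>\<^sup>+w. ennreal ((G u w)\<^sup>2) \<partial>M) \<le> ennreal C1" if u: "u \<in> {0..T}" for u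
      unfolding G_def C1_def by (rule affine_second_moment[OF jointly_measurable_at[OF yj u] y2m[OF u] C00])
    have frozen1: "(\<integral>\<^sup>+w. ennreal (((LINT u:{0..t}|lborel. k1 + lam12 * y2 u w) -
      (\<Sum>i\<in>grid_before n T t. T / real n * (k1 + lam12 * y2 (real i * (T / real n)) w)))\<^sup>2) \<partial>M) \<le> ennreal (T / real n * K)" if t: "t \<in> {0..T}" for t
    proof (rule order_trans[OF component_frozen_drift_error[OF W(2) cy2 T n0(1) C00 C10 xC(4) Gj G2 _ _ t]])
      show "AE w in M. \<forall>i<n. \<bar>c2 i w\<bar> \<le> T / real n * G (real i * (T / real n)) w" using jump by eventually_elim blast
      show "AE w in M. \<forall>u\<in>{0..T}. \<bar>l2 - lam21 * y2 u w\<bar> \<le> G u w" using drift by eventually_elim blast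
    qed (use T n0 K0 in \<open>auto simp: K\<^sub>1_def[symmetric] intro!: ennreal_leI divide_right_mono mult_left_mono\<close>)
    have frozen2: "(\<integral>\<^sup>+w. ennreal (((LINT u:{0..t}|lborel. l1 + lam22 * y1 u w) -
      (\<Sum>i\<in>grid_before n T t. T / real n * (l1 + lam22 * y1 (real i * (T / real n)) w)))\<^sup>2) \<partial>M) \<le> ennreal (T / real n * K)" if t: "t \<in> {0..T}" for t
    proof (rule order_trans[OF component_frozen_drift_error[OF W(1) cy1 T n0(1) C00 C10 xC(3) Gj G2 _ _ t]])
      show "AE w in M. \<forall>i<n. \<bar>c1 i w\<bar> \<le> T / real n * G (real i * (T / real n)) w" using jump by eventually_elim blast
      show "AE w in M. \<forall>u\<in>{0..T}. \<bar>k2 - lam11 * y1 u w\<bar> \<le> G u w" using drift by eventually_elim blast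
    qed (use T n0 K0 in \<open>auto simp: K\<^sub>2_def[symmetric] intro!: ennreal_leI divide_right_mono mult_left_mono\<close>)
    define z1 where "z1 u w = x1 u w - y1 u w" for u w
    define z2 where "z2 u w = x2 u w - y2 u w" for u w
    have zj: "jointly_measurable M 0 T z1" "jointly_measurable M 0 T z2"
      unfolding z1_def z2_def by (rule jointly_measurable_diff[OF dx1(4) dy1(4)], rule jointly_measurable_diff[OF dx2(4) dy2(4)])
    have zM: "z1 u \<in> borel_measurable M" "z2 u \<in> borel_measurable M" if "u \<in> {0..T}" for u
      using jointly_measurable_at[OF zj(1) that] jointly_measurable_at[OF zj(2) that] by auto
    \<comment> \<open>Nonnegativity bounds each difference by the sums of the components.\<close>
    have comb: "(\<integral>\<^sup>+w. ennreal ((Z w)\<^sup>2) \<partial>M) \<le> ennreal (2 * L\<^sup>2 * (C0 + C0))"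
      if u: "u \<in> {0..T}" and L: "0 \<le> L" and le: "\<And>w. \<bar>Z w\<bar> \<le> L * (\<bar>z1 u w\<bar> + \<bar>z2 u w\<bar>)" for u Z L
    proof -
      have "(\<integral>\<^sup>+w. ennreal ((Z w)\<^sup>2) \<partial>M) \<le> ennreal (2 * L\<^sup>2) *
        ((\<integral>\<^sup>+w. ennreal ((x1 u w + x2 u w)\<^sup>2) \<partial>M) + (\<integral>\<^sup>+w. ennreal ((y1 u w + y2 u w)\<^sup>2) \<partial>M))"
      proof (rule mean_square_combination_le[OF _ _ L])
        show "(\<lambda>w. x1 u w + x2 u w) \<in> borel_measurable M" "(\<lambda>w. y1 u w + y2 u w) \<in> borel_measurable M"
          using dx1(2)[OF u] dx2(2)[OF u] dy1(2)[OF u] dy2(2)[OF u] by measurable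
        show "AE w in M. \<bar>Z w\<bar> \<le> L * (\<bar>x1 u w + x2 u w\<bar> + \<bar>y1 u w + y2 u w\<bar>)"
          using AEat[OF dx1(7) u] AEat[OF dx2(7) u] AEat[OF dy1(7) u] AEat[OF dy2(7) u]
        proof eventually_elim
          case (elim w)
          have "\<bar>z1 u w\<bar> + \<bar>z2 u w\<bar> \<le> \<bar>x1 u w + x2 u w\<bar> + \<bar>y1 u w + y2 u w\<bar>"
            using elim unfolding z1_def z2_def by linarith
          from order_trans[OF le mult_left_mono[OF this L]] show ?case .
        qed
      qed
      also have "\<dots> \<le> ennreal (2 * L\<^sup>2) * (ennreal C0 + ennreal C0)"
        by (intro mult_left_mono add_mono x2m[OF u] y2m[OF u]) simp
      also have "\<dots> = ennreal (2 * L\<^sup>2 * (C0 + C0))" using C00 by (simp only: ennreal_mult' ennreal_plus zero_le_power2 zero_le_numeral mult_nonneg_nonneg)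
      finally show ?thesis .
    qed
    have lincomb: "\<bar>b * v - a * w\<bar> \<le> \<kappa> * (\<bar>w\<bar> + \<bar>v\<bar>)" if "\<bar>a\<bar> \<le> \<kappa>" "\<bar>b\<bar> \<le> \<kappa>" for a b v w :: real
    proof -
      have "\<bar>b * v\<bar> \<le> \<kappa> * \<bar>v\<bar>" "\<bar>a * w\<bar> \<le> \<kappa> * \<bar>w\<bar>" unfolding abs_mult using that by (auto intro: mult_right_mono)
      then show ?thesis unfolding distrib_left by linarith
    qed
    have b1: "(\<integral>\<^sup>+w. ennreal ((lam12 * (x2 u w - y2 u w) - lam11 * (x1 u w - y1 u w))\<^sup>2) \<partial>M) \<le> ennreal Cb" if "u \<in> {0..T}" for u
      unfolding Cb_def using lincomb[OF \<kappa>s(1,2)] by (intro comb[OF that \<kappa>0]) (simp add: z1_def z2_def)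
    have b2: "(\<integral>\<^sup>+w. ennreal ((lam22 * (x1 u w - y1 u w) - lam21 * (x2 u w - y2 u w))\<^sup>2) \<partial>M) \<le> ennreal Cb" if "u \<in> {0..T}" for u
      unfolding Cb_def using lincomb[OF \<kappa>s(3,4)] by (intro comb[OF that \<kappa>0]) (simp add: z1_def z2_def add.commute)
    note raw1 = component_error[where x=x1 and y=y1 and x'=x2 and y'=y2 and a=lam11 and b=lam12, OF W(1) T n cx1 cy1[unfolded c1_def] x0(1) y0(1) k dx2(4) dx2(8) dy2(3) dy2(1) dy2(8) C00 Cb0 K0(1) \<sigma>s(1) xC(1) xC(3) b1 frozen1,
      folded A_def, folded z1_def z2_def]
    have e1: "(\<integral>\<^sup>+w. ennreal \<bar>z1 t w\<bar> \<partial>M) \<le> (\<integral>\<^sup>+u\<in>{0..t}. (\<integral>\<^sup>+w. ennreal \<bar>lam12 * z2 u w - lam11 * z1 u w\<bar> \<partial>M) \<partial>lborel) + ennreal (A / ln (real n))"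
      "(\<integral>\<^sup>+w. ennreal ((z1 t w)\<^sup>2) \<partial>M) \<le> 4 * (ennreal (T / real n * K) +
        (ennreal T * (\<integral>\<^sup>+u\<in>{0..t}. (\<integral>\<^sup>+w. ennreal ((lam12 * z2 u w - lam11 * z1 u w)\<^sup>2) \<partial>M) \<partial>lborel) +
         ennreal s * (\<integral>\<^sup>+u\<in>{0..t}. (\<integral>\<^sup>+w. ennreal \<bar>z1 u w\<bar> \<partial>M) \<partial>lborel)))" if "t \<in> {0..T}" for t
      by (rule raw1(1); (assumption | rule that)) (rule raw1(2); (assumption | rule that))
    note raw2 = component_error[where x=x2 and y=y2 and x'=x1 and y'=y1 and a=lam21 and b=lam22, OF W(2) T n cx2 cy2[unfolded c2_def] x0(2) y0(2) l dx1(4) dx1(8) dy1(3) dy1(1) dy1(8) C00 Cb0 K0(1) \<sigma>s(2) xC(2) xC(4) b2 frozen2,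
      folded A_def, folded z1_def z2_def]
    have e2: "(\<integral>\<^sup>+w. ennreal \<bar>z2 t w\<bar> \<partial>M) \<le> (\<integral>\<^sup>+u\<in>{0..t}. (\<integral>\<^sup>+w. ennreal \<bar>lam22 * z1 u w - lam21 * z2 u w\<bar> \<partial>M) \<partial>lborel) + ennreal (A / ln (real n))"
      "(\<integral>\<^sup>+w. ennreal ((z2 t w)\<^sup>2) \<partial>M) \<le> 4 * (ennreal (T / real n * K) +
        (ennreal T * (\<integral>\<^sup>+u\<in>{0..t}. (\<integral>\<^sup>+w. ennreal ((lam22 * z1 u w - lam21 * z2 u w)\<^sup>2) \<partial>M) \<partial>lborel) +
         ennreal s * (\<integral>\<^sup>+u\<in>{0..t}. (\<integral>\<^sup>+w. ennreal \<bar>z2 u w\<bar> \<partial>M) \<partial>lborel)))" if "t \<in> {0..T}" for t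
      by (rule raw2(1); (assumption | rule that)) (rule raw2(2); (assumption | rule that))
    let ?p = "\<lambda>u. \<integral>\<^sup>+w. ennreal \<bar>z1 u w\<bar> \<partial>M" and ?q = "\<lambda>u. \<integral>\<^sup>+w. ennreal \<bar>z2 u w\<bar> \<partial>M"
    let ?P = "\<lambda>u. \<integral>\<^sup>+w. ennreal ((z1 u w)\<^sup>2) \<partial>M" and ?Q = "\<lambda>u. \<integral>\<^sup>+w. ennreal ((z2 u w)\<^sup>2) \<partial>M"
    have bdd2: "?P u \<le> ennreal (2 * 1\<^sup>2 * (C0 + C0))" "?Q u \<le> ennreal (2 * 1\<^sup>2 * (C0 + C0))" if "u \<in> {0..T}" for u
      by (rule comb[OF that]; simp)+
    have bdd1: "?p u \<le> ennreal (1 + 2 * 1\<^sup>2 * (C0 + C0))" "?q u \<le> ennreal (1 + 2 * 1\<^sup>2 * (C0 + C0))" if "u \<in> {0..T}" for u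
      by (intro first_moment_le zM[OF that] bdd2[OF that]; use C00 in simp)+
    have za: "jointly_measurable M 0 T (\<lambda>u w. \<bar>z1 u w\<bar>)" "jointly_measurable M 0 T (\<lambda>u w. \<bar>z2 u w\<bar>)"
      by (rule jointly_measurable_compose[OF zj(1)], measurable) (rule jointly_measurable_compose[OF zj(2)], measurable)
    have zs: "jointly_measurable M 0 T (\<lambda>u w. (z1 u w)\<^sup>2)" "jointly_measurable M 0 T (\<lambda>u w. (z2 u w)\<^sup>2)"
      by (rule jointly_measurable_compose[OF zj(1)], measurable) (rule jointly_measurable_compose[OF zj(2)], measurable)
    have pq: "?p u + ?q u \<le> ennreal (B1 / ln (real n))" if u: "u \<in> {0..T}" for u
    proof -
      have "?p u + ?q u \<le> ennreal (gronwall_factor (2 * \<kappa> + 1) T * (2 * (A / ln (real n))))"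
      proof (rule coupled_gronwall[OF T _ \<kappa>0 bdd1 _ _ u])
        show "0 \<le> A / ln (real n)" using A0 lnn by simp
        fix t assume t: "t \<in> {0..T}"
        have m: "u \<in> {0..T}" if "u \<in> {0..t}" for u using that t by auto
        have "(\<integral>\<^sup>+u\<in>{0..t}. (\<integral>\<^sup>+w. ennreal \<bar>lam12 * z2 u w - lam11 * z1 u w\<bar> \<partial>M) \<partial>lborel) \<le> ennreal \<kappa> * (\<integral>\<^sup>+u\<in>{0..t}. (?p u + ?q u) \<partial>lborel)"
          using t by (intro time_integral_le_of_means[OF za] mean_abs_combination_le zM m \<kappa>s) auto
        from order_trans[OF e1(1)[OF t] add_right_mono[OF this]]
        show "?p t \<le> ennreal (A / ln (real n)) + ennreal \<kappa> * (\<integral>\<^sup>+u\<in>{0..t}. (?p u + ?q u) \<partial>lborel)" by (simp only: add.commute)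
        have "(\<integral>\<^sup>+u\<in>{0..t}. (\<integral>\<^sup>+w. ennreal \<bar>lam22 * z1 u w - lam21 * z2 u w\<bar> \<partial>M) \<partial>lborel) \<le> ennreal \<kappa> * (\<integral>\<^sup>+u\<in>{0..t}. (?q u + ?p u) \<partial>lborel)"
          using t by (intro time_integral_le_of_means[OF za(2,1)] mean_abs_combination_le zM m \<kappa>s) auto
        from order_trans[OF e2(1)[OF t] add_right_mono[OF this]]
        show "?q t \<le> ennreal (A / ln (real n)) + ennreal \<kappa> * (\<integral>\<^sup>+u\<in>{0..t}. (?p u + ?q u) \<partial>lborel)" by (simp only: add.commute)
      qed
      then show ?thesis by (simp add: B1_def)
    qed
    define c where "c = 4 * (T * K + s * (T * B1)) / ln (real n)"
    have c0: "0 \<le> c" using TK0 lnn by (simp add: c_def)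
    \<comment> \<open>The mean square inequality once the mean absolute error is known to be \<open>O(1 / ln n)\<close>.\<close>
    have square: "r \<le> ennreal c + ennreal (8 * T * \<kappa>\<^sup>2) * X"
      if r: "r \<le> 4 * (ennreal (T / real n * K) + (ennreal T * S + ennreal s * R))"
        and S: "S \<le> ennreal (2 * \<kappa>\<^sup>2) * X" and R: "R \<le> ennreal (T * (B1 / ln (real n)))" for r S X R :: ennreal
    proof -
      have "ln (real n) \<le> real n" using ln_le_minus_one[of "real n"] n0 by simp
      then have "T * K / real n \<le> T * K / ln (real n)" using T K0 lnn by (intro divide_left_mono) auto
      then have f: "ennreal (T / real n * K) \<le> ennreal (T * K / ln (real n))" by (intro ennreal_leI) simp
      have "r \<le> 4 * (ennreal (T * K / ln (real n)) + (ennreal T * (ennreal (2 * \<kappa>\<^sup>2) * X) + ennreal s * ennreal (T * (B1 / ln (real n)))))"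
        using f S R by (intro order_trans[OF r] mult_left_mono add_mono) auto
      also have "\<dots> = (ennreal 4 * ennreal (T * K / ln (real n)) + ennreal 4 * (ennreal s * ennreal (T * (B1 / ln (real n))))) + (ennreal 4 * (ennreal T * ennreal (2 * \<kappa>\<^sup>2))) * X"
        by (simp add: distrib_left mult_ac add_ac)
      also have "ennreal 4 * ennreal (T * K / ln (real n)) + ennreal 4 * (ennreal s * ennreal (T * (B1 / ln (real n)))) = ennreal c"
      proof -
        have "ennreal c = ennreal (4 * (T * K / ln (real n)) + 4 * (s * (T * (B1 / ln (real n)))))"
          by (simp add: c_def add_divide_distrib distrib_left)
        also have "\<dots> = ennreal (4 * (T * K / ln (real n))) + ennreal (4 * (s * (T * (B1 / ln (real n)))))"
          using T K0 lnn s0 B10 by (intro ennreal_plus) auto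
        also have "\<dots> = ennreal 4 * ennreal (T * K / ln (real n)) + ennreal 4 * (ennreal s * ennreal (T * (B1 / ln (real n))))"
          using T K0 lnn s0 B10 ennreal_mult'[of 4] ennreal_mult'[of s] by (metis zero_le_numeral)
        finally show ?thesis ..
      qed
      also have "ennreal 4 * (ennreal T * ennreal (2 * \<kappa>\<^sup>2)) = ennreal (8 * T * \<kappa>\<^sup>2)"
      proof -
        have "8 * T * \<kappa>\<^sup>2 = 4 * (T * (2 * \<kappa>\<^sup>2))" by simp
        then show ?thesis using T by (metis ennreal_mult' less_imp_le zero_le_numeral)
      qed
      finally show ?thesis .
    qed
    have "?P t + ?Q t \<le> ennreal (gronwall_factor (2 * (8 * T * \<kappa>\<^sup>2) + 1) T * (2 * c))"
    proof (rule coupled_gronwall[OF T c0 _ bdd2 _ _ t])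
      show "0 \<le> 8 * T * \<kappa>\<^sup>2" using T by simp
      fix t assume t: "t \<in> {0..T}"
      have m: "u \<in> {0..T}" if "u \<in> {0..t}" for u using that t by auto
      have TB: "(\<integral>\<^sup>+u\<in>{0..t}. p u \<partial>lborel) \<le> ennreal (T * (B1 / ln (real n)))"
        if p: "\<And>u. u \<in> {0..T} \<Longrightarrow> p u \<le> ?p u + ?q u" for p
      proof -
        have "(\<integral>\<^sup>+u\<in>{0..t}. p u \<partial>lborel) \<le> ennreal ((t - 0) * (B1 / ln (real n)))"
          using t B10 lnn by (intro nn_integral_interval_le order_trans[OF p pq]) auto
        also have "\<dots> \<le> ennreal (T * (B1 / ln (real n)))" using t B10 lnn by (intro ennreal_leI mult_right_mono) auto
        finally show ?thesis .
      qed
      have R: "(\<integral>\<^sup>+u\<in>{0..t}. ?p u \<partial>lborel) \<le> ennreal (T * (B1 / ln (real n)))"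
        "(\<integral>\<^sup>+u\<in>{0..t}. ?q u \<partial>lborel) \<le> ennreal (T * (B1 / ln (real n)))" by (rule TB; simp)+
      have "(\<integral>\<^sup>+u\<in>{0..t}. (\<integral>\<^sup>+w. ennreal ((lam12 * z2 u w - lam11 * z1 u w)\<^sup>2) \<partial>M) \<partial>lborel) \<le> ennreal (2 * \<kappa>\<^sup>2) * (\<integral>\<^sup>+u\<in>{0..t}. (?P u + ?Q u) \<partial>lborel)"
        using t by (intro time_integral_le_of_means[OF zs] mean_square_combination_le zM m \<kappa>0 AE_I2 lincomb \<kappa>s) auto
      from square[OF e1(2)[OF t] this R(1)]
      show "?P t \<le> ennreal c + ennreal (8 * T * \<kappa>\<^sup>2) * (\<integral>\<^sup>+u\<in>{0..t}. (?P u + ?Q u) \<partial>lborel)" .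
      have "(\<integral>\<^sup>+u\<in>{0..t}. (\<integral>\<^sup>+w. ennreal ((lam22 * z1 u w - lam21 * z2 u w)\<^sup>2) \<partial>M) \<partial>lborel) \<le> ennreal (2 * \<kappa>\<^sup>2) * (\<integral>\<^sup>+u\<in>{0..t}. (?Q u + ?P u) \<partial>lborel)"
        using t by (intro time_integral_le_of_means[OF zs(2,1)] mean_square_combination_le zM m \<kappa>0 AE_I2 lincomb \<kappa>s) auto
      from square[OF e2(2)[OF t] this R(2)]
      show "?Q t \<le> ennreal c + ennreal (8 * T * \<kappa>\<^sup>2) * (\<integral>\<^sup>+u\<in>{0..t}. (?P u + ?Q u) \<partial>lborel)" by (simp only: add.commute)
    qed
    then have "?P t + ?Q t \<le> ennreal (B2 / ln (real n))" by (simp add: B2_def c_def)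
    then show ?thesis using dx1(2)[OF t] dx2(2)[OF t] dy1(2)[OF t] dy2(2)[OF t] by (simp only: z1_def z2_def simp_thms)
  qed
  show ?thesis using B20 main by blast
qed

end

theorem theorem3:
  fixes M :: "'a measure" and F :: "real \<Rightarrow> 'a measure"
    and W1 W2 x1 x2 :: "real \<Rightarrow> 'a \<Rightarrow> real"
    and T k l k1 k2 l1 l2 \<sigma>1 \<sigma>2 lam11 lam12 lam21 lam22 x10 x20 :: real
  assumes "complete_filtered_prob_space M F"
    and "wiener_process M F W1" and "wiener_process M F W2" and "indep_processes M W1 W2"
    and "T > 0" and "k > 0" and "l > 0" and "\<sigma>1 > 0" and "\<sigma>2 > 0"
    and "lam11 \<ge> 0" and "lam12 \<ge> 0" and "lam21 \<ge> 0" and "lam22 \<ge> 0"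
    and "k = k1 + k2" and "4 * k2 / \<sigma>1\<^sup>2 = of_int \<lfloor>4 * k / \<sigma>1\<^sup>2\<rfloor>"
    and "l = l1 + l2" and "4 * l2 / \<sigma>2\<^sup>2 = of_int \<lfloor>4 * l / \<sigma>2\<^sup>2\<rfloor>"
    and "x10 > 0" and "x20 > 0"
    and "4 * k / \<sigma>1\<^sup>2 > 1" and "4 * l / \<sigma>2\<^sup>2 > 1"
    and "two_factor_CIR M F W1 W2 T k l \<sigma>1 \<sigma>2 lam11 lam12 lam21 lam22 x10 x20 x1 x2"
  shows "\<exists>C>0. \<forall>n\<ge>2. \<forall>y1 y2.
           CIR_splitting_approximation M F W1 W2 T k1 k2 l1 l2 \<sigma>1 \<sigma>2 lam11 lam12 lam21 lam22 x10 x20 n y1 y2 \<longrightarrow>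
           (\<forall>t\<in>{0..T}.
              integrable M (\<lambda>\<omega>. \<bar>x1 t \<omega> - y1 t \<omega>\<bar>\<^sup>2 + \<bar>x2 t \<omega> - y2 t \<omega>\<bar>\<^sup>2) \<and>
              prob_space.expectation M (\<lambda>\<omega>. \<bar>x1 t \<omega> - y1 t \<omega>\<bar>\<^sup>2 + \<bar>x2 t \<omega> - y2 t \<omega>\<bar>\<^sup>2)
                \<le> C * (1 / sqrt (ln (real n))))"
proof -
  interpret complete_filtered_prob_space M F by fact
  let ?approx = "\<lambda>n y1 y2. CIR_splitting_approximation M F W1 W2 T k1 k2 l1 l2 \<sigma>1 \<sigma>2 lam11 lam12 lam21 lam22 x10 x20 n y1 y2"
  let ?err = "\<lambda>t y1 y2 \<omega>. \<bar>x1 t \<omega> - y1 t \<omega>\<bar>\<^sup>2 + \<bar>x2 t \<omega> - y2 t \<omega>\<bar>\<^sup>2"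
  have pos: "0 \<le> x10" "0 \<le> x20" using \<open>x10 > 0\<close> \<open>x20 > 0\<close> by auto
  obtain B where B: "0 \<le> B" and error: "\<forall>n\<ge>2. \<forall>y1 y2. ?approx n y1 y2 \<longrightarrow>
     (\<forall>t\<in>{0..T}. x1 t \<in> borel_measurable M \<and> x2 t \<in> borel_measurable M \<and>
        y1 t \<in> borel_measurable M \<and> y2 t \<in> borel_measurable M \<and>
        (\<integral>\<^sup>+\<omega>. ennreal ((x1 t \<omega> - y1 t \<omega>)\<^sup>2) \<partial>M) + (\<integral>\<^sup>+\<omega>. ennreal ((x2 t \<omega> - y2 t \<omega>)\<^sup>2) \<partial>M) \<le> ennreal (B / ln (real n)))"
    using splitting_mean_square_error[OF \<open>wiener_process M F W1\<close> \<open>wiener_process M F W2\<close> \<open>T > 0\<close> \<open>\<sigma>1 > 0\<close> \<open>\<sigma>2 > 0\<close>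
        \<open>lam11 \<ge> 0\<close> \<open>lam12 \<ge> 0\<close> \<open>lam21 \<ge> 0\<close> \<open>lam22 \<ge> 0\<close> \<open>k = k1 + k2\<close> \<open>l = l1 + l2\<close> pos
        \<open>two_factor_CIR M F W1 W2 T k l \<sigma>1 \<sigma>2 lam11 lam12 lam21 lam22 x10 x20 x1 x2\<close>] by blast
  define C where "C = B / sqrt (ln 2) + 1"
  have C: "0 < C" using B by (simp add: C_def add_nonneg_pos)
  have "integrable M (?err t y1 y2) \<and> expectation (?err t y1 y2) \<le> C * (1 / sqrt (ln (real n)))"
    if n: "2 \<le> n" and y: "?approx n y1 y2" and t: "t \<in> {0..T}" for n y1 y2 t
  proof -
    have [measurable]: "x1 t \<in> borel_measurable M" "x2 t \<in> borel_measurable M" "y1 t \<in> borel_measurable M" "y2 t \<in> borel_measurable M"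
      and e: "(\<integral>\<^sup>+\<omega>. ennreal ((x1 t \<omega> - y1 t \<omega>)\<^sup>2) \<partial>M) + (\<integral>\<^sup>+\<omega>. ennreal ((x2 t \<omega> - y2 t \<omega>)\<^sup>2) \<partial>M) \<le> ennreal (B / ln (real n))"
      using error n y t by blast+
    have m: "?err t y1 y2 \<in> borel_measurable M" by measurable
    have ln: "0 < ln (real n)" "ln 2 \<le> ln (real n)" using n by auto
    have "(\<integral>\<^sup>+\<omega>. ennreal (?err t y1 y2 \<omega>) \<partial>M) = (\<integral>\<^sup>+\<omega>. ennreal ((x1 t \<omega> - y1 t \<omega>)\<^sup>2) + ennreal ((x2 t \<omega> - y2 t \<omega>)\<^sup>2) \<partial>M)"
      by (intro nn_integral_cong) (simp add: ennreal_plus)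
    also have "\<dots> \<le> ennreal (B / ln (real n))" using e by (simp add: nn_integral_add)
    finally have *: "(\<integral>\<^sup>+\<omega>. ennreal (?err t y1 y2 \<omega>) \<partial>M) \<le> ennreal (B / ln (real n))" .
    have B0: "0 \<le> B / ln (real n)" using B ln by simp
    note ie = expectation_le_of_nn_integral[OF m _ * B0]
    \<comment> \<open>One of the two factors \<open>1 / sqrt (ln n)\<close> of \<open>1 / ln n\<close> is given away.\<close>
    have "B / ln (real n) = B / sqrt (ln (real n)) * (1 / sqrt (ln (real n)))" using ln by simp
    also have "\<dots> \<le> C * (1 / sqrt (ln (real n)))"
    proof (rule mult_right_mono)
      have "B / sqrt (ln (real n)) \<le> B / sqrt (ln 2)" using B ln by (intro divide_left_mono) auto
      then show "B / sqrt (ln (real n)) \<le> C" by (simp add: C_def)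
    qed (use ln in simp)
    finally have "B / ln (real n) \<le> C * (1 / sqrt (ln (real n)))" .
    with ie show ?thesis by (auto intro: order_trans)
  qed
  then show ?thesis using C by blast
qed

end
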